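(* Let $(M,g_{ab})$ be a space-time, let $\mathcal{H}$ be a dynamical horizon segment (DHS) in $M$, and suppose that $g_{ab}$ admits, in a neighborhood of $\mathcal{H}$, a rotational Killing field $\varphi^a$ that is tangential to every marginally trapped surface (MTS) leaf $\mathcal{S}$ of $\mathcal{H}$. Let $\mathfrak{n}=g_{ab}\varphi^a\varphi^b$ be the norm of $\varphi^a$ and $\mathfrak{t}_a=\epsilon_{abcd}(\nabla^b\varphi^c)\varphi^d$ its twist. Then for every MTS leaf $\mathcal{S}$ of $\mathcal{H}$ and every integer $\ell\ge 0$, the spin multipole $\mathtt{S}_\ell[\mathcal{S}]:=\mathtt{S}_{\ell,0}[\mathcal{S}]$ is given by $$\mathtt{S}_\ell[\mathcal{S}]=\frac14\oint_{\mathcal{S}}\frac{1}{\mathfrak{n}}\,\bigl(\mathfrak{t}^a\partial_a Y_{\ell,0}(\zeta)\bigr)\,\mathrm{d}^2\tilde V .$$ In particular, if $\mathfrak{t}^a$ vanishes on $\mathcal{S}$ (i.e. if $\varphi^a$ is hypersurface orthogonal there), then all spin multipoles $\mathtt{S}_{\ell,m}[\mathcal{S}]$ vanish.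
   Context: Space-times $(M,g_{ab})$ are smooth, 4-dimensional, oriented and time-oriented Lorentzian manifolds of signature $(-,+,+,+)$ with Levi-Civita derivative $\nabla_a$ and volume form $\epsilon_{abcd}$; all fields and submanifolds are smooth. Curvature conventions: $R_{abc}{}^{d}V_d = 2\nabla_{[a}\nabla_{b]}V_c$, $R_{ac}=R_{abc}{}^{b}$. Let $\mathcal{S}$ be a closed (compact without boundary) spacelike 2-dimensional submanifold of $M$, with intrinsic metric $\tilde q_{ab}$. It has two future-directed null normal fields $k^a,\underline{k}^a$, normalized by $k^a\underline{k}_a=-1$; the remaining freedom is $k^a\to f k^a$, $\underline{k}^a\to f^{-1}\underline{k}^a$ with $f>0$, and the multipoles below are insensitive to it. The expansions are $\Theta_{(k)}=\tilde q^{ab}\nabla_a k_b$ and $\Theta_{(\underline{k})}=\tilde q^{ab}\nabla_a\underline{k}_b$, and the shear of $k^a$ is $\sigma^{(k)}_{ab}=\left(\tilde q_a{}^c \tilde q_b{}^d-\tfrac12 \tilde q_{ab}\tilde q^{cd}\right)\nabla_{(c}k_{d)}$. $\mathcal{S}$ is a marginally trapped surface (MTS) if the expansion of one of its null normals, denoted $k^a$, vanishes identically. On an MTS set $\mathcal{E}=\sigma^{(k)}_{ab}\sigma_{(k)}^{ab}+R_{ab}k^ak^b$. A dynamical horizon segment (DHS) is a connected 3-dimensional submanifold $\mathcal{H}$ of $M$ which is nowhere null and such that: (1) $\mathcal{H}$ is foliated by MTSs $\mathcal{S}$, each with topology $S^2$, with $k^a$ denoting the future-pointing null normal satisfying $\Theta_{(k)}=0$;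 (2) if $\underline{k}^a$ is the other future-pointing null normal to the leaves, $\Theta_{(\underline{k})}$ is nowhere vanishing; (3) $\mathcal{E}$ does not vanish identically on any leaf $\mathcal{S}$. Spin multipoles. Let $\mathcal{S}$ be a leaf of $\mathcal{H}$, $\tilde D_a$ the Levi-Civita derivative of $\tilde q_{ab}$, $\mathrm{d}^2\tilde V$ its area element, $R$ its area radius (area $=4\pi R^2$), and $\tilde\epsilon_{ab}$ its area 2-form, oriented by $\tilde\epsilon_{cd}=\epsilon_{abcd}\,\underline{k}^a k^b$. A rotational Killing field $\varphi^a$ tangential to $\mathcal{S}$ is one whose restriction to $\mathcal{S}$ is a Killing field of $\tilde q_{ab}$ with closed orbits and exactly two zeros, normalized so that the affine parameter along its orbits has period $2\pi$. The function $\zeta:\mathcal{S}\to[-1,1]$ is defined by $\tilde D_a\zeta=R^{-2}\tilde\epsilon_{ba}\varphi^b$ and $\oint_{\mathcal{S}}\zeta\,\mathrm{d}^2\tilde V=0$; the coordinate $\varphi\in[0,2\pi)$ is an affine parameter of $\varphi^a$ with $\tilde q^{ab}\tilde D_a\varphi\,\tilde D_b\zeta=0$ (unique up to a rigid shift), and $\zeta=\cos\theta$. $Y_{\ell,m}(\theta,\varphi)$ are the standard spherical harmonics in these coordinates; $Y_{\ell,0}$ depends only on $\zeta$. The rotational 1-form is $\tilde\omega_a=-\tilde q_a{}^b\,\underline{k}_c\nabla_b k^c$, and the spin multipoles are $$\mathtt{S}_{\ell,m}[\mathcal{S}]=\tfrac14\oint_{\mathcal{S}}\bigl[2\,\tilde\epsilon^{ab}\tilde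 D_a\tilde\omega_b\bigr]\,Y_{\ell,m}(\theta,\varphi)\,\mathrm{d}^2\tilde V,\qquad \ell\ge0,\ -\ell\le m\le\ell .$$ Integrands containing $1/\mathfrak{n}$ are understood on the complement of the two zeros of $\varphi^a$ in $\mathcal{S}$ (a set of measure zero). *)

theory Defs
  imports "HOL-Analysis.Analysis"
begin

section \<open>Calculus on open subsets of Euclidean spaces\<close>

text \<open>The two predicates below are only used for open \<open>U\<close>.\<close>

primrec Ck_on :: "nat \<Rightarrow> 'a::real_normed_vector set \<Rightarrow> ('a \<Rightarrow> 'b::real_normed_vector) \<Rightarrow> bool" where
  "Ck_on 0 U f \<longleftrightarrow> continuous_on U f"
| "Ck_on (Suc k) U f \<longleftrightarrow>
     (\<forall>x\<in>U. f differentiable (at x)) \<and>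
     (\<forall>v. Ck_on k U (\<lambda>x. frechet_derivative f (at x) v))"

definition smooth_on :: "'a::real_normed_vector set \<Rightarrow> ('a \<Rightarrow> 'b::real_normed_vector) \<Rightarrow> bool" where
  "smooth_on U f \<longleftrightarrow> (\<forall>k. Ck_on k U f)"

definition partial :: "(real^'n \<Rightarrow> 'b::real_normed_vector) \<Rightarrow> real^'n \<Rightarrow> 'n \<Rightarrow> 'b" where
  "partial f x i = frechet_derivative f (at x) (axis i 1)"

text \<open>In the next four definitions \<open>G\<close> is the component matrix of a (pseudo-)Riemannian metric, as a
  function of the coordinates. They serve both for the space-time metric and for the metrics
  induced on surfaces.\<close>

definition christoffel :: "(real^'n \<Rightarrow> real^'n^'n) \<Rightarrow> real^'n \<Rightarrow> 'n \<Rightarrow> 'n \<Rightarrow> 'n \<Rightarrow> real" where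
  "christoffel G x i j k = 1/2 * (\<Sum>l\<in>UNIV. matrix_inv (G x) $ i $ l *
     (partial (\<lambda>y. G y $ l $ k) x j + partial (\<lambda>y. G y $ l $ j) x k - partial (\<lambda>y. G y $ j $ k) x l))"

text \<open>\<open>cov_deriv G w x a b\<close> is \<open>\<nabla>\<^sub>a w\<^sub>b\<close> for a covector field \<open>w\<close>.\<close>

definition cov_deriv ::
    "(real^'n \<Rightarrow> real^'n^'n) \<Rightarrow> (real^'n \<Rightarrow> real^'n) \<Rightarrow> real^'n \<Rightarrow> 'n \<Rightarrow> 'n \<Rightarrow> real" where
  "cov_deriv G w x a b =
     partial (\<lambda>y. w y $ b) x a - (\<Sum>d\<in>UNIV. christoffel G x d a b * w x $ d)"

text \<open>\<open>riemann G x a b c d\<close> is \<open>R\<^sub>a\<^sub>b\<^sub>c\<^sup>d\<close> with the sign fixed by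
  \<open>R\<^sub>a\<^sub>b\<^sub>c\<^sup>d V\<^sub>d = (\<nabla>\<^sub>a \<nabla>\<^sub>b - \<nabla>\<^sub>b \<nabla>\<^sub>a) V\<^sub>c\<close>.\<close>

definition riemann ::
    "(real^'n \<Rightarrow> real^'n^'n) \<Rightarrow> real^'n \<Rightarrow> 'n \<Rightarrow> 'n \<Rightarrow> 'n \<Rightarrow> 'n \<Rightarrow> real" where
  "riemann G x a b c d =
     partial (\<lambda>y. christoffel G y d a c) x b - partial (\<lambda>y. christoffel G y d b c) x a
     + (\<Sum>e\<in>UNIV. christoffel G x e a c * christoffel G x d b e
                 - christoffel G x e b c * christoffel G x d a e)"

definition ricci :: "(real^'n \<Rightarrow> real^'n^'n) \<Rightarrow> real^'n \<Rightarrow> 'n \<Rightarrow> 'n \<Rightarrow> real" where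
  "ricci G x a c = (\<Sum>b\<in>UNIV. riemann G x a b c b)"


section \<open>Space-times\<close>

text \<open>A chart is a pair of a domain and a coordinate map. A vector field is given by its components
  in every chart, as functions of the point of the manifold.\<close>

type_synonym 'a chart = "'a set \<times> ('a \<Rightarrow> real^4)"
type_synonym 'a vfield = "'a chart \<Rightarrow> 'a \<Rightarrow> real^4"

record 'a spacetime =
  charts :: "'a chart set"
  metric :: "'a chart \<Rightarrow> 'a \<Rightarrow> real^4^4"
  future :: "'a vfield"

abbreviation coord_inv :: "'a chart \<Rightarrow> real^4 \<Rightarrow> 'a" where
  "coord_inv c \<equiv> inv_into (fst c) (snd c)"

definition jacobian :: "'a chart \<Rightarrow> 'a chart \<Rightarrow> 'a \<Rightarrow> real^4^4" where
  "jacobian c d p = matrix (frechet_derivative (snd d \<circ> coord_inv c) (at (snd c p)))"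

text \<open>The manifold is the whole type. The orientation is encoded by using an oriented atlas.\<close>

definition oriented_smooth_atlas :: "'a::topological_space chart set \<Rightarrow> bool" where
  "oriented_smooth_atlas A \<longleftrightarrow>
     (\<Union>c\<in>A. fst c) = UNIV \<and>
     (\<forall>c\<in>A. open (fst c) \<and> open (snd c ` fst c) \<and>
        homeomorphism (fst c) (snd c ` fst c) (snd c) (coord_inv c)) \<and>
     (\<forall>c\<in>A. \<forall>d\<in>A. smooth_on (snd c ` (fst c \<inter> fst d)) (snd d \<circ> coord_inv c) \<and>
        (\<forall>p\<in>fst c \<inter> fst d. det (jacobian c d p) > 0))"

definition vector_along :: "'a chart set \<Rightarrow> 'a set \<Rightarrow> 'a vfield \<Rightarrow> bool" where
  "vector_along A D X \<longleftrightarrow>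
     (\<forall>c\<in>A. \<forall>d\<in>A. \<forall>p\<in>D \<inter> fst c \<inter> fst d. X d p = jacobian c d p *v X c p)"

definition smooth_vector_field :: "'a chart set \<Rightarrow> 'a set \<Rightarrow> 'a vfield \<Rightarrow> bool" where
  "smooth_vector_field A N X \<longleftrightarrow> vector_along A N X \<and>
     (\<forall>c\<in>A. smooth_on (snd c ` (fst c \<inter> N)) (X c \<circ> coord_inv c))"

definition minkowski :: "real^4^4" where
  "minkowski = (\<chi> i j. if i = j then (if i = 1 then -1 else 1) else 0)"

definition lorentz_metric :: "'a chart set \<Rightarrow> ('a chart \<Rightarrow> 'a \<Rightarrow> real^4^4) \<Rightarrow> bool" where
  "lorentz_metric A g \<longleftrightarrow>
     (\<forall>c\<in>A. smooth_on (snd c ` fst c) (g c \<circ> coord_inv c)) \<and>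
     (\<forall>c\<in>A. \<forall>p\<in>fst c. transpose (g c p) = g c p \<and>
        (\<exists>P. invertible P \<and> transpose P ** g c p ** P = minkowski)) \<and>
     (\<forall>c\<in>A. \<forall>d\<in>A. \<forall>p\<in>fst c \<inter> fst d.
        g c p = transpose (jacobian c d p) ** g d p ** jacobian c d p)"

definition is_spacetime :: "'a::topological_space spacetime \<Rightarrow> bool" where
  "is_spacetime M \<longleftrightarrow>
     oriented_smooth_atlas (charts M) \<and> lorentz_metric (charts M) (metric M) \<and>
     smooth_vector_field (charts M) UNIV (future M) \<and>
     (\<forall>c\<in>charts M. \<forall>p\<in>fst c. future M c p \<bullet> (metric M c p *v future M c p) < 0)"

text \<open>Quantities that do not depend on the chart are evaluated in a chosen chart.\<close>

definition chart_at :: "'a spacetime \<Rightarrow> 'a \<Rightarrow> 'a chart" where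
  "chart_at M p = (SOME c. c \<in> charts M \<and> p \<in> fst c)"

definition at_pt :: "'a spacetime \<Rightarrow> 'a vfield \<Rightarrow> 'a \<Rightarrow> real^4" where
  "at_pt M X p = X (chart_at M p) p"

definition ip :: "'a spacetime \<Rightarrow> 'a \<Rightarrow> real^4 \<Rightarrow> real^4 \<Rightarrow> real" where
  "ip M p v w = v \<bullet> (metric M (chart_at M p) p *v w)"

definition metric_coords :: "'a spacetime \<Rightarrow> 'a chart \<Rightarrow> real^4 \<Rightarrow> real^4^4" where
  "metric_coords M c = metric M c \<circ> coord_inv c"

text \<open>The volume form \<open>\<epsilon>(v\<^sub>1, v\<^sub>2, v\<^sub>3, v\<^sub>4)\<close>, for components in the chart \<open>c\<close>.\<close>

definition vol_form ::
    "'a spacetime \<Rightarrow> 'a chart \<Rightarrow> 'a \<Rightarrow> real^4 \<Rightarrow> real^4 \<Rightarrow> real^4 \<Rightarrow> real^4 \<Rightarrow> real" where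
  "vol_form M c p v1 v2 v3 v4 =
     sqrt (- det (metric M c p)) * det (vector [v1, v2, v3, v4] :: real^4^4)"

text \<open>\<open>nabla_low M X c p a b\<close> is \<open>\<nabla>\<^sub>a X\<^sub>b\<close> in the chart \<open>c\<close>.\<close>

definition nabla_low :: "'a spacetime \<Rightarrow> 'a vfield \<Rightarrow> 'a chart \<Rightarrow> 'a \<Rightarrow> 4 \<Rightarrow> 4 \<Rightarrow> real" where
  "nabla_low M X c p a b =
     cov_deriv (metric_coords M c) (\<lambda>x. metric_coords M c x *v X c (coord_inv c x)) (snd c p) a b"

definition killing_field :: "'a spacetime \<Rightarrow> 'a set \<Rightarrow> 'a vfield \<Rightarrow> bool" where
  "killing_field M N X \<longleftrightarrow> smooth_vector_field (charts M) N X \<and>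
     (\<forall>c\<in>charts M. \<forall>p\<in>N \<inter> fst c. \<forall>a b. nabla_low M X c p a b + nabla_low M X c p b a = 0)"

text \<open>The norm \<open>X\<^sub>a X\<^sup>a\<close> and the twist \<open>t\<^sub>a = \<epsilon>\<^sub>a\<^sub>b\<^sub>c\<^sub>d (\<nabla>\<^sup>b X\<^sup>c) X\<^sup>d\<close>; \<open>twist\<close> is the vector
  field \<open>t\<^sup>a\<close> with the index raised.\<close>

definition norm_sq :: "'a spacetime \<Rightarrow> 'a vfield \<Rightarrow> 'a \<Rightarrow> real" where
  "norm_sq M X p = ip M p (at_pt M X p) (at_pt M X p)"

definition twist_low :: "'a spacetime \<Rightarrow> 'a vfield \<Rightarrow> 'a chart \<Rightarrow> 'a \<Rightarrow> real^4" where
  "twist_low M X c p = (let ginv = matrix_inv (metric M c p) in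
     \<chi> a. \<Sum>b\<in>UNIV. \<Sum>d\<in>UNIV.
       (\<Sum>e\<in>UNIV. \<Sum>f\<in>UNIV. ginv $ b $ e * ginv $ d $ f * nabla_low M X c p e f) *
       vol_form M c p (axis a 1) (axis b 1) (axis d 1) (X c p))"

definition twist :: "'a spacetime \<Rightarrow> 'a vfield \<Rightarrow> 'a vfield" where
  "twist M X c p = matrix_inv (metric M c p) *v twist_low M X c p"


section \<open>Submanifolds\<close>

text \<open>Submanifolds are embedded. They are described by local parametrizations: smooth immersions of
  open subsets of \<open>\<real>\<^sup>k\<close> which are homeomorphisms onto relatively open subsets. Tensors on a
  submanifold are given by their components with respect to a local parametrization.\<close>

definition local_param ::
    "'a::topological_space spacetime \<Rightarrow> 'a set \<Rightarrow> (real^'k) set \<Rightarrow> (real^'k \<Rightarrow> 'a) \<Rightarrow> bool" where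
  "local_param M S V \<psi> \<longleftrightarrow>
     open V \<and> openin (top_of_set S) (\<psi> ` V) \<and> homeomorphism V (\<psi> ` V) \<psi> (inv_into V \<psi>) \<and>
     (\<forall>c\<in>charts M. smooth_on {u\<in>V. \<psi> u \<in> fst c} (snd c \<circ> \<psi>) \<and>
        (\<forall>u\<in>V. \<psi> u \<in> fst c \<longrightarrow> inj (frechet_derivative (snd c \<circ> \<psi>) (at u))))"

definition submanifold :: "'k::finite itself \<Rightarrow> 'a::topological_space spacetime \<Rightarrow> 'a set \<Rightarrow> bool" where
  "submanifold _ M S \<longleftrightarrow>
     (\<forall>p\<in>S. \<exists>V (\<psi> :: real^'k \<Rightarrow> 'a). local_param M S V \<psi> \<and> p \<in> \<psi> ` V)"

text \<open>Coordinate basis vectors, induced metric, tangency, and orthogonal projection (the components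
  \<open>X\<^sup>\<alpha> = q\<^sup>\<alpha>\<^sup>\<beta> g(X, e\<^sub>\<beta>)\<close>) of a space-time vector at \<open>\<psi> u\<close>.\<close>

definition frame :: "'a spacetime \<Rightarrow> (real^'k \<Rightarrow> 'a) \<Rightarrow> real^'k \<Rightarrow> 'k \<Rightarrow> real^4" where
  "frame M \<psi> u \<alpha> = partial (snd (chart_at M (\<psi> u)) \<circ> \<psi>) u \<alpha>"

definition induced :: "'a spacetime \<Rightarrow> (real^'k \<Rightarrow> 'a) \<Rightarrow> real^'k \<Rightarrow> real^'k^'k" where
  "induced M \<psi> u = (\<chi> \<alpha> \<beta>. ip M (\<psi> u) (frame M \<psi> u \<alpha>) (frame M \<psi> u \<beta>))"

definition tangent_low :: "'a spacetime \<Rightarrow> 'a vfield \<Rightarrow> (real^'k \<Rightarrow> 'a) \<Rightarrow> real^'k \<Rightarrow> real^'k" where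
  "tangent_low M X \<psi> u = (\<chi> \<alpha>. ip M (\<psi> u) (at_pt M X (\<psi> u)) (frame M \<psi> u \<alpha>))"

definition tangent_part :: "'a spacetime \<Rightarrow> 'a vfield \<Rightarrow> (real^'k \<Rightarrow> 'a) \<Rightarrow> real^'k \<Rightarrow> real^'k" where
  "tangent_part M X \<psi> u = matrix_inv (induced M \<psi> u) *v tangent_low M X \<psi> u"

definition smooth_along ::
    "'k::finite itself \<Rightarrow> 'a::topological_space spacetime \<Rightarrow> 'a set \<Rightarrow> 'a vfield \<Rightarrow> bool" where
  "smooth_along _ M S X \<longleftrightarrow> vector_along (charts M) S X \<and>
     (\<forall>V (\<psi> :: real^'k \<Rightarrow> 'a). local_param M S V \<psi> \<longrightarrow>
        (\<forall>c\<in>charts M. smooth_on {u\<in>V. \<psi> u \<in> fst c} (X c \<circ> \<psi>)))"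

text \<open>The vector \<open>e\<^sub>\<alpha>\<^sup>b \<nabla>\<^sub>b X\<close>, for a field \<open>X\<close> that need only be defined along the submanifold.\<close>

definition nabla_along :: "'a spacetime \<Rightarrow> 'a vfield \<Rightarrow> (real^'k \<Rightarrow> 'a) \<Rightarrow> real^'k \<Rightarrow> 'k \<Rightarrow> real^4" where
  "nabla_along M X \<psi> u \<alpha> = (let c = chart_at M (\<psi> u) in
     partial (X c \<circ> \<psi>) u \<alpha> +
     (\<chi> i. \<Sum>j\<in>UNIV. \<Sum>l\<in>UNIV. christoffel (metric_coords M c) (snd c (\<psi> u)) i j l *
        frame M \<psi> u \<alpha> $ j * X c (\<psi> u) $ l))"

definition nowhere_null :: "'a::topological_space spacetime \<Rightarrow> 'a set \<Rightarrow> bool" where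
  "nowhere_null M H \<longleftrightarrow>
     (\<forall>V (\<psi> :: real^3 \<Rightarrow> 'a). local_param M H V \<psi> \<longrightarrow> (\<forall>u\<in>V. det (induced M \<psi> u) \<noteq> 0))"


section \<open>Closed spacelike surfaces\<close>

definition closed_spacelike_surface :: "'a::topological_space spacetime \<Rightarrow> 'a set \<Rightarrow> bool" where
  "closed_spacelike_surface M S \<longleftrightarrow> compact S \<and> submanifold TYPE(2) M S \<and>
     (\<forall>V (\<psi> :: real^2 \<Rightarrow> 'a). local_param M S V \<psi> \<longrightarrow>
        (\<forall>u\<in>V. \<forall>w. w \<noteq> 0 \<longrightarrow> w \<bullet> (induced M \<psi> u *v w) > 0))"

text \<open>A field of scalars given in terms of parametrizations (and not depending on their choice), as a
  function on \<open>S\<close>.\<close>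

definition on_surface ::
    "'a::topological_space spacetime \<Rightarrow> 'a set \<Rightarrow> ((real^2 \<Rightarrow> 'a) \<Rightarrow> real^2 \<Rightarrow> 'b) \<Rightarrow> 'a \<Rightarrow> 'b" where
  "on_surface M S F p =
     (case (SOME (\<psi>, u). \<exists>V. local_param M S V \<psi> \<and> u \<in> V \<and> \<psi> u = p) of (\<psi>, u) \<Rightarrow> F \<psi> u)"

text \<open>The area measure. Each parametrization \<open>(V, \<psi>)\<close> gives the measure \<open>\<surd>(det q) du\<close> on
  \<open>\<psi> ` V\<close>. By the change of variables formula these measures agree on overlaps, so that their
  supremum in the lattice of measures is the measure obtained by gluing them.\<close>

definition area_measure :: "'a::topological_space spacetime \<Rightarrow> 'a set \<Rightarrow> 'a measure" where
  "area_measure M S =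
     (SUP (V, \<psi>) \<in> {(V, \<psi>). local_param M S V \<psi>}.
        distr (density (restrict_space lborel V) (\<lambda>u::real^2. ennreal (sqrt (det (induced M \<psi> u)))))
          borel \<psi>)"

definition area_radius :: "'a::topological_space spacetime \<Rightarrow> 'a set \<Rightarrow> real" where
  "area_radius M S = sqrt (measure (area_measure M S) S / (4 * pi))"

text \<open>Future-directed null normals \<open>k\<close>, \<open>l\<close> (the latter being \<open>\<underline>k\<close>) with \<open>k \<cdot> l = -1\<close>.\<close>

definition null_normals ::
    "'a::topological_space spacetime \<Rightarrow> 'a set \<Rightarrow> 'a vfield \<Rightarrow> 'a vfield \<Rightarrow> bool" where
  "null_normals M S k l \<longleftrightarrow> smooth_along TYPE(2) M S k \<and> smooth_along TYPE(2) M S l \<and>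
     (\<forall>p\<in>S. ip M p (at_pt M k p) (at_pt M k p) = 0 \<and> ip M p (at_pt M l p) (at_pt M l p) = 0 \<and>
        ip M p (at_pt M k p) (at_pt M l p) = -1 \<and>
        ip M p (at_pt M (future M) p) (at_pt M k p) < 0 \<and>
        ip M p (at_pt M (future M) p) (at_pt M l p) < 0) \<and>
     (\<forall>V (\<psi> :: real^2 \<Rightarrow> 'a). local_param M S V \<psi> \<longrightarrow>
        (\<forall>u\<in>V. tangent_low M k \<psi> u = 0 \<and> tangent_low M l \<psi> u = 0))"

text \<open>The projection \<open>B\<^sub>\<alpha>\<^sub>\<beta>\<close> of \<open>\<nabla>\<^sub>a k\<^sub>b\<close> to the surface.\<close>

definition null_ext :: "'a spacetime \<Rightarrow> 'a vfield \<Rightarrow> (real^2 \<Rightarrow> 'a) \<Rightarrow> real^2 \<Rightarrow> 2 \<Rightarrow> 2 \<Rightarrow> real" where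
  "null_ext M k \<psi> u \<alpha> \<beta> = ip M (\<psi> u) (nabla_along M k \<psi> u \<alpha>) (frame M \<psi> u \<beta>)"

definition expansion :: "'a spacetime \<Rightarrow> 'a vfield \<Rightarrow> (real^2 \<Rightarrow> 'a) \<Rightarrow> real^2 \<Rightarrow> real" where
  "expansion M k \<psi> u =
     (\<Sum>\<alpha>\<in>UNIV. \<Sum>\<beta>\<in>UNIV. matrix_inv (induced M \<psi> u) $ \<alpha> $ \<beta> * null_ext M k \<psi> u \<alpha> \<beta>)"

definition shear :: "'a spacetime \<Rightarrow> 'a vfield \<Rightarrow> (real^2 \<Rightarrow> 'a) \<Rightarrow> real^2 \<Rightarrow> 2 \<Rightarrow> 2 \<Rightarrow> real" where
  "shear M k \<psi> u \<alpha> \<beta> = (null_ext M k \<psi> u \<alpha> \<beta> + null_ext M k \<psi> u \<beta> \<alpha>) / 2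
     - induced M \<psi> u $ \<alpha> $ \<beta> * expansion M k \<psi> u / 2"

text \<open>\<open>\<E> = \<sigma>\<^sub>a\<^sub>b \<sigma>\<^sup>a\<^sup>b + R\<^sub>a\<^sub>b k\<^sup>a k\<^sup>b\<close>\<close>

definition energy_flux :: "'a spacetime \<Rightarrow> 'a vfield \<Rightarrow> (real^2 \<Rightarrow> 'a) \<Rightarrow> real^2 \<Rightarrow> real" where
  "energy_flux M k \<psi> u = (let qinv = matrix_inv (induced M \<psi> u); p = \<psi> u; c = chart_at M p in
     (\<Sum>\<alpha>\<in>UNIV. \<Sum>\<beta>\<in>UNIV. \<Sum>\<gamma>\<in>UNIV. \<Sum>\<delta>\<in>UNIV.
        qinv $ \<alpha> $ \<gamma> * qinv $ \<beta> $ \<delta> * shear M k \<psi> u \<alpha> \<beta> * shear M k \<psi> u \<gamma> \<delta>) +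
     (\<Sum>a\<in>UNIV. \<Sum>b\<in>UNIV. ricci (metric_coords M c) (snd c p) a b * k c p $ a * k c p $ b))"

text \<open>\<open>S\<close> is marginally trapped, \<open>k\<close> being the null normal whose expansion vanishes.\<close>

definition marginally_trapped ::
    "'a::topological_space spacetime \<Rightarrow> 'a set \<Rightarrow> 'a vfield \<Rightarrow> 'a vfield \<Rightarrow> bool" where
  "marginally_trapped M S k l \<longleftrightarrow> closed_spacelike_surface M S \<and> null_normals M S k l \<and>
     (\<forall>p\<in>S. on_surface M S (expansion M k) p = 0)"


section \<open>Dynamical horizon segments\<close>

text \<open>Foliations of a 3-dimensional submanifold by embedded surfaces, in terms of foliated
  parametrizations.\<close>

definition foliates :: "'a::topological_space spacetime \<Rightarrow> 'a set \<Rightarrow> 'a set set \<Rightarrow> bool" where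
  "foliates M H L \<longleftrightarrow> \<Union>L = H \<and> pairwise disjnt L \<and>
     (\<forall>S\<in>L. submanifold TYPE(2) M S) \<and>
     (\<forall>p\<in>H. \<exists>a b (\<psi> :: real^3 \<Rightarrow> 'a). local_param M H (box a b) \<psi> \<and> p \<in> \<psi> ` box a b \<and>
        (\<forall>S\<in>L. \<exists>C. {u\<in>box a b. \<psi> u \<in> S} = {u\<in>box a b. u $ 3 \<in> C}))"

definition dynamical_horizon_segment ::
    "'a::topological_space spacetime \<Rightarrow> 'a set \<Rightarrow> 'a set set \<Rightarrow> bool" where
  "dynamical_horizon_segment M H L \<longleftrightarrow>
     connected H \<and> submanifold TYPE(3) M H \<and> nowhere_null M H \<and> foliates M H L \<and>
     (\<forall>S\<in>L. S homeomorphic sphere (0::real^3) 1 \<and>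
        (\<exists>k l. marginally_trapped M S k l \<and>
           (\<forall>p\<in>S. on_surface M S (expansion M l) p \<noteq> 0) \<and>
           (\<exists>p\<in>S. on_surface M S (energy_flux M k) p \<noteq> 0)))"


section \<open>Rotational Killing fields and spin multipoles\<close>

definition zeros_on :: "'a spacetime \<Rightarrow> 'a vfield \<Rightarrow> 'a set \<Rightarrow> 'a set" where
  "zeros_on M X S = {p\<in>S. at_pt M X p = 0}"

definition tangential :: "'a::topological_space spacetime \<Rightarrow> 'a set \<Rightarrow> 'a vfield \<Rightarrow> bool" where
  "tangential M S X \<longleftrightarrow>
     (\<forall>V (\<psi> :: real^2 \<Rightarrow> 'a). local_param M S V \<psi> \<longrightarrow>
        (\<forall>u\<in>V. at_pt M X (\<psi> u) \<in> span (range (frame M \<psi> u))))"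

definition integral_curve ::
    "'a::topological_space spacetime \<Rightarrow> 'a vfield \<Rightarrow> (real \<Rightarrow> 'a) \<Rightarrow> bool" where
  "integral_curve M X \<gamma> \<longleftrightarrow> continuous_on UNIV \<gamma> \<and>
     (\<forall>c\<in>charts M. \<forall>t. \<gamma> t \<in> fst c \<longrightarrow>
        ((snd c \<circ> \<gamma>) has_vector_derivative X c (\<gamma> t)) (at t))"

text \<open>\<open>X\<close> is tangential to \<open>S\<close>, and its restriction to \<open>S\<close> is a Killing field of the induced metric
  with two zeros and closed orbits, of period \<open>2\<pi>\<close>.\<close>

definition rotational_on :: "'a::topological_space spacetime \<Rightarrow> 'a set \<Rightarrow> 'a vfield \<Rightarrow> bool" where
  "rotational_on M S X \<longleftrightarrow> tangential M S X \<and>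
     (\<forall>V (\<psi> :: real^2 \<Rightarrow> 'a). local_param M S V \<psi> \<longrightarrow>
        (\<forall>u\<in>V. \<forall>\<alpha> \<beta>. cov_deriv (induced M \<psi>) (tangent_low M X \<psi>) u \<alpha> \<beta>
                     + cov_deriv (induced M \<psi>) (tangent_low M X \<psi>) u \<beta> \<alpha> = 0)) \<and>
     card (zeros_on M X S) = 2 \<and>
     (\<forall>p\<in>S. \<exists>\<gamma>. integral_curve M X \<gamma> \<and> range \<gamma> \<subseteq> S \<and> \<gamma> 0 = p \<and>
        (\<forall>t. \<gamma> (t + 2 * pi) = \<gamma> t) \<and>
        (p \<notin> zeros_on M X S \<longrightarrow> inj_on \<gamma> {0..<2 * pi}))"

text \<open>The area 2-form \<open>\<epsilon>\<^sub>c\<^sub>d = \<epsilon>\<^sub>a\<^sub>b\<^sub>c\<^sub>d l\<^sup>a k\<^sup>b\<close> of the surface.\<close>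

definition area_form ::
    "'a spacetime \<Rightarrow> 'a vfield \<Rightarrow> 'a vfield \<Rightarrow> (real^2 \<Rightarrow> 'a) \<Rightarrow> real^2 \<Rightarrow> 2 \<Rightarrow> 2 \<Rightarrow> real" where
  "area_form M k l \<psi> u \<alpha> \<beta> = (let p = \<psi> u in
     vol_form M (chart_at M p) p (at_pt M l p) (at_pt M k p) (frame M \<psi> u \<alpha>) (frame M \<psi> u \<beta>))"

text \<open>The invariant coordinates \<open>\<zeta> = cos \<theta>\<close> and \<open>\<phi>\<close>. The azimuth \<open>\<phi>\<close> jumps along a meridian, so
  its derivatives are those of a smooth function \<open>h\<close> equal to it modulo \<open>2\<pi>\<close>; its values at the two
  zeros of \<open>X\<close> are irrelevant.\<close>

definition zeta_coordinate ::
    "'a::topological_space spacetime \<Rightarrow> 'a set \<Rightarrow> 'a vfield \<Rightarrow> 'a vfield \<Rightarrow> 'a vfield \<Rightarrow> ('a \<Rightarrow> real) \<Rightarrow> bool" where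
  "zeta_coordinate M S k l X \<zeta> \<longleftrightarrow> \<zeta> ` S \<subseteq> {-1..1} \<and>
     (\<forall>V (\<psi> :: real^2 \<Rightarrow> 'a). local_param M S V \<psi> \<longrightarrow> smooth_on V (\<zeta> \<circ> \<psi>) \<and>
        (\<forall>u\<in>V. \<forall>\<alpha>. partial (\<zeta> \<circ> \<psi>) u \<alpha> =
           (\<Sum>\<beta>\<in>UNIV. area_form M k l \<psi> u \<beta> \<alpha> * tangent_part M X \<psi> u $ \<beta>) / (area_radius M S)\<^sup>2)) \<and>
     (LINT p:S|area_measure M S. \<zeta> p) = 0"

definition azimuth_coordinate ::
    "'a::topological_space spacetime \<Rightarrow> 'a set \<Rightarrow> 'a vfield \<Rightarrow> ('a \<Rightarrow> real) \<Rightarrow> ('a \<Rightarrow> real) \<Rightarrow> bool" where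
  "azimuth_coordinate M S X \<zeta> \<phi> \<longleftrightarrow> (\<forall>p\<in>S - zeros_on M X S. \<phi> p \<in> {0..<2 * pi}) \<and>
     (\<forall>V (\<psi> :: real^2 \<Rightarrow> 'a). local_param M S V \<psi> \<longrightarrow>
        (\<forall>u\<in>V. \<psi> u \<notin> zeros_on M X S \<longrightarrow>
          (\<exists>W h. open W \<and> u \<in> W \<and> W \<subseteq> V \<and> smooth_on W h \<and>
             (\<forall>w\<in>W. (\<exists>n::int. \<phi> (\<psi> w) = h w + 2 * pi * of_int n) \<and>
                frechet_derivative h (at w) (tangent_part M X \<psi> w) = 1 \<and>
                (\<Sum>\<alpha>\<in>UNIV. \<Sum>\<beta>\<in>UNIV. matrix_inv (induced M \<psi> w) $ \<alpha> $ \<beta> *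
                   partial h w \<alpha> * partial (\<zeta> \<circ> \<psi>) w \<beta>) = 0))))"

text \<open>Standard spherical harmonics with the Condon-Shortley phase, normalized in \<open>L\<^sup>2\<close> of the unit
  sphere; the associated Legendre functions are given by Rodrigues' formula.\<close>

definition assoc_legendre :: "nat \<Rightarrow> nat \<Rightarrow> real \<Rightarrow> real" where
  "assoc_legendre n m x = (-1) ^ m * sqrt (1 - x\<^sup>2) ^ m / (2 ^ n * fact n) *
     ((deriv ^^ (n + m)) (\<lambda>y. (y\<^sup>2 - 1) ^ n)) x"

definition spherical_harmonic :: "nat \<Rightarrow> int \<Rightarrow> real \<Rightarrow> real \<Rightarrow> complex" where
  "spherical_harmonic n m \<theta> \<phi> = (let j = nat \<bar>m\<bar>;
      y = of_real (sqrt ((2 * real n + 1) / (4 * pi) * fact (n - j) / fact (n + j)) *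
            assoc_legendre n j (cos \<theta>)) * cis (real j * \<phi>)
    in if m \<ge> 0 then y else (-1) ^ j * cnj y)"

text \<open>\<open>Y\<^sub>\<l>\<^sub>,\<^sub>m\<close> as a function on the surface.\<close>

definition harmonic_on :: "('a \<Rightarrow> real) \<Rightarrow> ('a \<Rightarrow> real) \<Rightarrow> nat \<Rightarrow> int \<Rightarrow> 'a \<Rightarrow> complex" where
  "harmonic_on \<zeta> \<phi> n m p = spherical_harmonic n m (arccos (\<zeta> p)) (\<phi> p)"

definition rotational_1form ::
    "'a spacetime \<Rightarrow> 'a vfield \<Rightarrow> 'a vfield \<Rightarrow> (real^2 \<Rightarrow> 'a) \<Rightarrow> real^2 \<Rightarrow> real^2" where
  "rotational_1form M k l \<psi> u = (\<chi> \<alpha>. - ip M (\<psi> u) (at_pt M l (\<psi> u)) (nabla_along M k \<psi> u \<alpha>))"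

text \<open>\<open>\<epsilon>\<^sup>a\<^sup>b D\<^sub>a \<omega>\<^sub>b\<close>\<close>

definition rotational_curl ::
    "'a spacetime \<Rightarrow> 'a vfield \<Rightarrow> 'a vfield \<Rightarrow> (real^2 \<Rightarrow> 'a) \<Rightarrow> real^2 \<Rightarrow> real" where
  "rotational_curl M k l \<psi> u = (let qinv = matrix_inv (induced M \<psi> u) in
     \<Sum>\<alpha>\<in>UNIV. \<Sum>\<beta>\<in>UNIV.
       (\<Sum>\<gamma>\<in>UNIV. \<Sum>\<delta>\<in>UNIV. qinv $ \<alpha> $ \<gamma> * qinv $ \<beta> $ \<delta> * area_form M k l \<psi> u \<gamma> \<delta>) *
       cov_deriv (induced M \<psi>) (rotational_1form M k l \<psi>) u \<alpha> \<beta>)"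

definition spin_multipole ::
    "'a::topological_space spacetime \<Rightarrow> 'a set \<Rightarrow> 'a vfield \<Rightarrow> 'a vfield \<Rightarrow>
     ('a \<Rightarrow> real) \<Rightarrow> ('a \<Rightarrow> real) \<Rightarrow> nat \<Rightarrow> int \<Rightarrow> complex" where
  "spin_multipole M S k l \<zeta> \<phi> n m = 1/4 * (LINT p:S|area_measure M S.
     of_real (2 * on_surface M S (rotational_curl M k l) p) * harmonic_on \<zeta> \<phi> n m p)"

text \<open>\<open>X\<^sup>a \<partial>\<^sub>a f\<close> for a function \<open>f\<close> on the surface: the derivative along the orthogonal projection
  of \<open>X\<close> to the surface.\<close>

definition surface_deriv ::
    "'a spacetime \<Rightarrow> 'a vfield \<Rightarrow> ('a \<Rightarrow> complex) \<Rightarrow> (real^2 \<Rightarrow> 'a) \<Rightarrow> real^2 \<Rightarrow> complex" where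
  "surface_deriv M X f \<psi> u = frechet_derivative (f \<circ> \<psi>) (at u) (tangent_part M X \<psi> u)"

end

theory Submission imports Defs
begin

text \<open>Since \<open>\<Theta>\<close>, the expansion of \<open>l\<close>, does not vanish, \<open>\<beta> = \<omega> + d ln \<bar>\<Theta>\<bar>\<close> is a global 1-form on the leaf with
  \<open>d\<beta> = d\<omega>\<close>. It is the rotational 1-form of the null normals scaled by \<open>\<Theta>\<close>, which the Killing field \<open>X\<close>
  preserves, so that \<open>\<L>\<^sub>X \<beta> = 0\<close>; moreover \<open>\<beta>(X) = -\<kappa>\<close> with \<open>\<kappa> = k\<^sup>a l\<^sup>b \<nabla>\<^sub>a X\<^sub>b\<close>. Hence \<open>i\<^sub>X d\<omega> = d\<kappa>\<close>, and
  Stokes' theorem for \<open>2 Y \<beta>\<close>, with \<open>dY = Y' R\<^sup>-\<^sup>2 i\<^sub>X \<epsilon>\<close>, turns the integral of \<open>2 Y curl \<omega>\<close> into that of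
  \<open>-2 \<kappa> Y' R\<^sup>-\<^sup>2\<close>. In a null frame the part of the twist tangential to the leaf is seen to be
  \<open>2 \<kappa>\<close> times \<open>X\<close> turned by a right angle, so the latter integrand is \<open>t\<^sup>a \<partial>\<^sub>a Y / n\<close>. If the twist vanishes,
  then so do \<open>\<kappa>\<close>, \<open>d\<kappa>\<close> and therefore \<open>curl \<omega>\<close>.\<close>

text \<open>The given \<open>k\<close>, \<open>l\<close> need not be invariant under the flow of
  \<open>X\<close>. The flow rescales them, L_X k = c k and L_X l = - c l, and then L_X \<omega> =
  dc, so that \<omega> itself is not invariant. Invariant normals could be sought by averaging over
  the orbits; the expansion supplies them at once, because X(\<Theta>) = - c \<Theta> and the
  function c cancels in \<omega> + d ln |\<Theta>|. The second obstacle is regularity. Scalars on a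
  leaf are evaluated in an arbitrarily chosen parametrization, and the transition maps between
  parametrizations are obtained as differentiable maps, without a second derivative. That the curl
  does not depend on the parametrization is therefore read off from i_X d\<omega> = d\<kappa> where
  \<open>X\<close> does not vanish, and extended by continuity. Stokes' theorem is reduced to single
  patches by a partition of unity whose bump functions live on the space-time, so that they are of
  class C^1 in every parametrization without recourse to transition maps.\<close>

abbreviation fder :: "('a::real_normed_vector \<Rightarrow> 'b::real_normed_vector) \<Rightarrow> 'a \<Rightarrow> 'a \<Rightarrow> 'b" where
  "fder f x \<equiv> frechet_derivative f (at x)"

section \<open>Functions of class C^k\<close>

lemma fder_eqI: "(f has_derivative f') (at x) \<Longrightarrow> fder f x = f'"
  by (rule frechet_derivative_at[symmetric])

lemma fder_cong_open:
  assumes "open U" "x \<in> U" "\<And>y. y \<in> U \<Longrightarrow> f y = g y"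
  shows "fder f x = fder g x"
proof -
  have "(f has_derivative D) (at x) \<longleftrightarrow> (g has_derivative D) (at x)" for D
    using assms has_derivative_transform_within_open[OF _ assms(1,2)] by metis
  then show ?thesis unfolding frechet_derivative_def by simp
qed

lemma differentiable_cong_open:
  assumes "open U" "x \<in> U" "\<And>y. y \<in> U \<Longrightarrow> f y = g y" "f differentiable (at x)"
  shows "g differentiable (at x)"
  using assms unfolding differentiable_def by (metis has_derivative_transform_within_open)

lemma Ck_on_cong:
  assumes "open U" "\<And>x. x \<in> U \<Longrightarrow> f x = g x"
  shows "Ck_on k U f \<longleftrightarrow> Ck_on k U g"
  using assms(2)
proof (induction k arbitrary: f g)
  case 0 then show ?case by (simp cong: continuous_on_cong)
next
  case (Suc k)
  have fd: "fder f x = fder g x" if "x \<in> U" for x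
    by (rule fder_cong_open[OF assms(1) that Suc.prems])
  have "Ck_on k U (\<lambda>x. fder f x v) = Ck_on k U (\<lambda>x. fder g x v)" for v
    by (rule Suc.IH) (simp add: fd)
  moreover have "f differentiable (at x) \<longleftrightarrow> g differentiable (at x)" if "x \<in> U" for x
    using differentiable_cong_open[OF assms(1) that] Suc.prems by metis
  ultimately show ?case by simp
qed

lemma Ck_on_subset: "Ck_on k U f \<Longrightarrow> V \<subseteq> U \<Longrightarrow> Ck_on k V f"
  by (induction k arbitrary: f) (auto intro: continuous_on_subset)

lemma Ck_on_Suc_lower: "Ck_on (Suc k) U f \<Longrightarrow> Ck_on k U f"
proof (induction k arbitrary: f)
  case 0 then show ?case
    by (auto intro!: continuous_at_imp_continuous_on differentiable_imp_continuous_within)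
next
  case (Suc k) then show ?case by (metis Ck_on.simps(2))
qed

lemma Ck_on_mono: "Ck_on k U f \<Longrightarrow> j \<le> k \<Longrightarrow> Ck_on j U f"
  by (induction k) (auto simp del: Ck_on.simps(2) simp: le_Suc_eq dest: Ck_on_Suc_lower)

lemma Ck_on_imp_continuous_on: "Ck_on k U f \<Longrightarrow> continuous_on U f"
  using Ck_on_mono[of k U f 0] by simp

lemma Ck_on_has_derivative: "Ck_on (Suc k) U f \<Longrightarrow> x \<in> U \<Longrightarrow> (f has_derivative fder f x) (at x)"
  by (auto simp: frechet_derivative_works)

lemma Ck_on_fder: "Ck_on (Suc k) U f \<Longrightarrow> Ck_on k U (\<lambda>x. fder f x v)"
  by simp

lemma Ck_on_SucI:
  assumes "open U" "\<And>x. x \<in> U \<Longrightarrow> (f has_derivative f' x) (at x)" "\<And>v. Ck_on k U (\<lambda>x. f' x v)"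
  shows "Ck_on (Suc k) U f"
proof -
  have "fder f x = f' x" if "x \<in> U" for x by (rule fder_eqI[OF assms(2)[OF that]])
  then have "Ck_on k U (\<lambda>x. fder f x v)" for v
    using assms(3)[of v] Ck_on_cong[OF assms(1), of "\<lambda>x. fder f x v" "\<lambda>x. f' x v"] by simp
  then show ?thesis using assms(2) by (auto simp: differentiable_def)
qed

lemma Ck_on_Un: "open U \<Longrightarrow> open V \<Longrightarrow> Ck_on k U f \<Longrightarrow> Ck_on k V f \<Longrightarrow> Ck_on k (U \<union> V) f"
  by (induction k arbitrary: f) (auto intro: continuous_on_open_Un)

lemma Ck_on_const [simp]: "Ck_on k U (\<lambda>x. c)"
  by (induction k arbitrary: c) auto

lemma Ck_on_bounded_linear:
  assumes "open U" "bounded_linear L" "Ck_on k U f"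
  shows "Ck_on k U (\<lambda>x. L (f x))"
  using assms(3)
proof (induction k arbitrary: f)
  case 0 then show ?case using bounded_linear.continuous_on[OF assms(2)] by auto
next
  case (Suc k)
  show ?case
    by (rule Ck_on_SucI[OF assms(1) bounded_linear.has_derivative[OF assms(2) Ck_on_has_derivative[OF Suc.prems]]])
       (blast, rule Suc.IH[OF Ck_on_fder[OF Suc.prems]])
qed

lemma Ck_on_add:
  assumes "open U" "Ck_on k U f" "Ck_on k U g"
  shows "Ck_on k U (\<lambda>x. f x + g x)"
  using assms(2,3)
proof (induction k arbitrary: f g)
  case 0 then show ?case by (auto intro: continuous_intros)
next
  case (Suc k)
  show ?case
    by (rule Ck_on_SucI[OF assms(1) has_derivative_add[OF Ck_on_has_derivative[OF Suc.prems(1)] Ck_on_has_derivative[OF Suc.prems(2)]]])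
       (blast, blast, rule Suc.IH[OF Ck_on_fder[OF Suc.prems(1)] Ck_on_fder[OF Suc.prems(2)]])
qed

lemma Ck_on_minus: "open U \<Longrightarrow> Ck_on k U f \<Longrightarrow> Ck_on k U (\<lambda>x. - f x)"
  by (rule Ck_on_bounded_linear[OF _ bounded_linear_minus[OF bounded_linear_ident]])

lemma Ck_on_diff: "open U \<Longrightarrow> Ck_on k U f \<Longrightarrow> Ck_on k U g \<Longrightarrow> Ck_on k U (\<lambda>x. f x - g x)"
  using Ck_on_add[of U k f "\<lambda>x. - g x"] Ck_on_minus[of U k g] by simp

lemma Ck_on_bilinear:
  assumes "open U" "bounded_bilinear B" "Ck_on k U f" "Ck_on k U g"
  shows "Ck_on k U (\<lambda>x. B (f x) (g x))"
  using assms(3,4)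
proof (induction k arbitrary: f g)
  case 0 then show ?case using bounded_bilinear.continuous_on[OF assms(2)] by auto
next
  case (Suc k)
  have low: "Ck_on k U f" "Ck_on k U g" using Suc.prems Ck_on_Suc_lower by blast+
  show ?case
    by (rule Ck_on_SucI[OF assms(1) bounded_bilinear.FDERIV[OF assms(2) Ck_on_has_derivative[OF Suc.prems(1)] Ck_on_has_derivative[OF Suc.prems(2)]]])
       (blast, blast, intro Ck_on_add[OF assms(1)] Suc.IH low Ck_on_fder[OF Suc.prems(1)] Ck_on_fder[OF Suc.prems(2)])
qed

lemmas Ck_on_mult = Ck_on_bilinear[OF _ bounded_bilinear_mult]
lemmas Ck_on_scaleR = Ck_on_bilinear[OF _ bounded_bilinear_scaleR]

lemma Ck_on_sum:
  assumes "open U" "\<And>i. i \<in> I \<Longrightarrow> Ck_on k U (f i)"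
  shows "Ck_on k U (\<lambda>x. \<Sum>i\<in>I. f i x)"
  using assms(2) by (induction I rule: infinite_finite_induct) (simp_all add: Ck_on_add[OF assms(1)])

text \<open>\<open>Ck_on\<close> speaks of derivatives in fixed directions. Expanding in
  \<open>Basis\<close> reduces a direction that varies with the point, as in the chain rule, to
  these.\<close>

lemma linear_Basis_expand:
  assumes "bounded_linear (L :: 'a::euclidean_space \<Rightarrow> 'b::real_normed_vector)"
  shows "L v = (\<Sum>b\<in>Basis. (v \<bullet> b) *\<^sub>R L b)"
proof -
  have "L v = L (\<Sum>b\<in>Basis. (v \<bullet> b) *\<^sub>R b)" by (simp add: euclidean_representation)
  also have "\<dots> = (\<Sum>b\<in>Basis. (v \<bullet> b) *\<^sub>R L b)"
    by (simp add: linear_sum[OF bounded_linear.linear[OF assms]] linear_cmul[OF bounded_linear.linear[OF assms]])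
  finally show ?thesis .
qed

lemma Ck_on_compose:
  fixes f :: "'a::real_normed_vector \<Rightarrow> 'b::euclidean_space" and g :: "'b \<Rightarrow> 'c::real_normed_vector"
  assumes "open U" "open W" "\<And>x. x \<in> U \<Longrightarrow> f x \<in> W" "Ck_on k U f" "Ck_on k W g"
  shows "Ck_on k U (\<lambda>x. g (f x))"
  using assms(4,5)
proof (induction k arbitrary: g)
  case 0 show ?case
    unfolding Ck_on.simps(1)
    by (rule continuous_on_compose2[OF 0(2)[unfolded Ck_on.simps(1)] 0(1)[unfolded Ck_on.simps(1)]])
       (use assms(3) in auto)
next
  case (Suc k)
  have low: "Ck_on k U f" by (rule Ck_on_Suc_lower[OF Suc.prems(1)])
  \<comment> \<open>The chain rule with the outer derivative expanded in \<open>Basis\<close>: the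
    factors \<open>fder g (f x) b\<close> are again composites with \<open>f\<close>, and the
    induction hypothesis covers them because it holds for all outer functions.\<close>
  have der: "((\<lambda>x. g (f x)) has_derivative (\<lambda>v. \<Sum>b\<in>Basis. (fder f x v \<bullet> b) *\<^sub>R fder g (f x) b)) (at x)"
    if "x \<in> U" for x
  proof -
    have d: "(g has_derivative fder g (f x)) (at (f x))"
      by (rule Ck_on_has_derivative[OF Suc.prems(2) assms(3)[OF that]])
    have "((\<lambda>x. g (f x)) has_derivative (\<lambda>v. fder g (f x) (fder f x v))) (at x)"
      using has_derivative_compose[OF Ck_on_has_derivative[OF Suc.prems(1) that] d] .
    then show ?thesis
      by (rule has_derivative_eq_rhs) (rule ext, rule linear_Basis_expand[OF has_derivative_bounded_linear[OF d]])
  qed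
  have "Ck_on k U (\<lambda>x. \<Sum>b\<in>Basis. (fder f x v \<bullet> b) *\<^sub>R fder g (f x) b)" for v
  proof (intro Ck_on_sum assms(1) Ck_on_scaleR)
    fix b :: 'b
    show "Ck_on k U (\<lambda>x. fder f x v \<bullet> b)"
      using Ck_on_bounded_linear[OF assms(1) bounded_linear_inner_left Ck_on_fder[OF Suc.prems(1)]] by blast
    show "Ck_on k U (\<lambda>x. fder g (f x) b)"
      using Suc.IH[OF low Ck_on_fder[OF Suc.prems(2)]] by blast
  qed
  from Ck_on_SucI[OF assms(1) der this] show ?case by blast
qed

lemma Ck_on_inverse:
  fixes f :: "'a::real_normed_vector \<Rightarrow> real"
  assumes "open U" "\<And>x. x \<in> U \<Longrightarrow> f x \<noteq> 0" "Ck_on k U f"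
  shows "Ck_on k U (\<lambda>x. inverse (f x))"
  using assms(3)
proof (induction k)
  case 0 then show ?case using assms(2) by (auto intro: continuous_on_inverse)
next
  case (Suc k)
  have low: "Ck_on k U f" by (rule Ck_on_Suc_lower[OF Suc.prems])
  show ?case
    by (rule Ck_on_SucI[OF assms(1) Deriv.has_derivative_inverse[OF assms(2) Ck_on_has_derivative[OF Suc.prems]]])
       (assumption, assumption, intro Ck_on_minus[OF assms(1)] Ck_on_mult[OF assms(1)] Suc.IH[OF low] Ck_on_fder[OF Suc.prems])
qed

lemma Ck_on_divide:
  fixes f g :: "'a::real_normed_vector \<Rightarrow> real"
  assumes "open U" "\<And>x. x \<in> U \<Longrightarrow> g x \<noteq> 0" "Ck_on k U f" "Ck_on k U g"
  shows "Ck_on k U (\<lambda>x. f x / g x)"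
  unfolding divide_inverse by (rule Ck_on_mult[OF assms(1,3) Ck_on_inverse[OF assms(1,2,4)]])

lemma Ck_on_fder_field:
  fixes f :: "'a::euclidean_space \<Rightarrow> 'b::real_normed_vector"
  assumes "open U" "Ck_on (Suc k) U f" "Ck_on k U v"
  shows "Ck_on k U (\<lambda>x. fder f x (v x))"
proof -
  have "Ck_on k U (\<lambda>x. \<Sum>b\<in>Basis. (v x \<bullet> b) *\<^sub>R fder f x b)"
    using assms by (intro Ck_on_sum Ck_on_scaleR Ck_on_bounded_linear[OF _ bounded_linear_inner_left]) auto
  moreover have eq: "fder f x (v x) = (\<Sum>b\<in>Basis. (v x \<bullet> b) *\<^sub>R fder f x b)" if "x \<in> U" for x
    by (rule linear_Basis_expand[OF has_derivative_bounded_linear[OF Ck_on_has_derivative[OF assms(2) that]]])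
  ultimately show ?thesis
    using Ck_on_cong[where f="\<lambda>x. fder f x (v x)" and U=U, OF assms(1) eq] by simp
qed

section \<open>Symmetry of the second derivative\<close>

text \<open>The mean value theorem is used twice: along \<open>a\<close> for the difference of
  \<open>f\<close> over the step \<open>h *\<^sub>R b\<close>, then along \<open>b\<close> for the
  resulting derivative. Exchanging \<open>a\<close> and \<open>b\<close> leaves the second
  difference unchanged, which gives Schwarz's theorem below.\<close>

lemma real_second_difference:
  fixes f :: "'a::real_normed_vector \<Rightarrow> real"
  assumes U: "open U" and C: "Ck_on 2 U f" and h: "0 < h"
    and inU: "\<And>s t. s \<in> {0..h} \<Longrightarrow> t \<in> {0..h} \<Longrightarrow> x + s *\<^sub>R a + t *\<^sub>R b \<in> U"
  shows "\<exists>s\<in>{0<..<h}. \<exists>t\<in>{0<..<h}. f (x + h *\<^sub>R a + h *\<^sub>R b) - f (x + h *\<^sub>R a) - f (x + h *\<^sub>R b) + f x =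
     h * (h * fder (\<lambda>y. fder f y a) (x + s *\<^sub>R a + t *\<^sub>R b) b)"
proof -
  have C2: "Ck_on (Suc 1) U f" using C by (simp add: numeral_2_eq_2)
  have C1: "Ck_on (Suc 0) U (\<lambda>y. fder f y a)" by (rule Ck_on_fder[OF C2[unfolded One_nat_def]])
  define P where "P = (\<lambda>s. f (x + s *\<^sub>R a + h *\<^sub>R b) - f (x + s *\<^sub>R a))"
  have lin: "fder f y (r *\<^sub>R a) = r * fder f y a" if "y \<in> U" for y r
    using has_derivative_bounded_linear[OF Ck_on_has_derivative[OF C2 that]] by (simp add: linear_cmul bounded_linear.linear)
  have lin1: "fder (\<lambda>y. fder f y a) y (r *\<^sub>R b) = r * fder (\<lambda>y. fder f y a) y b" if "y \<in> U" for y r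
    using has_derivative_bounded_linear[OF Ck_on_has_derivative[OF C1 that]] by (simp add: linear_cmul bounded_linear.linear)
  have "\<exists>s>0. s < h \<and> P h - P 0 = (h - 0) * (fder f (x + s *\<^sub>R a + h *\<^sub>R b) a - fder f (x + s *\<^sub>R a) a)"
  proof (rule MVT2[OF h])
    fix s assume s: "0 \<le> s" "s \<le> h"
    have u: "x + s *\<^sub>R a + h *\<^sub>R b \<in> U" "x + s *\<^sub>R a \<in> U"
      using inU[of s h] inU[of s 0] s h by auto
    have "((\<lambda>s. f (x + s *\<^sub>R a + h *\<^sub>R b)) has_derivative (\<lambda>r. fder f (x + s *\<^sub>R a + h *\<^sub>R b) (r *\<^sub>R a))) (at s)"
      by (rule has_derivative_compose[of "\<lambda>s. x + s *\<^sub>R a + h *\<^sub>R b", OF _ Ck_on_has_derivative[OF C2 u(1)]]) (auto intro!: derivative_eq_intros)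
    moreover have "((\<lambda>s. f (x + s *\<^sub>R a)) has_derivative (\<lambda>r. fder f (x + s *\<^sub>R a) (r *\<^sub>R a))) (at s)"
      by (rule has_derivative_compose[of "\<lambda>s. x + s *\<^sub>R a", OF _ Ck_on_has_derivative[OF C2 u(2)]]) (auto intro!: derivative_eq_intros)
    ultimately have "(P has_derivative (\<lambda>r. fder f (x + s *\<^sub>R a + h *\<^sub>R b) (r *\<^sub>R a) - fder f (x + s *\<^sub>R a) (r *\<^sub>R a))) (at s)"
      unfolding P_def by (rule has_derivative_diff)
    then show "DERIV P s :> fder f (x + s *\<^sub>R a + h *\<^sub>R b) a - fder f (x + s *\<^sub>R a) a"
      unfolding has_field_derivative_def lin[OF u(1)] lin[OF u(2)] by (rule has_derivative_eq_rhs) (auto simp: algebra_simps)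
  qed
  then obtain s where s: "0 < s" "s < h" and Ps: "P h - P 0 = h * (fder f (x + s *\<^sub>R a + h *\<^sub>R b) a - fder f (x + s *\<^sub>R a) a)" by auto
  define Q where "Q = (\<lambda>t. fder f (x + s *\<^sub>R a + t *\<^sub>R b) a)"
  have "\<exists>t>0. t < h \<and> Q h - Q 0 = (h - 0) * fder (\<lambda>y. fder f y a) (x + s *\<^sub>R a + t *\<^sub>R b) b"
  proof (rule MVT2[OF h])
    fix t assume t: "0 \<le> t" "t \<le> h"
    have u: "x + s *\<^sub>R a + t *\<^sub>R b \<in> U" using inU[of s t] s t by auto
    have "((\<lambda>t. fder f (x + s *\<^sub>R a + t *\<^sub>R b) a) has_derivative (\<lambda>r. fder (\<lambda>y. fder f y a) (x + s *\<^sub>R a + t *\<^sub>R b) (r *\<^sub>R b))) (at t)"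
      by (rule has_derivative_compose[of "\<lambda>t. x + s *\<^sub>R a + t *\<^sub>R b", OF _ Ck_on_has_derivative[OF C1 u]]) (auto intro!: derivative_eq_intros)
    then show "DERIV Q t :> fder (\<lambda>y. fder f y a) (x + s *\<^sub>R a + t *\<^sub>R b) b"
      unfolding Q_def has_field_derivative_def lin1[OF u] by (rule has_derivative_eq_rhs) (auto simp: algebra_simps)
  qed
  then obtain t where t: "0 < t" "t < h" and Qt: "Q h - Q 0 = h * fder (\<lambda>y. fder f y a) (x + s *\<^sub>R a + t *\<^sub>R b) b" by auto
  have "P h - P 0 = h * (Q h - Q 0)" using Ps unfolding Q_def by simp
  then show ?thesis using s t Qt unfolding P_def by (intro bexI[of _ s] bexI[of _ t]) auto
qed

lemma real_fder_symmetric: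
  fixes f :: "'a::real_normed_vector \<Rightarrow> real"
  assumes U: "open U" and C: "Ck_on 2 U f" and x: "x \<in> U"
  shows "fder (\<lambda>y. fder f y a) x b = fder (\<lambda>y. fder f y b) x a"
proof (rule ccontr)
  define A where "A = (\<lambda>y. fder (\<lambda>y. fder f y a) y b)"
  define B where "B = (\<lambda>y. fder (\<lambda>y. fder f y b) y a)"
  assume "\<not> ?thesis"
  then have ne: "\<bar>A x - B x\<bar> > 0" unfolding A_def B_def by simp
  have cont: "continuous_on U A" "continuous_on U B"
    using C unfolding A_def B_def by (simp_all add: numeral_2_eq_2)
  \<comment> \<open>With a third of the gap, two errors below \<open>e\<close> cannot bridge
    it.\<close>
  define e where "e = \<bar>A x - B x\<bar> / 3"
  have e: "e > 0" using ne by (simp add: e_def)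
  obtain d1 where d1: "d1 > 0" "\<And>y. dist y x < d1 \<Longrightarrow> dist (A y) (A x) < e"
    using cont(1) U x e by (metis continuous_on_eq_continuous_at continuous_at_eps_delta dist_commute dist_norm)
  obtain d2 where d2: "d2 > 0" "\<And>y. dist y x < d2 \<Longrightarrow> dist (B y) (B x) < e"
    using cont(2) U x e by (metis continuous_on_eq_continuous_at continuous_at_eps_delta dist_commute dist_norm)
  obtain d3 where d3: "d3 > 0" "\<And>y. dist y x < d3 \<Longrightarrow> y \<in> U"
    using U x by (metis open_dist)
  define d where "d = min d1 (min d2 d3)"
  have d: "d > 0" using d1 d2 d3 by (simp add: d_def)
  \<comment> \<open>Small enough that the parallelogram with sides \<open>h *\<^sub>R a\<close> and
    \<open>h *\<^sub>R b\<close> stays within \<open>d\<close> of \<open>x\<close>.\<close>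
  define h where "h = d / (2 * (norm a + norm b + 1))"
  have h: "h > 0" using d by (simp add: h_def add_nonneg_pos)
  have near: "dist (x + s *\<^sub>R v + t *\<^sub>R w) x < d"
    if "s \<in> {0..h}" "t \<in> {0..h}" "norm v + norm w = norm a + norm b" for s t v w
  proof -
    have "dist (x + s *\<^sub>R v + t *\<^sub>R w) x \<le> norm (s *\<^sub>R v) + norm (t *\<^sub>R w)"
      unfolding dist_norm by (metis add.assoc add_diff_cancel_left' norm_triangle_ineq)
    also have "\<dots> \<le> h * norm v + h * norm w"
      using that by (auto intro!: add_mono mult_right_mono)
    also have "\<dots> = h * (norm a + norm b)" using that(3) by (simp add: algebra_simps flip: that(3))
    also have "\<dots> < h * (2 * (norm a + norm b + 1))"
      using h by (intro mult_strict_left_mono) (auto simp: add_nonneg_pos)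
    also have "\<dots> = d" unfolding h_def by (smt (verit) nonzero_eq_divide_eq norm_ge_zero)
    finally show ?thesis .
  qed
  obtain s t where st: "s \<in> {0<..<h}" "t \<in> {0<..<h}"
    and eq1: "f (x + h *\<^sub>R a + h *\<^sub>R b) - f (x + h *\<^sub>R a) - f (x + h *\<^sub>R b) + f x = h * (h * A (x + s *\<^sub>R a + t *\<^sub>R b))"
    using real_second_difference[OF U C h, of x a b] near d3 unfolding A_def d_def by fastforce
  obtain s' t' where st': "s' \<in> {0<..<h}" "t' \<in> {0<..<h}"
    and eq2: "f (x + h *\<^sub>R b + h *\<^sub>R a) - f (x + h *\<^sub>R b) - f (x + h *\<^sub>R a) + f x = h * (h * B (x + s' *\<^sub>R b + t' *\<^sub>R a))"
    using real_second_difference[OF U C h, of x b a] near d3 unfolding B_def d_def by fastforce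
  have "x + h *\<^sub>R b + h *\<^sub>R a = x + h *\<^sub>R a + h *\<^sub>R b" by simp
  with eq2 have "f (x + h *\<^sub>R a + h *\<^sub>R b) - f (x + h *\<^sub>R b) - f (x + h *\<^sub>R a) + f x =
      h * (h * B (x + s' *\<^sub>R b + t' *\<^sub>R a))" by (simp only:)
  then have "h * (h * A (x + s *\<^sub>R a + t *\<^sub>R b)) = h * (h * B (x + s' *\<^sub>R b + t' *\<^sub>R a))"
    using eq1 by linarith
  then have "A (x + s *\<^sub>R a + t *\<^sub>R b) = B (x + s' *\<^sub>R b + t' *\<^sub>R a)" using h by simp
  moreover have "dist (A (x + s *\<^sub>R a + t *\<^sub>R b)) (A x) < e"
    using near[of s t a b] st d1 unfolding d_def by auto
  moreover have "dist (B (x + s' *\<^sub>R b + t' *\<^sub>R a)) (B x) < e"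
    using near[of s' t' b a] st' d2 unfolding d_def by auto
  ultimately have "dist (A x) (B x) < e + e" by (metis dist_commute dist_triangle_less_add)
  moreover have "dist (A x) (B x) = 3 * e" unfolding e_def dist_real_def by simp
  ultimately show False using e by linarith
qed

lemma fder_symmetric:
  fixes f :: "'a::real_normed_vector \<Rightarrow> 'b::euclidean_space"
  assumes U: "open U" and C: "Ck_on 2 U f" and x: "x \<in> U"
  shows "fder (\<lambda>y. fder f y a) x b = fder (\<lambda>y. fder f y b) x a"
proof (rule euclidean_eqI)
  fix i :: 'b
  have C2: "Ck_on (Suc (Suc 0)) U f" using C by (simp add: numeral_2_eq_2)
  have inner1: "fder (\<lambda>z. f z \<bullet> i) y v = fder f y v \<bullet> i" if "y \<in> U" for y v
    by (rule fder_eqI[THEN fun_cong]) (rule has_derivative_inner_left[OF Ck_on_has_derivative[OF C2 that]])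
  have inner2: "fder (\<lambda>y. fder (\<lambda>z. f z \<bullet> i) y v) x w = fder (\<lambda>y. fder f y v) x w \<bullet> i" for v w
  proof -
    have "fder (\<lambda>y. fder (\<lambda>z. f z \<bullet> i) y v) x w = fder (\<lambda>y. fder f y v \<bullet> i) x w"
      by (rule fun_cong[OF fder_cong_open[OF U x inner1]])
    also have "\<dots> = fder (\<lambda>y. fder f y v) x w \<bullet> i"
      by (rule fder_eqI[THEN fun_cong])
         (rule has_derivative_inner_left[OF Ck_on_has_derivative[OF Ck_on_fder[OF C2] x]])
    finally show ?thesis .
  qed
  have C': "Ck_on 2 U (\<lambda>z. f z \<bullet> i)" by (rule Ck_on_bounded_linear[OF U bounded_linear_inner_left C])
  show "fder (\<lambda>y. fder f y a) x b \<bullet> i = fder (\<lambda>y. fder f y b) x a \<bullet> i"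
    by (rule trans[OF inner2[symmetric] trans[OF real_fder_symmetric[OF U C' x] inner2]])
qed

text \<open>The derivative of \<open>f\<close> is taken at a moving point in a moving direction.
  Second derivatives of the metric, of the Killing field and of coordinate changes enter through
  this rule.\<close>

lemma has_derivative_fder_field:
  fixes f :: "'a::euclidean_space \<Rightarrow> 'b::real_normed_vector" and F :: "'c::real_normed_vector \<Rightarrow> 'a"
  assumes U: "open U" and C: "Ck_on 2 U f" and x: "F u \<in> U"
    and F: "(F has_derivative F') (at u)" and a: "(a has_derivative a') (at u)"
  shows "((\<lambda>u. fder f (F u) (a u)) has_derivative
     (\<lambda>h. fder (\<lambda>y. fder f y (a u)) (F u) (F' h) + fder f (F u) (a' h))) (at u)"
proof -
  have C2: "Ck_on (Suc (Suc 0)) U f" using C by (simp add: numeral_2_eq_2)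
  have bl: "bounded_linear (fder f y)" if "y \<in> U" for y
    by (rule has_derivative_bounded_linear[OF Ck_on_has_derivative[OF C2 that]])
  have dfb: "((\<lambda>y. fder f y v) has_derivative fder (\<lambda>y. fder f y v) (F u)) (at (F u))" for v
    by (rule Ck_on_has_derivative[OF Ck_on_fder[OF C2] x])
  have 1: "((\<lambda>u. \<Sum>b\<in>Basis. (a u \<bullet> b) *\<^sub>R fder f (F u) b) has_derivative
     (\<lambda>h. \<Sum>b\<in>Basis. (a u \<bullet> b) *\<^sub>R fder (\<lambda>y. fder f y b) (F u) (F' h) + (a' h \<bullet> b) *\<^sub>R fder f (F u) b)) (at u)"
    by (intro has_derivative_sum has_derivative_scaleR has_derivative_inner_left a
        has_derivative_compose[OF F dfb])
  have "((\<lambda>y. \<Sum>b\<in>Basis. (a u \<bullet> b) *\<^sub>R fder f y b) has_derivative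
     (\<lambda>h. \<Sum>b\<in>Basis. (a u \<bullet> b) *\<^sub>R fder (\<lambda>y. fder f y b) (F u) h)) (at (F u))"
    by (intro has_derivative_sum has_derivative_scaleR_right dfb)
  then have "((\<lambda>y. fder f y (a u)) has_derivative
     (\<lambda>h. \<Sum>b\<in>Basis. (a u \<bullet> b) *\<^sub>R fder (\<lambda>y. fder f y b) (F u) h)) (at (F u))"
    by (rule has_derivative_transform_within_open[OF _ U x]) (simp add: linear_Basis_expand[OF bl, symmetric])
  then have 2: "fder (\<lambda>y. fder f y (a u)) (F u) h = (\<Sum>b\<in>Basis. (a u \<bullet> b) *\<^sub>R fder (\<lambda>y. fder f y b) (F u) h)" for h
    by (rule fder_eqI[THEN fun_cong])
  \<comment> \<open>The expansion in \<open>Basis\<close> requires \<open>F w\<close> to lie in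
    \<open>U\<close>, which holds near \<open>u\<close>.\<close>
  obtain W where W: "open W" "u \<in> W" "\<And>w. w \<in> W \<Longrightarrow> F w \<in> U"
  proof -
    have "isCont F u" using F has_derivative_continuous by blast
    then have "eventually (\<lambda>w. F w \<in> U) (nhds u)"
      unfolding isCont_def tendsto_def using U x by (metis eventually_nhds_conv_at)
    then show ?thesis using that unfolding eventually_nhds by blast
  qed
  have eq: "(\<Sum>b\<in>Basis. (a w \<bullet> b) *\<^sub>R fder f (F w) b) = fder f (F w) (a w)" if "w \<in> W" for w
    by (rule linear_Basis_expand[OF bl[OF W(3)[OF that]], symmetric])
  have "((\<lambda>u. fder f (F u) (a u)) has_derivative
     (\<lambda>h. \<Sum>b\<in>Basis. (a u \<bullet> b) *\<^sub>R fder (\<lambda>y. fder f y b) (F u) (F' h) + (a' h \<bullet> b) *\<^sub>R fder f (F u) b)) (at u)"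
    by (rule has_derivative_transform_within_open[OF 1 W(1,2) eq])
  then show ?thesis
    by (rule has_derivative_eq_rhs)
       (rule ext, simp only: 2 sum.distrib, rule arg_cong2[where f="(+)", OF refl linear_Basis_expand[OF bl[OF x], symmetric]])
qed

section \<open>Smooth functions\<close>

lemma smooth_on_Ck: "smooth_on U f \<Longrightarrow> Ck_on k U f" by (simp add: smooth_on_def)

lemma smooth_onI: "(\<And>k. Ck_on k U f) \<Longrightarrow> smooth_on U f" by (simp add: smooth_on_def)

lemma smooth_on_has_derivative: "smooth_on U f \<Longrightarrow> x \<in> U \<Longrightarrow> (f has_derivative fder f x) (at x)"
  by (rule Ck_on_has_derivative[OF smooth_on_Ck])

lemma smooth_on_fder: "smooth_on U f \<Longrightarrow> smooth_on U (\<lambda>x. fder f x v)"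
  by (rule smooth_onI, rule Ck_on_fder, rule smooth_on_Ck)

lemma smooth_on_continuous_on: "smooth_on U f \<Longrightarrow> continuous_on U f"
  by (rule Ck_on_imp_continuous_on[OF smooth_on_Ck])

lemma smooth_on_cong:
  "open U \<Longrightarrow> (\<And>x. x \<in> U \<Longrightarrow> f x = g x) \<Longrightarrow> smooth_on U f \<longleftrightarrow> smooth_on U g"
  unfolding smooth_on_def by (simp only: Ck_on_cong[of U f g])

lemma smooth_on_subset: "smooth_on U f \<Longrightarrow> V \<subseteq> U \<Longrightarrow> smooth_on V f"
  by (rule smooth_onI, rule Ck_on_subset, rule smooth_on_Ck)

lemma smooth_on_const [simp]: "smooth_on U (\<lambda>x. c)" by (simp add: smooth_on_def)

lemma smooth_on_bounded_linear:
  "open U \<Longrightarrow> bounded_linear L \<Longrightarrow> smooth_on U f \<Longrightarrow> smooth_on U (\<lambda>x. L (f x))"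
  by (rule smooth_onI, rule Ck_on_bounded_linear) (simp_all add: smooth_on_Ck)

lemma smooth_on_add: "open U \<Longrightarrow> smooth_on U f \<Longrightarrow> smooth_on U g \<Longrightarrow> smooth_on U (\<lambda>x. f x + g x)"
  by (rule smooth_onI, rule Ck_on_add) (simp_all add: smooth_on_Ck)

lemma smooth_on_diff: "open U \<Longrightarrow> smooth_on U f \<Longrightarrow> smooth_on U g \<Longrightarrow> smooth_on U (\<lambda>x. f x - g x)"
  by (rule smooth_onI, rule Ck_on_diff) (simp_all add: smooth_on_Ck)

lemma smooth_on_minus: "open U \<Longrightarrow> smooth_on U f \<Longrightarrow> smooth_on U (\<lambda>x. - f x)"
  by (rule smooth_onI, rule Ck_on_minus) (simp_all add: smooth_on_Ck)

lemma smooth_on_bilinear: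
  "open U \<Longrightarrow> bounded_bilinear B \<Longrightarrow> smooth_on U f \<Longrightarrow> smooth_on U g \<Longrightarrow> smooth_on U (\<lambda>x. B (f x) (g x))"
  by (rule smooth_onI, rule Ck_on_bilinear) (simp_all add: smooth_on_Ck)

lemmas smooth_on_mult = smooth_on_bilinear[OF _ bounded_bilinear_mult]
lemmas smooth_on_scaleR = smooth_on_bilinear[OF _ bounded_bilinear_scaleR]
lemmas smooth_on_inner = smooth_on_bilinear[OF _ bounded_bilinear_inner]

lemma smooth_on_sum:
  "open U \<Longrightarrow> (\<And>i. i \<in> I \<Longrightarrow> smooth_on U (f i)) \<Longrightarrow> smooth_on U (\<lambda>x. \<Sum>i\<in>I. f i x)"
  by (rule smooth_onI, rule Ck_on_sum) (simp_all add: smooth_on_Ck)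

lemma smooth_on_compose:
  fixes f :: "'a::real_normed_vector \<Rightarrow> 'b::euclidean_space" and g :: "'b \<Rightarrow> 'c::real_normed_vector"
  assumes "open U" "open W" "\<And>x. x \<in> U \<Longrightarrow> f x \<in> W" "smooth_on U f" "smooth_on W g"
  shows "smooth_on U (\<lambda>x. g (f x))"
  by (rule smooth_onI, rule Ck_on_compose[OF assms(1-3)]) (simp_all add: smooth_on_Ck assms)

lemma smooth_on_divide:
  fixes f g :: "'a::real_normed_vector \<Rightarrow> real"
  shows "open U \<Longrightarrow> (\<And>x. x \<in> U \<Longrightarrow> g x \<noteq> 0) \<Longrightarrow> smooth_on U f \<Longrightarrow> smooth_on U g \<Longrightarrow> smooth_on U (\<lambda>x. f x / g x)"
  by (rule smooth_onI, rule Ck_on_divide) (simp_all add: smooth_on_Ck)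

lemma smooth_on_fder_field:
  fixes f :: "'a::euclidean_space \<Rightarrow> 'b::real_normed_vector"
  shows "open U \<Longrightarrow> smooth_on U f \<Longrightarrow> smooth_on U v \<Longrightarrow> smooth_on U (\<lambda>x. fder f x (v x))"
  by (rule smooth_onI, rule Ck_on_fder_field) (simp_all add: smooth_on_Ck del: Ck_on.simps)

lemma smooth_on_fder_symmetric:
  fixes f :: "'a::real_normed_vector \<Rightarrow> 'b::euclidean_space"
  shows "open U \<Longrightarrow> smooth_on U f \<Longrightarrow> x \<in> U \<Longrightarrow> fder (\<lambda>y. fder f y a) x b = fder (\<lambda>y. fder f y b) x a"
  by (rule fder_symmetric) (simp_all add: smooth_on_Ck)

lemma smooth_on_fder_comp:
  fixes f :: "'a::euclidean_space \<Rightarrow> 'b::real_normed_vector" and F a :: "'c::real_normed_vector \<Rightarrow> 'a"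
  assumes "open U" "open W" "\<And>u. u \<in> U \<Longrightarrow> F u \<in> W" "smooth_on U F" "smooth_on W f" "smooth_on U a"
  shows "smooth_on U (\<lambda>u. fder f (F u) (a u))"
proof -
  have "smooth_on U (\<lambda>u. \<Sum>b\<in>Basis. (a u \<bullet> b) *\<^sub>R fder f (F u) b)"
    by (intro smooth_on_sum smooth_on_scaleR assms(1)
        smooth_on_bounded_linear[OF assms(1) bounded_linear_inner_left assms(6)]
        smooth_on_compose[OF assms(1-4) smooth_on_fder[OF assms(5)]])
  moreover have "fder f (F u) (a u) = (\<Sum>b\<in>Basis. (a u \<bullet> b) *\<^sub>R fder f (F u) b)" if "u \<in> U" for u
    by (rule linear_Basis_expand[OF has_derivative_bounded_linear[OF smooth_on_has_derivative[OF assms(5) assms(3)[OF that]]]])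
  ultimately show ?thesis
    using smooth_on_cong[OF assms(1), of "\<lambda>u. fder f (F u) (a u)"] by simp
qed

lemma fder_linear:
  assumes "smooth_on U f" "x \<in> U"
  shows "fder f x (a + b) = fder f x a + fder f x b" "fder f x (r *\<^sub>R a) = r *\<^sub>R fder f x a"
    "fder f x (a - b) = fder f x a - fder f x b" "fder f x (- a) = - fder f x a" "fder f x 0 = 0"
proof -
  have l: "linear (fder f x)"
    by (rule bounded_linear.linear[OF has_derivative_bounded_linear[OF smooth_on_has_derivative[OF assms]]])
  show "fder f x (a + b) = fder f x a + fder f x b" "fder f x (r *\<^sub>R a) = r *\<^sub>R fder f x a"
    "fder f x (a - b) = fder f x a - fder f x b" "fder f x (- a) = - fder f x a" "fder f x 0 = 0"
    by (rule linear_add[OF l] linear_cmul[OF l] linear_diff[OF l] linear_neg[OF l] linear_0[OF l])+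
qed

section \<open>Matrices as bilinear forms\<close>

text \<open>The bilinear form of a matrix. Used for the metric, for its directional derivatives and
  for \<nabla>X alike, it lets tensor identities be settled by linearity instead of index
  sums.\<close>

definition t3 :: "real^'n^'n \<Rightarrow> real^'n \<Rightarrow> real^'n \<Rightarrow> real" where
  "t3 A v w = v \<bullet> (A *v w)"

lemma t3_linear [simp]:
  "t3 A (v + v') w = t3 A v w + t3 A v' w" "t3 A v (w + w') = t3 A v w + t3 A v w'"
  "t3 (A + B) v w = t3 A v w + t3 B v w"
  "t3 A (v - v') w = t3 A v w - t3 A v' w" "t3 A v (w - w') = t3 A v w - t3 A v w'"
  "t3 (A - B) v w = t3 A v w - t3 B v w"
  "t3 A (r *\<^sub>R v) w = r * t3 A v w" "t3 A v (r *\<^sub>R w) = r * t3 A v w" "t3 (r *\<^sub>R A) v w = r * t3 A v w"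
  "t3 A (- v) w = - t3 A v w" "t3 A v (- w) = - t3 A v w" "t3 (- A) v w = - t3 A v w"
  "t3 A 0 w = 0" "t3 A v 0 = 0" "t3 0 v w = 0"
  unfolding t3_def
  by (simp_all add: inner_add_left inner_add_right inner_diff_left inner_diff_right
      matrix_vector_right_distrib matrix_vector_mult_add_rdistrib matrix_vector_mult_diff_distrib
      matrix_vector_mult_diff_rdistrib vec.scale vector_scaleR_matrix_ac scaleR_matrix_vector_assoc[symmetric]
      flip: scaleR_matrix_vector_assoc)
    (simp_all add: matrix_vector_mult_def inner_vec_def sum_distrib_left sum_negf algebra_simps)

lemma axis2_expand: "(v :: real^2) = v $ 1 *\<^sub>R axis 1 1 + v $ 2 *\<^sub>R axis 2 1"
  by (simp add: vec_eq_iff forall_2 axis_def)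

lemma t3_sum: "t3 A v w = (\<Sum>i\<in>UNIV. \<Sum>j\<in>UNIV. A $ i $ j * v $ i * w $ j)"
  unfolding t3_def by (simp add: inner_vec_def matrix_vector_mult_def sum_distrib_left algebra_simps)

lemma t3_transpose: "t3 (transpose A) v w = t3 A w v"
  unfolding t3_def by (metis dot_lmul_matrix inner_commute transpose_matrix_vector)

lemma bounded_bilinear_mvmult: "bounded_bilinear (\<lambda>(A::real^'n^'m) w. A *v w)"
  unfolding bilinear_conv_bounded_bilinear[symmetric] bilinear_def
  by (auto intro!: linearI simp: matrix_vector_right_distrib matrix_vector_mult_add_rdistrib
      vec.scale scaleR_matrix_vector_assoc matrix_vector_mult_scaleR)

lemma has_derivative_t3:
  assumes "(A has_derivative A') (at u)" "(v has_derivative v') (at u)" "(w has_derivative w') (at u)"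
  shows "((\<lambda>u. t3 (A u) (v u) (w u)) has_derivative
    (\<lambda>h. t3 (A' h) (v u) (w u) + t3 (A u) (v' h) (w u) + t3 (A u) (v u) (w' h))) (at u)"
  unfolding t3_def
  by (rule has_derivative_eq_rhs[OF has_derivative_inner[OF assms(2)
      bounded_bilinear.FDERIV[OF bounded_bilinear_mvmult assms(1,3)]]])
     (simp add: inner_add_right algebra_simps)

lemma smooth_on_t3:
  assumes "open U" "smooth_on U A" "smooth_on U v" "smooth_on U w"
  shows "smooth_on U (\<lambda>u. t3 (A u) (v u) (w u))"
  unfolding t3_def
  by (intro smooth_on_inner assms smooth_on_bilinear[OF _ bounded_bilinear_mvmult])

section \<open>Covariant derivatives along a map\<close>

text \<open>\<open>gam g x w a b\<close> is \<open>g(w, \<Gamma>(a, b))\<close> and \<open>Dcon g F W V v\<close> is \<open>g(W, \<nabla>\<^sub>v V)\<close> for fields \<open>V\<close>, \<open>W\<close>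
  along the map \<open>F\<close>.\<close>

definition gam :: "(real^'n \<Rightarrow> real^'n^'n) \<Rightarrow> real^'n \<Rightarrow> real^'n \<Rightarrow> real^'n \<Rightarrow> real^'n \<Rightarrow> real" where
  "gam g x w a b = 1/2 * (t3 (fder g x a) w b + t3 (fder g x b) w a - t3 (fder g x w) a b)"

definition Dcon :: "(real^'n \<Rightarrow> real^'n^'n) \<Rightarrow> ('e::real_normed_vector \<Rightarrow> real^'n) \<Rightarrow> ('e \<Rightarrow> real^'n) \<Rightarrow>
    ('e \<Rightarrow> real^'n) \<Rightarrow> 'e \<Rightarrow> 'e \<Rightarrow> real" where
  "Dcon g F W V v u = t3 (g (F u)) (W u) (fder V u v) + gam g (F u) (W u) (fder F u v) (V u)"

text \<open>A piece of a parametrized submanifold in coordinates: \<open>F\<close> maps the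
  parameters \<open>U\<close> into the coordinate region \<open>Q\<close>. The connection
  coefficients occur with lowered index, as \<open>gam\<close>, so this layer contains no inverse
  metric.\<close>

locale metric_patch =
  fixes U :: "'e::euclidean_space set" and Q :: "(real^'n) set"
    and g :: "real^'n \<Rightarrow> real^'n^'n" and F :: "'e \<Rightarrow> real^'n"
  assumes oU: "open U" and oQ: "open Q" and sg: "smooth_on Q g" and sF: "smooth_on U F"
    and FQ: "\<And>u. u \<in> U \<Longrightarrow> F u \<in> Q" and gsym: "\<And>x. x \<in> Q \<Longrightarrow> transpose (g x) = g x"
begin

lemma t3g_sym: "x \<in> Q \<Longrightarrow> t3 (g x) v w = t3 (g x) w v"
  using t3_transpose gsym by metis

lemma t3g'_sym: assumes "x \<in> Q" shows "t3 (fder g x a) v w = t3 (fder g x a) w v"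
proof -
  have d: "((\<lambda>x. t3 (g x) v w) has_derivative (\<lambda>h. t3 (fder g x h) v w)) (at x)" for v w
    by (rule has_derivative_eq_rhs[OF has_derivative_t3[OF smooth_on_has_derivative[OF sg assms] has_derivative_const has_derivative_const]]) simp
  have "((\<lambda>x. t3 (g x) v w) has_derivative (\<lambda>h. t3 (fder g x h) w v)) (at x)"
    by (rule has_derivative_transform_within_open[OF d oQ assms]) (simp add: t3g_sym)
  from has_derivative_unique[OF d this] show ?thesis by meson
qed

lemma gam_sym: "x \<in> Q \<Longrightarrow> gam g x w a b = gam g x w b a"
  unfolding gam_def using t3g'_sym by simp

lemmas g'_lin = fder_linear[OF sg]
lemmas F'_lin = fder_linear[OF sF]

lemma Dcon_cong_W: "W u = W' u \<Longrightarrow> Dcon g F W V v u = Dcon g F W' V v u"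
  by (simp add: Dcon_def)

lemma Dcon_W:
  assumes "u \<in> U"
  shows "Dcon g F (\<lambda>u. W u + W' u) V v u = Dcon g F W V v u + Dcon g F W' V v u"
    "Dcon g F (\<lambda>u. c u *\<^sub>R W u) V v u = c u * Dcon g F W V v u"
    "Dcon g F (\<lambda>u. - W u) V v u = - Dcon g F W V v u"
  using FQ[OF assms] by (simp_all add: Dcon_def gam_def g'_lin algebra_simps)

lemma Dcon_v:
  assumes "u \<in> U" "smooth_on U V"
  shows "Dcon g F W V (v + v') u = Dcon g F W V v u + Dcon g F W V v' u"
    "Dcon g F W V (r *\<^sub>R v) u = r * Dcon g F W V v u"
  using FQ[OF assms(1)]
  by (simp_all add: Dcon_def gam_def g'_lin F'_lin[OF assms(1)] fder_linear[OF assms(2,1)] algebra_simps)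

lemma Dcon_scale:
  assumes "u \<in> U" "smooth_on U V" "smooth_on U c"
  shows "Dcon g F W (\<lambda>u. c u *\<^sub>R V u) v u = c u * Dcon g F W V v u + fder c u v * t3 (g (F u)) (W u) (V u)"
proof -
  have "fder (\<lambda>u. c u *\<^sub>R V u) u = (\<lambda>h. c u *\<^sub>R fder V u h + fder c u h *\<^sub>R V u)"
    by (rule fder_eqI[OF has_derivative_scaleR[OF smooth_on_has_derivative[OF assms(3,1)] smooth_on_has_derivative[OF assms(2,1)]]])
  then show ?thesis
    using FQ[OF assms(1)] by (simp add: Dcon_def gam_def g'_lin algebra_simps)
qed

lemma Dcon_cong_V:
  assumes "u \<in> U" "\<And>u. u \<in> U \<Longrightarrow> V u = V' u"
  shows "Dcon g F W V v u = Dcon g F W V' v u"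
  using fder_cong_open[OF oU assms] assms by (simp add: Dcon_def)

lemma has_derivative_gF: "u \<in> U \<Longrightarrow> ((\<lambda>u. g (F u)) has_derivative (\<lambda>h. fder g (F u) (fder F u h))) (at u)"
  by (rule has_derivative_compose[OF smooth_on_has_derivative[OF sF] smooth_on_has_derivative[OF sg FQ]])

lemma smooth_gF: "smooth_on U (\<lambda>u. g (F u))"
  by (rule smooth_on_compose[OF oU oQ FQ sF sg])

lemma has_derivative_g'F:
  assumes "u \<in> U" "(a has_derivative a') (at u)"
  shows "((\<lambda>u. fder g (F u) (a u)) has_derivative
    (\<lambda>h. fder (\<lambda>y. fder g y (a u)) (F u) (fder F u h) + fder g (F u) (a' h))) (at u)"
  by (rule has_derivative_fder_field[OF oQ smooth_on_Ck[OF sg] FQ[OF assms(1)] smooth_on_has_derivative[OF sF assms(1)] assms(2)])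

lemma smooth_g'F: "smooth_on U a \<Longrightarrow> smooth_on U (\<lambda>u. fder g (F u) (a u))"
  by (rule smooth_on_fder_comp[OF oU oQ FQ sF sg])

lemma smooth_Dcon:
  assumes "smooth_on U V" "smooth_on U W" shows "smooth_on U (Dcon g F W V v)"
  unfolding Dcon_def gam_def
  by (intro smooth_on_add smooth_on_diff smooth_on_mult smooth_on_const smooth_on_t3 smooth_gF smooth_g'F
      smooth_on_fder assms sF oU)

text \<open>In the sum of the two \<open>gam\<close> terms the derivatives of the metric along
  \<open>V\<close> and \<open>W\<close> cancel, and what remains is its derivative along the surface
  direction.\<close>

lemma Dcon_compat:
  assumes "u \<in> U" "smooth_on U V" "smooth_on U W"
  shows "fder (\<lambda>u. t3 (g (F u)) (W u) (V u)) u v = Dcon g F W V v u + Dcon g F V W v u"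
proof -
  have "fder (\<lambda>u. t3 (g (F u)) (W u) (V u)) u v = t3 (fder g (F u) (fder F u v)) (W u) (V u)
     + t3 (g (F u)) (fder W u v) (V u) + t3 (g (F u)) (W u) (fder V u v)"
    by (rule fder_eqI[OF has_derivative_t3[OF has_derivative_gF[OF assms(1)]
          smooth_on_has_derivative[OF assms(3,1)] smooth_on_has_derivative[OF assms(2,1)]], THEN fun_cong])
  then show ?thesis
    using FQ[OF assms(1)] t3g_sym[of "F u" "fder W u v" "V u"]
      t3g'_sym[of "F u" "fder F u v" "W u" "V u"] t3g'_sym[of "F u" "V u" "W u" "fder F u v"]
      t3g'_sym[of "F u" "W u" "fder F u v" "V u"]
    by (simp add: Dcon_def gam_def field_simps)
qed

text \<open>The product rule kept in full, one term per factor: \<open>lie_Dcon\<close> rewrites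
  each of them for the direction \<open>T\<close>.\<close>

lemma fder_Dcon:
  fixes v
  assumes u: "u \<in> U" and V: "smooth_on U V" and W: "smooth_on U W"
  defines "x \<equiv> F u" and "a \<equiv> fder F u v"
  shows "fder (Dcon g F W V v) u h =
    t3 (fder g x (fder F u h)) (W u) (fder V u v) + t3 (g x) (fder W u h) (fder V u v) + t3 (g x) (W u) (fder (\<lambda>u. fder V u v) u h)
   + 1/2 * (t3 (fder (\<lambda>y. fder g y a) x (fder F u h) + fder g x (fder (\<lambda>u. fder F u v) u h)) (W u) (V u)
      + t3 (fder g x a) (fder W u h) (V u) + t3 (fder g x a) (W u) (fder V u h)
      + (t3 (fder (\<lambda>y. fder g y (V u)) x (fder F u h) + fder g x (fder V u h)) (W u) a
      + t3 (fder g x (V u)) (fder W u h) a + t3 (fder g x (V u)) (W u) (fder (\<lambda>u. fder F u v) u h))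
      - (t3 (fder (\<lambda>y. fder g y (W u)) x (fder F u h) + fder g x (fder W u h)) a (V u)
      + t3 (fder g x (W u)) (fder (\<lambda>u. fder F u v) u h) (V u) + t3 (fder g x (W u)) a (fder V u h)))"
  unfolding Dcon_def gam_def x_def a_def
  by (rule fder_eqI[THEN fun_cong])
     (intro has_derivative_add has_derivative_diff has_derivative_mult_right has_derivative_t3
      has_derivative_gF has_derivative_g'F u smooth_on_has_derivative[OF V] smooth_on_has_derivative[OF W]
      smooth_on_has_derivative[OF smooth_on_fder[OF V]] smooth_on_has_derivative[OF smooth_on_fder[OF sF]])

end

section \<open>Killing fields tangential to a map\<close>

text \<open>\<open>K0\<close> is the Killing equation in the form L_X g = 0, in which only partial
  derivatives occur; \<open>T\<close> consists of the components of \<open>X\<close> in the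
  parameters.\<close>

locale killing_patch = metric_patch U Q g F
  for U :: "(real^2) set" and Q :: "(real^'n) set" and g F +
  fixes X :: "real^'n \<Rightarrow> real^'n" and T :: "real^2 \<Rightarrow> real^2"
  assumes sX: "smooth_on Q X" and sT: "smooth_on U T"
    and XT: "\<And>u. u \<in> U \<Longrightarrow> X (F u) = fder F u (T u)"
    and K0: "\<And>x v w. x \<in> Q \<Longrightarrow>
       t3 (fder g x (X x)) v w + t3 (g x) (fder X x v) w + t3 (g x) v (fder X x w) = 0"
begin

text \<open>The Lie derivative along \<open>X\<close> of a field known on the surface only: as
  \<open>X\<close> is the image of \<open>T\<close> there, the derivative of \<open>V\<close> along
  \<open>X\<close> can be taken in the parameters.\<close>

definition Lie :: "(real^2 \<Rightarrow> real^'n) \<Rightarrow> real^2 \<Rightarrow> real^'n" where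
  "Lie V u = fder V u (T u) - fder X (F u) (V u)"

lemmas X'_lin = fder_linear[OF sX]
lemmas T'_lin = fder_linear[OF sT]

lemma smooth_Lie: "smooth_on U V \<Longrightarrow> smooth_on U (Lie V)"
  unfolding Lie_def
  by (intro smooth_on_diff oU smooth_on_fder_field sT smooth_on_fder_comp[OF oU oQ FQ sF sX])

text \<open>This differentiates \<open>K0\<close> in the direction \<open>a\<close>, which is
  possible because \<open>K0\<close> holds on all of the open set \<open>Q\<close>.\<close>

lemma killing_gam:
  assumes x: "x \<in> Q"
  shows "t3 (fder (\<lambda>y. fder g y (X x)) x a) v w + t3 (fder g x (fder X x a)) v w
     + t3 (fder g x a) (fder X x v) w + t3 (g x) (fder (\<lambda>y. fder X y v) x a) w
     + t3 (fder g x a) v (fder X x w) + t3 (g x) v (fder (\<lambda>y. fder X y w) x a) = 0"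
proof -
  have "((\<lambda>x. t3 (fder g x (X x)) v w + t3 (g x) (fder X x v) w + t3 (g x) v (fder X x w)) has_derivative
   (\<lambda>h. (t3 (fder (\<lambda>y. fder g y (X x)) x h + fder g x (fder X x h)) v w + t3 (fder g x (X x)) 0 w + t3 (fder g x (X x)) v 0)
     + (t3 (fder g x h) (fder X x v) w + t3 (g x) (fder (\<lambda>y. fder X y v) x h) w + t3 (g x) (fder X x v) 0)
     + (t3 (fder g x h) v (fder X x w) + t3 (g x) 0 (fder X x w) + t3 (g x) v (fder (\<lambda>y. fder X y w) x h)))) (at x)"
    by (intro has_derivative_add has_derivative_t3 has_derivative_const smooth_on_has_derivative[OF sg x]
        smooth_on_has_derivative[OF smooth_on_fder[OF sX] x]
        has_derivative_fder_field[OF oQ smooth_on_Ck[OF sg] x has_derivative_ident smooth_on_has_derivative[OF sX x]])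
  moreover have "((\<lambda>x. t3 (fder g x (X x)) v w + t3 (g x) (fder X x v) w + t3 (g x) v (fder X x w)) has_derivative
      (\<lambda>h. 0)) (at x)"
    by (rule has_derivative_transform_within_open[OF has_derivative_const[of 0] oQ x]) (simp add: K0)
  ultimately have "(\<lambda>h. (t3 (fder (\<lambda>y. fder g y (X x)) x h + fder g x (fder X x h)) v w + t3 (fder g x (X x)) 0 w + t3 (fder g x (X x)) v 0)
     + (t3 (fder g x h) (fder X x v) w + t3 (g x) (fder (\<lambda>y. fder X y v) x h) w + t3 (g x) (fder X x v) 0)
     + (t3 (fder g x h) v (fder X x w) + t3 (g x) 0 (fder X x w) + t3 (g x) v (fder (\<lambda>y. fder X y w) x h))) = (\<lambda>h. 0)"
    by (rule has_derivative_unique)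
  from fun_cong[OF this, of a] show ?thesis by simp
qed

text \<open>The Lie derivative of the Levi-Civita connection along a Killing field vanishes.\<close>

lemma lie_gam:
  assumes x: "x \<in> Q"
  shows "1/2 * (t3 (fder (\<lambda>y. fder g y a) x (X x)) w b + t3 (fder (\<lambda>y. fder g y b) x (X x)) w a
      - t3 (fder (\<lambda>y. fder g y w) x (X x)) a b)
    + gam g x (fder X x w) a b + gam g x w (fder X x a) b + gam g x w a (fder X x b)
    + t3 (g x) w (fder (\<lambda>y. fder X y b) x a) = 0"
proof -
  have s: "fder (\<lambda>y. fder g y m) x (X x) = fder (\<lambda>y. fder g y (X x)) x m" for m
    by (rule smooth_on_fder_symmetric[OF oQ sg x])
  have sX2: "fder (\<lambda>y. fder X y m) x m' = fder (\<lambda>y. fder X y m') x m" for m m'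
    by (rule smooth_on_fder_symmetric[OF oQ sX x])
  show ?thesis
    \<comment> \<open>Three permutations of the differentiated Killing equation are combined with
      the signs of the Koszul formula. Mixed second derivatives of \<open>X\<close> cancel in pairs,
      except for the last term of the claim, which survives twice.\<close>
    using killing_gam[OF x, of a w b] killing_gam[OF x, of b w a] killing_gam[OF x, of w a b]
      sX2[of a w] sX2[of b w] sX2[of a b]
      t3g_sym[OF x, of _ "fder (\<lambda>y. fder X y a) x w"] t3g_sym[OF x, of "fder (\<lambda>y. fder X y w) x a" b]
      t3g_sym[OF x, of "fder (\<lambda>y. fder X y w) x b" a]
      t3g'_sym[OF x, of "fder X x a"]  t3g'_sym[OF x, of a "fder X x w"] t3g'_sym[OF x, of b "fder X x w"]
      t3g'_sym[OF x, of w "fder X x a"] t3g'_sym[OF x, of w a "fder X x b"]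
    unfolding gam_def s by (simp add: algebra_simps)
qed

lemma lie_metric:
  assumes "u \<in> U" "smooth_on U V" "smooth_on U W"
  shows "fder (\<lambda>u. t3 (g (F u)) (W u) (V u)) u (T u) = t3 (g (F u)) (Lie W u) (V u) + t3 (g (F u)) (W u) (Lie V u)"
proof -
  have "fder (\<lambda>u. t3 (g (F u)) (W u) (V u)) u (T u) = t3 (fder g (F u) (fder F u (T u))) (W u) (V u)
     + t3 (g (F u)) (fder W u (T u)) (V u) + t3 (g (F u)) (W u) (fder V u (T u))"
    by (rule fder_eqI[OF has_derivative_t3[OF has_derivative_gF[OF assms(1)]
          smooth_on_has_derivative[OF assms(3,1)] smooth_on_has_derivative[OF assms(2,1)]], THEN fun_cong])
  then show ?thesis
    using K0[OF FQ[OF assms(1)], of "W u" "V u"] by (simp add: Lie_def XT[OF assms(1)])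
qed

text \<open>Differentiate \<open>XT\<close> in the direction \<open>v\<close> and exchange the two
  derivatives of \<open>F\<close>. In terms of brackets, [X, F_* v] is the image of [T, v], and
  [T, v] = - DT(v) for constant \<open>v\<close>.\<close>

lemma lie_frame_aux:
  assumes u: "u \<in> U"
  shows "fder (\<lambda>u. fder F u v) u (T u) = fder X (F u) (fder F u v) - fder F u (fder T u v)"
proof -
  have "((\<lambda>u. X (F u)) has_derivative (\<lambda>h. fder X (F u) (fder F u h))) (at u)"
    by (rule has_derivative_compose[OF smooth_on_has_derivative[OF sF u] smooth_on_has_derivative[OF sX FQ[OF u]]])
  moreover have "((\<lambda>u. X (F u)) has_derivative (\<lambda>h. fder (\<lambda>y. fder F y (T u)) u h + fder F u (fder T u h))) (at u)"
    by (rule has_derivative_transform_within_open[OF has_derivative_fder_field[OF oU smooth_on_Ck[OF sF] u has_derivative_ident smooth_on_has_derivative[OF sT u]] oU u])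
       (simp add: XT)
  ultimately have "(\<lambda>h. fder X (F u) (fder F u h)) = (\<lambda>h. fder (\<lambda>y. fder F y (T u)) u h + fder F u (fder T u h))"
    by (rule has_derivative_unique)
  from fun_cong[OF this, of v] smooth_on_fder_symmetric[OF oU sF u, of "T u" v]
  show ?thesis by simp
qed

lemma lie_frame: "u \<in> U \<Longrightarrow> Lie (\<lambda>u. fder F u v) u = - fder F u (fder T u v)"
  unfolding Lie_def using lie_frame_aux by simp

lemma fder_Lie:
  assumes u: "u \<in> U" and V: "smooth_on U V"
  shows "fder (Lie V) u v = fder (\<lambda>u. fder V u v) u (T u) + fder V u (fder T u v)
    - (fder (\<lambda>y. fder X y (V u)) (F u) (fder F u v) + fder X (F u) (fder V u v))"
proof -
  have "(Lie V has_derivative (\<lambda>h. (fder (\<lambda>y. fder V y (T u)) u h + fder V u (fder T u h))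
     - (fder (\<lambda>y. fder X y (V u)) (F u) (fder F u h) + fder X (F u) (fder V u h)))) (at u)"
    unfolding Lie_def
    by (intro has_derivative_diff has_derivative_fder_field[OF oU smooth_on_Ck[OF V] u has_derivative_ident smooth_on_has_derivative[OF sT u]]
       has_derivative_fder_field[OF oQ smooth_on_Ck[OF sX] FQ[OF u] smooth_on_has_derivative[OF sF u] smooth_on_has_derivative[OF V u]])
  from fder_eqI[OF this] show ?thesis
    using smooth_on_fder_symmetric[OF oU V u, of "T u" v] by simp
qed

text \<open>The flow of \<open>X\<close> preserves metric and connection, so L_X acts on g(W,
  \<nabla>_v V) through \<open>W\<close>, \<open>V\<close> and \<open>v\<close> alone;
  \<open>v\<close> is constant in the parameters and contributes [T, v] = - DT(v).\<close>

lemma lie_Dcon: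
  assumes u: "u \<in> U" and V: "smooth_on U V" and W: "smooth_on U W"
  shows "fder (Dcon g F W V v) u (T u) =
    Dcon g F (Lie W) V v u + Dcon g F W (Lie V) v u - Dcon g F W V (fder T u v) u"
proof -
  define x where "x = F u"
  define a where "a = fder F u v"
  have x: "x \<in> Q" using FQ[OF u] by (simp add: x_def)
  have XF: "fder F u (T u) = X x" using XT[OF u] x_def by simp
  have aT: "fder (\<lambda>u. fder F u v) u (T u) = fder X x a - fder F u (fder T u v)"
    using lie_frame_aux[OF u] by (simp add: x_def a_def)
  have WT: "fder W u (T u) = Lie W u + fder X x (W u)" by (simp add: Lie_def x_def)
  have VT: "fder V u (T u) = Lie V u + fder X x (V u)" by (simp add: Lie_def x_def)
  have VvT: "fder (\<lambda>u. fder V u v) u (T u) = fder (Lie V) u v - fder V u (fder T u v)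
    + (fder (\<lambda>y. fder X y (V u)) x a + fder X x (fder V u v))"
    using fder_Lie[OF u V, of v] by (simp add: x_def a_def)
  have lin: "fder g x (p + q) = fder g x p + fder g x q" "fder g x (p - q) = fder g x p - fder g x q" for p q
    using g'_lin x by auto
  \<comment> \<open>Each derivative along \<open>T\<close> is now a Lie derivative plus derivatives
    of \<open>X\<close>. Whatever contains neither a Lie derivative nor \<open>fder T u v\<close>,
    and is not such a term, vanishes in total by \<open>K0\<close> and
    \<open>lie_gam\<close>.\<close>
  have E: "fder (Dcon g F W V v) u (T u) =
    t3 (fder g x (X x)) (W u) (fder V u v) + t3 (g x) (Lie W u + fder X x (W u)) (fder V u v)
    + t3 (g x) (W u) (fder (Lie V) u v - fder V u (fder T u v)
    + (fder (\<lambda>y. fder X y (V u)) x a + fder X x (fder V u v)))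
   + 1/2 * (t3 (fder (\<lambda>y. fder g y a) x (X x) + fder g x (fder X x a - fder F u (fder T u v))) (W u) (V u)
      + t3 (fder g x a) (Lie W u + fder X x (W u)) (V u) + t3 (fder g x a) (W u) (Lie V u + fder X x (V u))
      + (t3 (fder (\<lambda>y. fder g y (V u)) x (X x) + fder g x (Lie V u + fder X x (V u))) (W u) a
      + t3 (fder g x (V u)) (Lie W u + fder X x (W u)) a + t3 (fder g x (V u)) (W u) (fder X x a - fder F u (fder T u v)))
      - (t3 (fder (\<lambda>y. fder g y (W u)) x (X x) + fder g x (Lie W u + fder X x (W u))) a (V u)
      + t3 (fder g x (W u)) (fder X x a - fder F u (fder T u v)) (V u) + t3 (fder g x (W u)) a (Lie V u + fder X x (V u))))"
    unfolding fder_Dcon[OF u V W] x_def[symmetric] a_def[symmetric] XF aT WT VT VvT ..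
  have R: "Dcon g F (Lie W) V v u + Dcon g F W (Lie V) v u - Dcon g F W V (fder T u v) u =
     t3 (g x) (Lie W u) (fder V u v) + gam g x (Lie W u) a (V u)
   + (t3 (g x) (W u) (fder (Lie V) u v) + gam g x (W u) a (Lie V u))
   - (t3 (g x) (W u) (fder V u (fder T u v)) + gam g x (W u) (fder F u (fder T u v)) (V u))"
    unfolding Dcon_def x_def[symmetric] a_def[symmetric] ..
  show ?thesis
    unfolding E R
    using K0[OF x, of "W u" "fder V u v"] lie_gam[OF x, of a "W u" "V u"]
    unfolding gam_def by (simp add: lin algebra_simps)
qed

end

section \<open>Null normals of an invariant surface\<close>

locale horizon_patch = killing_patch U Q g F X T
  for U :: "(real^2) set" and Q :: "(real^'n) set" and g F X T +
  fixes k l :: "real^2 \<Rightarrow> real^'n"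
  assumes sk: "smooth_on U k" and sl: "smooth_on U l"
    and kk: "\<And>u. u \<in> U \<Longrightarrow> t3 (g (F u)) (k u) (k u) = 0"
    and ll: "\<And>u. u \<in> U \<Longrightarrow> t3 (g (F u)) (l u) (l u) = 0"
    and kl: "\<And>u. u \<in> U \<Longrightarrow> t3 (g (F u)) (k u) (l u) = -1"
    and kF: "\<And>u v. u \<in> U \<Longrightarrow> t3 (g (F u)) (k u) (fder F u v) = 0"
    and lF: "\<And>u v. u \<in> U \<Longrightarrow> t3 (g (F u)) (l u) (fder F u v) = 0"
    and pos: "\<And>u v. u \<in> U \<Longrightarrow> v \<noteq> 0 \<Longrightarrow> t3 (g (F u)) (fder F u v) (fder F u v) > 0"
    and spanning: "\<And>u x. u \<in> U \<Longrightarrow> \<exists>a b v. x = a *\<^sub>R k u + b *\<^sub>R l u + fder F u v"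
begin

definition q where "q a b u = t3 (g (F u)) (fder F u a) (fder F u b)"
definition om where "om v u = - Dcon g F l k v u"
text \<open>The factor in L_X k = c k, read off by pairing with \<open>l\<close>, where g(k, l) =
  -1.\<close>

definition cc where "cc u = - t3 (g (F u)) (l u) (Lie k u)"
definition B where "B a b u = Dcon g F (\<lambda>u. fder F u b) l a u"
text \<open>This is g(l, \<nabla>_k X), in other notation k^a l^b \<nabla>_a X_b.\<close>

definition kap where "kap u = t3 (g (F u)) (l u) (fder X (F u) (k u)) + gam g (F u) (l u) (k u) (X (F u))"
text \<open>The trace of \<open>B\<close> with the inverse of the 2 by 2 matrix \<open>q\<close>,
  written out by Cramer's rule: the expansion of \<open>l\<close>.\<close>

definition Th where "Th u = (q (axis 2 1) (axis 2 1) u * B (axis 1 1) (axis 1 1) u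
    + q (axis 1 1) (axis 1 1) u * B (axis 2 1) (axis 2 1) u
    - q (axis 1 1) (axis 2 1) u * (B (axis 1 1) (axis 2 1) u + B (axis 2 1) (axis 1 1) u))
    / (q (axis 1 1) (axis 1 1) u * q (axis 2 1) (axis 2 1) u - (q (axis 1 1) (axis 2 1) u)\<^sup>2)"

text \<open>In the normal plane the null direction \<open>k\<close> is its own orthogonal
  complement; positivity of the surface metric removes the tangential part.\<close>

lemma decomp_k:
  assumes u: "u \<in> U" and a: "\<And>v. t3 (g (F u)) x (fder F u v) = 0" and b: "t3 (g (F u)) x (k u) = 0"
  shows "x = - t3 (g (F u)) x (l u) *\<^sub>R k u"
proof -
  obtain s t v where x: "x = s *\<^sub>R k u + t *\<^sub>R l u + fder F u v" using spanning[OF u] by blast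
  note sy = t3g_sym[OF FQ[OF u]]
  have "v = 0"
  proof (rule ccontr)
    assume "v \<noteq> 0"
    from pos[OF u this] a[of v] kF[OF u] lF[OF u] show False unfolding x by simp
  qed
  then have x: "x = s *\<^sub>R k u + t *\<^sub>R l u" unfolding x using F'_lin(5)[OF u] by simp
  have "t = 0" using b kk[OF u] kl[OF u] sy[of "l u" "k u"] unfolding x by simp
  then show ?thesis using kl[OF u] unfolding x by simp
qed

lemma decomp_l:
  assumes u: "u \<in> U" and a: "\<And>v. t3 (g (F u)) x (fder F u v) = 0" and b: "t3 (g (F u)) x (l u) = 0"
  shows "x = - t3 (g (F u)) x (k u) *\<^sub>R l u"
proof -
  obtain s t v where x: "x = s *\<^sub>R k u + t *\<^sub>R l u + fder F u v" using spanning[OF u] by blast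
  note sy = t3g_sym[OF FQ[OF u]]
  have "v = 0"
  proof (rule ccontr)
    assume "v \<noteq> 0"
    from pos[OF u this] a[of v] kF[OF u] lF[OF u] show False unfolding x by simp
  qed
  then have x: "x = s *\<^sub>R k u + t *\<^sub>R l u" unfolding x using F'_lin(5)[OF u] by simp
  have "s = 0" using b ll[OF u] kl[OF u] unfolding x by simp
  then show ?thesis using kl[OF u] sy[of "l u" "k u"] unfolding x by simp
qed

lemma fder_const_on: "u \<in> U \<Longrightarrow> (\<And>u. u \<in> U \<Longrightarrow> f u = c) \<Longrightarrow> fder f u h = 0"
  using fder_cong_open[OF oU, of u f "\<lambda>_. c"] by simp

text \<open>The flow maps tangent vectors of the surface to tangent vectors
  (\<open>lie_frame\<close>) and preserves the metric, so it maps normals to normals.\<close>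

lemma lie_normal:
  assumes u: "u \<in> U" and sn: "smooth_on U n" and nF: "\<And>u v. u \<in> U \<Longrightarrow> t3 (g (F u)) (n u) (fder F u v) = 0"
  shows "t3 (g (F u)) (Lie n u) (fder F u v) = 0"
proof -
  have "fder (\<lambda>u. t3 (g (F u)) (n u) (fder F u v)) u (T u) = 0"
    by (rule fder_const_on[OF u]) (rule nF)
  then show ?thesis
    using lie_metric[OF u smooth_on_fder[OF sF] sn, of v] lie_frame[OF u, of v] nF[OF u] by simp
qed

text \<open>L_X k is normal to the surface and, since g(k, k) = 0 is preserved, orthogonal to
  \<open>k\<close>; such vectors are multiples of \<open>k\<close>.\<close>

lemma lie_k: assumes u: "u \<in> U" shows "Lie k u = cc u *\<^sub>R k u"
proof -
  note sy = t3g_sym[OF FQ[OF u]]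
  have "fder (\<lambda>u. t3 (g (F u)) (k u) (k u)) u (T u) = 0" by (rule fder_const_on[OF u]) (rule kk)
  then have "t3 (g (F u)) (Lie k u) (k u) = 0" using lie_metric[OF u sk sk] sy[of "Lie k u" "k u"] by simp
  from decomp_k[OF u lie_normal[OF u sk kF] this] show ?thesis by (simp add: cc_def sy)
qed

text \<open>The factor is opposite to that of \<open>k\<close> because g(k, l) = -1 is
  preserved.\<close>

lemma lie_l: assumes u: "u \<in> U" shows "Lie l u = - cc u *\<^sub>R l u"
proof -
  note sy = t3g_sym[OF FQ[OF u]]
  have "fder (\<lambda>u. t3 (g (F u)) (l u) (l u)) u (T u) = 0" by (rule fder_const_on[OF u]) (rule ll)
  then have 1: "t3 (g (F u)) (Lie l u) (l u) = 0" using lie_metric[OF u sl sl] sy[of "Lie l u" "l u"] by simp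
  have "fder (\<lambda>u. t3 (g (F u)) (k u) (l u)) u (T u) = 0" by (rule fder_const_on[OF u]) (rule kl)
  then have 2: "t3 (g (F u)) (Lie l u) (k u) = cc u"
    using lie_metric[OF u sl sk] sy[of "Lie l u" "k u"] sy[of "Lie k u" "l u"] by (simp add: cc_def)
  from decomp_l[OF u lie_normal[OF u sl lF] 1] show ?thesis unfolding 2 .
qed

lemma smooth_cc: "smooth_on U cc"
  unfolding cc_def by (intro smooth_on_minus smooth_on_t3 oU smooth_gF sl smooth_Lie sk)

lemma smooth_q: "smooth_on U (q a b)"
  unfolding q_def by (intro smooth_on_t3 oU smooth_gF smooth_on_fder sF)

lemma smooth_B: "smooth_on U (B a b)"
  using smooth_Dcon[OF sl smooth_on_fder[OF sF, of b]] unfolding B_def .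

lemma smooth_om: "smooth_on U (om v)"
  unfolding om_def by (intro smooth_on_minus oU smooth_Dcon sk sl)

lemma q_lin:
  assumes "u \<in> U"
  shows "q (a + a') b u = q a b u + q a' b u" "q (r *\<^sub>R a) b u = r * q a b u"
    "q a (b + b') u = q a b u + q a b' u" "q a (r *\<^sub>R b) u = r * q a b u" "q a b u = q b a u"
  using t3g_sym[OF FQ[OF assms]] by (auto simp: q_def F'_lin[OF assms])

lemma B_lin:
  assumes "u \<in> U"
  shows "B (a + a') b u = B a b u + B a' b u" "B (r *\<^sub>R a) b u = r * B a b u"
    "B a (b + b') u = B a b u + B a b' u" "B a (r *\<^sub>R b) u = r * B a b u"
  using FQ[OF assms]
  by (simp_all add: B_def Dcon_v[OF assms sl]) (simp_all add: Dcon_def gam_def F'_lin[OF assms] g'_lin algebra_simps)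

lemma om_lin:
  assumes "u \<in> U"
  shows "om (a + a') u = om a u + om a' u" "om (r *\<^sub>R a) u = r * om a u"
  by (simp_all add: om_def Dcon_v[OF assms sk])

lemma lie_q: assumes u: "u \<in> U"
  shows "fder (q a b) u (T u) = - q (fder T u a) b u - q a (fder T u b) u"
  unfolding q_def lie_metric[OF u smooth_on_fder[OF sF, of b] smooth_on_fder[OF sF, of a]] lie_frame[OF u] by simp

text \<open>The derivative of \<open>cc\<close> comes multiplied by g(F_* b, l) = 0. Apart from the
  change of the frame, \<open>B\<close> therefore scales just as \<open>l\<close> does.\<close>

lemma lie_B: assumes u: "u \<in> U"
  shows "fder (B a b) u (T u) = - cc u * B a b u - B (fder T u a) b u - B a (fder T u b) u"
proof -
  have "fder (B a b) u (T u) = Dcon g F (Lie (\<lambda>u. fder F u b)) l a u + Dcon g F (\<lambda>u. fder F u b) (Lie l) a u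
     - Dcon g F (\<lambda>u. fder F u b) l (fder T u a) u"
    using lie_Dcon[OF u sl smooth_on_fder[OF sF, of b], of a] unfolding B_def .
  moreover have "Dcon g F (Lie (\<lambda>u. fder F u b)) l a u = - B a (fder T u b) u"
    unfolding B_def Dcon_W(3)[OF u, symmetric] by (rule Dcon_cong_W) (rule lie_frame[OF u])
  moreover have "Dcon g F (\<lambda>u. fder F u b) (Lie l) a u = - cc u * B a b u"
  proof -
    have "Dcon g F (\<lambda>u. fder F u b) (Lie l) a u = Dcon g F (\<lambda>u. fder F u b) (\<lambda>u. - cc u *\<^sub>R l u) a u"
      by (rule Dcon_cong_V[OF u lie_l])
    also have "\<dots> = - cc u * B a b u + fder (\<lambda>u. - cc u) u a * t3 (g (F u)) (fder F u b) (l u)"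
      unfolding B_def by (rule Dcon_scale[OF u sl smooth_on_minus[OF oU smooth_cc]])
    finally show ?thesis using lF[OF u] t3g_sym[OF FQ[OF u], of "fder F u b"] by simp
  qed
  ultimately show ?thesis unfolding B_def by simp
qed

text \<open>Here the derivative of \<open>cc\<close> survives, as g(l, k) = -1: \<omega> is a
  connection form of the normal bundle, and L_X \<omega> = dc.\<close>

lemma lie_om: assumes u: "u \<in> U"
  shows "fder (om v) u (T u) = fder cc u v - om (fder T u v) u"
proof -
  have "fder (om v) u (T u) = - fder (Dcon g F l k v) u (T u)"
    unfolding om_def
    by (rule fder_eqI[OF has_derivative_minus[OF smooth_on_has_derivative[OF smooth_Dcon[OF sk sl] u]], THEN fun_cong])
  also have "fder (Dcon g F l k v) u (T u) = Dcon g F (Lie l) k v u + Dcon g F l (Lie k) v u - Dcon g F l k (fder T u v) u"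
    by (rule lie_Dcon[OF u sk sl])
  also have "Dcon g F (Lie l) k v u = - cc u * Dcon g F l k v u"
    using Dcon_cong_W[of "Lie l" u "\<lambda>u. - cc u *\<^sub>R l u", OF lie_l[OF u]] Dcon_W(2)[OF u, of "\<lambda>u. - cc u"] by simp
  also have "Dcon g F l (Lie k) v u = Dcon g F l (\<lambda>u. cc u *\<^sub>R k u) v u"
    by (rule Dcon_cong_V[OF u lie_k])
  also have "\<dots> = cc u * Dcon g F l k v u + fder cc u v * t3 (g (F u)) (l u) (k u)"
    by (rule Dcon_scale[OF u sk smooth_cc])
  finally show ?thesis using kl[OF u] t3g_sym[OF FQ[OF u], of "l u"] unfolding om_def by simp
qed

text \<open>Absence of torsion gives \<nabla>_X k = L_X k + \<nabla>_k X, which is paired with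
  \<open>l\<close>.\<close>

lemma om_T: assumes u: "u \<in> U" shows "om (T u) u = cc u - kap u"
  unfolding om_def cc_def kap_def Dcon_def Lie_def
  using XT[OF u] gam_sym[OF FQ[OF u], of "l u" "X (F u)" "k u"] by simp

lemma det_q_pos: assumes u: "u \<in> U"
  shows "q (axis 1 1) (axis 1 1) u * q (axis 2 1) (axis 2 1) u - (q (axis 1 1) (axis 2 1) u)\<^sup>2 > 0"
proof -
  let ?a = "axis 1 1 :: real^2" and ?b = "axis 2 1 :: real^2"
  have p1: "q ?a ?a u > 0" unfolding q_def by (rule pos[OF u]) (simp add: vec_eq_iff forall_2 axis_def)
  \<comment> \<open>\<open>?w\<close> is orthogonal to \<open>?a\<close>, and its square norm is
    \<open>q ?a ?a u\<close> times the determinant.\<close>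
  let ?w = "(q ?a ?a u) *\<^sub>R ?b + (- q ?a ?b u) *\<^sub>R ?a"
  have "?w $ 2 = q ?a ?a u" by (simp add: axis_def)
  then have "?w \<noteq> 0" using p1 by (metis order_less_irrefl zero_index)
  then have "q ?w ?w u > 0" unfolding q_def by (rule pos[OF u])
  also have "q ?w ?w u = q ?a ?a u * (q ?a ?a u * q ?b ?b u - (q ?a ?b u)\<^sup>2)"
    unfolding q_lin(1-4)[OF u] using q_lin(5)[OF u, of ?b ?a] by (simp add: power2_eq_square algebra_simps)
  finally show ?thesis using p1 by (simp add: zero_less_mult_iff)
qed

lemma smooth_Th: "smooth_on U Th"
  unfolding Th_def
  by (intro smooth_on_divide smooth_on_add smooth_on_diff smooth_on_mult smooth_q smooth_B oU
      smooth_on_mult[OF oU, of "q (axis 1 1) (axis 2 1)" "q (axis 1 1) (axis 2 1)", folded power2_eq_square])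
     (use det_q_pos in fastforce)

text \<open>Numerator and determinant are densities: along \<open>T\<close> each acquires the factor
  -2 tr DT, which cancels in the quotient, and only the scaling of \<open>l\<close> remains.\<close>

lemma lie_Th: assumes u: "u \<in> U" shows "fder Th u (T u) = - cc u * Th u"
proof -
  let ?a = "axis 1 1 :: real^2" and ?b = "axis 2 1 :: real^2"
  define D where "D = (\<lambda>u. q ?a ?a u * q ?b ?b u - (q ?a ?b u)\<^sup>2)"
  define N where "N = (\<lambda>u. q ?b ?b u * B ?a ?a u + q ?a ?a u * B ?b ?b u - q ?a ?b u * (B ?a ?b u + B ?b ?a u))"
  define t11 where "t11 = fder T u ?a $ 1"
  define t12 where "t12 = fder T u ?a $ 2"
  define t21 where "t21 = fder T u ?b $ 1"
  define t22 where "t22 = fder T u ?b $ 2"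
  have Ta: "fder T u ?a = t11 *\<^sub>R ?a + t12 *\<^sub>R ?b" unfolding t11_def t12_def by (rule axis2_expand)
  have Tb: "fder T u ?b = t21 *\<^sub>R ?a + t22 *\<^sub>R ?b" unfolding t21_def t22_def by (rule axis2_expand)
  note dq = smooth_on_has_derivative[OF smooth_q u]
  note dB = smooth_on_has_derivative[OF smooth_B u]
  have D0: "D u \<noteq> 0" using det_q_pos[OF u] by (simp add: D_def)
  have dD: "(D has_derivative (\<lambda>h. q ?a ?a u * fder (q ?b ?b) u h + fder (q ?a ?a) u h * q ?b ?b u
      - (q ?a ?b u * fder (q ?a ?b) u h + fder (q ?a ?b) u h * q ?a ?b u))) (at u)"
    unfolding D_def power2_eq_square by (intro has_derivative_diff has_derivative_mult dq)
  have dN: "(N has_derivative (\<lambda>h. q ?b ?b u * fder (B ?a ?a) u h + fder (q ?b ?b) u h * B ?a ?a u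
      + (q ?a ?a u * fder (B ?b ?b) u h + fder (q ?a ?a) u h * B ?b ?b u)
      - (q ?a ?b u * (fder (B ?a ?b) u h + fder (B ?b ?a) u h) + fder (q ?a ?b) u h * (B ?a ?b u + B ?b ?a u)))) (at u)"
    unfolding N_def by (intro has_derivative_diff has_derivative_add has_derivative_mult dq dB)
  have qs: "q ?b ?a u = q ?a ?b u" by (rule q_lin(5)[OF u])
  note exp = lie_q[OF u] lie_B[OF u] Ta Tb q_lin(1-4)[OF u] B_lin[OF u] qs
  have DT: "fder D u (T u) = - 2 * (t11 + t22) * D u"
    unfolding fder_eqI[OF dD] exp by (simp add: D_def power2_eq_square algebra_simps)
  have NT: "fder N u (T u) = - cc u * N u - 2 * (t11 + t22) * N u"
    unfolding fder_eqI[OF dN] exp by (simp add: N_def algebra_simps)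
  have Th: "Th = (\<lambda>u. N u / D u)" unfolding Th_def N_def D_def by (rule ext) simp
  have dN': "(N has_derivative fder N u) (at u)" and dD': "(D has_derivative fder D u) (at u)"
    unfolding fder_eqI[OF dN] fder_eqI[OF dD] by (rule dN, rule dD)
  have "fder Th u (T u) = - N u * (inverse (D u) * fder D u (T u) * inverse (D u)) + fder N u (T u) / D u"
    unfolding Th by (rule fder_eqI[OF has_derivative_divide[OF dN' dD' D0], THEN fun_cong])
  then show ?thesis unfolding DT NT Th using D0 by (simp add: field_simps)
qed

lemma om_Th_T: assumes u: "u \<in> U" and "Th u \<noteq> 0"
  shows "om (T u) u + fder Th u (T u) / Th u = - kap u"
  using om_T[OF u] lie_Th[OF u] assms(2) by (simp add: field_simps)

text \<open>Here \<open>om_T\<close> is solved for \<open>kap\<close>, which expresses its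
  derivative by those of \<open>cc\<close>, \<open>T\<close> and \<open>om\<close> in place of
  second derivatives of \<open>X\<close>.\<close>

lemma has_derivative_kap:
  assumes u: "u \<in> U"
  shows "(kap has_derivative (\<lambda>v. fder cc u v - (T u $ 1 * fder (om (axis 1 1)) u v + fder T u v $ 1 * om (axis 1 1) u
     + (T u $ 2 * fder (om (axis 2 1)) u v + fder T u v $ 2 * om (axis 2 1) u)))) (at u)"
proof -
  have "((\<lambda>u. cc u - (T u $ 1 * om (axis 1 1) u + T u $ 2 * om (axis 2 1) u)) has_derivative
    (\<lambda>v. fder cc u v - (T u $ 1 * fder (om (axis 1 1)) u v + fder T u v $ 1 * om (axis 1 1) u
     + (T u $ 2 * fder (om (axis 2 1)) u v + fder T u v $ 2 * om (axis 2 1) u)))) (at u)"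
    by (intro has_derivative_diff has_derivative_add has_derivative_mult smooth_on_has_derivative[OF smooth_cc u]
       smooth_on_has_derivative[OF smooth_om u] bounded_linear.has_derivative[OF bounded_linear_vec_nth] smooth_on_has_derivative[OF sT u])
  then show ?thesis
  proof (rule has_derivative_transform_within_open[OF _ oU u])
    fix w assume w: "w \<in> U"
    have "om (T w) w = T w $ 1 * om (axis 1 1) w + T w $ 2 * om (axis 2 1) w"
      by (subst axis2_expand[of "T w"]) (simp only: om_lin[OF w])
    with om_T[OF w] show "cc w - (T w $ 1 * om (axis 1 1) w + T w $ 2 * om (axis 2 1) w) = kap w" by simp
  qed
qed

text \<open>Cartan's formula: L_X \<omega> = dc together with \<omega>(X) = c - \<kappa> leaves i_X
  d\<omega> = d\<kappa>, given here in components.\<close>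

lemma d_om_T: assumes u: "u \<in> U"
  shows "fder kap u (axis 1 1) = - T u $ 2 * (fder (om (axis 2 1)) u (axis 1 1) - fder (om (axis 1 1)) u (axis 2 1))"
    "fder kap u (axis 2 1) = T u $ 1 * (fder (om (axis 2 1)) u (axis 1 1) - fder (om (axis 1 1)) u (axis 2 1))"
proof -
  have om: "om v u = v $ 1 * om (axis 1 1) u + v $ 2 * om (axis 2 1) u" for v
    by (subst axis2_expand[of v]) (simp only: om_lin[OF u])
  have dom: "fder (om v) u (T u) = T u $ 1 * fder (om v) u (axis 1 1) + T u $ 2 * fder (om v) u (axis 2 1)" for v
    by (subst axis2_expand[of "T u"]) (simp only: fder_linear[OF smooth_om u] real_scaleR_def)
  show "fder kap u (axis 1 1) = - T u $ 2 * (fder (om (axis 2 1)) u (axis 1 1) - fder (om (axis 1 1)) u (axis 2 1))"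
    "fder kap u (axis 2 1) = T u $ 1 * (fder (om (axis 2 1)) u (axis 1 1) - fder (om (axis 1 1)) u (axis 2 1))"
    unfolding fder_eqI[OF has_derivative_kap[OF u]]
    using lie_om[OF u, of "axis 1 1"] lie_om[OF u, of "axis 2 1"]
    unfolding dom om[of "fder T u _"] by (simp_all add: algebra_simps)
qed

end

section \<open>The metric and the connection in charts\<close>

lemma det_4:
  "det (A::'a::comm_ring_1^4^4) =
    A$1$1 * (A$2$2 * (A$3$3 * A$4$4 - A$3$4 * A$4$3) - A$2$3 * (A$3$2 * A$4$4 - A$3$4 * A$4$2) + A$2$4 * (A$3$2 * A$4$3 - A$3$3 * A$4$2))
  - A$1$2 * (A$2$1 * (A$3$3 * A$4$4 - A$3$4 * A$4$3) - A$2$3 * (A$3$1 * A$4$4 - A$3$4 * A$4$1) + A$2$4 * (A$3$1 * A$4$3 - A$3$3 * A$4$1))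
  + A$1$3 * (A$2$1 * (A$3$2 * A$4$4 - A$3$4 * A$4$2) - A$2$2 * (A$3$1 * A$4$4 - A$3$4 * A$4$1) + A$2$4 * (A$3$1 * A$4$2 - A$3$2 * A$4$1))
  - A$1$4 * (A$2$1 * (A$3$2 * A$4$3 - A$3$3 * A$4$2) - A$2$2 * (A$3$1 * A$4$3 - A$3$3 * A$4$1) + A$2$3 * (A$3$1 * A$4$2 - A$3$2 * A$4$1))"
proof -
  have f1: "finite {2::4, 3, 4}" "1 \<notin> {2::4, 3, 4}" by auto
  have f2: "finite {3::4, 4}" "2 \<notin> {3::4, 4}" by auto
  have f3: "finite {4::4}" "3 \<notin> {4::4}" by auto
  show ?thesis
    unfolding det_def UNIV_4
    unfolding sum_over_permutations_insert[OF f1] sum_over_permutations_insert[OF f2] sum_over_permutations_insert[OF f3] permutes_sing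
    by (simp add: sign_swap_id permutation_swap_id permutation_compose sign_compose sign_id transpose_def permutation_id algebra_simps)
qed
lemma matrix_inv: assumes "invertible (A::real^'n^'m)" shows "A ** matrix_inv A = mat 1" "matrix_inv A ** A = mat 1"
  using someI_ex[OF assms[unfolded invertible_def]] unfolding matrix_inv_def by auto
lemma t3_congruence: "t3 (transpose J ** A ** J) v w = t3 A (J *v v) (J *v w)"
proof -
  have "t3 (transpose J ** A ** J) v w = v \<bullet> (transpose J *v (A *v (J *v w)))"
    by (simp only: t3_def matrix_vector_mul_assoc matrix_mul_assoc)
  also have "\<dots> = (J *v v) \<bullet> (A *v (J *v w))"
    unfolding transpose_matrix_vector by (subst inner_commute, subst dot_lmul_matrix, rule inner_commute)
  finally show ?thesis unfolding t3_def .
qed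

lemma vector_4': "(vector [x,y,z,w] :: real^4^4) $ 1 = x" "(vector [x,y,z,w] :: real^4^4) $ 2 = y"
 "(vector [x,y,z,w] :: real^4^4) $ 3 = z" "(vector [x,y,z,w] :: real^4^4) $ 4 = w"
  unfolding vector_def by simp_all

lemma real_vec_expand: "(v :: real^'n) = (\<Sum>m\<in>UNIV. v $ m *\<^sub>R axis m 1)"
  by (simp add: vec_eq_iff axis_def sum.delta if_distrib[where f="\<lambda>x. _ * x"] cong: if_cong)

lemma fder_axis_sum:
  fixes f :: "real^'n \<Rightarrow> 'b::real_normed_vector"
  assumes "f differentiable (at x)"
  shows "fder f x v = (\<Sum>m\<in>UNIV. v $ m *\<^sub>R partial f x m)"
proof -
  have l: "linear (fder f x)" using assms by (simp add: frechet_derivative_works has_derivative_linear)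
  have "fder f x v = fder f x (\<Sum>m\<in>UNIV. v $ m *\<^sub>R axis m 1)" using real_vec_expand[of v] by simp
  then show ?thesis unfolding partial_def by (simp add: linear_sum[OF l] linear_cmul[OF l])
qed

lemma t3_fder_sum:
  fixes G :: "real^'n \<Rightarrow> real^'n^'n"
  assumes "G differentiable (at x)"
  shows "t3 (fder G x a) v w = (\<Sum>i\<in>UNIV. \<Sum>j\<in>UNIV. \<Sum>m\<in>UNIV. partial (\<lambda>y. G y $ i $ j) x m * a $ m * v $ i * w $ j)"
proof -
  have d: "(G has_derivative fder G x) (at x)" using assms by (simp add: frechet_derivative_works)
  have "fder G x a $ i $ j = (\<Sum>m\<in>UNIV. a $ m * partial (\<lambda>y. G y $ i $ j) x m)" for i j
  proof -
    have d2: "((\<lambda>y. G y $ i $ j) has_derivative (\<lambda>h. fder G x h $ i $ j)) (at x)"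
      by (intro bounded_linear.has_derivative[OF bounded_linear_vec_nth] d)
    have "fder G x a $ i $ j = fder (\<lambda>y. G y $ i $ j) x a" using fder_eqI[OF d2] by simp
    also have "\<dots> = (\<Sum>m\<in>UNIV. a $ m * partial (\<lambda>y. G y $ i $ j) x m)"
      using fder_axis_sum[of "\<lambda>y. G y $ i $ j" x a] d2 differentiable_def by auto
    finally show ?thesis .
  qed
  then show ?thesis unfolding t3_sum by (simp add: sum_distrib_right sum_distrib_left mult_ac)
qed

lemma sum_rotate3: "(\<Sum>j\<in>A. \<Sum>k\<in>B. \<Sum>l\<in>C. f j k l) = (\<Sum>l\<in>C. \<Sum>j\<in>A. \<Sum>k\<in>B. f j k l)"
proof -
  have "(\<Sum>j\<in>A. \<Sum>k\<in>B. \<Sum>l\<in>C. f j k l) = (\<Sum>j\<in>A. \<Sum>l\<in>C. \<Sum>k\<in>B. f j k l)"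
    by (rule sum.cong[OF refl], rule sum.swap)
  also have "\<dots> = (\<Sum>l\<in>C. \<Sum>j\<in>A. \<Sum>k\<in>B. f j k l)" by (rule sum.swap)
  finally show ?thesis .
qed

text \<open>Contracting with \<open>G x\<close> cancels the inverse metric in
  \<open>christoffel\<close> and leaves the Koszul expression.\<close>

lemma christoffel_gam:
  fixes G :: "real^'n \<Rightarrow> real^'n^'n"
  assumes "G differentiable (at x)" "invertible (G x)"
  shows "t3 (G x) w (\<chi> i. \<Sum>j\<in>UNIV. \<Sum>k\<in>UNIV. christoffel G x i j k * a $ j * b $ k) = gam G x w a b"
proof -
  let ?p = "\<lambda>i j m. partial (\<lambda>y. G y $ i $ j) x m"
  \<comment> \<open>The Christoffel symbol with its upper index lowered, contracted with
    \<open>a\<close> and \<open>b\<close>.\<close>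
  define z where "z = (\<chi> l. \<Sum>j\<in>UNIV. \<Sum>k\<in>UNIV. 1/2 * (?p l k j + ?p l j k - ?p j k l) * a $ j * b $ k)"
  have "(\<chi> i. \<Sum>j\<in>UNIV. \<Sum>k\<in>UNIV. christoffel G x i j k * a $ j * b $ k) = matrix_inv (G x) *v z"
  proof (simp add: vec_eq_iff, rule allI)
    fix i
    have "(\<Sum>j\<in>UNIV. \<Sum>k\<in>UNIV. christoffel G x i j k * a $ j * b $ k) =
      (\<Sum>j\<in>UNIV. \<Sum>k\<in>UNIV. \<Sum>l\<in>UNIV. matrix_inv (G x) $ i $ l * (1/2 * (?p l k j + ?p l j k - ?p j k l) * a $ j * b $ k))"
      by (simp add: christoffel_def sum_distrib_left sum_distrib_right mult_ac)
    also have "\<dots> = (\<Sum>l\<in>UNIV. \<Sum>j\<in>UNIV. \<Sum>k\<in>UNIV. matrix_inv (G x) $ i $ l * (1/2 * (?p l k j + ?p l j k - ?p j k l) * a $ j * b $ k))"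
      by (rule sum_rotate3)
    also have "\<dots> = (matrix_inv (G x) *v z) $ i"
      by (simp add: matrix_vector_mult_def z_def sum_distrib_left)
    finally show "(\<Sum>j\<in>UNIV. \<Sum>k\<in>UNIV. christoffel G x i j k * a $ j * b $ k) = (matrix_inv (G x) *v z) $ i" .
  qed
  then have "t3 (G x) w (\<chi> i. \<Sum>j\<in>UNIV. \<Sum>k\<in>UNIV. christoffel G x i j k * a $ j * b $ k) = w \<bullet> z"
    unfolding t3_def by (simp add: matrix_vector_mul_assoc matrix_inv[OF assms(2)])
  also have "w \<bullet> z = 1/2 * ((\<Sum>l\<in>UNIV. \<Sum>j\<in>UNIV. \<Sum>k\<in>UNIV. ?p l k j * a $ j * w $ l * b $ k)
    + (\<Sum>l\<in>UNIV. \<Sum>j\<in>UNIV. \<Sum>k\<in>UNIV. ?p l j k * b $ k * w $ l * a $ j)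
    - (\<Sum>l\<in>UNIV. \<Sum>j\<in>UNIV. \<Sum>k\<in>UNIV. ?p j k l * w $ l * a $ j * b $ k))"
    unfolding z_def inner_vec_def inner_real_def vec_lambda_beta
    unfolding sum_distrib_left sum.distrib[symmetric] sum_subtractf[symmetric]
    by (intro sum.cong refl) (simp add: field_simps)
  also have "(\<Sum>l\<in>UNIV. \<Sum>j\<in>UNIV. \<Sum>k\<in>UNIV. ?p l k j * a $ j * w $ l * b $ k) = t3 (fder G x a) w b"
    unfolding t3_fder_sum[OF assms(1)] by (rule sum.cong[OF refl], rule sum.swap)
  also have "(\<Sum>l\<in>UNIV. \<Sum>j\<in>UNIV. \<Sum>k\<in>UNIV. ?p l j k * b $ k * w $ l * a $ j) = t3 (fder G x b) w a"
    unfolding t3_fder_sum[OF assms(1)] ..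
  also have "(\<Sum>l\<in>UNIV. \<Sum>j\<in>UNIV. \<Sum>k\<in>UNIV. ?p j k l * w $ l * a $ j * b $ k) = t3 (fder G x w) a b"
    unfolding t3_fder_sum[OF assms(1)] by (rule sum_rotate3[symmetric])
  finally show ?thesis unfolding gam_def .
qed

text \<open>Lowering the index commutes with the covariant derivative: the derivative of
  \<open>G\<close> in \<open>G y *v X y\<close>, minus the Christoffel term, is \<open>gam\<close>
  with the roles of \<open>w\<close> and \<open>X\<close> exchanged. This is metric compatibility
  once more.\<close>

lemma cov_deriv_contract:
  fixes G :: "real^'n \<Rightarrow> real^'n^'n" and X :: "real^'n \<Rightarrow> real^'n"
  assumes "G differentiable (at x)" "invertible (G x)" "transpose (G x) = G x" "X differentiable (at x)"
    and sym': "\<And>a v w. t3 (fder G x a) v w = t3 (fder G x a) w v"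
  shows "(\<Sum>a\<in>UNIV. \<Sum>b\<in>UNIV. cov_deriv G (\<lambda>y. G y *v X y) x a b * v $ a * w $ b) =
    t3 (G x) w (fder X x v) + gam G x w v (X x)"
proof -
  have dG: "(G has_derivative fder G x) (at x)" and dX: "(X has_derivative fder X x) (at x)"
    using assms by (simp_all add: frechet_derivative_works)
  have dGX: "((\<lambda>y. G y *v X y) has_derivative (\<lambda>h. G x *v fder X x h + fder G x h *v X x)) (at x)"
    by (rule bounded_bilinear.FDERIV[OF bounded_bilinear_mvmult dG dX])
  define D where "D = (\<lambda>h. G x *v fder X x h + fder G x h *v X x)"
  have p: "(\<Sum>a\<in>UNIV. v $ a * partial (\<lambda>y. (G y *v X y) $ b) x a) = D v $ b" for b
  proof -
    have "((\<lambda>y. (G y *v X y) $ b) has_derivative (\<lambda>h. D h $ b)) (at x)"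
      unfolding D_def by (rule bounded_linear.has_derivative[OF bounded_linear_vec_nth dGX])
    then have d: "(\<lambda>y. (G y *v X y) $ b) differentiable (at x)" and e: "fder (\<lambda>y. (G y *v X y) $ b) x v = D v $ b"
      using fder_eqI[THEN fun_cong] by (auto simp: differentiable_def)
    show ?thesis using fder_axis_sum[OF d, of v] e by simp
  qed
  have "(\<Sum>a\<in>UNIV. \<Sum>b\<in>UNIV. cov_deriv G (\<lambda>y. G y *v X y) x a b * v $ a * w $ b) =
     (\<Sum>a\<in>UNIV. \<Sum>b\<in>UNIV. w $ b * (v $ a * partial (\<lambda>y. (G y *v X y) $ b) x a))
   - (\<Sum>a\<in>UNIV. \<Sum>b\<in>UNIV. \<Sum>d\<in>UNIV. (G x *v X x) $ d * (christoffel G x d a b * v $ a * w $ b))"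
    unfolding cov_deriv_def sum_subtractf[symmetric]
    by (intro sum.cong refl) (simp add: sum_distrib_left sum_distrib_right algebra_simps)
  also have "(\<Sum>a\<in>UNIV. \<Sum>b\<in>UNIV. w $ b * (v $ a * partial (\<lambda>y. (G y *v X y) $ b) x a)) = w \<bullet> D v"
    by (subst sum.swap) (simp add: p inner_vec_def flip: sum_distrib_left)
  also have "(\<Sum>a\<in>UNIV. \<Sum>b\<in>UNIV. \<Sum>d\<in>UNIV. (G x *v X x) $ d * (christoffel G x d a b * v $ a * w $ b))
    = (\<Sum>d\<in>UNIV. \<Sum>a\<in>UNIV. \<Sum>b\<in>UNIV. (G x *v X x) $ d * (christoffel G x d a b * v $ a * w $ b))"
    by (rule sum_rotate3)
  also have "\<dots> = (G x *v X x) \<bullet> (\<chi> d. \<Sum>a\<in>UNIV. \<Sum>b\<in>UNIV. christoffel G x d a b * v $ a * w $ b)"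
    by (simp add: inner_vec_def sum_distrib_left)
  also have "\<dots> = t3 (G x) (\<chi> d. \<Sum>a\<in>UNIV. \<Sum>b\<in>UNIV. christoffel G x d a b * v $ a * w $ b) (X x)"
    by (simp add: t3_def inner_commute)
  also have "\<dots> = gam G x (X x) v w"
    using christoffel_gam[OF assms(1,2), of "X x" v w] t3_transpose[of "G x"] assms(3) by metis
  also have "w \<bullet> D v = t3 (G x) w (fder X x v) + t3 (fder G x v) w (X x)"
    by (simp add: D_def t3_def inner_add_right)
  finally show ?thesis
    unfolding gam_def using sym'[of v w] sym'[of w "X x"] sym'[of "X x" v] by (simp add: field_simps)
qed

text \<open>The terms with second derivatives of the transition map \<open>\<tau>\<close> cancel.\<close>

lemma Dcon_chart_change:
  assumes P: "metric_patch U Q g F" and P': "metric_patch U Q' g' F'"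
    and st: "smooth_on Q \<tau>" and Q': "\<And>x. x \<in> Q \<Longrightarrow> \<tau> x \<in> Q'"
    and g: "\<And>x v w. x \<in> Q \<Longrightarrow> t3 (g x) v w = t3 (g' (\<tau> x)) (fder \<tau> x v) (fder \<tau> x w)"
    and F': "\<And>u. u \<in> U \<Longrightarrow> F' u = \<tau> (F u)"
    and V': "\<And>u. u \<in> U \<Longrightarrow> V' u = fder \<tau> (F u) (V u)"
    and u: "u \<in> U" and W': "W' u = fder \<tau> (F u) (W u)"
    and sV: "smooth_on U V"
  shows "Dcon g' F' W' V' v u = Dcon g F W V v u"
proof -
  interpret P: metric_patch U Q g F by fact
  interpret P': metric_patch U Q' g' F' by fact
  define x where "x = F u"
  have x: "x \<in> Q" using P.FQ[OF u] x_def by simp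
  have tx: "\<tau> x \<in> Q'" by (rule Q'[OF x])
  define J where "J = fder \<tau> x"
  define H where "H a b = fder (\<lambda>y. fder \<tau> y b) x a" for a b
  have H: "H a b = H b a" for a b unfolding H_def by (rule smooth_on_fder_symmetric[OF P.oQ st x])
  note dt = smooth_on_has_derivative[OF st x]
  have F'v: "fder F' u v = J (fder F u v)" for v
  proof -
    have "fder F' u = fder (\<lambda>u. \<tau> (F u)) u" by (rule fder_cong_open[OF P.oU u F'])
    also have "\<dots> = (\<lambda>v. J (fder F u v))"
      unfolding J_def x_def
      by (rule fder_eqI[OF has_derivative_compose[OF smooth_on_has_derivative[OF P.sF u] dt[unfolded x_def]]])
    finally show ?thesis by simp
  qed
  have V'v: "fder V' u v = H (fder F u v) (V u) + J (fder V u v)" for v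
  proof -
    have "fder V' u = fder (\<lambda>u. fder \<tau> (F u) (V u)) u" by (rule fder_cong_open[OF P.oU u V'])
    also have "\<dots> = (\<lambda>h. fder (\<lambda>y. fder \<tau> y (V u)) (F u) (fder F u h) + fder \<tau> (F u) (fder V u h))"
      by (rule fder_eqI[OF has_derivative_fder_field[OF P.oQ smooth_on_Ck[OF st] P.FQ[OF u]
            smooth_on_has_derivative[OF P.sF u] smooth_on_has_derivative[OF sV u]]])
    finally show ?thesis by (simp add: J_def H_def x_def)
  qed
  have dg: "t3 (fder g x a) v w = t3 (fder g' (\<tau> x) (J a)) (J v) (J w) + t3 (g' (\<tau> x)) (H a v) (J w)
     + t3 (g' (\<tau> x)) (J v) (H a w)" for a v w
  proof -
    have 1: "((\<lambda>x. t3 (g x) v w) has_derivative (\<lambda>h. t3 (fder g x h) v w + t3 (g x) 0 w + t3 (g x) v 0)) (at x)"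
      by (intro has_derivative_t3 smooth_on_has_derivative[OF P.sg x] has_derivative_const)
    have 2: "((\<lambda>x. t3 (g' (\<tau> x)) (fder \<tau> x v) (fder \<tau> x w)) has_derivative
      (\<lambda>h. t3 (fder g' (\<tau> x) (J h)) (J v) (J w) + t3 (g' (\<tau> x)) (H h v) (J w) + t3 (g' (\<tau> x)) (J v) (H h w))) (at x)"
      unfolding J_def H_def
      by (intro has_derivative_t3 has_derivative_compose[OF dt smooth_on_has_derivative[OF P'.sg tx]]
          smooth_on_has_derivative[OF smooth_on_fder[OF st] x])
    have "((\<lambda>x. t3 (g x) v w) has_derivative
      (\<lambda>h. t3 (fder g' (\<tau> x) (J h)) (J v) (J w) + t3 (g' (\<tau> x)) (H h v) (J w) + t3 (g' (\<tau> x)) (J v) (H h w))) (at x)"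
      by (rule has_derivative_transform_within_open[OF 2 P.oQ x]) (simp add: g)
    from has_derivative_unique[OF 1 this] show ?thesis by (simp add: fun_eq_iff)
  qed
  \<comment> \<open>In the Koszul combination the second derivatives of \<open>\<tau>\<close> leave
    a single \<open>H a b\<close>, exactly the term that differentiating \<open>V'\<close> brings in
    on the other side.\<close>
  have G: "gam g x w a b = gam g' (\<tau> x) (J w) (J a) (J b) + t3 (g' (\<tau> x)) (J w) (H a b)" for w a b
    unfolding gam_def dg using H[of w a] H[of w b] H[of a b]
      P'.t3g_sym[OF tx, of "J b"] P'.t3g_sym[OF tx, of "J a"]
    by (simp add: field_simps)
  have eqs: "F u = x" "F' u = \<tau> x" "W' u = J (W u)" "V' u = J (V u)"
    using F'[OF u] W' V'[OF u] by (simp_all add: x_def J_def)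
  show ?thesis
    unfolding Dcon_def F'v V'v eqs using g[OF x, of "W u" "fder V u v"] G[of "W u" "fder F u v" "V u"]
    by (simp add: J_def[symmetric])
qed

lemma smooth_on_local:
  fixes f :: "'a::real_normed_vector \<Rightarrow> 'b::real_normed_vector"
  assumes "\<And>u. u \<in> V \<Longrightarrow> \<exists>W. open W \<and> u \<in> W \<and> smooth_on W f"
  shows "smooth_on V f"
proof -
  have "Ck_on k V f" if "\<And>u. u \<in> V \<Longrightarrow> \<exists>W. open W \<and> u \<in> W \<and> Ck_on k W f" for k and f :: "'a \<Rightarrow> 'b"
    using that
  proof (induction k arbitrary: f)
    case 0
    have "isCont f u" if "u \<in> V" for u
      using 0[OF that] by (auto simp: continuous_on_eq_continuous_at)
    then show ?case by (simp add: continuous_at_imp_continuous_on)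
  next
    case (Suc k)
    have "Ck_on k V (\<lambda>x. fder f x v)" for v
    proof (rule Suc.IH)
      fix u assume "u \<in> V"
      from Suc.prems[OF this] show "\<exists>W. open W \<and> u \<in> W \<and> Ck_on k W (\<lambda>x. fder f x v)" by (auto simp: )
    qed
    moreover have "f differentiable (at u)" if "u \<in> V" for u using Suc.prems[OF that] by auto
    ultimately show ?case by simp
  qed
  then show ?thesis using assms unfolding smooth_on_def by metis
qed

section \<open>Charts, transition maps and the metric of a space-time\<close>

locale spacetime =
  fixes M :: "'a::{t2_space,second_countable_topology} spacetime"
  assumes st: "is_spacetime M"
begin

lemma chart_open: "c \<in> charts M \<Longrightarrow> open (fst c)"
  using st by (simp add: is_spacetime_def oriented_smooth_atlas_def)

lemma chart_homeo: "c \<in> charts M \<Longrightarrow> homeomorphism (fst c) (snd c ` fst c) (snd c) (coord_inv c)"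
  using st by (simp add: is_spacetime_def oriented_smooth_atlas_def)

lemma coord_inv_snd: "c \<in> charts M \<Longrightarrow> p \<in> fst c \<Longrightarrow> coord_inv c (snd c p) = p"
  using homeomorphism_apply1[OF chart_homeo] .

lemma chart_at: "chart_at M p \<in> charts M" "p \<in> fst (chart_at M p)"
proof -
  have "p \<in> (\<Union>c\<in>charts M. fst c)"
    using st by (simp add: is_spacetime_def oriented_smooth_atlas_def)
  then have "\<exists>c. c \<in> charts M \<and> p \<in> fst c" by blast
  from someI_ex[OF this] show "chart_at M p \<in> charts M" "p \<in> fst (chart_at M p)"
    unfolding chart_at_def by auto
qed

lemma open_chart_image:
  assumes c: "c \<in> charts M" and N: "open N"
  shows "open (snd c ` (fst c \<inter> N))"
proof -
  have "openin (top_of_set (snd c ` fst c)) (snd c ` (fst c \<inter> N))"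
    by (rule homeomorphism_imp_open_map[OF chart_homeo[OF c]]) (use N in auto)
  moreover have "open (snd c ` fst c)"
    using st c by (simp add: is_spacetime_def oriented_smooth_atlas_def)
  ultimately show ?thesis using openin_open_eq by blast
qed

lemma smooth_transition:
  "c \<in> charts M \<Longrightarrow> d \<in> charts M \<Longrightarrow> smooth_on (snd c ` (fst c \<inter> fst d)) (snd d \<circ> coord_inv c)"
  using st by (simp add: is_spacetime_def oriented_smooth_atlas_def)

lemma jacobian_mult:
  assumes "c \<in> charts M" "d \<in> charts M" "p \<in> fst c" "p \<in> fst d"
  shows "jacobian c d p *v v = fder (snd d \<circ> coord_inv c) (snd c p) v"
proof -
  have "snd c p \<in> snd c ` (fst c \<inter> fst d)" using assms by auto
  from smooth_on_has_derivative[OF smooth_transition[OF assms(1,2)] this]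
  have "bounded_linear (fder (snd d \<circ> coord_inv c) (snd c p))" by (rule has_derivative_bounded_linear)
  from fun_cong[OF matrix_vector_mul(3)[OF this]] show ?thesis unfolding jacobian_def .
qed

lemma det_jacobian: "c \<in> charts M \<Longrightarrow> d \<in> charts M \<Longrightarrow> p \<in> fst c \<Longrightarrow> p \<in> fst d \<Longrightarrow> det (jacobian c d p) > 0"
  using st by (simp add: is_spacetime_def oriented_smooth_atlas_def)

lemma lorentz: "lorentz_metric (charts M) (metric M)" using st by (simp add: is_spacetime_def)

lemma smooth_metric: "c \<in> charts M \<Longrightarrow> smooth_on (snd c ` fst c) (metric_coords M c)"
  unfolding metric_coords_def using lorentz unfolding lorentz_metric_def by blast

lemma metric_sym: "c \<in> charts M \<Longrightarrow> p \<in> fst c \<Longrightarrow> transpose (metric M c p) = metric M c p"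
  using lorentz unfolding lorentz_metric_def by blast

lemma ip_sym: "ip M p v w = ip M p w v"
  using metric_sym[of "chart_at M p" p] t3_transpose[of "metric M (chart_at M p) p" v w] chart_at[of p]
  by (simp add: ip_def t3_def)

lemma null_normals_swap: "null_normals M S k l \<Longrightarrow> null_normals M S l k"
  unfolding null_normals_def using ip_sym by metis

lemma metric_coords_eq: "c \<in> charts M \<Longrightarrow> p \<in> fst c \<Longrightarrow> metric_coords M c (snd c p) = metric M c p"
  by (simp add: metric_coords_def coord_inv_snd)

text \<open>A congruence multiplies the determinant by a square, so its sign is that of
  \<open>minkowski\<close>.\<close>

lemma det_metric: assumes "c \<in> charts M" "p \<in> fst c" shows "det (metric M c p) < 0"
proof -
  obtain P where P: "invertible P" "transpose P ** metric M c p ** P = minkowski"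
    using lorentz assms unfolding lorentz_metric_def by blast
  have "det (transpose P ** metric M c p ** P) = (det P)\<^sup>2 * det (metric M c p)"
    by (simp add: det_mul power2_eq_square)
  moreover have "det minkowski = -1" by (simp add: det_4 minkowski_def)
  ultimately have "(det P)\<^sup>2 * det (metric M c p) = -1" using P by simp
  then show ?thesis using mult_nonneg_nonneg[OF zero_le_power2[of "det P"], of "det (metric M c p)"] by linarith
qed

lemma invertible_metric: "c \<in> charts M \<Longrightarrow> p \<in> fst c \<Longrightarrow> invertible (metric M c p)"
  using det_metric invertible_det_nz by fastforce

lemma metric_change:
  assumes "c \<in> charts M" "d \<in> charts M" "p \<in> fst c" "p \<in> fst d"
  shows "t3 (metric M c p) v w = t3 (metric M d p) (jacobian c d p *v v) (jacobian c d p *v w)"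
proof -
  have "metric M c p = transpose (jacobian c d p) ** metric M d p ** jacobian c d p"
    using lorentz assms unfolding lorentz_metric_def by blast
  then show ?thesis by (simp only: t3_congruence)
qed

end

section \<open>Parametrized submanifolds\<close>

locale param = spacetime M for M :: "'a::{t2_space,second_countable_topology} spacetime" +
  fixes S :: "'a set" and V :: "(real^'k) set" and \<psi> :: "real^'k \<Rightarrow> 'a"
  assumes lp: "local_param M S V \<psi>"
begin

definition dom :: "'a chart \<Rightarrow> (real^'k) set" where "dom c = {u\<in>V. \<psi> u \<in> fst c}"

lemma openV: "open V" using lp by (simp add: local_param_def)

lemma homeo: "homeomorphism V (\<psi> ` V) \<psi> (inv_into V \<psi>)" using lp by (simp add: local_param_def)

lemma cont: "continuous_on V \<psi>" using homeomorphism_cont1[OF homeo] .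

lemma inj: "inj_on \<psi> V" using homeomorphism_apply1[OF homeo] by (metis inj_onI)

lemma \<psi>S: "u \<in> V \<Longrightarrow> \<psi> u \<in> S" using lp openin_imp_subset by (fastforce simp: local_param_def)

lemma open_preimage: "open N \<Longrightarrow> open {u\<in>V. \<psi> u \<in> N}"
  using continuous_open_preimage[OF cont openV] by (simp add: vimage_def Int_def)

lemma open_dom: "c \<in> charts M \<Longrightarrow> open (dom c)"
  unfolding dom_def by (rule open_preimage[OF chart_open])

lemma dom_chart_at: "u \<in> V \<Longrightarrow> u \<in> dom (chart_at M (\<psi> u))"
  by (simp add: dom_def chart_at)

lemma smooth_F: "c \<in> charts M \<Longrightarrow> smooth_on (dom c) (snd c \<circ> \<psi>)"
  using lp by (simp add: local_param_def dom_def)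

lemma inj_F: "c \<in> charts M \<Longrightarrow> u \<in> dom c \<Longrightarrow> inj (fder (snd c \<circ> \<psi>) u)"
  using lp by (simp add: local_param_def dom_def)

lemma patch: "c \<in> charts M \<Longrightarrow> metric_patch (dom c) (snd c ` fst c) (metric_coords M c) (snd c \<circ> \<psi>)"
proof
  assume c: "c \<in> charts M"
  show "open (dom c)" by (rule open_dom[OF c])
  show "open (snd c ` fst c)" using open_chart_image[OF c open_UNIV] by simp
  show "smooth_on (snd c ` fst c) (metric_coords M c)" by (rule smooth_metric[OF c])
  show "smooth_on (dom c) (snd c \<circ> \<psi>)" by (rule smooth_F[OF c])
  show "\<And>u. u \<in> dom c \<Longrightarrow> (snd c \<circ> \<psi>) u \<in> snd c ` fst c" by (simp add: dom_def)
  show "\<And>x. x \<in> snd c ` fst c \<Longrightarrow> transpose (metric_coords M c x) = metric_coords M c x"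
    using metric_coords_eq[OF c] metric_sym[OF c] by auto
qed

lemma metric_F: "c \<in> charts M \<Longrightarrow> u \<in> dom c \<Longrightarrow> metric_coords M c ((snd c \<circ> \<psi>) u) = metric M c (\<psi> u)"
  by (simp add: metric_coords_eq dom_def)

lemma F_change:
  assumes "c \<in> charts M" "d \<in> charts M" "u \<in> dom c" "u \<in> dom d"
  shows "fder (snd d \<circ> \<psi>) u v = jacobian c d (\<psi> u) *v fder (snd c \<circ> \<psi>) u v"
proof -
  have p: "\<psi> u \<in> fst c" "\<psi> u \<in> fst d" using assms by (auto simp: dom_def)
  have "fder (snd d \<circ> \<psi>) u = fder (\<lambda>w. (snd d \<circ> coord_inv c) ((snd c \<circ> \<psi>) w)) u"
    by (rule fder_cong_open[OF open_Int[OF open_dom[OF assms(1)] open_dom[OF assms(2)]]])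
       (use assms coord_inv_snd[OF assms(1)] in \<open>auto simp: dom_def\<close>)
  also have "\<dots> = (\<lambda>v. fder (snd d \<circ> coord_inv c) ((snd c \<circ> \<psi>) u) (fder (snd c \<circ> \<psi>) u v))"
    by (rule fder_eqI, rule has_derivative_compose[OF smooth_on_has_derivative[OF smooth_F[OF assms(1)] assms(3)]],
        rule smooth_on_has_derivative[OF smooth_transition[OF assms(1,2)]]) (use p in auto)
  finally show ?thesis using jacobian_mult[OF assms(1,2) p] by simp
qed

lemma nabla_along_Dcon:
  assumes "u \<in> V"
  defines "c \<equiv> chart_at M (\<psi> u)"
  shows "ip M (\<psi> u) w (nabla_along M Y \<psi> u \<alpha>) = Dcon (metric_coords M c) (snd c \<circ> \<psi>) (\<lambda>_. w) (Y c \<circ> \<psi>) (axis \<alpha> 1) u"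
proof -
  have c: "c \<in> charts M" "\<psi> u \<in> fst c" "u \<in> dom c" using chart_at dom_chart_at assms by (auto simp: c_def)
  have d: "metric_coords M c differentiable (at (snd c (\<psi> u)))"
    using smooth_on_has_derivative[OF smooth_metric[OF c(1)]] c(2) by (auto simp: differentiable_def)
  have i: "invertible (metric_coords M c (snd c (\<psi> u)))"
    using invertible_metric[OF c(1,2)] metric_coords_eq[OF c(1,2)] by simp
  show ?thesis
    unfolding ip_def c_def[symmetric] nabla_along_def Let_def Dcon_def t3_def[symmetric] frame_def
      partial_def metric_F[OF c(1,3)]
    using metric_coords_eq[OF c(1,2)] christoffel_gam[OF d i, of w "fder (snd c \<circ> \<psi>) u (axis \<alpha> 1)" "Y c (\<psi> u)"] by simp
qed

text \<open>\<open>nabla_along\<close> and \<open>frame\<close> refer to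
  \<open>chart_at M (\<psi> u)\<close>, which may jump with \<open>u\<close>. Differentiation in
  \<open>u\<close> requires a fixed chart, and this lemma passes to one.\<close>

lemma Dcon_change:
  assumes c: "c \<in> charts M" and d: "d \<in> charts M" and u: "u \<in> dom c" "u \<in> dom d"
    and Y: "vector_along (charts M) S Y" and sY: "smooth_on (dom c) (Y c \<circ> \<psi>)"
    and W: "W' u = jacobian c d (\<psi> u) *v W u"
  shows "Dcon (metric_coords M d) (snd d \<circ> \<psi>) W' (Y d \<circ> \<psi>) v u = Dcon (metric_coords M c) (snd c \<circ> \<psi>) W (Y c \<circ> \<psi>) v u"
proof -
  let ?U = "dom c \<inter> dom d"
  let ?Q = "snd c ` (fst c \<inter> fst d)"
  interpret c: metric_patch "dom c" "snd c ` fst c" "metric_coords M c" "snd c \<circ> \<psi>" by (rule patch[OF c])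
  interpret d: metric_patch "dom d" "snd d ` fst d" "metric_coords M d" "snd d \<circ> \<psi>" by (rule patch[OF d])
  have P: "metric_patch ?U ?Q (metric_coords M c) (snd c \<circ> \<psi>)"
    by standard (use c.oU d.oU open_chart_image[OF c chart_open[OF d]] c.gsym in
      \<open>auto intro: smooth_on_subset[OF c.sg] smooth_on_subset[OF c.sF] simp: dom_def\<close>)
  have P': "metric_patch ?U (snd d ` fst d) (metric_coords M d) (snd d \<circ> \<psi>)"
    by standard (use c.oU d.oU d.oQ d.sg d.gsym in
      \<open>auto intro: smooth_on_subset[OF d.sF] simp: dom_def\<close>)
  show ?thesis
  proof (rule Dcon_chart_change[OF P P' smooth_transition[OF c d]])
    show "\<And>x. x \<in> ?Q \<Longrightarrow> (snd d \<circ> coord_inv c) x \<in> snd d ` fst d" using coord_inv_snd[OF c] by auto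
    show "t3 (metric_coords M c x) v w = t3 (metric_coords M d ((snd d \<circ> coord_inv c) x))
        (fder (snd d \<circ> coord_inv c) x v) (fder (snd d \<circ> coord_inv c) x w)" if "x \<in> ?Q" for x v w
    proof -
      from that obtain p where p: "p \<in> fst c" "p \<in> fst d" "x = snd c p" by auto
      show ?thesis
        using metric_change[OF c d p(1,2)] jacobian_mult[OF c d p(1,2)] p coord_inv_snd[OF c p(1)]
          metric_coords_eq[OF c] metric_coords_eq[OF d] by simp
    qed
    show "\<And>u. u \<in> ?U \<Longrightarrow> (snd d \<circ> \<psi>) u = (snd d \<circ> coord_inv c) ((snd c \<circ> \<psi>) u)"
      using coord_inv_snd[OF c] by (simp add: dom_def)
    show "(Y d \<circ> \<psi>) u = fder (snd d \<circ> coord_inv c) ((snd c \<circ> \<psi>) u) ((Y c \<circ> \<psi>) u)" if "u \<in> ?U" for u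
    proof -
      have p: "\<psi> u \<in> fst c" "\<psi> u \<in> fst d" "\<psi> u \<in> S" using that \<psi>S by (auto simp: dom_def)
      then have "Y d (\<psi> u) = jacobian c d (\<psi> u) *v Y c (\<psi> u)"
        using Y c d unfolding vector_along_def by blast
      then show ?thesis using jacobian_mult[OF c d p(1,2)] by simp
    qed
    show "u \<in> ?U" using u by simp
    show "W' u = fder (snd d \<circ> coord_inv c) ((snd c \<circ> \<psi>) u) (W u)"
      using W jacobian_mult[OF c d] u by (simp add: dom_def)
    show "smooth_on ?U (Y c \<circ> \<psi>)" by (rule smooth_on_subset[OF sY]) auto
  qed
qed

lemma frame_eq: "frame M \<psi> u \<alpha> = fder (snd (chart_at M (\<psi> u)) \<circ> \<psi>) u (axis \<alpha> 1)"
  by (simp add: frame_def partial_def)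

lemma induced_eq:
  assumes c: "c \<in> charts M" and u: "u \<in> dom c"
  shows "induced M \<psi> u $ \<alpha> $ \<beta> = t3 (metric_coords M c ((snd c \<circ> \<psi>) u)) (fder (snd c \<circ> \<psi>) u (axis \<alpha> 1)) (fder (snd c \<circ> \<psi>) u (axis \<beta> 1))"
proof -
  have uV: "u \<in> V" "\<psi> u \<in> fst c" using u by (auto simp: dom_def)
  show ?thesis
    unfolding metric_F[OF c u] metric_change[OF c chart_at(1) uV(2) chart_at(2)]
    using F_change[OF c chart_at(1) u dom_chart_at[OF uV(1)]]
    by (simp add: induced_def ip_def t3_def frame_eq)
qed

lemma tangent_low_eq:
  assumes c: "c \<in> charts M" and u: "u \<in> dom c" and Y: "Y (chart_at M (\<psi> u)) (\<psi> u) = jacobian c (chart_at M (\<psi> u)) (\<psi> u) *v Y c (\<psi> u)"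
  shows "tangent_low M Y \<psi> u $ \<alpha> = t3 (metric_coords M c ((snd c \<circ> \<psi>) u)) (Y c (\<psi> u)) (fder (snd c \<circ> \<psi>) u (axis \<alpha> 1))"
proof -
  have uV: "u \<in> V" "\<psi> u \<in> fst c" using u by (auto simp: dom_def)
  show ?thesis
    unfolding metric_F[OF c u] metric_change[OF c chart_at(1) uV(2) chart_at(2)]
    using F_change[OF c chart_at(1) u dom_chart_at[OF uV(1)]] Y
    by (simp add: tangent_low_def ip_def t3_def frame_eq at_pt_def)
qed

end

section \<open>Linear algebra in dimensions two and four\<close>

lemma axis2_nth [simp]: "(axis (1::2) (1::real)) $ 1 = 1" "(axis (1::2) (1::real)) $ 2 = 0"
  "(axis (2::2) (1::real)) $ 1 = 0" "(axis (2::2) (1::real)) $ 2 = 1"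
  by (simp_all add: axis_def)

lemma matrix_inv_unique:
  fixes A C :: "real^'n^'n"
  assumes "A ** C = mat 1"
  shows "matrix_inv A = C"
proof -
  have "invertible A" using assms matrix_left_right_inverse unfolding invertible_def by blast
  then have "matrix_inv A ** (A ** C) = C" by (simp add: matrix_mul_assoc matrix_inv)
  then show ?thesis by (simp add: assms)
qed

lemma matrix_inv_2:
  fixes A :: "real^2^2"
  assumes "A$1$1 * A$2$2 - A$1$2 * A$2$1 \<noteq> 0"
  shows "matrix_inv A $ 1 $ 1 = A$2$2 / (A$1$1 * A$2$2 - A$1$2 * A$2$1)"
    "matrix_inv A $ 1 $ 2 = - A$1$2 / (A$1$1 * A$2$2 - A$1$2 * A$2$1)"
    "matrix_inv A $ 2 $ 1 = - A$2$1 / (A$1$1 * A$2$2 - A$1$2 * A$2$1)"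
    "matrix_inv A $ 2 $ 2 = A$1$1 / (A$1$1 * A$2$2 - A$1$2 * A$2$1)"
proof -
  define D where "D = A$1$1 * A$2$2 - A$1$2 * A$2$1"
  have D: "D \<noteq> 0" using assms by (simp add: D_def)
  define C :: "real^2^2" where "C = vector [vector [A$2$2 / D, - A$1$2 / D], vector [- A$2$1 / D, A$1$1 / D]]"
  have AC: "A ** C = mat 1"
    using D by (simp add: vec_eq_iff forall_2 matrix_matrix_mult_def sum_2 C_def mat_def field_simps)
      (simp add: D_def algebra_simps)
  show "matrix_inv A $ 1 $ 1 = A$2$2 / (A$1$1 * A$2$2 - A$1$2 * A$2$1)"
    "matrix_inv A $ 1 $ 2 = - A$1$2 / (A$1$1 * A$2$2 - A$1$2 * A$2$1)"
    "matrix_inv A $ 2 $ 1 = - A$2$1 / (A$1$1 * A$2$2 - A$1$2 * A$2$1)"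
    "matrix_inv A $ 2 $ 2 = A$1$1 / (A$1$1 * A$2$2 - A$1$2 * A$2$1)"
    unfolding D_def[symmetric] matrix_inv_unique[OF AC] by (simp_all add: C_def)
qed

lemma t3_nth: "t3 A (axis i 1) (axis j 1) = A $ i $ j"
  unfolding t3_def by (simp add: inner_axis' matrix_vector_mult_basis column_def)

lemma gram_det:
  fixes P :: "real^4^4"
  shows "det (\<chi> i j. t3 g (P $ i) (P $ j)) = (det P)\<^sup>2 * det g"
proof -
  have "(\<chi> i j. t3 g (P $ i) (P $ j)) = P ** g ** transpose P"
    unfolding t3_sum
    by (simp add: vec_eq_iff matrix_matrix_mult_def transpose_def sum_distrib_left sum_distrib_right)
       (intro allI, subst sum.swap, simp add: mult_ac)
  then show ?thesis by (simp add: det_mul power2_eq_square)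
qed

text \<open>The Gram matrix of the four vectors splits into the null block, of determinant -1, and
  the block of \<open>e\<close> and \<open>f\<close>. By \<open>gram_det\<close> its determinant is
  also \<open>det g\<close> times the square of the volume they span; this relates the induced area
  to the space-time volume form.\<close>

lemma null_gram_det:
  fixes k l e f :: "real^4"
  assumes "\<And>v w. t3 g v w = t3 g w v" "t3 g k k = 0" "t3 g l l = 0" "t3 g k l = -1"
    "t3 g k e = 0" "t3 g k f = 0" "t3 g l e = 0" "t3 g l f = 0"
  shows "t3 g e e * t3 g f f - (t3 g e f)\<^sup>2 = - det g * (det (vector [l, k, e, f] :: real^4^4))\<^sup>2"
proof -
  have "det (\<chi> i j. t3 g ((vector [l, k, e, f] :: real^4^4) $ i) ((vector [l, k, e, f] :: real^4^4) $ j)) =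
     - (t3 g e e * t3 g f f - (t3 g e f)\<^sup>2)"
    unfolding det_4 by (simp add: vector_4' assms(2-8) assms(1)[of l k] assms(1)[of e k] assms(1)[of f k]
        assms(1)[of e l] assms(1)[of f l] assms(1)[of f e] power2_eq_square)
  then show ?thesis unfolding gram_det by (simp add: algebra_simps)
qed

lemma rows_span:
  fixes l k e f :: "real^4"
  assumes "det (vector [l, k, e, f] :: real^4^4) \<noteq> 0"
  shows "\<exists>a b c d. x = a *\<^sub>R k + b *\<^sub>R l + (c *\<^sub>R e + d *\<^sub>R f)"
proof -
  let ?P = "vector [l, k, e, f] :: real^4^4"
  have "invertible (transpose ?P)" using assms by (simp add: invertible_det_nz)
  then have "transpose ?P *v (matrix_inv (transpose ?P) *v x) = x"
    by (simp add: matrix_vector_mul_assoc matrix_inv del: transpose_matrix_vector)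
  then obtain y where "transpose ?P *v y = x" by blast
  then have "x = y $ 2 *\<^sub>R k + y $ 1 *\<^sub>R l + (y $ 3 *\<^sub>R e + y $ 4 *\<^sub>R f)"
    by (auto simp: vec_eq_iff vector_matrix_mult_def sum_4 vector_4' algebra_simps)
  then show ?thesis by blast
qed

lemma smooth_on_transfer:
  "open U \<Longrightarrow> smooth_on U g \<Longrightarrow> (\<And>x. x \<in> U \<Longrightarrow> f x = g x) \<Longrightarrow> smooth_on U f"
  using smooth_on_cong[of U f g] by simp

section \<open>Changes of parametrization\<close>

text \<open>Continuity of \<open>\<tau>\<close> is upgraded to differentiability: near
  \<open>\<tau> u\<close> the map \<open>h\<close> differs from a translation by a small multiple of
  the distance, so \<open>\<tau>\<close> moves like the differentiable composite. Transition maps of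
  parametrizations are at first known to be continuous only.\<close>

lemma has_derivative_lift:
  fixes \<tau> :: "'a::real_normed_vector \<Rightarrow> 'b::real_normed_vector"
  assumes h: "(h has_derivative (\<lambda>x. x)) (at (\<tau> u))" and c: "isCont \<tau> u"
    and H: "((\<lambda>v. h (\<tau> v)) has_derivative E) (at u)"
  shows "(\<tau> has_derivative E) (at u)"
  unfolding has_derivative_at_alt
proof (intro conjI allI impI)
  show bE: "bounded_linear E" using H by (rule has_derivative_bounded_linear)
  obtain K where K: "K > 0" "\<And>x. norm (E x) \<le> norm x * K"
    using bounded_linear.pos_bounded[OF bE] by blast
  fix e :: real assume e: "e > 0"
  \<comment> \<open>The bound 1/2 lets the error \<open>e1 * norm (\<tau> v - \<tau> u)\<close> be
    absorbed on the left, which yields a Lipschitz bound for \<open>\<tau>\<close> with constant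
    \<open>2 * (K + 1)\<close>. The other bound makes \<open>e1\<close> times this constant at most
    \<open>e / 2\<close>.\<close>
  define e1 where "e1 = min (1/2) (e / (4 * (K + 1)))"
  define e2 where "e2 = min 1 (e / 2)"
  have e1: "e1 > 0" using e K by (simp add: e1_def)
  have e1h: "e1 \<le> 1/2" unfolding e1_def by (rule min.cobounded1)
  have e2: "e2 > 0" "e2 \<le> 1" "e2 \<le> e/2" using e by (auto simp: e2_def)
  have e1K: "e1 * (2 * (K + 1)) \<le> e / 2"
  proof -
    have "e1 * (2 * (K + 1)) \<le> e / (4 * (K + 1)) * (2 * (K + 1))"
      using K by (intro mult_right_mono) (auto simp: e1_def)
    also have "\<dots> = e / 2" using K by (simp add: field_simps)
    finally show ?thesis .
  qed
  obtain d1 where d1: "d1 > 0" "\<And>y. norm (y - \<tau> u) < d1 \<Longrightarrow> norm (h y - h (\<tau> u) - (y - \<tau> u)) \<le> e1 * norm (y - \<tau> u)"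
    using h e1 unfolding has_derivative_at_alt by blast
  obtain d2 where d2: "d2 > 0" "\<And>v. norm (v - u) < d2 \<Longrightarrow> norm (\<tau> v - \<tau> u) < d1"
    using c d1 unfolding continuous_at_eps_delta dist_norm by blast
  obtain d3 where d3: "d3 > 0" "\<And>v. norm (v - u) < d3 \<Longrightarrow> norm (h (\<tau> v) - h (\<tau> u) - E (v - u)) \<le> e2 * norm (v - u)"
    using H e2 unfolding has_derivative_at_alt by blast
  show "\<exists>d>0. \<forall>v. norm (v - u) < d \<longrightarrow> norm (\<tau> v - \<tau> u - E (v - u)) \<le> e * norm (v - u)"
  proof (intro exI conjI allI impI)
    show "min d2 d3 > 0" using d2 d3 by simp
    fix v assume "norm (v - u) < min d2 d3"
    then have A: "norm (h (\<tau> v) - h (\<tau> u) - (\<tau> v - \<tau> u)) \<le> e1 * norm (\<tau> v - \<tau> u)"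
      and B: "norm (h (\<tau> v) - h (\<tau> u) - E (v - u)) \<le> e2 * norm (v - u)"
      using d1 d2 d3 by auto
    have "norm (h (\<tau> v) - h (\<tau> u)) \<le> e2 * norm (v - u) + norm (v - u) * K"
      using B K(2)[of "v - u"] norm_triangle_sub[of "h (\<tau> v) - h (\<tau> u)" "E (v - u)"] by linarith
    also have "\<dots> \<le> norm (v - u) * (K + 1)"
      using e2 by (simp add: algebra_simps mult_left_le_one_le)
    finally have C: "norm (h (\<tau> v) - h (\<tau> u)) \<le> norm (v - u) * (K + 1)" .
    have "norm (\<tau> v - \<tau> u) \<le> norm (h (\<tau> v) - h (\<tau> u)) + e1 * norm (\<tau> v - \<tau> u)"
      using A norm_triangle_sub[of "\<tau> v - \<tau> u" "h (\<tau> v) - h (\<tau> u)"] by (simp add: norm_minus_commute)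
    also have "e1 * norm (\<tau> v - \<tau> u) \<le> 1/2 * norm (\<tau> v - \<tau> u)"
      by (rule mult_right_mono[OF e1h]) simp
    finally have "norm (\<tau> v - \<tau> u) \<le> norm (v - u) * (2 * (K + 1))" using C by (simp add: algebra_simps)
    then have "e1 * norm (\<tau> v - \<tau> u) \<le> e1 * (norm (v - u) * (2 * (K + 1)))"
      using e1 by (simp add: mult_left_mono)
    also have "\<dots> = norm (v - u) * (e1 * (2 * (K + 1)))" by simp
    also have "\<dots> \<le> norm (v - u) * (e / 2)" using e1K by (rule mult_left_mono) simp
    finally have D: "norm (h (\<tau> v) - h (\<tau> u) - (\<tau> v - \<tau> u)) \<le> norm (v - u) * (e / 2)" using A by linarith
    have B': "norm (h (\<tau> v) - h (\<tau> u) - E (v - u)) \<le> norm (v - u) * (e / 2)"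
      using B mult_right_mono[OF e2(3), of "norm (v - u)"] by (simp add: mult.commute)
    have "norm (\<tau> v - \<tau> u - E (v - u)) = norm ((h (\<tau> v) - h (\<tau> u) - E (v - u)) - (h (\<tau> v) - h (\<tau> u) - (\<tau> v - \<tau> u)))"
      by (simp add: algebra_simps)
    also have "\<dots> \<le> norm (v - u) * (e / 2) + norm (v - u) * (e / 2)"
      using norm_triangle_ineq4 B' D by (meson add_mono order_trans)
    finally show "norm (\<tau> v - \<tau> u - E (v - u)) \<le> e * norm (v - u)" by (simp add: algebra_simps)
  qed
qed

locale two_params = P1: param M S V1 \<psi>1 + P2: param M S V2 \<psi>2
  for M :: "'a::{t2_space,second_countable_topology} spacetime" and S
    and V1 V2 :: "(real^'k) set" and \<psi>1 \<psi>2
begin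

definition \<tau> where "\<tau> = inv_into V1 \<psi>1 \<circ> \<psi>2"
definition W where "W = {u\<in>V2. \<psi>2 u \<in> \<psi>1 ` V1}"

lemma openW: "open W"
proof -
  obtain Z where Z: "open Z" "\<psi>1 ` V1 = S \<inter> Z"
    using P1.lp unfolding local_param_def by (metis openin_open)
  have "W = {u\<in>V2. \<psi>2 u \<in> Z}" using Z(2) P2.\<psi>S by (auto simp: W_def)
  then show ?thesis using P2.open_preimage[OF Z(1)] by simp
qed

lemma WV: "u \<in> W \<Longrightarrow> u \<in> V2" by (simp add: W_def)

lemma \<tau>: "u \<in> W \<Longrightarrow> \<tau> u \<in> V1" "u \<in> W \<Longrightarrow> \<psi>1 (\<tau> u) = \<psi>2 u"
  unfolding W_def \<tau>_def comp_apply by (blast intro: inv_into_into, blast intro: f_inv_into_f)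

lemma \<tau>_eq: "u1 \<in> V1 \<Longrightarrow> u \<in> V2 \<Longrightarrow> \<psi>1 u1 = \<psi>2 u \<Longrightarrow> \<tau> u = u1"
  unfolding \<tau>_def comp_apply using homeomorphism_apply1[OF P1.homeo, of u1] by simp

lemma inj_\<tau>: "inj_on \<tau> W"
proof (rule inj_onI)
  fix x y assume xy: "x \<in> W" "y \<in> W" "\<tau> x = \<tau> y"
  then have "\<psi>2 x = \<psi>2 y" using \<tau>(2)[of x] \<tau>(2)[of y] by simp
  then show "x = y" using inj_onD[OF P2.inj] WV xy by blast
qed

lemma cont_\<tau>: "continuous_on W \<tau>"
  unfolding \<tau>_def
  by (rule continuous_on_compose[OF continuous_on_subset[OF P2.cont]
        continuous_on_subset[OF homeomorphism_cont2[OF P1.homeo]]]) (auto simp: W_def)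

text \<open>A linear left inverse \<open>A\<close> of the injective derivative of \<open>?F1\<close>
  turns \<open>?F1\<close> into a map with derivative the identity, and its composite with
  \<open>\<tau>\<close> is the differentiable map \<open>A\<close> after \<open>?F2\<close>. So
  \<open>has_derivative_lift\<close> applies; injectivity is inherited from the immersion
  \<open>?F2\<close>.\<close>

lemma exists_J:
  assumes u: "u \<in> W"
  shows "\<exists>J. inj J \<and> (\<tau> has_derivative J) (at u)"
proof -
  define c where "c = chart_at M (\<psi>2 u)"
  have c: "c \<in> charts M" "u \<in> P2.dom c" "\<tau> u \<in> P1.dom c"
    using P1.chart_at P2.dom_chart_at[OF WV[OF u]] P1.dom_chart_at[OF \<tau>(1)[OF u]] \<tau>(2)[OF u] by (auto simp: c_def)
  let ?F1 = "snd c \<circ> \<psi>1" and ?F2 = "snd c \<circ> \<psi>2"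
  have D1: "(?F1 has_derivative fder ?F1 (\<tau> u)) (at (\<tau> u))" by (rule smooth_on_has_derivative[OF P1.smooth_F[OF c(1)] c(3)])
  have D2: "(?F2 has_derivative fder ?F2 u) (at u)" by (rule smooth_on_has_derivative[OF P2.smooth_F[OF c(1)] c(2)])
  obtain A where A: "linear A" "A \<circ> fder ?F1 (\<tau> u) = id"
    using linear_injective_left_inverse[OF has_derivative_linear[OF D1] P1.inj_F[OF c(1,3)]] by blast
  have bA: "bounded_linear A" using A(1) by (simp add: linear_conv_bounded_linear)
  have h: "((\<lambda>x. A (?F1 x)) has_derivative (\<lambda>x. x)) (at (\<tau> u))"
    using bounded_linear.has_derivative[OF bA D1] A(2) by (simp add: fun_eq_iff)
  have "((\<lambda>v. A (?F2 v)) has_derivative (\<lambda>x. A (fder ?F2 u x))) (at u)"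
    by (rule bounded_linear.has_derivative[OF bA D2])
  then have H: "((\<lambda>v. A (?F1 (\<tau> v))) has_derivative (\<lambda>x. A (fder ?F2 u x))) (at u)"
    by (rule has_derivative_transform_within_open[OF _ openW u]) (simp add: \<tau>(2))
  have "isCont \<tau> u" using cont_\<tau> openW u by (simp add: continuous_on_eq_continuous_at)
  from has_derivative_lift[where h="\<lambda>x. A (?F1 x)", OF h this H]
  have J: "(\<tau> has_derivative (\<lambda>x. A (fder ?F2 u x))) (at u)" .
  have "((\<lambda>v. ?F1 (\<tau> v)) has_derivative (\<lambda>x. fder ?F1 (\<tau> u) (A (fder ?F2 u x)))) (at u)"
    by (rule has_derivative_compose[OF J D1])
  then have "(?F2 has_derivative (\<lambda>x. fder ?F1 (\<tau> u) (A (fder ?F2 u x)))) (at u)"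
    by (rule has_derivative_transform_within_open[OF _ openW u]) (simp add: \<tau>(2))
  from has_derivative_unique[OF D2 this] have "fder ?F2 u = (\<lambda>x. fder ?F1 (\<tau> u) (A (fder ?F2 u x)))" .
  then have "inj (\<lambda>x. A (fder ?F2 u x))"
    using P2.inj_F[OF c(1,2)] unfolding inj_def by metis
  with J show ?thesis by blast
qed

lemma J: assumes "u \<in> W" shows "(\<tau> has_derivative fder \<tau> u) (at u)" "inj (fder \<tau> u)" "linear (fder \<tau> u)"
proof -
  obtain J where J: "inj J" "(\<tau> has_derivative J) (at u)" using exists_J[OF assms] by blast
  with fder_eqI[OF J(2)] show "(\<tau> has_derivative fder \<tau> u) (at u)" "inj (fder \<tau> u)" by auto
  then show "linear (fder \<tau> u)" using has_derivative_linear by blast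
qed

lemma has_derivative_\<psi>2:
  assumes u: "u \<in> W" and f: "(f \<circ> \<psi>1) differentiable (at (\<tau> u))"
  shows "((f \<circ> \<psi>2) has_derivative (\<lambda>v. fder (f \<circ> \<psi>1) (\<tau> u) (fder \<tau> u v))) (at u)"
proof -
  have "((\<lambda>v. (f \<circ> \<psi>1) (\<tau> v)) has_derivative (\<lambda>v. fder (f \<circ> \<psi>1) (\<tau> u) (fder \<tau> u v))) (at u)"
    by (rule has_derivative_compose[OF J(1)[OF u]]) (rule f[unfolded frechet_derivative_works])
  then show ?thesis by (rule has_derivative_transform_within_open[OF _ openW u]) (simp add: \<tau>(2))
qed

lemmas fder_\<psi>2 = fder_eqI[OF has_derivative_\<psi>2, THEN fun_cong]

end

section \<open>Surfaces with null normals in a space-time with a tangential Killing field\<close>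

locale killing_surface = spacetime M
  for M :: "'a::{t2_space,second_countable_topology} spacetime" +
  fixes S N :: "'a set" and k l X :: "'a vfield"
  assumes css: "closed_spacelike_surface M S" and nn: "null_normals M S k l"
    and oN: "open N" and SN: "S \<subseteq> N" and kf: "killing_field M N X" and tang: "tangential M S X"

lemma (in killing_surface) S_borel: "S \<in> sets borel"
  using css by (simp add: closed_spacelike_surface_def borel_closed compact_imp_closed)

locale killing_surface_param = killing_surface M S N k l X + param M S V \<psi>
  for M :: "'a::{t2_space,second_countable_topology} spacetime" and S N k l X
    and V :: "(real^2) set" and \<psi>
begin

lemma vector_along_fields: "vector_along (charts M) S k" "vector_along (charts M) S l" "vector_along (charts M) S X"
proof -
  show "vector_along (charts M) S k" "vector_along (charts M) S l"
    using nn unfolding null_normals_def smooth_along_def by blast+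
  have "vector_along (charts M) N X"
    using kf unfolding killing_field_def smooth_vector_field_def by blast
  then show "vector_along (charts M) S X" using SN unfolding vector_along_def by blast
qed

lemma to_chart_at:
  assumes "vector_along (charts M) S Y" "c \<in> charts M" "u \<in> dom c"
  shows "at_pt M Y (\<psi> u) = jacobian c (chart_at M (\<psi> u)) (\<psi> u) *v Y c (\<psi> u)"
proof -
  have "\<psi> u \<in> S \<inter> fst c \<inter> fst (chart_at M (\<psi> u))"
    using assms(3) \<psi>S chart_at(2)[of "\<psi> u"] unfolding dom_def by blast
  then show ?thesis using assms(1,2) chart_at(1)[of "\<psi> u"] unfolding vector_along_def at_pt_def by blast
qed

lemma ip_eq:
  assumes "vector_along (charts M) S Y" "vector_along (charts M) S Z" "c \<in> charts M" "u \<in> dom c"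
  shows "ip M (\<psi> u) (at_pt M Y (\<psi> u)) (at_pt M Z (\<psi> u)) = t3 (metric M c (\<psi> u)) (Y c (\<psi> u)) (Z c (\<psi> u))"
  unfolding to_chart_at[OF assms(1,3,4)] to_chart_at[OF assms(2,3,4)]
  using metric_change[OF assms(3) chart_at(1) _ chart_at(2), of "\<psi> u"] assms(4)
  by (simp add: ip_def t3_def dom_def)

lemma sk: "c \<in> charts M \<Longrightarrow> smooth_on (dom c) (k c \<circ> \<psi>)"
  and sl: "c \<in> charts M \<Longrightarrow> smooth_on (dom c) (l c \<circ> \<psi>)"
  using nn lp unfolding null_normals_def smooth_along_def dom_def by blast+

lemma linF: "c \<in> charts M \<Longrightarrow> u \<in> dom c \<Longrightarrow> linear (fder (snd c \<circ> \<psi>) u)"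
  using has_derivative_linear[OF smooth_on_has_derivative[OF smooth_F]] .

lemma F_expand: "c \<in> charts M \<Longrightarrow> u \<in> dom c \<Longrightarrow> fder (snd c \<circ> \<psi>) u v =
   v $ 1 *\<^sub>R fder (snd c \<circ> \<psi>) u (axis 1 1) + v $ 2 *\<^sub>R fder (snd c \<circ> \<psi>) u (axis 2 1)"
  by (subst axis2_expand) (simp only: linear_add[OF linF] linear_cmul[OF linF])

lemma t3_induced:
  assumes "c \<in> charts M" "u \<in> dom c"
  shows "t3 (induced M \<psi> u) v w = t3 (metric M c (\<psi> u)) (fder (snd c \<circ> \<psi>) u v) (fder (snd c \<circ> \<psi>) u w)"
  unfolding F_expand[OF assms, of v] F_expand[OF assms, of w]
  by (simp add: t3_sum[of "induced M \<psi> u"] sum_2 induced_eq[OF assms] metric_F[OF assms, simplified] algebra_simps)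

lemma induced_pos: "u \<in> V \<Longrightarrow> w \<noteq> 0 \<Longrightarrow> t3 (induced M \<psi> u) w w > 0"
  using css lp unfolding closed_spacelike_surface_def t3_def by blast

lemma tlow_normal:
  assumes "vector_along (charts M) S Y" "c \<in> charts M" "u \<in> dom c" "tangent_low M Y \<psi> u = 0"
  shows "t3 (metric M c (\<psi> u)) (Y c (\<psi> u)) (fder (snd c \<circ> \<psi>) u v) = 0"
  unfolding F_expand[OF assms(2,3), of v]
  using tangent_low_eq[where Y=Y, OF assms(2,3) to_chart_at[OF assms(1-3), unfolded at_pt_def]] assms(4) metric_F[OF assms(2,3)]
  by simp

lemma normals:
  assumes c: "c \<in> charts M" and u: "u \<in> dom c"
  defines "g \<equiv> metric M c (\<psi> u)" and "p \<equiv> \<psi> u" and "F \<equiv> fder (snd c \<circ> \<psi>) u"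
  shows "t3 g (k c p) (k c p) = 0" "t3 g (l c p) (l c p) = 0" "t3 g (k c p) (l c p) = -1"
    "t3 g (k c p) (F v) = 0" "t3 g (l c p) (F v) = 0" "t3 g v1 v2 = t3 g v2 v1"
proof -
  have uV: "u \<in> V" "p \<in> S" "p \<in> fst c" using u \<psi>S by (auto simp: dom_def p_def)
  show "t3 g (k c p) (k c p) = 0" "t3 g (l c p) (l c p) = 0" "t3 g (k c p) (l c p) = -1"
    using ip_eq[OF vector_along_fields(1) vector_along_fields(1) c u] ip_eq[OF vector_along_fields(2) vector_along_fields(2) c u] ip_eq[OF vector_along_fields(1) vector_along_fields(2) c u] uV nn
    unfolding null_normals_def g_def p_def by auto
  have "tangent_low M k \<psi> u = 0" "tangent_low M l \<psi> u = 0"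
    using nn lp uV unfolding null_normals_def by blast+
  then show "t3 g (k c p) (F v) = 0" "t3 g (l c p) (F v) = 0"
    using tlow_normal vector_along_fields c u unfolding g_def p_def F_def by blast+
  show "t3 g v1 v2 = t3 g v2 v1"
    using t3_transpose[of g v1 v2] metric_sym[OF c uV(3)] by (simp add: g_def p_def)
qed

lemma det_rows:
  assumes c: "c \<in> charts M" and u: "u \<in> dom c"
  shows "induced M \<psi> u $ 1 $ 1 * induced M \<psi> u $ 2 $ 2 - (induced M \<psi> u $ 1 $ 2)\<^sup>2 =
    - det (metric M c (\<psi> u)) * (det (vector [l c (\<psi> u), k c (\<psi> u), fder (snd c \<circ> \<psi>) u (axis 1 1), fder (snd c \<circ> \<psi>) u (axis 2 1)] :: real^4^4))\<^sup>2"
  unfolding induced_eq[OF c u] metric_F[OF c u]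
  by (rule null_gram_det) (rule normals[OF c u])+

lemma induced_sym: "induced M \<psi> u $ a $ b = induced M \<psi> u $ b $ a"
proof -
  have "ip M (\<psi> u) v w = ip M (\<psi> u) w v" for v w
    using t3_transpose metric_sym[OF chart_at(1) chart_at(2)[of "\<psi> u"]] unfolding ip_def t3_def[symmetric] by metis
  then show ?thesis by (simp add: induced_def)
qed

lemma induced_det: assumes "u \<in> V"
  shows "induced M \<psi> u $ 1 $ 1 * induced M \<psi> u $ 2 $ 2 - (induced M \<psi> u $ 1 $ 2)\<^sup>2 > 0"
    "det (induced M \<psi> u) = induced M \<psi> u $ 1 $ 1 * induced M \<psi> u $ 2 $ 2 - (induced M \<psi> u $ 1 $ 2)\<^sup>2"
proof -
  let ?q = "induced M \<psi> u"
  show "det ?q = ?q $ 1 $ 1 * ?q $ 2 $ 2 - (?q $ 1 $ 2)\<^sup>2"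
    using induced_sym[of u 1 2] by (simp add: det_2 power2_eq_square)
  have p1: "?q $ 1 $ 1 > 0" using induced_pos[OF assms, of "axis 1 1"] by (simp add: t3_nth axis_eq_0_iff)
  let ?w = "(?q $ 1 $ 1) *\<^sub>R axis 2 1 + (- ?q $ 1 $ 2) *\<^sub>R (axis 1 1 :: real^2)"
  have "?w $ 2 = ?q $ 1 $ 1" by simp
  then have "?w \<noteq> 0" using p1 by (metis order_less_irrefl zero_index)
  then have "t3 ?q ?w ?w > 0" by (rule induced_pos[OF assms])
  also have "t3 ?q ?w ?w = ?q $ 1 $ 1 * (?q $ 1 $ 1 * ?q $ 2 $ 2 - (?q $ 1 $ 2)\<^sup>2)"
    using induced_sym[of u 2 1] unfolding t3_linear t3_nth by (simp add: power2_eq_square algebra_simps)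
  finally show "?q $ 1 $ 1 * ?q $ 2 $ 2 - (?q $ 1 $ 2)\<^sup>2 > 0" using p1 by (simp add: zero_less_mult_iff)
qed

lemma det_nz: "c \<in> charts M \<Longrightarrow> u \<in> dom c \<Longrightarrow>
   det (vector [l c (\<psi> u), k c (\<psi> u), fder (snd c \<circ> \<psi>) u (axis 1 1), fder (snd c \<circ> \<psi>) u (axis 2 1)] :: real^4^4) \<noteq> 0"
  using det_rows[of c u] induced_det(1)[of u] by (auto simp: dom_def)

lemma qinv:
  assumes "u \<in> V"
  defines "D \<equiv> det (induced M \<psi> u)"
  shows "matrix_inv (induced M \<psi> u) $ 1 $ 1 = induced M \<psi> u $ 2 $ 2 / D"
    "matrix_inv (induced M \<psi> u) $ 1 $ 2 = - induced M \<psi> u $ 1 $ 2 / D"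
    "matrix_inv (induced M \<psi> u) $ 2 $ 1 = - induced M \<psi> u $ 1 $ 2 / D"
    "matrix_inv (induced M \<psi> u) $ 2 $ 2 = induced M \<psi> u $ 1 $ 1 / D" "D > 0" "invertible (induced M \<psi> u)"
proof -
  show D: "D > 0" using induced_det[OF assms(1)] by (simp add: D_def)
  then show "invertible (induced M \<psi> u)" by (simp add: D_def invertible_det_nz)
  have nz: "induced M \<psi> u $ 1 $ 1 * induced M \<psi> u $ 2 $ 2 - induced M \<psi> u $ 1 $ 2 * induced M \<psi> u $ 2 $ 1 \<noteq> 0"
    using D by (simp add: D_def det_2)
  show "matrix_inv (induced M \<psi> u) $ 1 $ 1 = induced M \<psi> u $ 2 $ 2 / D"
    "matrix_inv (induced M \<psi> u) $ 1 $ 2 = - induced M \<psi> u $ 1 $ 2 / D"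
    "matrix_inv (induced M \<psi> u) $ 2 $ 1 = - induced M \<psi> u $ 1 $ 2 / D"
    "matrix_inv (induced M \<psi> u) $ 2 $ 2 = induced M \<psi> u $ 1 $ 1 / D"
    using matrix_inv_2[OF nz] induced_sym[of u 2 1] by (simp_all add: D_def det_2)
qed

lemma smooth_induced: "smooth_on V (\<lambda>u. induced M \<psi> u $ a $ b)"
proof (rule smooth_on_local)
  fix u assume u: "u \<in> V"
  define c where "c = chart_at M (\<psi> u)"
  have c: "c \<in> charts M" "u \<in> dom c" using chart_at dom_chart_at[OF u] by (auto simp: c_def)
  interpret metric_patch "dom c" "snd c ` fst c" "metric_coords M c" "snd c \<circ> \<psi>" by (rule patch[OF c(1)])
  have "smooth_on (dom c) (\<lambda>u. t3 (metric_coords M c ((snd c \<circ> \<psi>) u)) (fder (snd c \<circ> \<psi>) u (axis a 1)) (fder (snd c \<circ> \<psi>) u (axis b 1)))"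
    by (intro smooth_on_t3 oU smooth_gF smooth_on_fder sF)
  then have "smooth_on (dom c) (\<lambda>u. induced M \<psi> u $ a $ b)"
    by (rule smooth_on_transfer[OF oU]) (rule induced_eq[OF c(1)])
  then show "\<exists>W. open W \<and> u \<in> W \<and> smooth_on W (\<lambda>u. induced M \<psi> u $ a $ b)" using oU c(2) by blast
qed

lemma smooth_X: "c \<in> charts M \<Longrightarrow> smooth_on (snd c ` (fst c \<inter> N)) (X c \<circ> coord_inv c)"
  using kf by (simp add: killing_field_def smooth_vector_field_def)

lemma dom_N: "u \<in> dom c \<Longrightarrow> (snd c \<circ> \<psi>) u \<in> snd c ` (fst c \<inter> N)"
  using \<psi>S SN by (auto simp: dom_def)

lemma X_F: "c \<in> charts M \<Longrightarrow> u \<in> dom c \<Longrightarrow> (X c \<circ> coord_inv c) ((snd c \<circ> \<psi>) u) = X c (\<psi> u)"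
  by (simp add: coord_inv_snd dom_def)

lemma smooth_tlow: "smooth_on V (\<lambda>u. tangent_low M X \<psi> u $ a)"
proof (rule smooth_on_local)
  fix u assume u: "u \<in> V"
  define c where "c = chart_at M (\<psi> u)"
  have c: "c \<in> charts M" "u \<in> dom c" using chart_at dom_chart_at[OF u] by (auto simp: c_def)
  interpret metric_patch "dom c" "snd c ` fst c" "metric_coords M c" "snd c \<circ> \<psi>" by (rule patch[OF c(1)])
  have s: "smooth_on (dom c) (\<lambda>u. t3 (metric_coords M c ((snd c \<circ> \<psi>) u)) ((X c \<circ> coord_inv c) ((snd c \<circ> \<psi>) u)) (fder (snd c \<circ> \<psi>) u (axis a 1)))"
    by (intro smooth_on_t3 oU smooth_gF smooth_on_fder sF smooth_on_compose[OF oU open_chart_image[OF c(1) oN] dom_N sF smooth_X[OF c(1)]])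
  have e: "tangent_low M X \<psi> w $ a = t3 (metric_coords M c ((snd c \<circ> \<psi>) w)) ((X c \<circ> coord_inv c) ((snd c \<circ> \<psi>) w)) (fder (snd c \<circ> \<psi>) w (axis a 1))"
    if "w \<in> dom c" for w
    unfolding X_F[OF c(1) that] by (rule tangent_low_eq[where Y=X, OF c(1) that to_chart_at[OF vector_along_fields(3) c(1) that, unfolded at_pt_def]])
  have "smooth_on (dom c) (\<lambda>u. tangent_low M X \<psi> u $ a)"
    by (rule smooth_on_transfer[OF oU s e])
  then show "\<exists>W. open W \<and> u \<in> W \<and> smooth_on W (\<lambda>u. tangent_low M X \<psi> u $ a)" using oU c(2) by blast
qed

lemma tangent_part_2:
  assumes "u \<in> V"
  shows "tangent_part M Y \<psi> u $ 1 = (induced M \<psi> u $ 2 $ 2 * tangent_low M Y \<psi> u $ 1 - induced M \<psi> u $ 1 $ 2 * tangent_low M Y \<psi> u $ 2) / det (induced M \<psi> u)"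
   "tangent_part M Y \<psi> u $ 2 = (induced M \<psi> u $ 1 $ 1 * tangent_low M Y \<psi> u $ 2 - induced M \<psi> u $ 1 $ 2 * tangent_low M Y \<psi> u $ 1) / det (induced M \<psi> u)"
  unfolding tangent_part_def matrix_vector_mult_def
  by (simp_all add: sum_2 qinv(1-4)[OF assms] diff_divide_distrib)

lemma smooth_T: "smooth_on V (tangent_part M X \<psi>)"
proof -
  have d: "smooth_on V (\<lambda>u. det (induced M \<psi> u))"
    unfolding det_2 by (intro smooth_on_diff smooth_on_mult smooth_induced openV)
  have nz: "det (induced M \<psi> u) \<noteq> 0" if "u \<in> V" for u using qinv(5)[OF that] by simp
  have "smooth_on V (\<lambda>u. ((induced M \<psi> u $ 2 $ 2 * tangent_low M X \<psi> u $ 1 - induced M \<psi> u $ 1 $ 2 * tangent_low M X \<psi> u $ 2) / det (induced M \<psi> u)) *\<^sub>R axis 1 1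
     + ((induced M \<psi> u $ 1 $ 1 * tangent_low M X \<psi> u $ 2 - induced M \<psi> u $ 1 $ 2 * tangent_low M X \<psi> u $ 1) / det (induced M \<psi> u)) *\<^sub>R (axis 2 1 :: real^2))"
    by (intro smooth_on_add smooth_on_scaleR smooth_on_divide smooth_on_diff smooth_on_mult smooth_induced smooth_tlow d openV smooth_on_const)
       (erule nz)+
  moreover have "tangent_part M X \<psi> u = ((induced M \<psi> u $ 2 $ 2 * tangent_low M X \<psi> u $ 1 - induced M \<psi> u $ 1 $ 2 * tangent_low M X \<psi> u $ 2) / det (induced M \<psi> u)) *\<^sub>R axis 1 1
     + ((induced M \<psi> u $ 1 $ 1 * tangent_low M X \<psi> u $ 2 - induced M \<psi> u $ 1 $ 2 * tangent_low M X \<psi> u $ 1) / det (induced M \<psi> u)) *\<^sub>R (axis 2 1 :: real^2)"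
    if "u \<in> V" for u
    using tangent_part_2[OF that] by (subst axis2_expand) simp
  ultimately show ?thesis using smooth_on_cong[OF openV, of "tangent_part M X \<psi>"] by simp
qed

text \<open>On the span of the frame the projection is the identity: lowering \<open>w\<close> and
  raising it again with the induced metric returns \<open>w\<close>. The value in the chosen chart
  is then carried over to \<open>c\<close>.\<close>

lemma X_tangent:
  assumes c: "c \<in> charts M" and u: "u \<in> dom c"
  shows "X c (\<psi> u) = fder (snd c \<circ> \<psi>) u (tangent_part M X \<psi> u)"
proof -
  have uV: "u \<in> V" "\<psi> u \<in> fst c" using u by (auto simp: dom_def)
  define d where "d = chart_at M (\<psi> u)"
  have d: "d \<in> charts M" "u \<in> dom d" "\<psi> u \<in> fst d" using chart_at dom_chart_at[OF uV(1)] by (auto simp: d_def)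
  have "at_pt M X (\<psi> u) \<in> span (range (frame M \<psi> u))"
    using tang lp uV unfolding tangential_def by blast
  also have "range (frame M \<psi> u) = {fder (snd d \<circ> \<psi>) u (axis 1 1), fder (snd d \<circ> \<psi>) u (axis 2 1)}"
    by (auto simp: UNIV_2 frame_eq d_def)
  finally obtain a b where ab: "at_pt M X (\<psi> u) = a *\<^sub>R fder (snd d \<circ> \<psi>) u (axis 1 1) + b *\<^sub>R fder (snd d \<circ> \<psi>) u (axis 2 1)"
    by (auto simp: span_insert algebra_simps elim: span_breakdown_eq[THEN iffD1, elim_format])
  define w :: "real^2" where "w = a *\<^sub>R axis 1 1 + b *\<^sub>R axis 2 1"
  from ab have X: "X d (\<psi> u) = fder (snd d \<circ> \<psi>) u w"
    by (simp add: w_def at_pt_def d_def[symmetric] linear_add[OF linF[OF d(1,2)]] linear_cmul[OF linF[OF d(1,2)]])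
  have "tangent_low M X \<psi> u $ \<alpha> = t3 (metric_coords M d ((snd d \<circ> \<psi>) u)) (X d (\<psi> u)) (fder (snd d \<circ> \<psi>) u (axis \<alpha> 1))" for \<alpha>
    by (rule tangent_low_eq[where Y=X, OF d(1,2) to_chart_at[OF vector_along_fields(3) d(1,2), unfolded at_pt_def]])
  then have "tangent_low M X \<psi> u $ \<alpha> = t3 (induced M \<psi> u) w (axis \<alpha> 1)" for \<alpha>
    unfolding X t3_induced[OF d(1,2)] metric_F[OF d(1,2)] .
  then have "tangent_low M X \<psi> u = induced M \<psi> u *v w"
    using induced_sym[of u 2 1] unfolding vec_eq_iff forall_2 by (simp add: w_def t3_nth matrix_vector_mult_def sum_2 algebra_simps)
  then have "tangent_part M X \<psi> u = w"
    by (simp add: tangent_part_def matrix_vector_mul_assoc matrix_inv[OF qinv(6)[OF uV(1)]])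
  then have "X d (\<psi> u) = fder (snd d \<circ> \<psi>) u (tangent_part M X \<psi> u)" using X by simp
  moreover have "X c (\<psi> u) = jacobian d c (\<psi> u) *v X d (\<psi> u)"
    using vector_along_fields(3) c d uV \<psi>S unfolding vector_along_def by blast
  ultimately show ?thesis using F_change[OF d(1) c d(2) u] by simp
qed

lemma nabla_low_contract:
  assumes c: "c \<in> charts M" and p: "p \<in> fst c" "p \<in> N"
  shows "(\<Sum>a\<in>UNIV. \<Sum>b\<in>UNIV. nabla_low M X c p a b * v $ a * w $ b) =
      t3 (metric_coords M c (snd c p)) w (fder (X c \<circ> coord_inv c) (snd c p) v) + gam (metric_coords M c) (snd c p) w v (X c p)"
proof -
  note P = patch[OF c]
  have y: "snd c p \<in> snd c ` (fst c \<inter> N)" "snd c p \<in> snd c ` fst c" using p by blast+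
  have "(\<Sum>a\<in>UNIV. \<Sum>b\<in>UNIV. cov_deriv (metric_coords M c) (\<lambda>y. metric_coords M c y *v (X c \<circ> coord_inv c) y) (snd c p) a b * v $ a * w $ b) =
      t3 (metric_coords M c (snd c p)) w (fder (X c \<circ> coord_inv c) (snd c p) v) + gam (metric_coords M c) (snd c p) w v ((X c \<circ> coord_inv c) (snd c p))"
  proof (rule cov_deriv_contract)
    show "metric_coords M c differentiable (at (snd c p))"
      using smooth_on_has_derivative[OF smooth_metric[OF c] y(2)] unfolding differentiable_def by blast
    show "(X c \<circ> coord_inv c) differentiable (at (snd c p))"
      using smooth_on_has_derivative[OF smooth_X[OF c] y(1)] unfolding differentiable_def by blast
    show "invertible (metric_coords M c (snd c p))"
      unfolding metric_coords_eq[OF c p(1)] by (rule invertible_metric[OF c p(1)])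
    show "transpose (metric_coords M c (snd c p)) = metric_coords M c (snd c p)" by (rule metric_patch.gsym[OF P y(2)])
    show "\<And>a v w. t3 (fder (metric_coords M c) (snd c p) a) v w = t3 (fder (metric_coords M c) (snd c p) a) w v"
      by (rule metric_patch.t3g'_sym[OF P y(2)])
  qed
  then show ?thesis unfolding nabla_low_def comp_def coord_inv_snd[OF c p(1)] .
qed

text \<open>Symmetrizing \<nabla>_a X_b adds two \<open>gam\<close> terms whose sum is the
  derivative of the metric along \<open>X\<close>. This turns the covariant Killing equation into
  L_X g = 0.\<close>

lemma killing_eq:
  assumes c: "c \<in> charts M" and x: "x \<in> snd c ` (fst c \<inter> N)"
  shows "t3 (fder (metric_coords M c) x ((X c \<circ> coord_inv c) x)) v w + t3 (metric_coords M c x) (fder (X c \<circ> coord_inv c) x v) w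
    + t3 (metric_coords M c x) v (fder (X c \<circ> coord_inv c) x w) = 0"
proof -
  note P = patch[OF c]
  from x obtain p where p: "p \<in> fst c" "p \<in> N" "x = snd c p" by blast
  have xQ: "x \<in> snd c ` fst c" using x by blast
  have K: "nabla_low M X c p a b + nabla_low M X c p b a = 0" for a b
    using kf c p(1,2) unfolding killing_field_def by blast
  have anti: "nabla_low M X c p a b = - nabla_low M X c p b a" for a b using K[of a b] by linarith
  have "(\<Sum>a\<in>UNIV. \<Sum>b\<in>UNIV. nabla_low M X c p a b * v $ a * w $ b) = (\<Sum>a\<in>UNIV. \<Sum>b\<in>UNIV. - (nabla_low M X c p b a * v $ a * w $ b))"
    by (intro sum.cong refl, subst anti, simp)
  also have "\<dots> = - (\<Sum>a\<in>UNIV. \<Sum>b\<in>UNIV. nabla_low M X c p b a * v $ a * w $ b)"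
    by (simp only: sum_negf)
  also have "(\<Sum>a\<in>UNIV. \<Sum>b\<in>UNIV. nabla_low M X c p b a * v $ a * w $ b) = (\<Sum>a\<in>UNIV. \<Sum>b\<in>UNIV. nabla_low M X c p a b * w $ a * v $ b)"
    by (subst sum.swap) (simp add: mult_ac)
  finally have "t3 (metric_coords M c x) w (fder (X c \<circ> coord_inv c) x v) + gam (metric_coords M c) x w v (X c p)
     = - (t3 (metric_coords M c x) v (fder (X c \<circ> coord_inv c) x w) + gam (metric_coords M c) x v w (X c p))"
    unfolding nabla_low_contract[OF c p(1,2)] p(3) .
  moreover have "(X c \<circ> coord_inv c) x = X c p" using coord_inv_snd[OF c p(1)] p(3) by simp
  ultimately show ?thesis
    using metric_patch.t3g_sym[OF P xQ, of w] metric_patch.t3g'_sym[OF P xQ, of v w] metric_patch.t3g'_sym[OF P xQ, of w v]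
      metric_patch.t3g'_sym[OF P xQ, of "X c p" v w]
    unfolding gam_def by (simp add: field_simps)
qed

text \<open>This is the bridge to the coordinate calculus: within each chart the surface, its
  normals and the Killing field form an instance of the local situation studied above.\<close>

lemma horizon_patch_chart:
  assumes c: "c \<in> charts M"
  shows "horizon_patch (dom c) (snd c ` (fst c \<inter> N)) (metric_coords M c) (snd c \<circ> \<psi>) (X c \<circ> coord_inv c)
     (tangent_part M X \<psi>) (k c \<circ> \<psi>) (l c \<circ> \<psi>)"
proof -
  interpret metric_patch "dom c" "snd c ` fst c" "metric_coords M c" "snd c \<circ> \<psi>" by (rule patch[OF c])
  have sub: "snd c ` (fst c \<inter> N) \<subseteq> snd c ` fst c" by auto
  show ?thesis
  proof
    show "open (dom c)" "smooth_on (dom c) (snd c \<circ> \<psi>)" by (fact oU sF)+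
    show "open (snd c ` (fst c \<inter> N))" by (rule open_chart_image[OF c oN])
    show "smooth_on (snd c ` (fst c \<inter> N)) (metric_coords M c)" by (rule smooth_on_subset[OF sg sub])
    show "\<And>u. u \<in> dom c \<Longrightarrow> (snd c \<circ> \<psi>) u \<in> snd c ` (fst c \<inter> N)" by (rule dom_N)
    show "\<And>x. x \<in> snd c ` (fst c \<inter> N) \<Longrightarrow> transpose (metric_coords M c x) = metric_coords M c x" using gsym sub by blast
    show "smooth_on (snd c ` (fst c \<inter> N)) (X c \<circ> coord_inv c)" by (rule smooth_X[OF c])
    show "smooth_on (dom c) (tangent_part M X \<psi>)" by (rule smooth_on_subset[OF smooth_T]) (auto simp: dom_def)
    show "(X c \<circ> coord_inv c) ((snd c \<circ> \<psi>) u) = fder (snd c \<circ> \<psi>) u (tangent_part M X \<psi> u)" if "u \<in> dom c" for u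
      unfolding X_F[OF c that] by (rule X_tangent[OF c that])
    show "\<And>x v w. x \<in> snd c ` (fst c \<inter> N) \<Longrightarrow>
       t3 (fder (metric_coords M c) x ((X c \<circ> coord_inv c) x)) v w +
       t3 (metric_coords M c x) (fder (X c \<circ> coord_inv c) x v) w +
       t3 (metric_coords M c x) v (fder (X c \<circ> coord_inv c) x w) = 0" by (rule killing_eq[OF c])
    show "smooth_on (dom c) (k c \<circ> \<psi>)" "smooth_on (dom c) (l c \<circ> \<psi>)" by (rule sk[OF c] sl[OF c])+
    fix u assume u: "u \<in> dom c"
    note n = normals[OF c u]
    show "t3 (metric_coords M c ((snd c \<circ> \<psi>) u)) ((k c \<circ> \<psi>) u) ((k c \<circ> \<psi>) u) = 0"
      "t3 (metric_coords M c ((snd c \<circ> \<psi>) u)) ((l c \<circ> \<psi>) u) ((l c \<circ> \<psi>) u) = 0"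
      "t3 (metric_coords M c ((snd c \<circ> \<psi>) u)) ((k c \<circ> \<psi>) u) ((l c \<circ> \<psi>) u) = -1"
      unfolding metric_F[OF c u] using n by simp_all
    show "t3 (metric_coords M c ((snd c \<circ> \<psi>) u)) ((k c \<circ> \<psi>) u) (fder (snd c \<circ> \<psi>) u v) = 0"
      "t3 (metric_coords M c ((snd c \<circ> \<psi>) u)) ((l c \<circ> \<psi>) u) (fder (snd c \<circ> \<psi>) u v) = 0" for v
      unfolding metric_F[OF c u] using n by simp_all
    show "v \<noteq> 0 \<Longrightarrow> 0 < t3 (metric_coords M c ((snd c \<circ> \<psi>) u)) (fder (snd c \<circ> \<psi>) u v) (fder (snd c \<circ> \<psi>) u v)" for v
      unfolding metric_F[OF c u] t3_induced[OF c u, symmetric] using induced_pos u by (simp add: dom_def)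
    show "\<exists>a b v. x = a *\<^sub>R (k c \<circ> \<psi>) u + b *\<^sub>R (l c \<circ> \<psi>) u + fder (snd c \<circ> \<psi>) u v" for x
    proof -
      obtain a b e f where x: "x = a *\<^sub>R k c (\<psi> u) + b *\<^sub>R l c (\<psi> u) + (e *\<^sub>R fder (snd c \<circ> \<psi>) u (axis 1 1) + f *\<^sub>R fder (snd c \<circ> \<psi>) u (axis 2 1))"
        using rows_span[OF det_nz[OF c u]] by blast
      have "fder (snd c \<circ> \<psi>) u (vector [e, f]) = e *\<^sub>R fder (snd c \<circ> \<psi>) u (axis 1 1) + f *\<^sub>R fder (snd c \<circ> \<psi>) u (axis 2 1)"
        using F_expand[OF c u, of "vector [e, f]"] by simp
      with x show ?thesis by (metis comp_apply)
    qed
  qed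
qed

end

section \<open>The twist in a null frame\<close>

definition det4 :: "real^4 \<Rightarrow> real^4 \<Rightarrow> real^4 \<Rightarrow> real^4 \<Rightarrow> real" where
  "det4 a b c d = det (vector [a, b, c, d] :: real^4^4)"

lemma det4_swap: "det4 b a c d = - det4 a b c d" "det4 a c b d = - det4 a b c d" "det4 a b d c = - det4 a b c d"
proof -
  have sw: "det (\<chi> i. A $ Transposition.transpose m n i) = - det A" if "m \<noteq> n" for A :: "real^4^4" and m n
    using det_permute_rows[OF permutes_swap_id[of m UNIV n], of A] that by (simp add: sign_swap_id)
  have "(\<chi> i. (vector [a, b, c, d] :: real^4^4) $ Transposition.transpose 1 2 i) = vector [b, a, c, d]"
    "(\<chi> i. (vector [a, b, c, d] :: real^4^4) $ Transposition.transpose 2 3 i) = vector [a, c, b, d]"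
    "(\<chi> i. (vector [a, b, c, d] :: real^4^4) $ Transposition.transpose 3 4 i) = vector [a, b, d, c]"
    by (simp_all add: vec_eq_iff[where 'b=4] forall_4 vector_4' transpose_def)
  then show "det4 b a c d = - det4 a b c d" "det4 a c b d = - det4 a b c d" "det4 a b d c = - det4 a b c d"
    using sw[of 1 2 "vector [a, b, c, d]"] sw[of 2 3 "vector [a, b, c, d]"] sw[of 3 4 "vector [a, b, c, d]"]
    unfolding det4_def by simp_all
qed

lemma det4_linear1: "linear (\<lambda>a. det4 a b c d)"
proof -
  have "(x1 + y1) * C1 - (x2 + y2) * C2 + (x3 + y3) * C3 - (x4 + y4) * C4 =
     (x1 * C1 - x2 * C2 + x3 * C3 - x4 * C4) + (y1 * C1 - y2 * C2 + y3 * C3 - y4 * C4)"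
    for x1 x2 x3 x4 y1 y2 y3 y4 C1 C2 C3 C4 :: real by (simp add: algebra_simps)
  moreover have "r * x1 * C1 - r * x2 * C2 + r * x3 * C3 - r * x4 * C4 = r *\<^sub>R (x1 * C1 - x2 * C2 + x3 * C3 - x4 * C4)"
    for r x1 x2 x3 x4 C1 C2 C3 C4 :: real by (simp add: algebra_simps)
  ultimately show ?thesis
    unfolding det4_def det_4 vector_4' by (intro linearI) (simp_all only: vector_add_component vector_scaleR_component real_scaleR_def)
qed

lemma det4_linear2: "linear (\<lambda>b. det4 a b c d)"
  using linear_compose_neg[OF det4_linear1[of a c d]] unfolding det4_swap(1)[of a] by simp

lemma det4_linear3: "linear (\<lambda>c. det4 a b c d)"
  using linear_compose_neg[OF det4_linear2[of a b d]] unfolding det4_swap(2)[of a b] by simp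

lemma det4_linear4: "linear (\<lambda>d. det4 a b c d)"
  using linear_compose_neg[OF det4_linear3[of a b c]] unfolding det4_swap(3)[of a b c] by simp

lemma det4_same: "det4 a a b c = 0" "det4 a b b c = 0" "det4 a b c c = 0" "det4 a b a c = 0" "det4 a b c b = 0" "det4 a b c a = 0"
proof -
  show 1: "det4 a a b c = 0" "det4 a b b c = 0" "det4 a b c c = 0" for a b c
    using det4_swap(1)[of a a b c] det4_swap(2)[of a b b c] det4_swap(3)[of a b c c] by simp_all
  show 2: "det4 a b a c = 0" "det4 a b c b = 0" for a b c
    using det4_swap(2)[of a b a c] 1 det4_swap(3)[of a b b c] by simp_all
  show "det4 a b c a = 0" using det4_swap(3)[of a b a c] 2 by simp
qed

lemma continuous_on_det: "continuous_on S A \<Longrightarrow> continuous_on S (\<lambda>x. det (A x :: real^'n^'n))"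
  unfolding det_def by (intro continuous_intros)

lemma continuous_on_det4:
  assumes "continuous_on S a" "continuous_on S b" "continuous_on S c" "continuous_on S d"
  shows "continuous_on S (\<lambda>x. det4 (a x) (b x) (c x) (d x))"
proof -
  have "continuous_on S (\<lambda>x. (vector [a x, b x, c x, d x] :: real^4^4) $ i $ j)" for i j
    using exhaust_4[of i] by (elim disjE) (simp_all add: vector_4' assms continuous_on_component)
  then show ?thesis unfolding det4_def det_def by (intro continuous_on_sum continuous_on_mult continuous_on_const continuous_on_prod)
qed

lemma linear_axis_sum: "linear L \<Longrightarrow> L (v :: real^'n) = (\<Sum>m\<in>UNIV. v $ m * (L (axis m 1) :: real))"
  by (subst real_vec_expand[of v]) (simp add: linear_sum linear_cmul)

text \<open>As an alternating form in \<open>v\<close> and \<open>w\<close> that vanishes on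
  \<open>e\<close> and \<open>f\<close>, the left side is a multiple of the area form of the normal
  plane, and g(k, -), g(l, -) are up to sign the coordinates along \<open>l\<close> and
  \<open>k\<close>.\<close>

lemma det_middle_null_frame:
  fixes l k e f :: "real^4" and g :: "real^4^4"
  assumes sy: "\<And>v w. t3 g v w = t3 g w v" and n: "t3 g k k = 0" "t3 g l l = 0" "t3 g k l = -1"
    "t3 g k e = 0" "t3 g k f = 0" "t3 g l e = 0" "t3 g l f = 0"
    and nz: "det4 l k e f \<noteq> 0"
  shows "det4 e v w f =
    det4 l k e f * (t3 g k v * t3 g l w - t3 g l v * t3 g k w)"
proof -
  define m where "m v w = det4 e v w f" for v w
  have lin: "m (x + y) w = m x w + m y w" "m w (x + y) = m w x + m w y"
    "m (r *\<^sub>R x) w = r * m x w" "m w (r *\<^sub>R x) = r * m w x" for x y w r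
    unfolding m_def
    by (simp_all add: linear_add[OF det4_linear2] linear_add[OF det4_linear3] linear_cmul[OF det4_linear2] linear_cmul[OF det4_linear3])
  have z: "m e w = 0" "m w e = 0" "m f w = 0" "m w f = 0" "m w w = 0" for w
    unfolding m_def det4_same by simp_all
  have lk: "m l k = det4 l k e f" "m k l = - det4 l k e f"
    unfolding m_def using det4_swap(1)[of l e k f] det4_swap(2)[of l k e f] det4_swap(2)[of e l k f] by simp_all
  obtain a b c d where v: "v = a *\<^sub>R k + b *\<^sub>R l + (c *\<^sub>R e + d *\<^sub>R f)" using rows_span[OF nz[unfolded det4_def]] by blast
  obtain a' b' c' d' where w: "w = a' *\<^sub>R k + b' *\<^sub>R l + (c' *\<^sub>R e + d' *\<^sub>R f)" using rows_span[OF nz[unfolded det4_def]] by blast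
  have "m v w = (b * a' - a * b') * det4 l k e f"
    unfolding v w lin z lk by (simp add: algebra_simps)
  moreover have "t3 g k v = - b" "t3 g l w = - a'" "t3 g l v = - a" "t3 g k w = - b'"
    unfolding v w using n sy[of l k] by simp_all
  ultimately show ?thesis unfolding m_def by (simp add: algebra_simps)
qed

text \<open>With \<open>e\<close> and \<open>f\<close> in the outer slots, the volume form sees only
  the normal components of the raised matrix. These are taken with the covectors of \<open>k\<close>
  and \<open>l\<close>, which lowers the indices again.\<close>

lemma twist_null_frame:
  fixes l k e f :: "real^4" and g A :: "real^4^4"
  assumes sy: "transpose g = g" and inv: "invertible g" and n: "t3 g k k = 0" "t3 g l l = 0" "t3 g k l = -1"
    "t3 g k e = 0" "t3 g k f = 0" "t3 g l e = 0" "t3 g l f = 0"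
    and nz: "det4 l k e f \<noteq> 0"
  defines "J \<equiv> matrix_inv g"
  shows "(\<Sum>b\<in>UNIV. \<Sum>d\<in>UNIV. (\<Sum>i\<in>UNIV. \<Sum>j\<in>UNIV. J $ b $ i * J $ d $ j * A $ i $ j) * det4 e (axis b 1) (axis d 1) f)
    = (t3 A k l - t3 A l k) * det4 l k e f"
proof -
  have sy': "t3 g v w = t3 g w v" for v w using t3_transpose[of g v w] sy by simp
  have Jg: "J *v (g *v x) = x" for x unfolding J_def by (simp add: matrix_vector_mul_assoc matrix_inv[OF inv])
  have "J ** g = mat 1" "g ** J = mat 1" unfolding J_def by (simp_all add: matrix_inv[OF inv])
  then have "transpose (J ** g) = mat 1" by (simp add: transpose_mat)
  then have "g ** transpose J = mat 1" by (simp add: matrix_transpose_mul sy)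
  from matrix_inv_unique[OF this] have Jt: "transpose J = J" by (simp add: J_def)
  \<comment> \<open>\<open>A\<close> with both indices raised.\<close>
  define B where "B = transpose J ** A ** J"
  have B: "B $ b $ d = (\<Sum>i\<in>UNIV. \<Sum>j\<in>UNIV. J $ b $ i * J $ d $ j * A $ i $ j)" for b d
  proof -
    have "B $ b $ d = (\<Sum>j\<in>UNIV. (\<Sum>i\<in>UNIV. J $ b $ i * A $ i $ j) * J $ j $ d)"
      unfolding B_def Jt by (simp add: matrix_matrix_mult_def)
    also have "\<dots> = (\<Sum>j\<in>UNIV. \<Sum>i\<in>UNIV. J $ b $ i * J $ d $ j * A $ i $ j)"
    proof -
      have "J $ j $ d = J $ d $ j" for j
        using arg_cong[OF Jt, of "\<lambda>A. A $ j $ d"] by (simp add: transpose_def)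
      then show ?thesis by (simp add: sum_distrib_right sum_distrib_left mult_ac)
    qed
    also have "\<dots> = (\<Sum>i\<in>UNIV. \<Sum>j\<in>UNIV. J $ b $ i * J $ d $ j * A $ i $ j)" by (rule sum.swap)
    finally show ?thesis .
  qed
  have ax: "t3 g x (axis b 1) = (g *v x) $ b" for x b
    using sy'[of x "axis b 1"] by (simp add: t3_def inner_axis')
  define \<mu> where "\<mu> = det4 l k e f"
  have m: "det4 e (axis b 1) (axis d 1) f = \<mu> * ((g *v k) $ b * (g *v l) $ d - (g *v l) $ b * (g *v k) $ d)" for b d
    unfolding det_middle_null_frame[OF sy' n nz] ax \<mu>_def ..
  have "(\<Sum>b\<in>UNIV. \<Sum>d\<in>UNIV. B $ b $ d * det4 e (axis b 1) (axis d 1) f) =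
     \<mu> * (t3 B (g *v k) (g *v l) - t3 B (g *v l) (g *v k))"
    unfolding m t3_sum sum_distrib_left right_diff_distrib sum_subtractf by (simp add: mult_ac)
  also have "\<dots> = \<mu> * (t3 A k l - t3 A l k)" unfolding B_def t3_congruence Jg ..
  finally show ?thesis unfolding B \<mu>_def by (simp add: mult.commute)
qed

section \<open>Intrinsic quantities on the surface\<close>

text \<open>The scalar k^a l^b \<nabla>_a X_b in the chosen chart. Its agreement with the value in
  any other chart is \<open>kappa_chart\<close>, for surfaces of nonvanishing expansion.\<close>

definition kappa :: "'a spacetime \<Rightarrow> 'a vfield \<Rightarrow> 'a vfield \<Rightarrow> 'a vfield \<Rightarrow> 'a \<Rightarrow> real" where
  "kappa M k l X p = (\<Sum>a\<in>UNIV. \<Sum>b\<in>UNIV. nabla_low M X (chart_at M p) p a b * at_pt M k p $ a * at_pt M l p $ b)"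

context killing_surface_param begin

lemma om_eq:
  assumes c: "c \<in> charts M" and u: "u \<in> dom c"
  shows "rotational_1form M k l \<psi> u $ \<alpha> = horizon_patch.om (metric_coords M c) (snd c \<circ> \<psi>) (k c \<circ> \<psi>) (l c \<circ> \<psi>) (axis \<alpha> 1) u"
proof -
  define d where "d = chart_at M (\<psi> u)"
  have uV: "u \<in> V" using u by (simp add: dom_def)
  have d: "d \<in> charts M" "u \<in> dom d" using chart_at dom_chart_at[OF uV] by (auto simp: d_def)
  have "rotational_1form M k l \<psi> u $ \<alpha> = - Dcon (metric_coords M d) (snd d \<circ> \<psi>) (\<lambda>_. at_pt M l (\<psi> u)) (k d \<circ> \<psi>) (axis \<alpha> 1) u"
    unfolding rotational_1form_def d_def using nabla_along_Dcon[OF uV] by simp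
  also have "Dcon (metric_coords M d) (snd d \<circ> \<psi>) (\<lambda>_. at_pt M l (\<psi> u)) (k d \<circ> \<psi>) (axis \<alpha> 1) u =
     Dcon (metric_coords M c) (snd c \<circ> \<psi>) (l c \<circ> \<psi>) (k c \<circ> \<psi>) (axis \<alpha> 1) u"
    by (rule Dcon_change[OF c d(1) u d(2) vector_along_fields(1) sk[OF c]])
       (use to_chart_at[OF vector_along_fields(2) c u] in \<open>simp add: d_def\<close>)
  finally show ?thesis unfolding horizon_patch.om_def[OF horizon_patch_chart[OF c]] .
qed

lemma B_eq:
  assumes c: "c \<in> charts M" and u: "u \<in> dom c"
  shows "null_ext M l \<psi> u \<alpha> \<beta> = horizon_patch.B (metric_coords M c) (snd c \<circ> \<psi>) (l c \<circ> \<psi>) (axis \<alpha> 1) (axis \<beta> 1) u"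
proof -
  define d where "d = chart_at M (\<psi> u)"
  have uV: "u \<in> V" using u by (simp add: dom_def)
  have d: "d \<in> charts M" "u \<in> dom d" using chart_at dom_chart_at[OF uV] by (auto simp: d_def)
  have "null_ext M l \<psi> u \<alpha> \<beta> = Dcon (metric_coords M d) (snd d \<circ> \<psi>) (\<lambda>_. frame M \<psi> u \<beta>) (l d \<circ> \<psi>) (axis \<alpha> 1) u"
    unfolding null_ext_def d_def ip_sym[of "\<psi> u" "nabla_along M l \<psi> u \<alpha>"] using nabla_along_Dcon[OF uV] by simp
  also have "\<dots> = Dcon (metric_coords M c) (snd c \<circ> \<psi>) (\<lambda>u. fder (snd c \<circ> \<psi>) u (axis \<beta> 1)) (l c \<circ> \<psi>) (axis \<alpha> 1) u"
    by (rule Dcon_change[OF c d(1) u d(2) vector_along_fields(2) sl[OF c]])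
       (use F_change[OF c d(1) u d(2), of "axis \<beta> 1"] in \<open>simp add: d_def frame_eq\<close>)
  finally show ?thesis unfolding horizon_patch.B_def[OF horizon_patch_chart[OF c]] .
qed

lemma q_eq:
  assumes c: "c \<in> charts M" and u: "u \<in> dom c"
  shows "induced M \<psi> u $ \<alpha> $ \<beta> = horizon_patch.q (metric_coords M c) (snd c \<circ> \<psi>) (axis \<alpha> 1) (axis \<beta> 1) u"
  unfolding horizon_patch.q_def[OF horizon_patch_chart[OF c]] by (rule induced_eq[OF c u])

lemma expansion_2:
  assumes "u \<in> V"
  shows "expansion M Y \<psi> u = (induced M \<psi> u $ 2 $ 2 * null_ext M Y \<psi> u 1 1 + induced M \<psi> u $ 1 $ 1 * null_ext M Y \<psi> u 2 2
      - induced M \<psi> u $ 1 $ 2 * (null_ext M Y \<psi> u 1 2 + null_ext M Y \<psi> u 2 1)) / det (induced M \<psi> u)"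
proof -
  have "D > 0 \<Longrightarrow> q22 / D * n11 + (- q12) / D * n12 + ((- q12) / D * n21 + q11 / D * n22) = (q22 * n11 + q11 * n22 - q12 * (n12 + n21)) / D"
    for D q11 q12 q22 n11 n12 n21 n22 :: real by (simp add: field_simps)
  from this[OF qinv(5)[OF assms]] show ?thesis
    unfolding expansion_def sum_2 qinv(1-4)[OF assms] .
qed

lemma Th_eq:
  assumes c: "c \<in> charts M" and u: "u \<in> dom c"
  shows "expansion M l \<psi> u = horizon_patch.Th (metric_coords M c) (snd c \<circ> \<psi>) (l c \<circ> \<psi>) u"
proof -
  have uV: "u \<in> V" using u by (simp add: dom_def)
  show ?thesis
    unfolding expansion_2[OF uV] horizon_patch.Th_def[OF horizon_patch_chart[OF c]] induced_det(2)[OF uV] B_eq[OF c u] q_eq[OF c u] ..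
qed

lemma smooth_on_by_charts:
  assumes "\<And>c. c \<in> charts M \<Longrightarrow> smooth_on (dom c) f"
  shows "smooth_on V f"
proof (rule smooth_on_local)
  fix u assume u: "u \<in> V"
  show "\<exists>W. open W \<and> u \<in> W \<and> smooth_on W f"
    using open_dom[OF chart_at(1)[of "\<psi> u"]] dom_chart_at[OF u] assms[OF chart_at(1)] by blast
qed

lemma smooth_r: "smooth_on V (\<lambda>u. rotational_1form M k l \<psi> u $ \<alpha>)"
proof (rule smooth_on_by_charts)
  fix c assume c: "c \<in> charts M"
  show "smooth_on (dom c) (\<lambda>u. rotational_1form M k l \<psi> u $ \<alpha>)"
    by (rule smooth_on_transfer[OF open_dom[OF c] horizon_patch.smooth_om[OF horizon_patch_chart[OF c]]]) (rule om_eq[OF c])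
qed

lemma smooth_expansion: "smooth_on V (expansion M l \<psi>)"
proof (rule smooth_on_by_charts)
  fix c assume c: "c \<in> charts M"
  show "smooth_on (dom c) (expansion M l \<psi>)"
    by (rule smooth_on_transfer[OF open_dom[OF c] horizon_patch.smooth_Th[OF horizon_patch_chart[OF c]]]) (rule Th_eq[OF c])
qed

lemma kappa_chart_at:
  assumes u: "u \<in> V"
  defines "c \<equiv> chart_at M (\<psi> u)"
  shows "kappa M k l X (\<psi> u) = horizon_patch.kap (metric_coords M c) (snd c \<circ> \<psi>) (X c \<circ> coord_inv c) (k c \<circ> \<psi>) (l c \<circ> \<psi>) u"
proof -
  have c: "c \<in> charts M" "\<psi> u \<in> fst c" "\<psi> u \<in> N" "u \<in> dom c" using chart_at dom_chart_at[OF u] \<psi>S[OF u] SN by (auto simp: c_def)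
  show ?thesis
    unfolding kappa_def at_pt_def c_def[symmetric] nabla_low_contract[OF c(1-3)] horizon_patch.kap_def[OF horizon_patch_chart[OF c(1)]]
    using X_F[OF c(1,4)] by simp
qed

text \<open>The atlas is oriented: as the Jacobian determinant is positive, it leaves the square
  root without an absolute value and compensates the change of the determinant of the four
  vectors.\<close>

lemma area_form_chart:
  assumes c: "c \<in> charts M" and u: "u \<in> dom c"
  shows "area_form M k l \<psi> u \<alpha> \<beta> = vol_form M c (\<psi> u) (l c (\<psi> u)) (k c (\<psi> u)) (fder (snd c \<circ> \<psi>) u (axis \<alpha> 1)) (fder (snd c \<circ> \<psi>) u (axis \<beta> 1))"
proof -
  define d where "d = chart_at M (\<psi> u)"
  have uV: "u \<in> V" "\<psi> u \<in> fst c" using u by (simp_all add: dom_def)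
  have d: "d \<in> charts M" "u \<in> dom d" "\<psi> u \<in> fst d" using chart_at dom_chart_at[OF uV(1)] by (auto simp: d_def)
  define J where "J = jacobian c d (\<psi> u)"
  have J: "det J > 0" unfolding J_def by (rule det_jacobian[OF c d(1) uV(2) d(3)])
  have g: "det (metric M c (\<psi> u)) = det (metric M d (\<psi> u)) * (det J)\<^sup>2"
  proof -
    have "metric M c (\<psi> u) = transpose J ** metric M d (\<psi> u) ** J"
      using lorentz c d uV unfolding lorentz_metric_def J_def by blast
    then show ?thesis by (simp add: det_mul power2_eq_square)
  qed
  have v: "det4 (J *v v1) (J *v v2) (J *v v3) (J *v v4) = det J * det4 v1 v2 v3 v4" for v1 v2 v3 v4
  proof -
    have "(vector [J *v v1, J *v v2, J *v v3, J *v v4] :: real^4^4) = vector [v1, v2, v3, v4] ** transpose J"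
      by (simp add: vec_eq_iff forall_4 vector_4' matrix_matrix_mult_def matrix_vector_mult_def transpose_def mult.commute)
    then show ?thesis unfolding det4_def by (simp add: det_mul)
  qed
  have s: "sqrt (- det (metric M c (\<psi> u))) = sqrt (- det (metric M d (\<psi> u))) * det J"
  proof -
    have "- det (metric M c (\<psi> u)) = (- det (metric M d (\<psi> u))) * (det J)\<^sup>2" unfolding g by simp
    then show ?thesis using J by (simp only: real_sqrt_mult real_sqrt_abs abs_of_pos)
  qed
  have "area_form M k l \<psi> u \<alpha> \<beta> = vol_form M d (\<psi> u) (J *v l c (\<psi> u)) (J *v k c (\<psi> u)) (J *v fder (snd c \<circ> \<psi>) u (axis \<alpha> 1)) (J *v fder (snd c \<circ> \<psi>) u (axis \<beta> 1))"
    unfolding area_form_def Let_def to_chart_at[OF vector_along_fields(1) c u] to_chart_at[OF vector_along_fields(2) c u] frame_eq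
    unfolding d_def[symmetric] F_change[OF c d(1) u d(2)] J_def ..
  then show ?thesis unfolding vol_form_def det4_def[symmetric] v s by simp
qed

lemma area_form_antisym: "area_form M k l \<psi> u 2 1 = - area_form M k l \<psi> u 1 2"
   "area_form M k l \<psi> u 1 1 = 0" "area_form M k l \<psi> u 2 2 = 0"
  unfolding area_form_def Let_def vol_form_def det4_def[symmetric] det4_same
  using det4_swap(3)[of _ _ "frame M \<psi> u 1" "frame M \<psi> u 2"] by simp_all

lemma area_form_sq: "u \<in> V \<Longrightarrow> (area_form M k l \<psi> u 1 2)\<^sup>2 = det (induced M \<psi> u)"
proof -
  assume u: "u \<in> V"
  define c where "c = chart_at M (\<psi> u)"
  have c: "c \<in> charts M" "u \<in> dom c" "\<psi> u \<in> fst c" using chart_at dom_chart_at[OF u] by (auto simp: c_def)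
  have "- det (metric M c (\<psi> u)) \<ge> 0" using det_metric[OF c(1,3)] by simp
  then show ?thesis
    unfolding area_form_chart[OF c(1,2)] vol_form_def induced_det(2)[OF u] det_rows[OF c(1,2)] power_mult_distrib by simp
qed

lemma area_form_nz: "u \<in> V \<Longrightarrow> area_form M k l \<psi> u 1 2 \<noteq> 0"
  using area_form_sq qinv(5) by fastforce

lemma continuous_area_form: "continuous_on V (\<lambda>u. area_form M k l \<psi> u 1 2)"
proof -
  have "isCont (\<lambda>u. area_form M k l \<psi> u 1 2) u" if u: "u \<in> V" for u
  proof -
    define c where "c = chart_at M (\<psi> u)"
    have c: "c \<in> charts M" "u \<in> dom c" using chart_at dom_chart_at[OF u] by (auto simp: c_def)
    interpret h: horizon_patch "dom c" "snd c ` (fst c \<inter> N)" "metric_coords M c" "snd c \<circ> \<psi>" "X c \<circ> coord_inv c"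
      "tangent_part M X \<psi>" "k c \<circ> \<psi>" "l c \<circ> \<psi>" by (rule horizon_patch_chart[OF c(1)])
    have cg: "continuous_on (dom c) (\<lambda>u. metric_coords M c ((snd c \<circ> \<psi>) u))" by (rule smooth_on_continuous_on[OF h.smooth_gF])
    have ck: "continuous_on (dom c) (k c \<circ> \<psi>)" "continuous_on (dom c) (l c \<circ> \<psi>)"
      by (rule smooth_on_continuous_on[OF h.sk] smooth_on_continuous_on[OF h.sl])+
    have cF: "continuous_on (dom c) (\<lambda>u. fder (snd c \<circ> \<psi>) u v)" for v
      by (rule smooth_on_continuous_on[OF smooth_on_fder[OF h.sF]])
    have "continuous_on (dom c) (\<lambda>u. sqrt (- det (metric_coords M c ((snd c \<circ> \<psi>) u))) *
       det4 ((l c \<circ> \<psi>) u) ((k c \<circ> \<psi>) u) (fder (snd c \<circ> \<psi>) u (axis 1 1)) (fder (snd c \<circ> \<psi>) u (axis 2 1)))"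
      by (intro continuous_on_mult continuous_on_real_sqrt continuous_on_minus continuous_on_det
          continuous_on_det4 cg ck cF)
    then have "continuous_on (dom c) (\<lambda>u. area_form M k l \<psi> u 1 2)"
      by (rule continuous_on_cong[THEN iffD1, rotated -1]) (simp_all add: area_form_chart[OF c(1)] vol_form_def det4_def metric_F[OF c(1), simplified])
    then show ?thesis using open_dom[OF c(1)] c(2) by (simp add: continuous_on_eq_continuous_at)
  qed
  then show ?thesis by (simp add: continuous_at_imp_continuous_on)
qed

text \<open>Christoffel symbols are symmetric, so the covariant curl equals the coordinate one.
  Raising both indices of the area form divides it by det q, which is its own square.\<close>

lemma rotational_curl_eq:
  assumes u: "u \<in> V"
  shows "rotational_curl M k l \<psi> u = (fder (\<lambda>u. rotational_1form M k l \<psi> u $ 2) u (axis 1 1)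
     - fder (\<lambda>u. rotational_1form M k l \<psi> u $ 1) u (axis 2 1)) / area_form M k l \<psi> u 1 2"
proof -
  have gsym: "(\<lambda>y. induced M \<psi> y $ a $ b) = (\<lambda>y. induced M \<psi> y $ b $ a)" for a b
    by (rule ext) (rule induced_sym)
  have chr: "christoffel (induced M \<psi>) u d 1 2 = christoffel (induced M \<psi>) u d 2 1" for d
    unfolding christoffel_def sum_2 using gsym[of 1 2] by (simp add: algebra_simps)
  define e where "e = area_form M k l \<psi> u 1 2"
  define q11 where "q11 = induced M \<psi> u $ 1 $ 1"
  define q12 where "q12 = induced M \<psi> u $ 1 $ 2"
  define q22 where "q22 = induced M \<psi> u $ 2 $ 2"
  define D where "D = det (induced M \<psi> u)"
  have D: "D = q11 * q22 - q12\<^sup>2" unfolding D_def q11_def q12_def q22_def by (rule induced_det(2)[OF u])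
  have D0: "D > 0" unfolding D_def by (rule qinv(5)[OF u])
  have eD: "e * e = D" using area_form_sq[OF u] by (simp add: e_def D_def power2_eq_square)
  have e0: "e \<noteq> 0" using area_form_nz[OF u] by (simp add: e_def)
  define c12 where "c12 = cov_deriv (induced M \<psi>) (rotational_1form M k l \<psi>) u 1 2"
  define c21 where "c21 = cov_deriv (induced M \<psi>) (rotational_1form M k l \<psi>) u 2 1"
  define c11 where "c11 = cov_deriv (induced M \<psi>) (rotational_1form M k l \<psi>) u 1 1"
  define c22 where "c22 = cov_deriv (induced M \<psi>) (rotational_1form M k l \<psi>) u 2 2"
  have dc: "c12 - c21 = fder (\<lambda>u. rotational_1form M k l \<psi> u $ 2) u (axis 1 1) - fder (\<lambda>u. rotational_1form M k l \<psi> u $ 1) u (axis 2 1)"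
    unfolding c12_def c21_def cov_deriv_def partial_def chr by simp
  have "rotational_curl M k l \<psi> u = (q11 * q22 - q12\<^sup>2) * e / (D * D) * (c12 - c21)"
    unfolding rotational_curl_def Let_def sum_2 qinv(1-4)[OF u] area_form_antisym
    unfolding e_def[symmetric] q11_def[symmetric] q12_def[symmetric] q22_def[symmetric] D_def[symmetric]
      c12_def[symmetric] c21_def[symmetric] c11_def[symmetric] c22_def[symmetric]
    using D0 by (simp add: field_simps power2_eq_square)
  also have "\<dots> = (c12 - c21) / e"
    unfolding D[symmetric] using D0 e0 by (simp add: eD[symmetric])
  finally show ?thesis unfolding dc e_def .
qed

lemma norm_sq_eq:
  assumes u: "u \<in> V"
  shows "norm_sq M X (\<psi> u) = t3 (induced M \<psi> u) (tangent_part M X \<psi> u) (tangent_part M X \<psi> u)"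
proof -
  define c where "c = chart_at M (\<psi> u)"
  have c: "c \<in> charts M" "u \<in> dom c" using chart_at dom_chart_at[OF u] by (auto simp: c_def)
  show ?thesis
    unfolding norm_sq_def ip_eq[OF vector_along_fields(3) vector_along_fields(3) c] X_tangent[OF c] t3_induced[OF c] ..
qed

lemma zeros_iff: assumes u: "u \<in> V" shows "\<psi> u \<in> zeros_on M X S \<longleftrightarrow> tangent_part M X \<psi> u = 0"
proof -
  define c where "c = chart_at M (\<psi> u)"
  have c: "c \<in> charts M" "u \<in> dom c" using chart_at dom_chart_at[OF u] by (auto simp: c_def)
  have "at_pt M X (\<psi> u) = fder (snd c \<circ> \<psi>) u (tangent_part M X \<psi> u)"
    using X_tangent[OF c] by (simp add: at_pt_def c_def)
  moreover have "fder (snd c \<circ> \<psi>) u v = 0 \<longleftrightarrow> v = 0" for v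
    using linear_injective_0[OF linF[OF c]] inj_F[OF c] linear_0[OF linF[OF c]] by blast
  ultimately show ?thesis using \<psi>S[OF u] by (simp add: zeros_on_def)
qed

text \<open>\<open>X\<close> is a combination of \<open>e\<close> and \<open>f\<close>. Whichever of
  them fills the first slot of the volume form drops out of the last, so only its other component
  contributes. The factor 2 comes from the antisymmetry of \<nabla>X in
  \<open>t3 A k l - t3 A l k\<close>.\<close>

lemma twist_tangent_low:
  assumes u: "u \<in> V"
  shows "tangent_low M (twist M X) \<psi> u $ 1 = 2 * kappa M k l X (\<psi> u) * area_form M k l \<psi> u 1 2 * tangent_part M X \<psi> u $ 2"
    "tangent_low M (twist M X) \<psi> u $ 2 = - 2 * kappa M k l X (\<psi> u) * area_form M k l \<psi> u 1 2 * tangent_part M X \<psi> u $ 1"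
proof -
  define p where "p = \<psi> u"
  define c where "c = chart_at M p"
  have c: "c \<in> charts M" "u \<in> dom c" "p \<in> fst c" "p \<in> N"
    using chart_at dom_chart_at[OF u] \<psi>S[OF u] SN by (auto simp: c_def p_def)
  define g where "g = metric M c p"
  define e where "e = fder (snd c \<circ> \<psi>) u (axis 1 1)"
  define f where "f = fder (snd c \<circ> \<psi>) u (axis 2 1)"
  define A where "A = (\<chi> i j. nabla_low M X c p i j)"
  define J where "J = matrix_inv g"
  define s where "s = sqrt (- det g)"
  define T where "T = tangent_part M X \<psi> u"
  have gs: "transpose g = g" unfolding g_def by (rule metric_sym[OF c(1,3)])
  have ginv: "invertible g" unfolding g_def by (rule invertible_metric[OF c(1,3)])
  have gJ: "g *v (J *v x) = x" for x unfolding J_def by (simp add: matrix_vector_mul_assoc matrix_inv[OF ginv])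
  have Xp: "X c p = T $ 1 *\<^sub>R e + T $ 2 *\<^sub>R f"
    unfolding p_def X_tangent[OF c(1,2)] T_def[symmetric] e_def f_def by (rule F_expand[OF c(1,2)])
  note n = normals[OF c(1,2), folded p_def, folded g_def]
  have tw: "(\<Sum>b\<in>UNIV. \<Sum>d\<in>UNIV. (\<Sum>i\<in>UNIV. \<Sum>j\<in>UNIV. J $ b $ i * J $ d $ j * A $ i $ j) * det4 e (axis b 1) (axis d 1) f)
    = (t3 A (k c p) (l c p) - t3 A (l c p) (k c p)) * det4 (l c p) (k c p) e f"
    unfolding J_def
    by (rule twist_null_frame[OF gs ginv n(1-3)]) (use n det_nz[OF c(1,2)] in \<open>simp_all add: e_def f_def p_def det4_def\<close>)
  have anti: "A $ i $ j = - A $ j $ i" for i j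
  proof -
    have "nabla_low M X c p i j + nabla_low M X c p j i = 0"
      using kf c unfolding killing_field_def by blast
    then show ?thesis unfolding A_def by simp
  qed
  have "t3 A (l c p) (k c p) = t3 (transpose A) (k c p) (l c p)" by (rule t3_transpose[symmetric])
  also have "transpose A = - A"
    unfolding vec_eq_iff
  proof (intro allI)
    fix i j show "transpose A $ i $ j = (- A) $ i $ j" using anti[of j i] by (simp add: transpose_def)
  qed
  finally have tA: "t3 A (l c p) (k c p) = - t3 A (k c p) (l c p)" by simp
  have kap: "t3 A (k c p) (l c p) = kappa M k l X p"
    unfolding t3_sum kappa_def at_pt_def c_def[symmetric] A_def by simp
  have low: "ip M p (at_pt M (twist M X) p) w = w \<bullet> twist_low M X c p" for w
    unfolding ip_def at_pt_def c_def[symmetric] twist_def g_def[symmetric] J_def[symmetric]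
    using t3_transpose[of g w "J *v twist_low M X c p"] gs gJ by (simp add: t3_def)
  have contr: "w \<bullet> twist_low M X c p = s * (\<Sum>b\<in>UNIV. \<Sum>d\<in>UNIV. (\<Sum>i\<in>UNIV. \<Sum>j\<in>UNIV. J $ b $ i * J $ d $ j * A $ i $ j)
      * det4 w (axis b 1) (axis d 1) (X c p))" for w
  proof -
    have d: "(\<Sum>a\<in>UNIV. w $ a * det4 (axis a 1) x y z) = det4 w x y z" for x y z :: "real^4"
      by (rule linear_axis_sum[OF det4_linear1, symmetric])
    have "w \<bullet> twist_low M X c p = (\<Sum>a\<in>UNIV. \<Sum>b\<in>UNIV. \<Sum>d\<in>UNIV. s * ((\<Sum>i\<in>UNIV. \<Sum>j\<in>UNIV. J $ b $ i * J $ d $ j * A $ i $ j)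
      * (w $ a * det4 (axis a 1) (axis b 1) (axis d 1) (X c p))))"
      unfolding twist_low_def Let_def vol_form_def det4_def[symmetric] g_def[symmetric] J_def[symmetric] s_def[symmetric] inner_vec_def
      by (simp add: A_def sum_distrib_left mult_ac)
    also have "\<dots> = (\<Sum>b\<in>UNIV. \<Sum>d\<in>UNIV. \<Sum>a\<in>UNIV. s * ((\<Sum>i\<in>UNIV. \<Sum>j\<in>UNIV. J $ b $ i * J $ d $ j * A $ i $ j)
      * (w $ a * det4 (axis a 1) (axis b 1) (axis d 1) (X c p))))"
      by (rule sum_rotate3[symmetric])
    also have "\<dots> = s * (\<Sum>b\<in>UNIV. \<Sum>d\<in>UNIV. (\<Sum>i\<in>UNIV. \<Sum>j\<in>UNIV. J $ b $ i * J $ d $ j * A $ i $ j)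
      * (\<Sum>a\<in>UNIV. w $ a * det4 (axis a 1) (axis b 1) (axis d 1) (X c p)))"
      by (simp only: sum_distrib_left)
    finally show ?thesis unfolding d .
  qed
  have de: "det4 e x y (X c p) = T $ 2 * det4 e x y f" for x y
    unfolding Xp by (simp add: linear_add[OF det4_linear4] linear_cmul[OF det4_linear4] det4_same)
  have df: "det4 f x y (X c p) = - T $ 1 * det4 e x y f" for x y
    unfolding Xp using det4_swap(1)[of e f x y] det4_swap(2)[of e f x y] det4_swap(3)[of e x f y]
      det4_swap(1)[of x f y e] det4_swap(2)[of x f y e] det4_swap(3)[of x y f e] det4_swap(1)[of x e y f] det4_swap(2)[of x e y f]
    by (simp add: linear_add[OF det4_linear4] linear_cmul[OF det4_linear4] det4_same)
  have af: "area_form M k l \<psi> u 1 2 = s * det4 (l c p) (k c p) e f"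
    unfolding area_form_chart[OF c(1,2)] vol_form_def det4_def s_def g_def e_def f_def p_def ..
  have 1: "e \<bullet> twist_low M X c p = 2 * kappa M k l X p * area_form M k l \<psi> u 1 2 * T $ 2"
  proof -
    have "e \<bullet> twist_low M X c p = s * T $ 2 * (\<Sum>b\<in>UNIV. \<Sum>d\<in>UNIV. (\<Sum>i\<in>UNIV. \<Sum>j\<in>UNIV. J $ b $ i * J $ d $ j * A $ i $ j) * det4 e (axis b 1) (axis d 1) f)"
      unfolding contr de by (simp add: sum_distrib_left mult_ac)
    then show ?thesis unfolding tw tA kap af by (simp add: algebra_simps)
  qed
  have 2: "f \<bullet> twist_low M X c p = - 2 * kappa M k l X p * area_form M k l \<psi> u 1 2 * T $ 1"
  proof -
    have "f \<bullet> twist_low M X c p = - s * T $ 1 * (\<Sum>b\<in>UNIV. \<Sum>d\<in>UNIV. (\<Sum>i\<in>UNIV. \<Sum>j\<in>UNIV. J $ b $ i * J $ d $ j * A $ i $ j) * det4 e (axis b 1) (axis d 1) f)"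
      unfolding contr df by (simp add: sum_distrib_left mult_ac)
    then show ?thesis unfolding tw tA kap af by (simp add: algebra_simps)
  qed
  have fr: "frame M \<psi> u 1 = e" "frame M \<psi> u 2 = f" unfolding frame_eq e_def f_def c_def p_def by simp_all
  show "tangent_low M (twist M X) \<psi> u $ 1 = 2 * kappa M k l X (\<psi> u) * area_form M k l \<psi> u 1 2 * tangent_part M X \<psi> u $ 2"
    "tangent_low M (twist M X) \<psi> u $ 2 = - 2 * kappa M k l X (\<psi> u) * area_form M k l \<psi> u 1 2 * tangent_part M X \<psi> u $ 1"
    using 1 2 unfolding tangent_low_def vec_lambda_beta p_def[symmetric] low fr T_def by simp_all
qed

end

section \<open>Surfaces on which the expansion of \<open>l\<close> vanishes nowhere\<close>

locale horizon_param = killing_surface_param M S N k l X V \<psi>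
  for M :: "'a::{t2_space,second_countable_topology} spacetime" and S N k l X V \<psi> +
  assumes Th_nz: "\<And>u. u \<in> V \<Longrightarrow> expansion M l \<psi> u \<noteq> 0"
begin

abbreviation r where "r \<alpha> \<equiv> (\<lambda>u. rotational_1form M k l \<psi> u $ \<alpha>)"
abbreviation th where "th \<equiv> expansion M l \<psi>"
abbreviation T where "T \<equiv> tangent_part M X \<psi>"

lemma r_T_chart:
  assumes c: "c \<in> charts M" and u: "u \<in> dom c"
  shows "T u $ 1 * r 1 u + T u $ 2 * r 2 u + fder th u (T u) / th u =
    - horizon_patch.kap (metric_coords M c) (snd c \<circ> \<psi>) (X c \<circ> coord_inv c) (k c \<circ> \<psi>) (l c \<circ> \<psi>) u"
proof -
  interpret h: horizon_patch "dom c" "snd c ` (fst c \<inter> N)" "metric_coords M c" "snd c \<circ> \<psi>" "X c \<circ> coord_inv c"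
      "tangent_part M X \<psi>" "k c \<circ> \<psi>" "l c \<circ> \<psi>" by (rule horizon_patch_chart[OF c])
  have uV: "u \<in> V" using u by (simp add: dom_def)
  have "h.om (T u) u = T u $ 1 * h.om (axis 1 1) u + T u $ 2 * h.om (axis 2 1) u"
    by (subst axis2_expand[of "T u"]) (simp only: h.om_lin[OF u])
  moreover have "fder th u = fder h.Th u" by (rule fder_cong_open[OF open_dom[OF c] u Th_eq[OF c]])
  moreover have "h.Th u \<noteq> 0" using Th_nz[OF uV] Th_eq[OF c u] by simp
  ultimately show ?thesis using h.om_Th_T[OF u] unfolding om_eq[OF c u] Th_eq[OF c u] by simp
qed

lemma r_T:
  assumes u: "u \<in> V"
  shows "T u $ 1 * r 1 u + T u $ 2 * r 2 u + fder th u (T u) / th u = - kappa M k l X (\<psi> u)"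
  using r_T_chart[OF chart_at(1) dom_chart_at[OF u]] unfolding kappa_chart_at[OF u] .

text \<open>The other side of \<open>r_T_chart\<close> does not mention the chart, so
  \<open>kap\<close> has the same value in all of them.\<close>

lemma kappa_chart:
  assumes c: "c \<in> charts M" and u: "u \<in> dom c"
  shows "kappa M k l X (\<psi> u) = horizon_patch.kap (metric_coords M c) (snd c \<circ> \<psi>) (X c \<circ> coord_inv c) (k c \<circ> \<psi>) (l c \<circ> \<psi>) u"
  using r_T_chart[OF c u] r_T[of u] u by (simp add: dom_def)

text \<open>This is i_X d\<omega> = d\<kappa>, with d\<omega> written as the curl times the area
  form. Where \<open>T\<close> is nonzero it determines the curl from the function \<kappa> on the
  leaf, which is how \<open>inv_curl\<close> and \<open>curl_zero\<close> use it.\<close>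

lemma d_kappa:
  assumes u: "u \<in> V"
  shows "(kappa M k l X \<circ> \<psi>) differentiable (at u)"
    "fder (kappa M k l X \<circ> \<psi>) u v = rotational_curl M k l \<psi> u * area_form M k l \<psi> u 1 2 * (T u $ 1 * v $ 2 - T u $ 2 * v $ 1)"
proof -
  define c where "c = chart_at M (\<psi> u)"
  have c: "c \<in> charts M" "u \<in> dom c" using chart_at dom_chart_at[OF u] by (auto simp: c_def)
  interpret h: horizon_patch "dom c" "snd c ` (fst c \<inter> N)" "metric_coords M c" "snd c \<circ> \<psi>" "X c \<circ> coord_inv c"
      "tangent_part M X \<psi>" "k c \<circ> \<psi>" "l c \<circ> \<psi>" by (rule horizon_patch_chart[OF c(1)])
  have d: "h.kap differentiable (at u)" using h.has_derivative_kap[OF c(2)] unfolding differentiable_def by blast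
  have eq: "h.kap w = (kappa M k l X \<circ> \<psi>) w" if "w \<in> dom c" for w using kappa_chart[OF c(1) that] by simp
  show dk: "(kappa M k l X \<circ> \<psi>) differentiable (at u)"
    by (rule differentiable_cong_open[OF open_dom[OF c(1)] c(2) eq d])
  have fk: "fder (kappa M k l X \<circ> \<psi>) u = fder h.kap u"
    by (rule fder_cong_open[OF open_dom[OF c(1)] c(2)]) (rule eq[symmetric])
  have fr: "fder (r \<alpha>) u = fder (h.om (axis \<alpha> 1)) u" for \<alpha>
    by (rule fder_cong_open[OF open_dom[OF c(1)] c(2)]) (rule om_eq[OF c(1)])
  have l: "linear (fder (kappa M k l X \<circ> \<psi>) u)"
    using dk by (simp add: frechet_derivative_works has_derivative_linear)
  note l = l[unfolded fk]
  have cu: "fder (h.om (axis 2 1)) u (axis 1 1) - fder (h.om (axis 1 1)) u (axis 2 1) = rotational_curl M k l \<psi> u * area_form M k l \<psi> u 1 2"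
    unfolding rotational_curl_eq[OF u] fr using area_form_nz[OF u] by simp
  show "fder (kappa M k l X \<circ> \<psi>) u v = rotational_curl M k l \<psi> u * area_form M k l \<psi> u 1 2 * (T u $ 1 * v $ 2 - T u $ 2 * v $ 1)"
    unfolding fk by (subst axis2_expand[of v])
       (simp only: linear_add[OF l] linear_cmul[OF l] h.d_om_T[OF c(2)] cu, simp add: algebra_simps)
qed

end

section \<open>Change of variables for nonnegative integrals\<close>

lemma has_real_absolute_integral_change_of_variables:
  fixes f :: "real^'m::{finite,wellorder} \<Rightarrow> real" and g :: "real^'m::_ \<Rightarrow> real^'m::_"
  assumes "S \<in> sets lebesgue" "\<And>x. x \<in> S \<Longrightarrow> (g has_derivative g' x) (at x within S)" "inj_on g S"
  shows "(\<lambda>x. \<bar>det (matrix (g' x))\<bar> * f (g x)) absolutely_integrable_on S \<and>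
           integral S (\<lambda>x. \<bar>det (matrix (g' x))\<bar> * f (g x)) = b
     \<longleftrightarrow> f absolutely_integrable_on (g ` S) \<and> integral (g ` S) f = b"
  using has_absolute_integral_change_of_variables[OF assms, of "\<lambda>x. vec (f x) :: real^1" "vec b"]
  unfolding absolutely_integrable_on_1_iff integral_on_1_eq by simp

text \<open>It translates between nonnegative Lebesgue integrals and the absolutely integrable
  functions for which the change of variables is available; failure of integrability corresponds to
  the value infinity.\<close>

lemma nn_integral_set_nonneg:
  fixes h :: "'a::euclidean_space \<Rightarrow> real"
  assumes m: "(\<lambda>x. indicator S x *\<^sub>R h x) \<in> borel_measurable lebesgue" and p: "\<And>x. x \<in> S \<Longrightarrow> h x \<ge> 0"
  shows "(\<integral>\<^sup>+x. ennreal (h x) * indicator S x \<partial>lebesgue) =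
     (if h absolutely_integrable_on S then ennreal (integral S h) else \<infinity>)"
proof -
  have eq: "(\<integral>\<^sup>+x. ennreal (h x) * indicator S x \<partial>lebesgue) = (\<integral>\<^sup>+x. ennreal (indicator S x *\<^sub>R h x) \<partial>lebesgue)"
    by (intro nn_integral_cong) (simp add: indicator_def)
  have nn: "AE x in lebesgue. 0 \<le> indicator S x *\<^sub>R h x"
    by (intro AE_I2) (simp add: indicator_def p)
  show ?thesis
  proof (cases "h absolutely_integrable_on S")
    case True
    then have i: "integrable lebesgue (\<lambda>x. indicator S x *\<^sub>R h x)" unfolding set_integrable_def .
    have "(\<integral>\<^sup>+x. ennreal (indicator S x *\<^sub>R h x) \<partial>lebesgue) = ennreal (LINT x:S|lebesgue. h x)"
      unfolding set_lebesgue_integral_def by (rule nn_integral_eq_integral[OF i nn])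
    then show ?thesis using eq True set_lebesgue_integral_eq_integral(2)[OF True] by simp
  next
    case False
    have "\<not> (\<integral>\<^sup>+x. ennreal (indicator S x *\<^sub>R h x) \<partial>lebesgue) < \<infinity>"
      using integrableI_nonneg[OF m nn] False unfolding set_integrable_def by blast
    then show ?thesis using eq False by (metis infinity_ennreal_def less_top)
  qed
qed

lemma nn_integral_change_of_variables:
  fixes f :: "real^'m::{finite,wellorder} \<Rightarrow> real" and g :: "real^'m::_ \<Rightarrow> real^'m::_"
  assumes "S \<in> sets lebesgue" "\<And>x. x \<in> S \<Longrightarrow> (g has_derivative g' x) (at x within S)" "inj_on g S"
    and m1: "(\<lambda>x. indicator S x *\<^sub>R (\<bar>det (matrix (g' x))\<bar> * f (g x))) \<in> borel_measurable lebesgue"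
    and m2: "(\<lambda>x. indicator (g ` S) x *\<^sub>R f x) \<in> borel_measurable lebesgue"
    and p: "\<And>x. x \<in> g ` S \<Longrightarrow> f x \<ge> 0"
  shows "(\<integral>\<^sup>+x. ennreal (\<bar>det (matrix (g' x))\<bar> * f (g x)) * indicator S x \<partial>lebesgue) =
    (\<integral>\<^sup>+y. ennreal (f y) * indicator (g ` S) y \<partial>lebesgue)"
proof -
  have p1: "\<And>x. x \<in> S \<Longrightarrow> \<bar>det (matrix (g' x))\<bar> * f (g x) \<ge> 0" using p by simp
  note cv = has_real_absolute_integral_change_of_variables[OF assms(1-3), of f]
  have "(\<integral>\<^sup>+x. ennreal (\<bar>det (matrix (g' x))\<bar> * f (g x)) * indicator S x \<partial>lebesgue) =
    (if (\<lambda>x. \<bar>det (matrix (g' x))\<bar> * f (g x)) absolutely_integrable_on S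
     then ennreal (integral S (\<lambda>x. \<bar>det (matrix (g' x))\<bar> * f (g x))) else \<infinity>)"
    by (rule nn_integral_set_nonneg[OF m1 p1])
  also have "\<dots> = (if f absolutely_integrable_on (g ` S) then ennreal (integral (g ` S) f) else \<infinity>)"
    \<comment> \<open>Taking each of the two integrals for \<open>b\<close> shows that one side is
      integrable if and only if the other is, with equal values.\<close>
    using cv[of "integral (g ` S) f"] cv[of "integral S (\<lambda>x. \<bar>det (matrix (g' x))\<bar> * f (g x))"] by auto
  also have "\<dots> = (\<integral>\<^sup>+y. ennreal (f y) * indicator (g ` S) y \<partial>lebesgue)"
    by (rule nn_integral_set_nonneg[OF m2 p, symmetric])
  finally show ?thesis .
qed

section \<open>The area measure\<close>

abbreviation patch_measure :: "'a::topological_space spacetime \<Rightarrow> (real^2) set \<Rightarrow> (real^2 \<Rightarrow> 'a) \<Rightarrow> 'a measure" where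
  "patch_measure M V \<psi> \<equiv> distr (density (restrict_space lborel V) (\<lambda>u. ennreal (sqrt (det (induced M \<psi> u))))) borel \<psi>"

context killing_surface_param begin

lemma cont_induced: "continuous_on V (\<lambda>u. sqrt (det (induced M \<psi> u)))"
  unfolding det_2
  by (intro continuous_on_real_sqrt continuous_on_diff continuous_on_mult smooth_on_continuous_on[OF smooth_induced])

lemma meas_\<psi>: "\<psi> \<in> measurable (restrict_space lborel V) borel"
  and meas_d: "(\<lambda>u. sqrt (det (induced M \<psi> u))) \<in> borel_measurable (restrict_space lborel V)"
proof -
  have s: "sets (restrict_space lborel V) = sets (restrict_space borel V)" by (simp add: sets_restrict_space)
  show "\<psi> \<in> measurable (restrict_space lborel V) borel"
    unfolding measurable_cong_sets[OF s refl] by (rule borel_measurable_continuous_on_restrict[OF cont])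
  show "(\<lambda>u. sqrt (det (induced M \<psi> u))) \<in> borel_measurable (restrict_space lborel V)"
    unfolding measurable_cong_sets[OF s refl] by (rule borel_measurable_continuous_on_restrict[OF cont_induced])
qed

lemma V_borel: "V \<in> sets borel" using openV by simp

lemma preimage_borel: assumes "A \<in> sets borel" shows "{u\<in>V. \<psi> u \<in> A} \<in> sets borel"
proof -
  have "\<psi> -` A \<inter> space (restrict_space lborel V) \<in> sets (restrict_space lborel V)"
    by (rule measurable_sets[OF meas_\<psi> assms])
  moreover have "\<psi> -` A \<inter> space (restrict_space lborel V) = {u\<in>V. \<psi> u \<in> A}" by (auto simp: space_restrict_space)
  ultimately show ?thesis using V_borel by (simp add: sets_restrict_space_iff)
qed

lemma emeasure_patch:
  assumes A: "A \<in> sets borel"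
  shows "emeasure (patch_measure M V \<psi>) A = (\<integral>\<^sup>+u. ennreal (sqrt (det (induced M \<psi> u))) * indicator {u\<in>V. \<psi> u \<in> A} u \<partial>lborel)"
proof -
  have m: "\<psi> \<in> measurable (density (restrict_space lborel V) (\<lambda>u. ennreal (sqrt (det (induced M \<psi> u))))) borel"
    using meas_\<psi> by simp
  have "emeasure (patch_measure M V \<psi>) A = emeasure (density (restrict_space lborel V) (\<lambda>u. ennreal (sqrt (det (induced M \<psi> u))))) (\<psi> -` A \<inter> space (restrict_space lborel V))"
    using emeasure_distr[OF m A] by simp
  also have "\<dots> = (\<integral>\<^sup>+u. ennreal (sqrt (det (induced M \<psi> u))) * indicator (\<psi> -` A \<inter> space (restrict_space lborel V)) u \<partial>restrict_space lborel V)"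
    using meas_d measurable_sets[OF meas_\<psi> A] by (intro emeasure_density) simp_all
  also have "\<dots> = (\<integral>\<^sup>+u. ennreal (sqrt (det (induced M \<psi> u))) * indicator (\<psi> -` A \<inter> space (restrict_space lborel V)) u * indicator V u \<partial>lborel)"
    using V_borel by (intro nn_integral_restrict_space) simp
  also have "\<dots> = (\<integral>\<^sup>+u. ennreal (sqrt (det (induced M \<psi> u))) * indicator {u\<in>V. \<psi> u \<in> A} u \<partial>lborel)"
    by (intro nn_integral_cong) (auto simp: indicator_def space_restrict_space)
  finally show ?thesis .
qed

lemma image_borel: "\<psi> ` V \<in> sets borel"
proof -
  obtain Z where Z: "open Z" "\<psi> ` V = S \<inter> Z" using lp unfolding local_param_def by (metis openin_open)
  then show ?thesis using S_borel by simp
qed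

end

section \<open>Comparison of the area measures of two parametrizations\<close>

locale two_surface_params = killing_surface M S N k l X +
  K1: killing_surface_param M S N k l X V1 \<psi>1 + K2: killing_surface_param M S N k l X V2 \<psi>2
  for M :: "'a::{t2_space,second_countable_topology} spacetime" and S N k l X V1 \<psi>1 V2 \<psi>2
begin

sublocale two_params M S V1 V2 \<psi>1 \<psi>2 by standard

lemma induced_transform:
  assumes u: "u \<in> W"
  shows "t3 (induced M \<psi>2 u) v w = t3 (induced M \<psi>1 (\<tau> u)) (fder \<tau> u v) (fder \<tau> u w)"
    and frame_transform: "c \<in> charts M \<Longrightarrow> u \<in> K2.dom c \<Longrightarrow> fder (snd c \<circ> \<psi>2) u v = fder (snd c \<circ> \<psi>1) (\<tau> u) (fder \<tau> u v)"
proof -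
  have fr: "fder (snd c \<circ> \<psi>2) u v = fder (snd c \<circ> \<psi>1) (\<tau> u) (fder \<tau> u v)" if c: "c \<in> charts M" "u \<in> K2.dom c" for c v
  proof -
    have "\<tau> u \<in> K1.dom c" using c(2) \<tau>[OF u] by (simp add: K1.dom_def K2.dom_def)
    from smooth_on_has_derivative[OF K1.smooth_F[OF c(1)] this] have "(snd c \<circ> \<psi>1) differentiable (at (\<tau> u))"
      unfolding differentiable_def by blast
    from fder_\<psi>2[OF u this] show ?thesis .
  qed
  then show "c \<in> charts M \<Longrightarrow> u \<in> K2.dom c \<Longrightarrow> fder (snd c \<circ> \<psi>2) u v = fder (snd c \<circ> \<psi>1) (\<tau> u) (fder \<tau> u v)" .
  define c where "c = chart_at M (\<psi>2 u)"
  have c: "c \<in> charts M" "u \<in> K2.dom c" "\<tau> u \<in> K1.dom c"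
    using chart_at K2.dom_chart_at[OF WV[OF u]] K1.dom_chart_at[OF \<tau>(1)[OF u]] \<tau>(2)[OF u] by (auto simp: c_def)
  show "t3 (induced M \<psi>2 u) v w = t3 (induced M \<psi>1 (\<tau> u)) (fder \<tau> u v) (fder \<tau> u w)"
    unfolding K2.t3_induced[OF c(1,2)] K1.t3_induced[OF c(1,3)] fr[OF c(1,2)] \<tau>(2)[OF u] ..
qed

lemma det_induced_transform:
  assumes u: "u \<in> W"
  shows "sqrt (det (induced M \<psi>2 u)) = \<bar>det (matrix (fder \<tau> u))\<bar> * sqrt (det (induced M \<psi>1 (\<tau> u)))"
proof -
  define J where "J = matrix (fder \<tau> u)"
  have J: "fder \<tau> u v = J *v v" for v
    unfolding J_def using fun_cong[OF matrix_vector_mul(2)[OF J(3)[OF u]]] by simp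
  have "induced M \<psi>2 u = transpose J ** induced M \<psi>1 (\<tau> u) ** J"
    unfolding vec_eq_iff t3_nth[symmetric] t3_congruence induced_transform[OF u] J by simp
  then have "det (induced M \<psi>2 u) = (det J)\<^sup>2 * det (induced M \<psi>1 (\<tau> u))" by (simp add: det_mul power2_eq_square)
  then show ?thesis unfolding J_def by (simp only: real_sqrt_mult real_sqrt_abs)
qed

text \<open>Change of variables by \<open>\<tau>\<close> identifies the two measures on the overlap.
  It is an inequality because the second measure does not see the part of \<open>A\<close> outside
  the image of \<open>\<psi>2\<close>; for the supremum of all patch measures this is
  enough.\<close>

lemma patch_measure_le:
  assumes A: "A \<in> sets borel"
    and AP: "A \<subseteq> \<psi>1 ` V1"
  shows "emeasure (patch_measure M V2 \<psi>2) A \<le> emeasure (patch_measure M V1 \<psi>1) A"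
proof -
  define B2 where "B2 = {u\<in>V2. \<psi>2 u \<in> A}"
  define B1 where "B1 = {u\<in>V1. \<psi>1 u \<in> A \<inter> \<psi>2 ` V2}"
  have B2W: "B2 \<subseteq> W" using AP by (auto simp: B2_def W_def)
  have im: "\<tau> ` B2 = B1"
  proof
    show "\<tau> ` B2 \<subseteq> B1"
      using B2W \<tau> WV by (fastforce simp: B1_def B2_def)
    show "B1 \<subseteq> \<tau> ` B2"
    proof
      fix x assume "x \<in> B1"
      then obtain u where u: "u \<in> V2" "\<psi>1 x = \<psi>2 u" "x \<in> V1" "\<psi>1 x \<in> A" by (auto simp: B1_def)
      then have "u \<in> B2" "\<tau> u = x" using \<tau>_eq by (auto simp: B2_def)
      then show "x \<in> \<tau> ` B2" by blast
    qed
  qed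
  have b: "B2 \<in> sets borel" "B1 \<in> sets borel"
    unfolding B1_def B2_def
    by (rule K2.preimage_borel[OF A]) (rule K1.preimage_borel[OF sets.Int[OF A K2.image_borel]])
  have le: "f \<in> borel_measurable lebesgue" if "f \<in> borel_measurable borel" for f :: "real^2 \<Rightarrow> real"
    using that by (simp add: measurable_completion)
  have c2: "continuous_on B2 (\<lambda>u. sqrt (det (induced M \<psi>2 u)))"
    by (rule continuous_on_subset[OF K2.cont_induced]) (auto simp: B2_def)
  have c1: "continuous_on B1 (\<lambda>u. sqrt (det (induced M \<psi>1 u)))"
    by (rule continuous_on_subset[OF K1.cont_induced]) (auto simp: B1_def)
  have eq: "indicator B2 u *\<^sub>R (\<bar>det (matrix (fder \<tau> u))\<bar> * sqrt (det (induced M \<psi>1 (\<tau> u)))) = indicator B2 u *\<^sub>R sqrt (det (induced M \<psi>2 u))" for u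
    using det_induced_transform[of u] B2W by (auto simp: indicator_def)
  have "emeasure (patch_measure M V2 \<psi>2) A = (\<integral>\<^sup>+u. ennreal (sqrt (det (induced M \<psi>2 u))) * indicator B2 u \<partial>lebesgue)"
    unfolding K2.emeasure_patch[OF A] B2_def[symmetric] nn_integral_completion ..
  also have "\<dots> = (\<integral>\<^sup>+u. ennreal (\<bar>det (matrix (fder \<tau> u))\<bar> * sqrt (det (induced M \<psi>1 (\<tau> u)))) * indicator B2 u \<partial>lebesgue)"
    using det_induced_transform B2W by (intro nn_integral_cong) (auto simp: indicator_def)
  also have "\<dots> = (\<integral>\<^sup>+y. ennreal (sqrt (det (induced M \<psi>1 y))) * indicator (\<tau> ` B2) y \<partial>lebesgue)"
  proof (rule nn_integral_change_of_variables)
    show "B2 \<in> sets lebesgue" using b by simp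
    show "\<And>x. x \<in> B2 \<Longrightarrow> (\<tau> has_derivative fder \<tau> x) (at x within B2)"
      using J(1) B2W by (meson has_derivative_at_withinI subsetD)
    show "inj_on \<tau> B2" by (rule inj_on_subset[OF inj_\<tau> B2W])
    show "(\<lambda>x. indicator B2 x *\<^sub>R (\<bar>det (matrix (fder \<tau> x))\<bar> * sqrt (det (induced M \<psi>1 (\<tau> x))))) \<in> borel_measurable lebesgue"
      unfolding eq by (rule le, rule borel_measurable_continuous_on_indicator[OF b(1) c2])
    show "(\<lambda>x. indicator (\<tau> ` B2) x *\<^sub>R sqrt (det (induced M \<psi>1 x))) \<in> borel_measurable lebesgue"
      unfolding im by (rule le, rule borel_measurable_continuous_on_indicator[OF b(2) c1])
    show "0 \<le> sqrt (det (induced M \<psi>1 x))" if "x \<in> \<tau> ` B2" for x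
      using that K1.qinv(5)[of x] unfolding im by (auto simp: B1_def intro: less_imp_le)
  qed
  also have "\<dots> \<le> (\<integral>\<^sup>+y. ennreal (sqrt (det (induced M \<psi>1 y))) * indicator {u\<in>V1. \<psi>1 u \<in> A} y \<partial>lebesgue)"
    unfolding im by (intro nn_integral_mono mult_left_mono) (auto simp: B1_def indicator_def)
  also have "\<dots> = emeasure (patch_measure M V1 \<psi>1) A"
    unfolding K1.emeasure_patch[OF A] nn_integral_completion ..
  finally show ?thesis .
qed

end

lemma sets_sup_borel:
  assumes "sets A = sets C" "sets B = sets C"
  shows "sets (sup A B) = sets C" "sup A B = sup_measure' A B"
  using assms sets_eq_imp_space_eq[OF assms(1)] sets_eq_imp_space_eq[OF assms(2)]
  by (simp_all add: sup_measure_def sup_lexord_def)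

text \<open>A supremum of measures is not formed set by set: different members may dominate on
  different parts of \<open>Y\<close>. Hence the domination is assumed for all measurable subsets of
  \<open>A\<close>, and carried through the induction in that form.\<close>

lemma emeasure_finite_SUP_le:
  assumes "finite J" "J \<noteq> {}" "\<And>j. j \<in> J \<Longrightarrow> sets (m j) = sets C"
    "\<And>j Y. j \<in> J \<Longrightarrow> Y \<in> sets C \<Longrightarrow> Y \<subseteq> A \<Longrightarrow> emeasure (m j) Y \<le> emeasure C Y"
    "Y \<in> sets C" "Y \<subseteq> A"
  shows "sets (SUP j\<in>J. m j) = sets C \<and> emeasure (SUP j\<in>J. m j) Y \<le> emeasure C Y"
  using assms
proof (induction J arbitrary: Y rule: finite_ne_induct)
  case (singleton x)
  then show ?case by simp
next
  case (insert x F)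
  have F: "sets (SUP j\<in>F. m j) = sets C" "\<And>Z. Z \<in> sets C \<Longrightarrow> Z \<subseteq> A \<Longrightarrow> emeasure (SUP j\<in>F. m j) Z \<le> emeasure C Z"
    using insert.IH insert.prems by (auto intro: )
  have x: "sets (m x) = sets C" using insert.prems by simp
  have S: "(SUP j\<in>insert x F. m j) = sup (m x) (SUP j\<in>F. m j)" by simp
  have "emeasure (sup_measure' (m x) (SUP j\<in>F. m j)) Y \<le> emeasure C Y"
    by (rule emeasure_sup_measure'_le2) (use F x insert.prems in auto)
  then show ?case unfolding S sets_sup_borel(2)[OF x F(1)] using sets_sup_borel[OF x F(1)] by simp
qed

context killing_surface begin

lemma param_locale: "local_param M S V \<psi> \<Longrightarrow> killing_surface_param M S N k l X V \<psi>"
  by unfold_locales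

lemma two_locale: assumes "local_param M S V1 \<psi>1" "local_param M S V2 \<psi>2"
  shows "two_surface_params M S N k l X V1 \<psi>1 V2 \<psi>2"
proof -
  interpret K1: killing_surface_param M S N k l X V1 \<psi>1 by (rule param_locale[OF assms(1)])
  interpret K2: killing_surface_param M S N k l X V2 \<psi>2 by (rule param_locale[OF assms(2)])
  show ?thesis by unfold_locales
qed

abbreviation \<mu> where "\<mu> \<equiv> area_measure M S"

text \<open>On the image of \<open>\<psi>\<close> the patch measure of \<open>\<psi>\<close>
  dominates that of every other parametrization by \<open>patch_measure_le\<close>, hence every
  finite supremum, so the supremum is attained there.\<close>

lemma area_measure_patch:
  fixes V :: "(real^2) set" and \<psi> :: "real^2 \<Rightarrow> 'a"
  assumes lp: "local_param M S V \<psi>"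
  shows "sets \<mu> = sets borel"
    and "A \<in> sets borel \<Longrightarrow> A \<subseteq> \<psi> ` V \<Longrightarrow> emeasure \<mu> A = emeasure (patch_measure M V \<psi>) A"
proof -
  let ?I = "{(V, \<psi>). local_param M S V (\<psi> :: real^2 \<Rightarrow> 'a)}"
  let ?m = "\<lambda>x. case x of (V, \<psi>) \<Rightarrow> patch_measure M V \<psi>"
  have mu: "\<mu> = (SUP x\<in>?I. ?m x)" unfolding area_measure_def ..
  have I: "(V, \<psi>) \<in> ?I" using lp by simp
  have s: "\<And>x. x \<in> ?I \<Longrightarrow> sets (?m x) = sets borel" by auto
  show "sets \<mu> = sets borel" unfolding mu
    by (rule sets_SUP) (use s I in auto)
  assume A: "A \<in> sets borel" "A \<subseteq> \<psi> ` V"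
  \<comment> \<open>The supremum of a family of measures is, on each set, the supremum over its
    finite subfamilies.\<close>
  have E: "emeasure \<mu> A = (SUP J\<in>{J. J \<noteq> {} \<and> finite J \<and> J \<subseteq> ?I}. emeasure (SUP x\<in>J. ?m x) A)"
    unfolding mu by (rule emeasure_SUP[where N=borel]) (use s I A in auto)
  show "emeasure \<mu> A = emeasure (patch_measure M V \<psi>) A"
  proof (rule antisym)
    show "emeasure \<mu> A \<le> emeasure (patch_measure M V \<psi>) A"
      unfolding E
    proof (rule SUP_least)
      fix J assume J: "J \<in> {J. J \<noteq> {} \<and> finite J \<and> J \<subseteq> ?I}"
      have "emeasure (?m x) Y \<le> emeasure (patch_measure M V \<psi>) Y" if "x \<in> J" "Y \<in> sets borel" "Y \<subseteq> A" for x Y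
      proof -
        obtain V' \<psi>' where x: "x = (V', \<psi>')" by (cases x)
        have xI: "x \<in> ?I" using that(1) J by blast
        then have lp': "local_param M S V' \<psi>'" unfolding x by simp
        interpret two_surface_params M S N k l X V \<psi> V' \<psi>' by (rule two_locale[OF lp lp'])
        show ?thesis using patch_measure_le[OF that(2)] that(3) A(2) x by auto
      qed
      then show "emeasure (SUP x\<in>J. ?m x) A \<le> emeasure (patch_measure M V \<psi>) A"
        using J s A by (intro emeasure_finite_SUP_le[where A=A, THEN conjunct2]) auto
    qed
    have "emeasure (patch_measure M V \<psi>) A = emeasure (SUP x\<in>{(V, \<psi>)}. ?m x) A" by simp
    also have "\<dots> \<le> emeasure \<mu> A" unfolding E by (rule SUP_upper) (use I in auto)
    finally show "emeasure (patch_measure M V \<psi>) A \<le> emeasure \<mu> A" .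
  qed
qed

section \<open>Finiteness of the area and integrals in a single patch\<close>

lemma ex_param: "p \<in> S \<Longrightarrow> \<exists>V \<psi>. local_param M S V (\<psi> :: real^2 \<Rightarrow> 'a) \<and> p \<in> \<psi> ` V"
  using css unfolding closed_spacelike_surface_def submanifold_def by blast

text \<open>A point has a single preimage under a parametrization. This allows the zeros of
  \<open>X\<close> to be removed from the domain of integration.\<close>

lemma area_point: assumes "p \<in> S" shows "emeasure \<mu> {p} = 0"
proof -
  obtain V \<psi> where L: "local_param M S V (\<psi> :: real^2 \<Rightarrow> 'a)" "p \<in> \<psi> ` V" using ex_param[OF assms] by blast
  interpret killing_surface_param M S N k l X V \<psi> by (rule param_locale[OF L(1)])
  obtain u where u: "u \<in> V" "\<psi> u = p" using L(2) by blast
  have "{w\<in>V. \<psi> w \<in> {p}} = {u}" using u inj by (auto dest: inj_onD)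
  then have "emeasure \<mu> {p} = (\<integral>\<^sup>+w. ennreal (sqrt (det (induced M \<psi> w))) * indicator {u} w \<partial>lborel)"
    using area_measure_patch(2)[OF L(1), of "{p}"] L(2) emeasure_patch[of "{p}"] by simp
  also have "\<dots> = 0"
    by (subst nn_integral_indicator_singleton) simp_all
  finally show ?thesis .
qed

text \<open>By compactness finitely many small patches cover the leaf. Each is the image of a ball
  whose closure stays in the parameter domain, so its area density is bounded.\<close>

lemma area_finite: "emeasure \<mu> S < \<infinity>"
proof (cases "S = {}")
  case True then show ?thesis by simp
next
  case False
  have cS: "compact S" using css by (simp add: closed_spacelike_surface_def)
  have "\<exists>Z. open Z \<and> p \<in> Z \<and> S \<inter> Z \<in> sets borel \<and> emeasure \<mu> (S \<inter> Z) < \<infinity>" if p: "p \<in> S" for p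
  proof -
    obtain V \<psi> where L: "local_param M S V (\<psi> :: real^2 \<Rightarrow> 'a)" "p \<in> \<psi> ` V" using ex_param[OF p] by blast
    interpret killing_surface_param M S N k l X V \<psi> by (rule param_locale[OF L(1)])
    obtain u where u: "u \<in> V" "\<psi> u = p" using L(2) by blast
    obtain e where e: "e > 0" "cball u e \<subseteq> V" using openV u(1) open_contains_cball by blast
    have "openin (top_of_set (\<psi> ` V)) (\<psi> ` ball u e)"
      by (rule homeomorphism_imp_open_map[OF homeo]) (use e ball_subset_cball in \<open>auto intro!: open_openin_trans simp: openin_open_eq[OF openV]\<close>)
    then have "openin (top_of_set S) (\<psi> ` ball u e)"
      using L(1) openin_trans unfolding local_param_def by blast
    then obtain Z where Z: "open Z" "\<psi> ` ball u e = S \<inter> Z" by (metis openin_open)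
    have SZ: "S \<inter> Z \<in> sets borel" using S_borel Z by simp
    have "compact (cball u e)" by simp
    then have "bounded ((\<lambda>u. sqrt (det (induced M \<psi> u))) ` cball u e)"
      by (intro compact_imp_bounded compact_continuous_image continuous_on_subset[OF cont_induced e(2)])
    then obtain K where K: "\<And>w. w \<in> cball u e \<Longrightarrow> norm (sqrt (det (induced M \<psi> w))) \<le> K"
      unfolding bounded_iff by (meson imageI)
    have sub: "{w\<in>V. \<psi> w \<in> S \<inter> Z} \<subseteq> cball u e"
    proof
      fix w assume w: "w \<in> {w\<in>V. \<psi> w \<in> S \<inter> Z}"
      then obtain w' where w': "w' \<in> ball u e" "\<psi> w = \<psi> w'" using Z(2) by blast
      from w'(1) have "w' \<in> V" using e(2) ball_subset_cball by blast
      then have "w = w'" using inj_onD[OF inj, of w w'] w w'(2) by blast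
      then show "w \<in> cball u e" using w'(1) by auto
    qed
    have SZP: "S \<inter> Z \<subseteq> \<psi> ` V" using Z(2) e(2) ball_subset_cball[of u e] by blast
    have "emeasure \<mu> (S \<inter> Z) = (\<integral>\<^sup>+w. ennreal (sqrt (det (induced M \<psi> w))) * indicator {w\<in>V. \<psi> w \<in> S \<inter> Z} w \<partial>lborel)"
      unfolding area_measure_patch(2)[OF L(1) SZ SZP] by (rule emeasure_patch[OF SZ])
    also have "\<dots> \<le> (\<integral>\<^sup>+w. ennreal K * indicator (cball u e) w \<partial>lborel)"
    proof (intro nn_integral_mono)
      fix w
      show "ennreal (sqrt (det (induced M \<psi> w))) * indicator {w\<in>V. \<psi> w \<in> S \<inter> Z} w \<le> ennreal K * indicator (cball u e) w"
      proof (cases "w \<in> {w\<in>V. \<psi> w \<in> S \<inter> Z}")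
        case True
        then have "w \<in> cball u e" using sub by blast
        then show ?thesis using K[of w] True by (simp add: indicator_def ennreal_leI)
      qed simp
    qed
    also have "\<dots> = ennreal K * emeasure lborel (cball u e)" by (rule nn_integral_cmult_indicator) simp
    also have "\<dots> < \<infinity>" using emeasure_bounded_finite[OF bounded_cball, of u e] by (simp add: ennreal_mult_less_top)
    finally show ?thesis using Z u e SZ by (intro exI[of _ Z]) (auto simp: centre_in_ball)
  qed
  then obtain Z where Z: "\<And>p. p \<in> S \<Longrightarrow> open (Z p) \<and> p \<in> Z p \<and> S \<inter> Z p \<in> sets borel \<and> emeasure \<mu> (S \<inter> Z p) < \<infinity>"
    by metis
  obtain C where C: "C \<subseteq> S" "finite C" "S \<subseteq> (\<Union>p\<in>C. Z p)"
    by (rule compactE_image[OF cS, of S Z]) (use Z in auto)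
  obtain V \<psi> where L: "local_param M S V (\<psi> :: real^2 \<Rightarrow> 'a)" using ex_param False by blast
  have s: "sets \<mu> = sets borel" by (rule area_measure_patch(1)[OF L])
  have U: "(\<Union>p\<in>C. S \<inter> Z p) \<in> sets \<mu>"
    by (rule sets.finite_UN[OF C(2)]) (use C Z s in auto)
  have "S \<subseteq> (\<Union>p\<in>C. S \<inter> Z p)" using C(3) by blast
  then have "emeasure \<mu> S \<le> emeasure \<mu> (\<Union>p\<in>C. S \<inter> Z p)" by (rule emeasure_mono[OF _ U])
  also have "\<dots> \<le> (\<Sum>p\<in>C. emeasure \<mu> (S \<inter> Z p))"
    by (rule emeasure_subadditive_finite) (use C Z s in auto)
  also have "\<dots> < \<infinity>" using C Z by (auto simp: less_top[symmetric])
  finally show ?thesis .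
qed

text \<open>An integrand that vanishes on the rest of the leaf sees only the restriction of the area
  measure to the image of \<open>\<psi>\<close>, and there it is the patch measure.\<close>

lemma area_integral_patch:
  fixes f :: "'a \<Rightarrow> real" and V :: "(real^2) set" and \<psi> :: "real^2 \<Rightarrow> 'a"
  assumes lp: "local_param M S V \<psi>" and f: "(\<lambda>p. indicator (\<psi> ` V) p *\<^sub>R f p) \<in> borel_measurable borel"
    and z: "\<And>p. p \<in> S \<Longrightarrow> p \<notin> \<psi> ` V \<Longrightarrow> f p = 0"
  shows "(LINT p:S|\<mu>. f p) = (LINT u:V|lborel. sqrt (det (induced M \<psi> u)) * f (\<psi> u))"
proof -
  interpret killing_surface_param M S N k l X V \<psi> by (rule param_locale[OF lp])
  let ?P = "\<psi> ` V"
  have s: "sets \<mu> = sets borel" by (rule area_measure_patch(1)[OF lp])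
  have sp: "space \<mu> = UNIV" using sets_eq_imp_space_eq[OF s] by simp
  have PS: "?P \<subseteq> S" using \<psi>S by blast
  have "(LINT p:S|\<mu>. f p) = (LINT p|\<mu>. indicator ?P p *\<^sub>R f p)"
    unfolding set_lebesgue_integral_def using PS z by (intro Bochner_Integration.integral_cong) (auto simp: indicator_def)
  also have "\<dots> = (LINT p|restrict_space \<mu> ?P. f p)"
    by (rule integral_restrict_space[symmetric]) (use image_borel s sp in simp)
  also have "restrict_space \<mu> ?P = restrict_space (patch_measure M V \<psi>) ?P"
  proof (rule measure_eqI)
    show "sets (restrict_space \<mu> ?P) = sets (restrict_space (patch_measure M V \<psi>) ?P)"
      using s by (simp add: sets_restrict_space)
    fix A assume "A \<in> sets (restrict_space \<mu> ?P)"
    then have A: "A \<in> sets borel" "A \<subseteq> ?P" using image_borel s sp by (auto simp: sets_restrict_space_iff)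
    show "emeasure (restrict_space \<mu> ?P) A = emeasure (restrict_space (patch_measure M V \<psi>) ?P) A"
      using area_measure_patch(2)[OF lp A] image_borel s sp A(2) by (subst (1 2) emeasure_restrict_space) auto
  qed
  also have "(LINT p|restrict_space (patch_measure M V \<psi>) ?P. f p) = (LINT p|patch_measure M V \<psi>. indicator ?P p *\<^sub>R f p)"
    by (rule integral_restrict_space) (use image_borel in simp)
  also have "\<dots> = (LINT u|density (restrict_space lborel V) (\<lambda>u. ennreal (sqrt (det (induced M \<psi> u)))). indicator ?P (\<psi> u) *\<^sub>R f (\<psi> u))"
    by (rule integral_distr) (use meas_\<psi> f in simp_all)
  also have "\<dots> = (LINT u|restrict_space lborel V. sqrt (det (induced M \<psi> u)) *\<^sub>R (indicator ?P (\<psi> u) *\<^sub>R f (\<psi> u)))"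
  proof (rule integral_density)
    show "(\<lambda>u. indicator ?P (\<psi> u) *\<^sub>R f (\<psi> u)) \<in> borel_measurable (restrict_space lborel V)"
      using measurable_compose[OF meas_\<psi> f] .
    show "AE u in restrict_space lborel V. 0 \<le> sqrt (det (induced M \<psi> u))"
      by (rule AE_I2) (use qinv(5) in \<open>auto simp: space_restrict_space intro: less_imp_le\<close>)
  qed (rule meas_d)
  also have "\<dots> = (LINT u|restrict_space lborel V. sqrt (det (induced M \<psi> u)) * f (\<psi> u))"
    by (intro Bochner_Integration.integral_cong) (auto simp: space_restrict_space)
  also have "\<dots> = (LINT u:V|lborel. sqrt (det (induced M \<psi> u)) * f (\<psi> u))"
    unfolding set_lebesgue_integral_def by (rule integral_restrict_space) (use V_borel in simp)
  finally show ?thesis .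
qed

end

section \<open>Integrals of derivatives\<close>

lemma Ck_on_ident: "Ck_on k U (\<lambda>x. x)" if "open U"
proof (cases k)
  case 0 then show ?thesis by simp
next
  case (Suc j)
  show ?thesis unfolding Suc by (rule Ck_on_SucI[OF that has_derivative_ident]) simp
qed

lemma smooth_on_poly: "smooth_on UNIV (poly (p :: real poly))"
proof (induction p)
  case 0 then show ?case by (simp add: poly_0)
next
  case (pCons a p)
  have "smooth_on UNIV (\<lambda>x. a + x * poly p x)"
    by (intro smooth_on_add smooth_on_mult smooth_on_const pCons.IH open_UNIV smooth_onI Ck_on_ident)
  then show ?case by (simp add: poly_pCons)
qed

lemma fder_eq_0_outside:
  assumes "closed C" "\<And>x. x \<notin> C \<Longrightarrow> f x = 0" "x \<notin> C"
  shows "fder f x v = 0"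
  using fder_cong_open[of "- C" x f "\<lambda>_. 0"] assms by (simp add: open_Compl)

text \<open>The integral of a difference quotient vanishes by translation invariance.\<close>

lemma integral_fder_compact_support:
  fixes f :: "'a::euclidean_space \<Rightarrow> real"
  assumes C1: "Ck_on (Suc 0) UNIV f" and K: "compact K" and z: "\<And>x. x \<notin> K \<Longrightarrow> f x = 0"
  shows "(LINT x|lborel. fder f x v) = 0"
proof -
  define D where "D x = fder f x v" for x
  have cf: "continuous_on UNIV f" using Ck_on_imp_continuous_on[OF C1] .
  have cD: "continuous_on UNIV D" using Ck_on_fder[OF C1, of v] by (simp add: D_def)
  have zD: "D x = 0" if "x \<notin> K" for x
    unfolding D_def by (rule fder_eq_0_outside[OF compact_imp_closed[OF K] z that])
  obtain B0 where B0: "\<And>x. x \<in> K \<Longrightarrow> norm (D x) \<le> B0"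
    using compact_imp_bounded[OF compact_continuous_image[OF continuous_on_subset[OF cD] K]]
    unfolding bounded_iff by (meson imageI subset_UNIV)
  define B where "B = max B0 0"
  have B: "\<bar>D x\<bar> \<le> B" for x using B0[of x] zD[of x] by (cases "x \<in> K") (auto simp: B_def)
  obtain R where R: "\<And>x. x \<in> K \<Longrightarrow> norm x \<le> R" using compact_imp_bounded[OF K] unfolding bounded_iff by blast
  \<comment> \<open>Step sizes tending to 0 from above; the bound 1 confines the supports of all
    difference quotients to one bounded set.\<close>
  define t where "t n = inverse (real (Suc n))" for n
  have t: "t n > 0" "t n \<le> 1" for n by (simp_all add: t_def inverse_le_1_iff)
  define s where "s n x = (f (x + t n *\<^sub>R v) - f x) / t n" for n x
  have line: "((\<lambda>h. f (x + h *\<^sub>R v)) has_real_derivative D (x + h *\<^sub>R v)) (at h)" for x h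
  proof -
    have d: "(f has_derivative fder f (x + h *\<^sub>R v)) (at (x + h *\<^sub>R v))" by (rule Ck_on_has_derivative[OF C1]) simp
    have "((\<lambda>h. f (x + h *\<^sub>R v)) has_derivative (\<lambda>r. fder f (x + h *\<^sub>R v) (r *\<^sub>R v))) (at h)"
      by (rule has_derivative_compose[of "\<lambda>h. x + h *\<^sub>R v", OF _ d]) (auto intro!: derivative_eq_intros)
    then show ?thesis
      unfolding has_field_derivative_def linear_cmul[OF has_derivative_linear[OF d]] D_def
      by (rule has_derivative_eq_rhs) (simp add: fun_eq_iff)
  qed
  have q: "\<bar>s n x\<bar> \<le> B" for n x
  proof -
    obtain h where "f (x + t n *\<^sub>R v) - f (x + 0 *\<^sub>R v) = (t n - 0) * D (x + h *\<^sub>R v)"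
      using MVT2[OF t(1)[of n], of "\<lambda>h. f (x + h *\<^sub>R v)" "\<lambda>h. D (x + h *\<^sub>R v)"] line by auto
    then have "s n x = D (x + h *\<^sub>R v)" using t(1)[of n] by (simp add: s_def)
    then show ?thesis using B by simp
  qed
  \<comment> \<open>The majorant for dominated convergence: difference quotients are values of the
    derivative by the mean value theorem, hence bounded by \<open>B\<close>, and they vanish farther
    than \<open>norm v\<close> from \<open>K\<close>.\<close>
  define w where "w x = B * indicator (cball 0 (R + norm v)) x" for x :: 'a
  have "(\<lambda>n. LINT x|lborel. s n x) \<longlonglongrightarrow> (LINT x|lborel. D x)"
  proof (rule integral_dominated_convergence[where w=w])
    show "D \<in> borel_measurable lborel" using borel_measurable_continuous_onI[OF cD] by simp
    show "s n \<in> borel_measurable lborel" for n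
    proof -
      have "continuous_on UNIV (\<lambda>x. f (x + t n *\<^sub>R v))"
        by (rule continuous_on_compose2[OF cf]) (auto intro!: continuous_intros)
      then have "continuous_on UNIV (s n)" unfolding s_def using cf t(1)[of n]
        by (intro continuous_on_divide continuous_on_diff continuous_on_const) auto
      then show ?thesis using borel_measurable_continuous_onI by simp
    qed
    show "integrable lborel w" unfolding w_def
      using emeasure_bounded_finite[OF bounded_cball, of 0 "R + norm v"]
      by (intro integrable_mult_right integrable_real_indicator) simp_all
    show "AE x in lborel. (\<lambda>n. s n x) \<longlonglongrightarrow> D x"
    proof (rule AE_I2)
      fix x
      have "(\<lambda>h. (f (x + (0 + h) *\<^sub>R v) - f (x + 0 *\<^sub>R v)) / h) \<midarrow>0\<rightarrow> D (x + 0 *\<^sub>R v)"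
        using line[of x 0] unfolding DERIV_def .
      moreover have "filterlim t (at 0) sequentially"
        unfolding filterlim_at using t(1) LIMSEQ_inverse_real_of_nat
        by (auto simp: t_def[abs_def] intro!: always_eventually)
      ultimately have "(\<lambda>n. (f (x + (0 + t n) *\<^sub>R v) - f (x + 0 *\<^sub>R v)) / t n) \<longlonglongrightarrow> D (x + 0 *\<^sub>R v)"
        by (rule filterlim_compose)
      then show "(\<lambda>n. s n x) \<longlonglongrightarrow> D x" by (simp add: s_def)
    qed
    show "AE x in lborel. norm (s n x) \<le> w x" for n
    proof (rule AE_I2)
      fix x
      show "norm (s n x) \<le> w x"
      proof (cases "x \<in> cball 0 (R + norm v)")
        case True then show ?thesis using q by (simp add: w_def)
      next
        case False
        then have n: "norm x > R + norm v" by simp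
        then have "x \<notin> K" using R[of x] norm_ge_zero[of v] by fastforce
        moreover have "x + t n *\<^sub>R v \<notin> K"
        proof
          assume "x + t n *\<^sub>R v \<in> K"
          then have "norm (x + t n *\<^sub>R v) \<le> R" by (rule R)
          moreover have "norm x \<le> norm (x + t n *\<^sub>R v) + norm (t n *\<^sub>R v)"
            using norm_triangle_ineq4[of "x + t n *\<^sub>R v" "t n *\<^sub>R v"] by simp
          moreover have "norm (t n *\<^sub>R v) \<le> norm v" using t[of n] by (simp add: mult_left_le_one_le)
          ultimately show False using n by linarith
        qed
        ultimately show ?thesis using z False by (simp add: s_def w_def)
      qed
    qed
  qed
  moreover have "(LINT x|lborel. s n x) = 0" for n
  proof -
    have fe: "indicator K x *\<^sub>R f x = f x" for x using z by (cases "x \<in> K") auto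
    have "integrable lborel (\<lambda>x. indicator K x *\<^sub>R f x)"
      using borel_integrable_compact[OF K continuous_on_subset[OF cf]] by simp
    then have i: "integrable lborel f" unfolding fe .
    have mt: "(\<lambda>x. t n *\<^sub>R v + x) \<in> borel_measurable lborel" by simp
    have fm: "f \<in> borel_measurable borel" by (rule borel_measurable_continuous_onI[OF cf])
    have d: "distr lborel borel (\<lambda>x. t n *\<^sub>R v + x) = lborel" by (rule lborel_distr_plus)
    have i2: "integrable lborel (\<lambda>x. f (x + t n *\<^sub>R v))"
      using integrable_distr_eq[of "\<lambda>x. t n *\<^sub>R v + x" lborel borel f] i fm d by (simp add: add.commute)
    have e: "(LINT x|lborel. f (x + t n *\<^sub>R v)) = (LINT x|lborel. f x)"
      using integral_distr[of "\<lambda>x. t n *\<^sub>R v + x" lborel borel f] fm d by (simp add: add.commute)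
    show ?thesis unfolding s_def using i i2 e by simp
  qed
  ultimately have "(\<lambda>n::nat. 0) \<longlonglongrightarrow> (LINT x|lborel. D x)" by simp
  then show ?thesis unfolding D_def[symmetric] by (metis LIMSEQ_const_iff)
qed

text \<open>The extension by zero is of class C^1 because \<open>V\<close> and the complement of
  \<open>K\<close> are open, cover the whole space, and carry C^1 functions that agree on the
  overlap.\<close>

lemma integral_fder_open:
  fixes f :: "'a::euclidean_space \<Rightarrow> real"
  assumes V: "open V" and C1: "Ck_on (Suc 0) V f" and K: "compact K" "K \<subseteq> V"
    and z: "\<And>x. x \<in> V \<Longrightarrow> x \<notin> K \<Longrightarrow> f x = 0"
  shows "(LINT x:V|lborel. fder f x v) = 0"
proof -
  define f0 where "f0 x = (if x \<in> V then f x else 0)" for x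
  have oK: "open (- K)" using compact_imp_closed[OF K(1)] by (simp add: open_Compl)
  have "Ck_on (Suc 0) V f0"
    using C1 Ck_on_cong[OF V, of f f0] by (simp add: f0_def del: Ck_on.simps)
  moreover have "Ck_on (Suc 0) (- K) f0"
    using Ck_on_const[of "Suc 0" "- K" "0 :: real"] Ck_on_cong[OF oK, of f0 "\<lambda>_. 0"] z by (simp add: f0_def del: Ck_on.simps)
  ultimately have "Ck_on (Suc 0) (V \<union> - K) f0" by (rule Ck_on_Un[OF V oK])
  moreover have "V \<union> - K = UNIV" using K by blast
  ultimately have C: "Ck_on (Suc 0) UNIV f0" by simp
  have z0: "f0 x = 0" if "x \<notin> K" for x using z that by (simp add: f0_def)
  have "indicator V x *\<^sub>R fder f x v = fder f0 x v" for x
  proof (cases "x \<in> V")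
    case True
    have "fder f x = fder f0 x" by (rule fder_cong_open[OF V True]) (simp add: f0_def)
    then show ?thesis using True by simp
  next
    case False
    then have "x \<notin> K" using K by blast
    then show ?thesis using fder_eq_0_outside[OF compact_imp_closed[OF K(1)] z0] False by simp
  qed
  then show ?thesis
    unfolding set_lebesgue_integral_def using integral_fder_compact_support[OF C K(1) z0] by simp
qed

text \<open>The profile of the bump functions. Stokes' theorem uses only first derivatives of the
  cut-offs, and the squared positive part is a simple C^1 function that vanishes on a
  half-line.\<close>

lemma Ck_on_max_sq: "Ck_on (Suc 0) UNIV (\<lambda>s::real. (max 0 s)\<^sup>2)"
proof (rule Ck_on_SucI[OF open_UNIV])
  fix x :: real
  show "((\<lambda>s. (max 0 s)\<^sup>2) has_derivative (\<lambda>h. 2 * max 0 x * h)) (at x)"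
  proof (cases "x = 0")
    case True
    show ?thesis
      unfolding has_derivative_at_alt
    proof (intro conjI allI impI)
      show "bounded_linear (\<lambda>h. 2 * max 0 x * h)" by (rule bounded_linear_mult_right)
      fix e :: real assume e: "e > 0"
      show "\<exists>d>0. \<forall>y. norm (y - x) < d \<longrightarrow> norm ((max 0 y)\<^sup>2 - (max 0 x)\<^sup>2 - 2 * max 0 x * (y - x)) \<le> e * norm (y - x)"
      proof (intro exI conjI allI impI)
        \<comment> \<open>At 0 the function is at most the square of its argument, so the radius
          \<open>e\<close> itself works.\<close>
        show "e > 0" by (rule e)
        fix y assume y: "norm (y - x) < e"
        have "(max 0 y)\<^sup>2 \<le> \<bar>y\<bar> * \<bar>y\<bar>" by (auto simp: max_def power2_eq_square)
        also have "\<dots> \<le> e * \<bar>y\<bar>" using y True by (intro mult_right_mono) auto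
        finally show "norm ((max 0 y)\<^sup>2 - (max 0 x)\<^sup>2 - 2 * max 0 x * (y - x)) \<le> e * norm (y - x)"
          using True by simp
      qed
    qed
  next
    case False
    show ?thesis
    proof (cases "x > 0")
      case True
      have "((\<lambda>s. s\<^sup>2) has_derivative (\<lambda>h. 2 * max 0 x * h)) (at x)"
        using True by (auto intro!: derivative_eq_intros simp: max_def)
      then show ?thesis
        by (rule has_derivative_transform_within_open[of _ _ _ _ "{0<..}"]) (use True in \<open>auto simp: max_def\<close>)
    next
      case F: False
      have "((\<lambda>s. 0) has_derivative (\<lambda>h. 2 * max 0 x * h)) (at x)"
        using F by (auto intro!: derivative_eq_intros simp: max_def)
      then show ?thesis
        by (rule has_derivative_transform_within_open[of _ _ _ _ "{..<0}"]) (use F False in \<open>auto simp: max_def\<close>)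
    qed
  qed
  show "Ck_on 0 UNIV (\<lambda>x. 2 * max 0 x * v)" for v :: real by (auto intro!: continuous_intros)
qed

section \<open>Bump functions\<close>

context spacetime begin

text \<open>It is defined on the space-time rather than on a patch of the leaf, so that it can be
  pulled back by every parametrization. It vanishes outside the compact preimage of a coordinate
  ball.\<close>

definition bump :: "'a chart \<Rightarrow> real^4 \<Rightarrow> real \<Rightarrow> 'a \<Rightarrow> real" where
  "bump c x r p = (if p \<in> fst c then (max 0 (r\<^sup>2 - (snd c p - x) \<bullet> (snd c p - x)))\<^sup>2 else 0)"

lemma bump_nonneg: "bump c x r p \<ge> 0" by (simp add: bump_def)

lemma bump_zero:
  assumes "c \<in> charts M" "r > 0" "p \<notin> coord_inv c ` cball x r"
  shows "bump c x r p = 0"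
proof (cases "p \<in> fst c")
  case True
  have "snd c p \<notin> cball x r"
    using assms(3) coord_inv_snd[OF assms(1) True] by (metis imageI)
  then have "r < norm (snd c p - x)" by (simp add: dist_norm norm_minus_commute)
  then have "r\<^sup>2 < (norm (snd c p - x))\<^sup>2" using assms(2) by (intro power_strict_mono) auto
  then show ?thesis by (simp add: bump_def max_def power2_norm_eq_inner)
qed (simp add: bump_def)

lemma bump_pos: "p \<in> fst c \<Longrightarrow> r > 0 \<Longrightarrow> snd c p \<in> ball x r \<Longrightarrow> bump c x r p > 0"
proof -
  assume p: "p \<in> fst c" and r: "r > 0" and b: "snd c p \<in> ball x r"
  have "norm (snd c p - x) < r" using b by (simp add: dist_norm norm_minus_commute)
  then have "(norm (snd c p - x))\<^sup>2 < r\<^sup>2" by (intro power_strict_mono) auto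
  then show ?thesis using p by (simp add: bump_def max_def power2_norm_eq_inner)
qed

lemma compact_coord_ball:
  assumes "c \<in> charts M" "cball x r \<subseteq> snd c ` fst c"
  shows "compact (coord_inv c ` cball x r)"
  by (rule compact_continuous_image[OF continuous_on_subset[OF homeomorphism_cont2[OF chart_homeo[OF assms(1)]] assms(2)]]) simp

end

text \<open>The preimage of the closed coordinate ball is compact, hence closed in the Hausdorff
  space-time. Off this set the bump is zero, and in the chart it is an explicit C^1 expression; the
  two open regions cover \<open>V\<close>.\<close>

lemma (in param) Ck_bump:
  assumes c: "c \<in> charts M" and r: "r > 0" and b: "cball x r \<subseteq> snd c ` fst c"
  shows "Ck_on (Suc 0) V (bump c x r \<circ> \<psi>)"
proof -
  let ?K = "coord_inv c ` cball x r"
  have cK: "closed ?K" by (rule compact_imp_closed[OF compact_coord_ball[OF c b]])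
  let ?W = "{u\<in>V. \<psi> u \<in> - ?K}"
  have oW: "open ?W" by (rule open_preimage) (use cK in \<open>simp add: open_Compl\<close>)
  have 1: "Ck_on (Suc 0) ?W (bump c x r \<circ> \<psi>)"
    using Ck_on_cong[OF oW, of "bump c x r \<circ> \<psi>" "\<lambda>_. 0"] bump_zero[OF c r] by (simp del: Ck_on.simps)
  have F: "smooth_on (dom c) (snd c \<circ> \<psi>)" by (rule smooth_F[OF c])
  have s: "Ck_on (Suc 0) (dom c) (\<lambda>u. r\<^sup>2 - ((snd c \<circ> \<psi>) u - x) \<bullet> ((snd c \<circ> \<psi>) u - x))"
    by (rule smooth_on_Ck) (intro smooth_on_diff smooth_on_inner smooth_on_const F open_dom[OF c])
  have "Ck_on (Suc 0) (dom c) (\<lambda>u. (max 0 (r\<^sup>2 - ((snd c \<circ> \<psi>) u - x) \<bullet> ((snd c \<circ> \<psi>) u - x)))\<^sup>2)"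
    by (rule Ck_on_compose[OF open_dom[OF c] open_UNIV UNIV_I s Ck_on_max_sq])
  then have 2: "Ck_on (Suc 0) (dom c) (bump c x r \<circ> \<psi>)"
    by (subst Ck_on_cong[OF open_dom[OF c], where g="\<lambda>u. (max 0 (r\<^sup>2 - ((snd c \<circ> \<psi>) u - x) \<bullet> ((snd c \<circ> \<psi>) u - x)))\<^sup>2"])
       (simp_all add: bump_def dom_def)
  have "?W \<union> dom c = V"
  proof -
    have "?K \<subseteq> fst c"
    proof
      fix p assume "p \<in> ?K"
      then obtain y where "p = coord_inv c y" "y \<in> snd c ` fst c" using b by blast
      then show "p \<in> fst c" by (simp add: inv_into_into)
    qed
    then show ?thesis by (auto simp: dom_def)
  qed
  then show ?thesis using Ck_on_Un[OF oW open_dom[OF c] 1 2] by simp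
qed

section \<open>Invariance under changes of parametrization\<close>

text \<open>The trace of the second fundamental form, paired with \<open>w\<close>. Unlike the
  expansion it involves the normal only through its value at the point, hence linearly; this is what
  allows different null normals to be compared.\<close>

definition normal_trace :: "'a spacetime \<Rightarrow> 'a chart \<Rightarrow> (real^2 \<Rightarrow> 'a) \<Rightarrow> real^2 \<Rightarrow> real^4 \<Rightarrow> real" where
  "normal_trace M c \<psi> u w = - (\<Sum>\<alpha>\<in>UNIV. \<Sum>\<beta>\<in>UNIV. matrix_inv (induced M \<psi> u) $ \<alpha> $ \<beta> *
     Dcon (metric_coords M c) (snd c \<circ> \<psi>) (\<lambda>_. w) (\<lambda>u. fder (snd c \<circ> \<psi>) u (axis \<beta> 1)) (axis \<alpha> 1) u)"

context killing_surface_param begin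

text \<open>Differentiating g(l, e) = 0 for a frame vector e moves the derivative from
  \<open>l\<close> to the frame, up to a sign.\<close>

lemma expansion_normal_trace:
  assumes u: "u \<in> V"
  defines "c \<equiv> chart_at M (\<psi> u)"
  shows "expansion M l \<psi> u = normal_trace M c \<psi> u (l c (\<psi> u))"
proof -
  have c: "c \<in> charts M" "u \<in> dom c" using chart_at dom_chart_at[OF u] by (auto simp: c_def)
  interpret h: horizon_patch "dom c" "snd c ` (fst c \<inter> N)" "metric_coords M c" "snd c \<circ> \<psi>" "X c \<circ> coord_inv c"
      "tangent_part M X \<psi>" "k c \<circ> \<psi>" "l c \<circ> \<psi>" by (rule horizon_patch_chart[OF c(1)])
  have "null_ext M l \<psi> u \<alpha> \<beta> = - Dcon (metric_coords M c) (snd c \<circ> \<psi>) (\<lambda>_. l c (\<psi> u)) (\<lambda>u. fder (snd c \<circ> \<psi>) u (axis \<beta> 1)) (axis \<alpha> 1) u" for \<alpha> \<beta>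
  proof -
    have "fder (\<lambda>u. t3 (metric_coords M c ((snd c \<circ> \<psi>) u)) ((l c \<circ> \<psi>) u) (fder (snd c \<circ> \<psi>) u (axis \<beta> 1))) u (axis \<alpha> 1) = 0"
      by (rule h.fder_const_on[OF c(2)]) (rule h.lF)
    then have "Dcon (metric_coords M c) (snd c \<circ> \<psi>) (l c \<circ> \<psi>) (\<lambda>u. fder (snd c \<circ> \<psi>) u (axis \<beta> 1)) (axis \<alpha> 1) u + h.B (axis \<alpha> 1) (axis \<beta> 1) u = 0"
      unfolding h.B_def using h.Dcon_compat[OF c(2) smooth_on_fder[OF h.sF, of "axis \<beta> 1"] h.sl, of "axis \<alpha> 1"] by simp
    then show ?thesis unfolding B_eq[OF c]
      using h.Dcon_cong_W[of "l c \<circ> \<psi>" u "\<lambda>_. l c (\<psi> u)"] by simp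
  qed
  then show ?thesis unfolding expansion_def normal_trace_def by (simp add: sum_negf)
qed

lemma normal_trace_linear:
  assumes u: "u \<in> V"
  defines "c \<equiv> chart_at M (\<psi> u)"
  shows "normal_trace M c \<psi> u (a *\<^sub>R v + b *\<^sub>R w) = a * normal_trace M c \<psi> u v + b * normal_trace M c \<psi> u w"
proof -
  have c: "c \<in> charts M" "u \<in> dom c" using chart_at dom_chart_at[OF u] by (auto simp: c_def)
  interpret h: horizon_patch "dom c" "snd c ` (fst c \<inter> N)" "metric_coords M c" "snd c \<circ> \<psi>" "X c \<circ> coord_inv c"
      "tangent_part M X \<psi>" "k c \<circ> \<psi>" "l c \<circ> \<psi>" by (rule horizon_patch_chart[OF c(1)])
  show ?thesis unfolding normal_trace_def sum_2
    using h.Dcon_W(1)[OF c(2), of "\<lambda>_. a *\<^sub>R v" "\<lambda>_. b *\<^sub>R w"] h.Dcon_W(2)[OF c(2), of "\<lambda>_. a" "\<lambda>_. v"] h.Dcon_W(2)[OF c(2), of "\<lambda>_. b" "\<lambda>_. w"]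
    by (simp add: algebra_simps)
qed

lemma normal_span:
  assumes u: "u \<in> V" and Y: "\<And>v. t3 (metric M (chart_at M (\<psi> u)) (\<psi> u)) y (fder (snd (chart_at M (\<psi> u)) \<circ> \<psi>) u v) = 0"
  shows "\<exists>a b. y = a *\<^sub>R k (chart_at M (\<psi> u)) (\<psi> u) + b *\<^sub>R l (chart_at M (\<psi> u)) (\<psi> u)"
proof -
  define c where "c = chart_at M (\<psi> u)"
  have c: "c \<in> charts M" "u \<in> dom c" using chart_at dom_chart_at[OF u] by (auto simp: c_def)
  interpret h: horizon_patch "dom c" "snd c ` (fst c \<inter> N)" "metric_coords M c" "snd c \<circ> \<psi>" "X c \<circ> coord_inv c"
      "tangent_part M X \<psi>" "k c \<circ> \<psi>" "l c \<circ> \<psi>" by (rule horizon_patch_chart[OF c(1)])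
  obtain a b v where y: "y = a *\<^sub>R (k c \<circ> \<psi>) u + b *\<^sub>R (l c \<circ> \<psi>) u + fder (snd c \<circ> \<psi>) u v"
    using h.spanning[OF c(2)] by blast
  have "v = 0"
  proof (rule ccontr)
    assume "v \<noteq> 0"
    from h.pos[OF c(2) this] Y[of v] h.kF[OF c(2), of v] h.lF[OF c(2), of v] show False
      unfolding metric_F[OF c] y c_def[symmetric] by simp
  qed
  then show ?thesis using y h.F'_lin(5)[OF c(2)] by (auto simp: c_def)
qed

end

context two_surface_params begin

lemma diff_\<psi>1:
  assumes "u \<in> W" "c \<in> charts M" "u \<in> K2.dom c"
  shows "\<tau> u \<in> K1.dom c" "(k c \<circ> \<psi>1) differentiable (at (\<tau> u))" "(l c \<circ> \<psi>1) differentiable (at (\<tau> u))"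
proof -
  show d: "\<tau> u \<in> K1.dom c" using assms \<tau>[OF assms(1)] by (simp add: K1.dom_def K2.dom_def)
  show "(k c \<circ> \<psi>1) differentiable (at (\<tau> u))" "(l c \<circ> \<psi>1) differentiable (at (\<tau> u))"
    using smooth_on_has_derivative[OF K1.sk[OF assms(2)] d] smooth_on_has_derivative[OF K1.sl[OF assms(2)] d]
    unfolding differentiable_def by blast+
qed

text \<open>The derivative in \<open>B\<close> falls on \<open>l\<close> and not on the frame, so no
  second derivative of \<open>\<tau>\<close> occurs. Numerator and determinant both acquire the
  squared Jacobian determinant.\<close>

lemma expansion_transform:
  assumes u: "u \<in> W"
  shows "expansion M l \<psi>2 u = expansion M l \<psi>1 (\<tau> u)"
proof -
  define c where "c = chart_at M (\<psi>2 u)"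
  have c: "c \<in> charts M" "u \<in> K2.dom c" using chart_at K2.dom_chart_at[OF WV[OF u]] by (auto simp: c_def)
  note d = diff_\<psi>1[OF u c]
  interpret h1: horizon_patch "K1.dom c" "snd c ` (fst c \<inter> N)" "metric_coords M c" "snd c \<circ> \<psi>1" "X c \<circ> coord_inv c"
      "tangent_part M X \<psi>1" "k c \<circ> \<psi>1" "l c \<circ> \<psi>1" by (rule K1.horizon_patch_chart[OF c(1)])
  interpret h2: horizon_patch "K2.dom c" "snd c ` (fst c \<inter> N)" "metric_coords M c" "snd c \<circ> \<psi>2" "X c \<circ> coord_inv c"
      "tangent_part M X \<psi>2" "k c \<circ> \<psi>2" "l c \<circ> \<psi>2" by (rule K2.horizon_patch_chart[OF c(1)])
  note fr = frame_transform[OF u c]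
  have q: "h2.q v w u = h1.q (fder \<tau> u v) (fder \<tau> u w) (\<tau> u)" for v w
    unfolding h1.q_def h2.q_def fr using \<tau>(2)[OF u] by simp
  have B: "h2.B v w u = h1.B (fder \<tau> u v) (fder \<tau> u w) (\<tau> u)" for v w
    unfolding h1.B_def h2.B_def Dcon_def fr fder_\<psi>2[OF u d(3)] using \<tau>(2)[OF u] by simp
  define a1 a2 b1 b2 where "a1 = fder \<tau> u (axis 1 1) $ 1" and "a2 = fder \<tau> u (axis 1 1) $ 2"
    and "b1 = fder \<tau> u (axis 2 1) $ 1" and "b2 = fder \<tau> u (axis 2 1) $ 2"
  have J: "fder \<tau> u (axis 1 1) = a1 *\<^sub>R axis 1 1 + a2 *\<^sub>R axis 2 1" "fder \<tau> u (axis 2 1) = b1 *\<^sub>R axis 1 1 + b2 *\<^sub>R axis 2 1"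
    unfolding a1_def a2_def b1_def b2_def by (rule axis2_expand)+
  define dJ where "dJ = a1 * b2 - a2 * b1"
  have qs: "h1.q (axis 2 1) (axis 1 1) (\<tau> u) = h1.q (axis 1 1) (axis 2 1) (\<tau> u)" by (rule h1.q_lin(5)[OF d(1)])
  have D: "h2.q (axis 1 1) (axis 1 1) u * h2.q (axis 2 1) (axis 2 1) u - (h2.q (axis 1 1) (axis 2 1) u)\<^sup>2 =
    dJ\<^sup>2 * (h1.q (axis 1 1) (axis 1 1) (\<tau> u) * h1.q (axis 2 1) (axis 2 1) (\<tau> u) - (h1.q (axis 1 1) (axis 2 1) (\<tau> u))\<^sup>2)"
    unfolding q J h1.q_lin(1-4)[OF d(1)] qs dJ_def by (simp add: power2_eq_square algebra_simps)
  have dJ0: "dJ \<noteq> 0" using h2.det_q_pos[OF c(2)] unfolding D by auto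
  have Nu: "h2.q (axis 2 1) (axis 2 1) u * h2.B (axis 1 1) (axis 1 1) u + h2.q (axis 1 1) (axis 1 1) u * h2.B (axis 2 1) (axis 2 1) u
     - h2.q (axis 1 1) (axis 2 1) u * (h2.B (axis 1 1) (axis 2 1) u + h2.B (axis 2 1) (axis 1 1) u) =
    dJ\<^sup>2 * (h1.q (axis 2 1) (axis 2 1) (\<tau> u) * h1.B (axis 1 1) (axis 1 1) (\<tau> u) + h1.q (axis 1 1) (axis 1 1) (\<tau> u) * h1.B (axis 2 1) (axis 2 1) (\<tau> u)
     - h1.q (axis 1 1) (axis 2 1) (\<tau> u) * (h1.B (axis 1 1) (axis 2 1) (\<tau> u) + h1.B (axis 2 1) (axis 1 1) (\<tau> u)))"
    unfolding q B J h1.q_lin(1-4)[OF d(1)] h1.B_lin[OF d(1)] qs dJ_def by (simp add: power2_eq_square algebra_simps)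
  show ?thesis
    unfolding K2.Th_eq[OF c] K1.Th_eq[OF c(1) d(1)] h2.Th_def h1.Th_def Nu D using dJ0 by simp
qed

lemma area_form_transform:
  assumes u: "u \<in> W"
  shows "area_form M k l \<psi>2 u 1 2 = (fder \<tau> u (axis 1 1) $ 1 * fder \<tau> u (axis 2 1) $ 2 - fder \<tau> u (axis 1 1) $ 2 * fder \<tau> u (axis 2 1) $ 1)
     * area_form M k l \<psi>1 (\<tau> u) 1 2"
proof -
  define c where "c = chart_at M (\<psi>2 u)"
  have c: "c \<in> charts M" "u \<in> K2.dom c" using chart_at K2.dom_chart_at[OF WV[OF u]] by (auto simp: c_def)
  note d = diff_\<psi>1[OF u c]
  note E = K1.F_expand[OF c(1) d(1)]
  have "det4 x y (a1 *\<^sub>R e + a2 *\<^sub>R f) (b1 *\<^sub>R e + b2 *\<^sub>R f) = (a1 * b2 - a2 * b1) * det4 x y e f" for x y e f a1 a2 b1 b2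
    unfolding linear_add[OF det4_linear3] linear_add[OF det4_linear4] linear_cmul[OF det4_linear3] linear_cmul[OF det4_linear4]
      det4_same using det4_swap(3)[of x y e f] by (simp add: algebra_simps)
  then show ?thesis
    unfolding K2.area_form_chart[OF c] K1.area_form_chart[OF c(1) d(1)] frame_transform[OF u c] \<tau>(2)[OF u]
      vol_form_def det4_def[symmetric] E[of "fder \<tau> u (axis 1 1)"] E[of "fder \<tau> u (axis 2 1)"] by simp
qed

lemma rotational_1form_transform:
  assumes u: "u \<in> W"
  shows "rotational_1form M k l \<psi>2 u $ \<alpha> = fder \<tau> u (axis \<alpha> 1) $ 1 * rotational_1form M k l \<psi>1 (\<tau> u) $ 1
    + fder \<tau> u (axis \<alpha> 1) $ 2 * rotational_1form M k l \<psi>1 (\<tau> u) $ 2"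
proof -
  define c where "c = chart_at M (\<psi>2 u)"
  have c: "c \<in> charts M" "u \<in> K2.dom c" using chart_at K2.dom_chart_at[OF WV[OF u]] by (auto simp: c_def)
  note d = diff_\<psi>1[OF u c]
  interpret h1: horizon_patch "K1.dom c" "snd c ` (fst c \<inter> N)" "metric_coords M c" "snd c \<circ> \<psi>1" "X c \<circ> coord_inv c"
      "tangent_part M X \<psi>1" "k c \<circ> \<psi>1" "l c \<circ> \<psi>1" by (rule K1.horizon_patch_chart[OF c(1)])
  interpret h2: horizon_patch "K2.dom c" "snd c ` (fst c \<inter> N)" "metric_coords M c" "snd c \<circ> \<psi>2" "X c \<circ> coord_inv c"
      "tangent_part M X \<psi>2" "k c \<circ> \<psi>2" "l c \<circ> \<psi>2" by (rule K2.horizon_patch_chart[OF c(1)])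
  have o: "h2.om v u = h1.om (fder \<tau> u v) (\<tau> u)" for v
    unfolding h1.om_def h2.om_def Dcon_def frame_transform[OF u c] fder_\<psi>2[OF u d(2)] using \<tau>(2)[OF u] by simp
  have "h1.om v (\<tau> u) = v $ 1 * h1.om (axis 1 1) (\<tau> u) + v $ 2 * h1.om (axis 2 1) (\<tau> u)" for v
    by (subst axis2_expand[of v]) (simp only: h1.om_lin[OF d(1)])
  from this[of "fder \<tau> u (axis \<alpha> 1)"] show ?thesis unfolding K2.om_eq[OF c] K1.om_eq[OF c(1) d(1)] o .
qed

lemma tangent_transform:
  assumes u: "u \<in> W"
  shows "tangent_part M X \<psi>1 (\<tau> u) = fder \<tau> u (tangent_part M X \<psi>2 u)"
proof -
  define c where "c = chart_at M (\<psi>2 u)"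
  have c: "c \<in> charts M" "u \<in> K2.dom c" using chart_at K2.dom_chart_at[OF WV[OF u]] by (auto simp: c_def)
  note d = diff_\<psi>1[OF u c]
  have "fder (snd c \<circ> \<psi>1) (\<tau> u) (tangent_part M X \<psi>1 (\<tau> u)) = fder (snd c \<circ> \<psi>1) (\<tau> u) (fder \<tau> u (tangent_part M X \<psi>2 u))"
    using K1.X_tangent[OF c(1) d(1)] K2.X_tangent[OF c] frame_transform[OF u c] \<tau>(2)[OF u] by simp
  then show ?thesis using K1.inj_F[OF c(1) d(1)] by (simp add: inj_eq)
qed

end

section \<open>Functions on the surface\<close>

text \<open>Every point of \<open>W\<close> is a limit of points outside a finite set. This carries
  identities across the zeros of \<open>X\<close>, where division by its components fails.\<close>

lemma eq_off_finite:
  fixes f g :: "'a::{perfect_space,t2_space} \<Rightarrow> real"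
  assumes "open W" "continuous_on W f" "continuous_on W g" "finite E" "\<And>x. x \<in> W \<Longrightarrow> x \<notin> E \<Longrightarrow> f x = g x" "x \<in> W"
  shows "f x = g x"
proof -
  have c: "isCont (\<lambda>x. f x - g x) x"
    using continuous_on_diff[OF assms(2,3)] assms(1,6) by (simp add: continuous_on_eq_continuous_at)
  have "open (W - (E - {x}))" using assms(1,4) by (intro open_Diff finite_imp_closed) auto
  then have "eventually (\<lambda>y. y \<in> W - (E - {x})) (nhds x)" using assms(6) by (intro eventually_nhds_in_open) auto
  then have "eventually (\<lambda>y. f y - g y = 0) (at x)"
    unfolding eventually_at_filter by eventually_elim (use assms(5) in auto)
  then have "(\<lambda>y. f y - g y) \<midarrow>x\<rightarrow> 0" by (rule tendsto_eventually)
  with c have "f x - g x = 0" unfolding isCont_def by (metis LIM_unique)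
  then show ?thesis by simp
qed

lemma (in param) restrict_param:
  assumes V': "V' \<subseteq> V" "open V'"
  shows "local_param M S V' \<psi>"
  unfolding local_param_def
proof (intro conjI ballI)
  show "open V'" by fact
  have "openin (top_of_set V) V'" using V' openV by (simp add: openin_open_eq)
  from homeomorphism_imp_open_map[OF homeo this] have "openin (top_of_set (\<psi> ` V)) (\<psi> ` V')" .
  then show "openin (top_of_set S) (\<psi> ` V')"
    using lp openin_trans unfolding local_param_def by blast
  have inj': "inj_on \<psi> V'" by (rule inj_on_subset[OF inj V'(1)])
  have eq: "inv_into V \<psi> p = inv_into V' \<psi> p" if p: "p \<in> \<psi> ` V'" for p
  proof -
    obtain u where u: "u \<in> V'" "p = \<psi> u" using p by blast
    then show ?thesis using inv_into_f_f[OF inj, of u] inv_into_f_f[OF inj', of u] V'(1) by auto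
  qed
  show "homeomorphism V' (\<psi> ` V') \<psi> (inv_into V' \<psi>)"
  proof (rule homeomorphismI)
    show "continuous_on V' \<psi>" by (rule continuous_on_subset[OF cont V'(1)])
    show "continuous_on (\<psi> ` V') (inv_into V' \<psi>)"
      by (rule continuous_on_eq[OF continuous_on_subset[OF homeomorphism_cont2[OF homeo]] eq]) (use V' in auto)
  qed (use inj' in \<open>auto simp: inv_into_f_f inv_into_into\<close>)
  fix c assume c: "c \<in> charts M"
  show "smooth_on {u\<in>V'. \<psi> u \<in> fst c} (snd c \<circ> \<psi>)"
    by (rule smooth_on_subset[OF smooth_F[OF c]]) (use V' in \<open>auto simp: dom_def\<close>)
  fix u assume u: "u \<in> V'"
  show "\<psi> u \<in> fst c \<longrightarrow> inj (frechet_derivative (snd c \<circ> \<psi>) (at u))"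
    using inj_F[OF c, of u] u V' by (auto simp: dom_def)
qed

context killing_surface begin

text \<open>The choice made by \<open>on_surface\<close>; it is the same for all
  \<open>F\<close>.\<close>

definition sel :: "'a \<Rightarrow> (real^2 \<Rightarrow> 'a) \<times> (real^2)" where
  "sel p = (SOME (\<psi>, u). \<exists>V. local_param M S V \<psi> \<and> u \<in> V \<and> \<psi> u = p)"

lemma on_surface_sel: "on_surface M S F p = F (fst (sel p)) (snd (sel p))"
  unfolding on_surface_def sel_def by (simp add: case_prod_beta)

lemma sel: assumes "p \<in> S"
  obtains V where "local_param M S V (fst (sel p))" "snd (sel p) \<in> V" "fst (sel p) (snd (sel p)) = p"
proof -
  obtain V \<psi> u where "local_param M S V (\<psi> :: real^2 \<Rightarrow> 'a)" "u \<in> V" "\<psi> u = p" using ex_param[OF assms] by blast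
  then have "\<exists>x. case x of (\<psi>, u) \<Rightarrow> \<exists>V. local_param M S V (\<psi> :: real^2 \<Rightarrow> 'a) \<and> u \<in> V \<and> \<psi> u = p" by auto
  from someI_ex[OF this, folded sel_def] have "\<exists>V. local_param M S V (fst (sel p)) \<and> snd (sel p) \<in> V \<and> fst (sel p) (snd (sel p)) = p"
    by (simp only: case_prod_beta)
  then show ?thesis using that by blast
qed

lemma on_surface_eq:
  assumes inv: "\<And>V1 \<psi>1 V2 \<psi>2 u1 u2. local_param M S V1 (\<psi>1 :: real^2 \<Rightarrow> 'a) \<Longrightarrow> local_param M S V2 \<psi>2 \<Longrightarrow>
      u1 \<in> V1 \<Longrightarrow> u2 \<in> V2 \<Longrightarrow> \<psi>1 u1 = \<psi>2 u2 \<Longrightarrow> F \<psi>1 u1 = F \<psi>2 u2"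
    and lp: "local_param M S V (\<psi> :: real^2 \<Rightarrow> 'a)" and u: "u \<in> V"
  shows "on_surface M S F (\<psi> u) = F \<psi> u"
proof -
  interpret killing_surface_param M S N k l X V \<psi> by (rule param_locale[OF lp])
  show ?thesis
    by (rule sel[OF \<psi>S[OF u]]) (use inv[OF _ lp _ u] in \<open>auto simp: on_surface_sel\<close>)
qed

text \<open>Images of parametrizations are relatively open in the leaf, so continuity can be tested
  in them.\<close>

lemma continuous_on_S:
  fixes f :: "'a \<Rightarrow> real"
  assumes "\<And>V \<psi>. local_param M S V (\<psi> :: real^2 \<Rightarrow> 'a) \<Longrightarrow> continuous_on V (f \<circ> \<psi>)"
  shows "continuous_on S f"
  unfolding continuous_on_eq_continuous_within
proof
  fix p assume p: "p \<in> S"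
  obtain V \<psi> where L: "local_param M S V (\<psi> :: real^2 \<Rightarrow> 'a)" "p \<in> \<psi> ` V" using ex_param[OF p] by blast
  interpret killing_surface_param M S N k l X V \<psi> by (rule param_locale[OF L(1)])
  obtain Z where Z: "open Z" "\<psi> ` V = S \<inter> Z" using L(1) unfolding local_param_def by (metis openin_open)
  have "continuous_on (\<psi> ` V) ((f \<circ> \<psi>) \<circ> inv_into V \<psi>)"
    by (rule continuous_on_compose[OF homeomorphism_cont2[OF homeo]])
       (simp only: homeomorphism_image2[OF homeo] assms[OF L(1)])
  then have "continuous_on (\<psi> ` V) f"
    by (rule continuous_on_eq) (simp only: comp_def f_inv_into_f)
  then have "continuous (at p within S \<inter> Z) f" using L(2) Z(2) by (simp add: continuous_on_eq_continuous_within)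
  moreover have "at p within S = at p within S \<inter> Z"
    by (rule at_within_nhd[of p Z]) (use L(2) Z in auto)
  ultimately show "continuous (at p within S) f" by simp
qed

lemma sets_\<mu>: "S \<noteq> {} \<Longrightarrow> sets \<mu> = sets borel"
  using ex_param area_measure_patch(1) by blast

lemma integrable_on_S:
  fixes f :: "'a \<Rightarrow> real"
  assumes ne: "S \<noteq> {}" and f: "continuous_on S f"
  shows "set_integrable \<mu> S f"
  unfolding set_integrable_def
proof -
  have "compact (f ` S)" using css f by (intro compact_continuous_image) (simp_all add: closed_spacelike_surface_def)
  then obtain B where B: "\<And>p. p \<in> S \<Longrightarrow> norm (f p) \<le> B" by (meson compact_imp_bounded bounded_iff imageI)
  show "integrable \<mu> (\<lambda>x. indicator S x *\<^sub>R f x)"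
  proof (rule integrableI_bounded_set[where A=S and B=B])
    show "S \<in> sets \<mu>" using S_borel sets_\<mu>[OF ne] by simp
    show "(\<lambda>x. indicator S x *\<^sub>R f x) \<in> borel_measurable \<mu>"
      unfolding measurable_cong_sets[OF sets_\<mu>[OF ne] refl]
      by (rule borel_measurable_continuous_on_indicator[OF S_borel f])
    show "emeasure \<mu> S < \<infinity>" by (rule area_finite)
  qed (use B in auto)
qed

lemma inv_expansion:
  assumes "local_param M S V1 (\<psi>1 :: real^2 \<Rightarrow> 'a)" "local_param M S V2 \<psi>2" "u1 \<in> V1" "u2 \<in> V2" "\<psi>1 u1 = \<psi>2 u2"
  shows "expansion M l \<psi>1 u1 = expansion M l \<psi>2 u2"
proof -
  interpret two_surface_params M S N k l X V1 \<psi>1 V2 \<psi>2 by (rule two_locale[OF assms(1,2)])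
  have "u2 \<in> W" using assms(3,4) assms(5)[symmetric] by (auto simp: W_def)
  from expansion_transform[OF this] show ?thesis using \<tau>_eq[OF assms(3-5)] by simp
qed

end

section \<open>The curl of the rotational 1-form as a function on the leaf\<close>

locale horizon = killing_surface M S N k l X
  for M :: "'a::{t2_space,second_countable_topology} spacetime" and S N k l X +
  assumes thnz: "\<And>V \<psi> u. local_param M S V (\<psi> :: real^2 \<Rightarrow> 'a) \<Longrightarrow> u \<in> V \<Longrightarrow> expansion M l \<psi> u \<noteq> 0"
    and fz: "finite (zeros_on M X S)" and ne: "S \<noteq> {}"
begin

lemma hparam: assumes "local_param M S V (\<psi> :: real^2 \<Rightarrow> 'a)" shows "horizon_param M S N k l X V \<psi>"
proof -
  interpret killing_surface_param M S N k l X V \<psi> by (rule param_locale[OF assms])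
  show ?thesis by unfold_locales (rule thnz[OF assms])
qed

abbreviation \<kappa> where "\<kappa> \<equiv> kappa M k l X"

definition curlS where "curlS p = on_surface M S (rotational_curl M k l) p"
definition ThS where "ThS p = on_surface M S (expansion M l) p"

lemma ThS: "local_param M S V (\<psi> :: real^2 \<Rightarrow> 'a) \<Longrightarrow> u \<in> V \<Longrightarrow> ThS (\<psi> u) = expansion M l \<psi> u"
  unfolding ThS_def by (rule on_surface_eq[OF inv_expansion])

lemma continuous_curl:
  assumes lp: "local_param M S V (\<psi> :: real^2 \<Rightarrow> 'a)"
  shows "continuous_on V (rotational_curl M k l \<psi>)"
proof -
  interpret horizon_param M S N k l X V \<psi> by (rule hparam[OF lp])
  have "continuous_on V (\<lambda>u. (fder (r 2) u (axis 1 1) - fder (r 1) u (axis 2 1)) / area_form M k l \<psi> u 1 2)"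
    by (intro continuous_on_divide continuous_on_diff continuous_area_form
        smooth_on_continuous_on[OF smooth_on_fder[OF smooth_r]]) (use area_form_nz in blast)
  then show ?thesis by (rule continuous_on_eq) (simp add: rotational_curl_eq)
qed

lemma finite_zeros: assumes lp: "local_param M S V (\<psi> :: real^2 \<Rightarrow> 'a)" shows "finite {u\<in>V. \<psi> u \<in> zeros_on M X S}"
proof -
  interpret horizon_param M S N k l X V \<psi> by (rule hparam[OF lp])
  show ?thesis
    by (rule finite_imageD[of \<psi>]) (auto intro: finite_subset[OF _ fz] inj_on_subset[OF inj])
qed

text \<open>The usual argument would differentiate the transformation law of the 1-form and so use
  second derivatives of \<open>\<tau>\<close>. Instead \<open>d_kappa\<close>, applied to the one
  function \<kappa> in both parametrizations, determines the curl where \<open>X\<close> does not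
  vanish; continuity fills in the zeros.\<close>

lemma inv_curl:
  assumes lp: "local_param M S V1 (\<psi>1 :: real^2 \<Rightarrow> 'a)" "local_param M S V2 \<psi>2" and u: "u1 \<in> V1" "u2 \<in> V2" "\<psi>1 u1 = \<psi>2 u2"
  shows "rotational_curl M k l \<psi>1 u1 = rotational_curl M k l \<psi>2 u2"
proof -
  interpret two_surface_params M S N k l X V1 \<psi>1 V2 \<psi>2 by (rule two_locale[OF lp])
  interpret H1: horizon_param M S N k l X V1 \<psi>1 by (rule hparam[OF lp(1)])
  interpret H2: horizon_param M S N k l X V2 \<psi>2 by (rule hparam[OF lp(2)])
  have W: "u2 \<in> W" using u(1,2) u(3)[symmetric] by (auto simp: W_def)
  have "rotational_curl M k l \<psi>1 (\<tau> u2) = rotational_curl M k l \<psi>2 u2"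
  proof (rule eq_off_finite[where f="\<lambda>u. rotational_curl M k l \<psi>1 (\<tau> u)" and g="rotational_curl M k l \<psi>2", OF openW _ _ finite_zeros[OF lp(2)] _ W])
    show "continuous_on W (\<lambda>u. rotational_curl M k l \<psi>1 (\<tau> u))"
      by (rule continuous_on_compose2[OF continuous_curl[OF lp(1)] cont_\<tau>]) (use \<tau> in auto)
    show "continuous_on W (rotational_curl M k l \<psi>2)"
      by (rule continuous_on_subset[OF continuous_curl[OF lp(2)]]) (use WV in auto)
    fix u assume u: "u \<in> W" "u \<notin> {u \<in> V2. \<psi>2 u \<in> zeros_on M X S}"
    note uV = WV[OF u(1)] \<tau>(1)[OF u(1)]
    define T2 where "T2 = tangent_part M X \<psi>2 u"
    have T2: "T2 \<noteq> 0" using u K2.zeros_iff[OF uV(1)] uV by (simp add: T2_def)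
    define a1 a2 b1 b2 where "a1 = fder \<tau> u (axis 1 1) $ 1" and "a2 = fder \<tau> u (axis 1 1) $ 2"
      and "b1 = fder \<tau> u (axis 2 1) $ 1" and "b2 = fder \<tau> u (axis 2 1) $ 2"
    have J: "fder \<tau> u v $ 1 = v $ 1 * a1 + v $ 2 * b1" "fder \<tau> u v $ 2 = v $ 1 * a2 + v $ 2 * b2" for v
    proof -
      have "fder \<tau> u v = v $ 1 *\<^sub>R fder \<tau> u (axis 1 1) + v $ 2 *\<^sub>R fder \<tau> u (axis 2 1)"
        by (subst axis2_expand[of v]) (simp only: linear_add[OF J(3)[OF u(1)]] linear_cmul[OF J(3)[OF u(1)]])
      then show "fder \<tau> u v $ 1 = v $ 1 * a1 + v $ 2 * b1" "fder \<tau> u v $ 2 = v $ 1 * a2 + v $ 2 * b2"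
        by (simp_all add: a1_def a2_def b1_def b2_def)
    qed
    \<comment> \<open>\<open>T2\<close> turned by a right angle, so that \<open>n\<close> is the
      square norm of \<open>T2\<close> and therefore nonzero.\<close>
    define v where "v = (- T2 $ 2) *\<^sub>R axis 1 1 + T2 $ 1 *\<^sub>R (axis 2 1 :: real^2)"
    have v: "v $ 1 = - T2 $ 2" "v $ 2 = T2 $ 1" by (simp_all add: v_def)
    define n where "n = T2 $ 1 * v $ 2 - T2 $ 2 * v $ 1"
    have n: "n \<noteq> 0"
    proof
      assume "n = 0"
      then have "T2 $ 1 * T2 $ 1 + T2 $ 2 * T2 $ 2 = 0" by (simp add: n_def v)
      then have "T2 $ 1 = 0 \<and> T2 $ 2 = 0" by (simp only: sum_squares_eq_zero_iff)
      then show False using T2 by (simp add: vec_eq_iff forall_2)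
    qed
    have "fder (\<kappa> \<circ> \<psi>2) u v = fder (\<kappa> \<circ> \<psi>1) (\<tau> u) (fder \<tau> u v)"
      by (rule fder_\<psi>2[OF u(1) H1.d_kappa(1)[OF uV(2)]])
    then have "rotational_curl M k l \<psi>2 u * area_form M k l \<psi>2 u 1 2 * n =
      rotational_curl M k l \<psi>1 (\<tau> u) * area_form M k l \<psi>1 (\<tau> u) 1 2 * ((a1 * b2 - a2 * b1) * n)"
      unfolding H1.d_kappa(2)[OF uV(2)] H2.d_kappa(2)[OF uV(1)] tangent_transform[OF u(1)] T2_def[symmetric] J n_def
      by (simp add: algebra_simps)
    also have "\<dots> = rotational_curl M k l \<psi>1 (\<tau> u) * area_form M k l \<psi>2 u 1 2 * n"
      unfolding area_form_transform[OF u(1)] a1_def a2_def b1_def b2_def by simp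
    finally show "rotational_curl M k l \<psi>1 (\<tau> u) = rotational_curl M k l \<psi>2 u"
      using n K2.area_form_nz[OF uV(1)] by simp
  qed
  then show ?thesis using \<tau>_eq[OF u] by simp
qed

lemma curlS: "local_param M S V (\<psi> :: real^2 \<Rightarrow> 'a) \<Longrightarrow> u \<in> V \<Longrightarrow> curlS (\<psi> u) = rotational_curl M k l \<psi> u"
  unfolding curlS_def by (rule on_surface_eq[OF inv_curl])

lemma curl_zero:
  assumes tw: "\<And>p. p \<in> S \<Longrightarrow> at_pt M (twist M X) p = 0" and p: "p \<in> S"
  shows "curlS p = 0"
proof -
  obtain V \<psi> u where L: "local_param M S V (\<psi> :: real^2 \<Rightarrow> 'a)" "u \<in> V" "\<psi> u = p" using ex_param[OF p] by blast
  interpret horizon_param M S N k l X V \<psi> by (rule hparam[OF L(1)])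
  let ?E = "{u\<in>V. \<psi> u \<in> zeros_on M X S}"
  have T0: "T w \<noteq> 0" if "w \<in> V" "w \<notin> ?E" for w using zeros_iff[OF that(1)] that by simp
  have k0: "\<kappa> (\<psi> w) = 0" if w: "w \<in> V" "w \<notin> ?E" for w
  proof -
    have "tangent_low M (twist M X) \<psi> w = 0"
      unfolding tangent_low_def tw[OF \<psi>S[OF w(1)]] by (simp add: vec_eq_iff ip_def)
    then have "\<kappa> (\<psi> w) * T w $ 1 = 0" "\<kappa> (\<psi> w) * T w $ 2 = 0"
      using twist_tangent_low[OF w(1)] area_form_nz[OF w(1)] by simp_all
    then show ?thesis using T0[OF w] by (auto simp: vec_eq_iff forall_2)
  qed
  have "rotational_curl M k l \<psi> u = 0"
  \<comment> \<open>At the zeros of \<open>X\<close> the equation for d\<kappa> is empty; the curl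
    vanishes there by continuity.\<close>
  proof (rule eq_off_finite[where g="\<lambda>_. 0", OF openV continuous_curl[OF L(1)] continuous_on_const finite_zeros[OF L(1)] _ L(2)])
    fix w assume w: "w \<in> V" "w \<notin> ?E"
    have oE: "open (V - ?E)" by (rule open_Diff[OF openV finite_imp_closed[OF finite_zeros[OF L(1)]]])
    have f0: "fder (\<kappa> \<circ> \<psi>) w v = 0" for v
      using fder_cong_open[OF oE, of w "\<kappa> \<circ> \<psi>" "\<lambda>_. 0"] w k0 by simp
    have "rotational_curl M k l \<psi> w * area_form M k l \<psi> w 1 2 * T w $ 1 = 0"
      "rotational_curl M k l \<psi> w * area_form M k l \<psi> w 1 2 * T w $ 2 = 0"
      using d_kappa(2)[OF w(1), of "axis 2 1"] d_kappa(2)[OF w(1), of "axis 1 1"] unfolding f0 by simp_all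
    then show "rotational_curl M k l \<psi> w = 0"
      using area_form_nz[OF w(1)] T0[OF w] by (auto simp: vec_eq_iff forall_2)
  qed
  then show ?thesis using curlS[OF L(1,2)] L(3) by simp
qed

end

section \<open>Stokes' theorem for the rotational form\<close>

text \<open>\<open>q\<close> stands for the polynomial in \<open>\<zeta>\<close> that represents a
  zonal harmonic, so that \<open>Y\<close> below is smooth up to the poles.\<close>

locale horizon_zeta = horizon M S N k l X
  for M :: "'a::{t2_space,second_countable_topology} spacetime" and S N k l X +
  fixes \<zeta> :: "'a \<Rightarrow> real" and q :: "real poly"
  assumes zc: "zeta_coordinate M S k l X \<zeta>"
begin

definition Y where "Y p = poly q (\<zeta> p)"
definition Y' where "Y' p = poly (pderiv q) (\<zeta> p)"
definition \<rho> where "\<rho> = (area_radius M S)\<^sup>2"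

text \<open>\<open>beta\<close> is \<open>2 Y\<close> times the rotational form of the rescaled normals \<open>\<Theta> k\<close>, \<open>l / \<Theta>\<close>.\<close>

definition beta :: "(real^2 \<Rightarrow> 'a) \<Rightarrow> 2 \<Rightarrow> real^2 \<Rightarrow> real" where
  "beta \<psi> \<alpha> u = 2 * Y (\<psi> u) * (rotational_1form M k l \<psi> u $ \<alpha> + fder (expansion M l \<psi>) u (axis \<alpha> 1) / expansion M l \<psi> u)"

text \<open>The exterior derivative of \<open>beta\<close> divided by the area form, see
  \<open>d_beta\<close>.\<close>

definition \<Phi> where "\<Phi> p = 2 * (Y p * curlS p + Y' p * \<kappa> p / \<rho>)"

text \<open>The 2-form d\<eta> \<and> \<open>beta\<close> divided by the area form. Together with
  \<open>\<Phi>\<close> it gives the exterior derivative of \<eta> times \<open>beta\<close> in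
  \<open>cut\<close>.\<close>

definition wedge :: "('a \<Rightarrow> real) \<Rightarrow> (real^2 \<Rightarrow> 'a) \<Rightarrow> real^2 \<Rightarrow> real" where
  "wedge \<eta> \<psi> u = (fder (\<eta> \<circ> \<psi>) u (axis 1 1) * beta \<psi> 2 u - fder (\<eta> \<circ> \<psi>) u (axis 2 1) * beta \<psi> 1 u) / area_form M k l \<psi> u 1 2"

definition test :: "('a \<Rightarrow> real) \<Rightarrow> bool" where
  "test \<eta> \<longleftrightarrow> (\<forall>V \<psi>. local_param M S V (\<psi> :: real^2 \<Rightarrow> 'a) \<longrightarrow> Ck_on (Suc 0) V (\<eta> \<circ> \<psi>))"

definition cut where "cut \<eta> p = \<eta> p * \<Phi> p + on_surface M S (wedge \<eta>) p"

lemma smooth_\<zeta>: "local_param M S V (\<psi> :: real^2 \<Rightarrow> 'a) \<Longrightarrow> smooth_on V (\<zeta> \<circ> \<psi>)"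
  using zc unfolding zeta_coordinate_def by blast

lemma d_\<zeta>:
  assumes lp: "local_param M S V (\<psi> :: real^2 \<Rightarrow> 'a)" and u: "u \<in> V"
  shows "fder (\<zeta> \<circ> \<psi>) u v = area_form M k l \<psi> u 1 2 * (tangent_part M X \<psi> u $ 1 * v $ 2 - tangent_part M X \<psi> u $ 2 * v $ 1) / \<rho>"
proof -
  interpret horizon_param M S N k l X V \<psi> by (rule hparam[OF lp])
  have p: "fder (\<zeta> \<circ> \<psi>) u (axis \<alpha> 1) = (\<Sum>\<beta>\<in>UNIV. area_form M k l \<psi> u \<beta> \<alpha> * T u $ \<beta>) / \<rho>" for \<alpha>
    using zc lp u unfolding zeta_coordinate_def partial_def \<rho>_def by blast
  have l: "linear (fder (\<zeta> \<circ> \<psi>) u)" by (rule has_derivative_linear[OF smooth_on_has_derivative[OF smooth_\<zeta>[OF lp] u]])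
  have "fder (\<zeta> \<circ> \<psi>) u v = v $ 1 * fder (\<zeta> \<circ> \<psi>) u (axis 1 1) + v $ 2 * fder (\<zeta> \<circ> \<psi>) u (axis 2 1)"
    by (subst axis2_expand[of v]) (simp only: linear_add[OF l] linear_cmul[OF l] real_scaleR_def)
  also have "\<dots> = area_form M k l \<psi> u 1 2 * (T u $ 1 * v $ 2 - T u $ 2 * v $ 1) / \<rho>"
    unfolding p sum_2 area_form_antisym by (simp add: diff_divide_distrib add_divide_distrib algebra_simps)
  finally show ?thesis .
qed

lemma smooth_Y: assumes lp: "local_param M S V (\<psi> :: real^2 \<Rightarrow> 'a)" shows "smooth_on V (Y \<circ> \<psi>)"
proof -
  interpret horizon_param M S N k l X V \<psi> by (rule hparam[OF lp])
  show ?thesis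
    using smooth_on_compose[OF openV open_UNIV UNIV_I smooth_\<zeta>[OF lp] smooth_on_poly[of q]] by (simp add: Y_def comp_def)
qed

lemma d_Y:
  assumes lp: "local_param M S V (\<psi> :: real^2 \<Rightarrow> 'a)" and u: "u \<in> V"
  shows "fder (Y \<circ> \<psi>) u v = Y' (\<psi> u) * fder (\<zeta> \<circ> \<psi>) u v"
proof -
  have "((\<lambda>w. poly q ((\<zeta> \<circ> \<psi>) w)) has_derivative (\<lambda>v. poly (pderiv q) ((\<zeta> \<circ> \<psi>) u) * fder (\<zeta> \<circ> \<psi>) u v)) (at u)"
    using has_derivative_compose[OF smooth_on_has_derivative[OF smooth_\<zeta>[OF lp] u], of "poly q" "(*) (poly (pderiv q) ((\<zeta> \<circ> \<psi>) u))"]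
      poly_DERIV[of q "(\<zeta> \<circ> \<psi>) u"] unfolding has_field_derivative_def by simp
  from fder_eqI[OF this] show ?thesis by (simp add: Y_def Y'_def comp_def)
qed

lemma smooth_beta: assumes lp: "local_param M S V (\<psi> :: real^2 \<Rightarrow> 'a)" shows "smooth_on V (beta \<psi> \<alpha>)"
proof -
  interpret horizon_param M S N k l X V \<psi> by (rule hparam[OF lp])
  show ?thesis
    unfolding beta_def
    by (intro smooth_on_mult smooth_on_add smooth_on_divide smooth_on_const smooth_on_fder smooth_r smooth_expansion openV
       smooth_Y[OF lp, unfolded comp_def] Th_nz)
qed

text \<open>The part d ln |\<Theta>| is closed by symmetry of second derivatives, which leaves Y
  d\<omega> and dY \<and> \<beta>, where \<beta> = \<omega> + d ln |\<Theta>|. As dY is a multiple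
  of i_X \<epsilon>, and i_X \<epsilon> \<and> \<beta> = - \<beta>(X) \<epsilon> in dimension two,
  the latter turns into \<kappa>.\<close>

lemma d_beta:
  assumes lp: "local_param M S V (\<psi> :: real^2 \<Rightarrow> 'a)" and u: "u \<in> V"
  shows "fder (beta \<psi> 2) u (axis 1 1) - fder (beta \<psi> 1) u (axis 2 1) = area_form M k l \<psi> u 1 2 * \<Phi> (\<psi> u)"
proof -
  interpret horizon_param M S N k l X V \<psi> by (rule hparam[OF lp])
  define e where "e = area_form M k l \<psi> u 1 2"
  define C where "C = rotational_curl M k l \<psi> u"
  have e0: "e \<noteq> 0" unfolding e_def by (rule area_form_nz[OF u])
  have t0: "th u \<noteq> 0" by (rule Th_nz[OF u])
  let ?w = "\<lambda>\<alpha> u. r \<alpha> u + fder th u (axis \<alpha> 1) / th u"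
  have dth: "(th has_derivative fder th u) (at u)" by (rule smooth_on_has_derivative[OF smooth_expansion u])
  have dth2: "((\<lambda>u. fder th u a) has_derivative fder (\<lambda>u. fder th u a) u) (at u)" for a
    by (rule smooth_on_has_derivative[OF smooth_on_fder[OF smooth_expansion] u])
  have dr: "(r \<alpha> has_derivative fder (r \<alpha>) u) (at u)" for \<alpha> by (rule smooth_on_has_derivative[OF smooth_r u])
  have dY: "((\<lambda>u. 2 * Y (\<psi> u)) has_derivative (\<lambda>h. 2 * fder (Y \<circ> \<psi>) u h)) (at u)"
    using has_derivative_mult_right[OF smooth_on_has_derivative[OF smooth_Y[OF lp] u], of 2] by (simp add: comp_def)
  have dw: "(?w \<alpha> has_derivative (\<lambda>h. fder (r \<alpha>) u h + (- fder th u (axis \<alpha> 1) * (inverse (th u) * fder th u h * inverse (th u))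
      + fder (\<lambda>u. fder th u (axis \<alpha> 1)) u h / th u))) (at u)" for \<alpha>
    by (rule has_derivative_add[OF dr has_derivative_divide[OF dth2 dth t0]])
  have db: "fder (beta \<psi> \<alpha>) u h = 2 * Y (\<psi> u) * (fder (r \<alpha>) u h + (- fder th u (axis \<alpha> 1) * (inverse (th u) * fder th u h * inverse (th u))
      + fder (\<lambda>u. fder th u (axis \<alpha> 1)) u h / th u)) + 2 * fder (Y \<circ> \<psi>) u h * ?w \<alpha> u" for \<alpha> h
    unfolding beta_def by (rule fder_eqI[OF has_derivative_mult[OF dY dw], THEN fun_cong])
  have sy: "fder (\<lambda>u. fder th u (axis 2 1)) u (axis 1 1) = fder (\<lambda>u. fder th u (axis 1 1)) u (axis 2 1)"
    by (rule smooth_on_fder_symmetric[OF openV smooth_expansion u])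
  have l: "linear (fder th u)" by (rule has_derivative_linear[OF dth])
  have thT: "fder th u (T u) = T u $ 1 * fder th u (axis 1 1) + T u $ 2 * fder th u (axis 2 1)"
    by (subst axis2_expand[of "T u"]) (simp only: linear_add[OF l] linear_cmul[OF l] real_scaleR_def)
  have rT: "T u $ 1 * ?w 1 u + T u $ 2 * ?w 2 u = - \<kappa> (\<psi> u)"
    using r_T[OF u] unfolding thT by (simp add: distrib_left add_divide_distrib)
  have cu: "fder (r 2) u (axis 1 1) - fder (r 1) u (axis 2 1) = C * e"
    unfolding C_def rotational_curl_eq[OF u] e_def using area_form_nz[OF u] by simp
  have Y1: "fder (Y \<circ> \<psi>) u (axis 1 1) = - (Y' (\<psi> u) * e / \<rho>) * T u $ 2"
    and Y2: "fder (Y \<circ> \<psi>) u (axis 2 1) = (Y' (\<psi> u) * e / \<rho>) * T u $ 1"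
    unfolding d_Y[OF lp u] d_\<zeta>[OF lp u] e_def by simp_all
  have "fder (beta \<psi> 2) u (axis 1 1) - fder (beta \<psi> 1) u (axis 2 1) =
     2 * Y (\<psi> u) * (fder (r 2) u (axis 1 1) - fder (r 1) u (axis 2 1))
     + 2 * (fder (Y \<circ> \<psi>) u (axis 1 1) * ?w 2 u - fder (Y \<circ> \<psi>) u (axis 2 1) * ?w 1 u)"
    unfolding db sy by (simp add: algebra_simps)
  also have "fder (Y \<circ> \<psi>) u (axis 1 1) * ?w 2 u - fder (Y \<circ> \<psi>) u (axis 2 1) * ?w 1 u =
     - (Y' (\<psi> u) * e / \<rho>) * (T u $ 1 * ?w 1 u + T u $ 2 * ?w 2 u)"
    unfolding Y1 Y2 by (simp only: algebra_simps)
  finally show ?thesis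
    unfolding rT cu \<Phi>_def curlS[OF lp u] C_def[symmetric] e_def[symmetric] by (simp add: algebra_simps)
qed

lemma continuous_\<Phi>: assumes lp: "local_param M S V (\<psi> :: real^2 \<Rightarrow> 'a)" shows "continuous_on V (\<Phi> \<circ> \<psi>)"
    and continuous_\<kappa>: "continuous_on V (\<kappa> \<circ> \<psi>)" and continuous_Y': "continuous_on V (Y' \<circ> \<psi>)"
    and continuous_Y: "continuous_on V (Y \<circ> \<psi>)" and continuous_curlS: "continuous_on V (curlS \<circ> \<psi>)"
proof -
  interpret horizon_param M S N k l X V \<psi> by (rule hparam[OF lp])
  show k: "continuous_on V (\<kappa> \<circ> \<psi>)"
    using d_kappa(1) by (intro continuous_at_imp_continuous_on ballI differentiable_imp_continuous_within)
  have z: "continuous_on V (\<zeta> \<circ> \<psi>)" by (rule smooth_on_continuous_on[OF smooth_\<zeta>[OF lp]])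
  show y': "continuous_on V (Y' \<circ> \<psi>)" unfolding Y'_def comp_def
    by (intro continuous_on_poly z[unfolded comp_def])
  show y: "continuous_on V (Y \<circ> \<psi>)" by (rule smooth_on_continuous_on[OF smooth_Y[OF lp]])
  show c: "continuous_on V (curlS \<circ> \<psi>)" by (rule continuous_on_eq[OF continuous_curl[OF lp]]) (simp add: curlS[OF lp])
  show "continuous_on V (\<Phi> \<circ> \<psi>)" unfolding \<Phi>_def comp_def
    unfolding divide_inverse
    by (intro continuous_on_mult continuous_on_add continuous_on_const k[unfolded comp_def] y[unfolded comp_def] y'[unfolded comp_def] c[unfolded comp_def])
qed

text \<open>Numerator and area form are 2-forms and acquire the same Jacobian determinant.\<close>

lemma inv_wedge:
  assumes \<eta>: "test \<eta>" and lp: "local_param M S V1 (\<psi>1 :: real^2 \<Rightarrow> 'a)" "local_param M S V2 \<psi>2"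
    and u: "u1 \<in> V1" "u2 \<in> V2" "\<psi>1 u1 = \<psi>2 u2"
  shows "wedge \<eta> \<psi>1 u1 = wedge \<eta> \<psi>2 u2"
proof -
  interpret two_surface_params M S N k l X V1 \<psi>1 V2 \<psi>2 by (rule two_locale[OF lp])
  interpret H1: horizon_param M S N k l X V1 \<psi>1 by (rule hparam[OF lp(1)])
  interpret H2: horizon_param M S N k l X V2 \<psi>2 by (rule hparam[OF lp(2)])
  have W: "u2 \<in> W" using u(1,2) u(3)[symmetric] by (auto simp: W_def)
  have t: "\<tau> u2 = u1" by (rule \<tau>_eq[OF u])
  define a1 a2 b1 b2 where "a1 = fder \<tau> u2 (axis 1 1) $ 1" and "a2 = fder \<tau> u2 (axis 1 1) $ 2"
    and "b1 = fder \<tau> u2 (axis 2 1) $ 1" and "b2 = fder \<tau> u2 (axis 2 1) $ 2"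
  have J: "fder \<tau> u2 (axis 1 1) = a1 *\<^sub>R axis 1 1 + a2 *\<^sub>R axis 2 1" "fder \<tau> u2 (axis 2 1) = b1 *\<^sub>R axis 1 1 + b2 *\<^sub>R axis 2 1"
    unfolding a1_def a2_def b1_def b2_def by (rule axis2_expand)+
  have tr: "fder (f \<circ> \<psi>2) u2 (axis 1 1) = a1 * fder (f \<circ> \<psi>1) u1 (axis 1 1) + a2 * fder (f \<circ> \<psi>1) u1 (axis 2 1)"
    "fder (f \<circ> \<psi>2) u2 (axis 2 1) = b1 * fder (f \<circ> \<psi>1) u1 (axis 1 1) + b2 * fder (f \<circ> \<psi>1) u1 (axis 2 1)"
    if "(f \<circ> \<psi>1) differentiable (at u1)" for f :: "'a \<Rightarrow> real"
  proof -
    have l: "linear (fder (f \<circ> \<psi>1) u1)" using that by (simp add: frechet_derivative_works has_derivative_linear)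
    show "fder (f \<circ> \<psi>2) u2 (axis 1 1) = a1 * fder (f \<circ> \<psi>1) u1 (axis 1 1) + a2 * fder (f \<circ> \<psi>1) u1 (axis 2 1)"
    "fder (f \<circ> \<psi>2) u2 (axis 2 1) = b1 * fder (f \<circ> \<psi>1) u1 (axis 1 1) + b2 * fder (f \<circ> \<psi>1) u1 (axis 2 1)"
      using fder_\<psi>2[OF W, of f] that unfolding t by (simp_all add: J linear_add[OF l] linear_cmul[OF l])
  qed
  have d\<eta>: "(\<eta> \<circ> \<psi>1) differentiable (at u1)"
    using \<eta>[unfolded test_def, rule_format, OF lp(1)] u(1) by simp
  \<comment> \<open>The chain rule \<open>fder_\<psi>2\<close> is for functions on the leaf, and
    \<open>ThS\<close> is the expansion as such a function.\<close>
  have th1: "fder (ThS \<circ> \<psi>1) u1 = fder (expansion M l \<psi>1) u1"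
    by (rule fder_cong_open[OF K1.openV u(1)]) (simp add: ThS[OF lp(1)])
  have th2: "fder (ThS \<circ> \<psi>2) u2 = fder (expansion M l \<psi>2) u2"
    by (rule fder_cong_open[OF K2.openV u(2)]) (simp add: ThS[OF lp(2)])
  have dth: "(ThS \<circ> \<psi>1) differentiable (at u1)"
    by (rule differentiable_cong_open[OF K1.openV u(1), of "expansion M l \<psi>1"])
       (use ThS[OF lp(1)] smooth_on_has_derivative[OF K1.smooth_expansion u(1)] in \<open>auto simp: differentiable_def\<close>)
  have ex: "expansion M l \<psi>2 u2 = expansion M l \<psi>1 u1" using expansion_transform[OF W] t by simp
  have r: "rotational_1form M k l \<psi>2 u2 $ 1 = a1 * rotational_1form M k l \<psi>1 u1 $ 1 + a2 * rotational_1form M k l \<psi>1 u1 $ 2"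
    "rotational_1form M k l \<psi>2 u2 $ 2 = b1 * rotational_1form M k l \<psi>1 u1 $ 1 + b2 * rotational_1form M k l \<psi>1 u1 $ 2"
    using rotational_1form_transform[OF W, of 1] rotational_1form_transform[OF W, of 2] unfolding t a1_def a2_def b1_def b2_def by simp_all
  have b: "beta \<psi>2 1 u2 = a1 * beta \<psi>1 1 u1 + a2 * beta \<psi>1 2 u1" "beta \<psi>2 2 u2 = b1 * beta \<psi>1 1 u1 + b2 * beta \<psi>1 2 u1"
    unfolding beta_def r ex u(3) th2[symmetric] tr[OF dth] th1 by (simp_all add: algebra_simps add_divide_distrib)
  have e: "area_form M k l \<psi>2 u2 1 2 = (a1 * b2 - a2 * b1) * area_form M k l \<psi>1 u1 1 2"
    using area_form_transform[OF W] unfolding t a1_def a2_def b1_def b2_def .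
  have nz: "a1 * b2 - a2 * b1 \<noteq> 0" using K2.area_form_nz[OF u(2)] unfolding e by auto
  have "fder (\<eta> \<circ> \<psi>2) u2 (axis 1 1) * beta \<psi>2 2 u2 - fder (\<eta> \<circ> \<psi>2) u2 (axis 2 1) * beta \<psi>2 1 u2
    = (a1 * b2 - a2 * b1) * (fder (\<eta> \<circ> \<psi>1) u1 (axis 1 1) * beta \<psi>1 2 u1 - fder (\<eta> \<circ> \<psi>1) u1 (axis 2 1) * beta \<psi>1 1 u1)"
    unfolding tr[OF d\<eta>] b by (simp add: algebra_simps)
  then show ?thesis unfolding wedge_def e using nz by simp
qed

lemma cut_eq:
  assumes \<eta>: "test \<eta>" and lp: "local_param M S V (\<psi> :: real^2 \<Rightarrow> 'a)" and u: "u \<in> V"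
  shows "cut \<eta> (\<psi> u) = \<eta> (\<psi> u) * \<Phi> (\<psi> u) + wedge \<eta> \<psi> u"
    "cut \<eta> (\<psi> u) = (fder (\<lambda>u. \<eta> (\<psi> u) * beta \<psi> 2 u) u (axis 1 1) - fder (\<lambda>u. \<eta> (\<psi> u) * beta \<psi> 1 u) u (axis 2 1)) / area_form M k l \<psi> u 1 2"
proof -
  interpret horizon_param M S N k l X V \<psi> by (rule hparam[OF lp])
  show 1: "cut \<eta> (\<psi> u) = \<eta> (\<psi> u) * \<Phi> (\<psi> u) + wedge \<eta> \<psi> u"
    unfolding cut_def using on_surface_eq[where F="wedge \<eta>", OF inv_wedge[OF \<eta>] lp u] by simp
  have d\<eta>: "((\<lambda>u. \<eta> (\<psi> u)) has_derivative fder (\<eta> \<circ> \<psi>) u) (at u)"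
    using \<eta> lp Ck_on_has_derivative[of 0 V "\<eta> \<circ> \<psi>" u] u unfolding test_def by (auto simp: comp_def)
  have d: "fder (\<lambda>u. \<eta> (\<psi> u) * beta \<psi> \<alpha> u) u h = \<eta> (\<psi> u) * fder (beta \<psi> \<alpha>) u h + fder (\<eta> \<circ> \<psi>) u h * beta \<psi> \<alpha> u" for \<alpha> h
    by (rule fder_eqI[OF has_derivative_mult[OF d\<eta> smooth_on_has_derivative[OF smooth_beta[OF lp] u]], THEN fun_cong])
  have "fder (\<lambda>u. \<eta> (\<psi> u) * beta \<psi> 2 u) u (axis 1 1) - fder (\<lambda>u. \<eta> (\<psi> u) * beta \<psi> 1 u) u (axis 2 1) =
     \<eta> (\<psi> u) * (fder (beta \<psi> 2) u (axis 1 1) - fder (beta \<psi> 1) u (axis 2 1))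
     + (fder (\<eta> \<circ> \<psi>) u (axis 1 1) * beta \<psi> 2 u - fder (\<eta> \<circ> \<psi>) u (axis 2 1) * beta \<psi> 1 u)"
    unfolding d by (simp add: algebra_simps)
  then show "cut \<eta> (\<psi> u) = (fder (\<lambda>u. \<eta> (\<psi> u) * beta \<psi> 2 u) u (axis 1 1) - fder (\<lambda>u. \<eta> (\<psi> u) * beta \<psi> 1 u) u (axis 2 1)) / area_form M k l \<psi> u 1 2"
    unfolding 1 wedge_def d_beta[OF lp u] using area_form_nz[OF u] by (simp add: add_divide_distrib)
qed

lemma continuous_cut: assumes \<eta>: "test \<eta>" shows "continuous_on S (cut \<eta>)"
proof (rule continuous_on_S)
  fix V \<psi> assume lp: "local_param M S V (\<psi> :: real^2 \<Rightarrow> 'a)"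
  interpret horizon_param M S N k l X V \<psi> by (rule hparam[OF lp])
  have C: "Ck_on (Suc 0) V (\<eta> \<circ> \<psi>)" using \<eta> lp unfolding test_def by blast
  have c1: "continuous_on V (\<lambda>u. \<eta> (\<psi> u))" using Ck_on_imp_continuous_on[OF C] by (simp add: comp_def)
  have c2: "continuous_on V (\<lambda>u. fder (\<eta> \<circ> \<psi>) u v)" for v using Ck_on_fder[OF C, of v] by simp
  have c3: "continuous_on V (beta \<psi> \<alpha>)" for \<alpha> by (rule smooth_on_continuous_on[OF smooth_beta[OF lp]])
  have "continuous_on V (\<lambda>u. \<eta> (\<psi> u) * \<Phi> (\<psi> u) + wedge \<eta> \<psi> u)"
    unfolding wedge_def
    by (intro continuous_on_add continuous_on_mult continuous_on_divide continuous_on_diff c1 c2 c3 continuous_area_form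
       continuous_\<Phi>[OF lp, unfolded comp_def]) (use area_form_nz in blast)
  then show "continuous_on V (cut \<eta> \<circ> \<psi>)"
    by (rule continuous_on_eq) (simp add: cut_eq(1)[OF \<eta> lp])
qed

text \<open>The integrand is the exterior derivative of a 1-form with compact support in one patch,
  hence a difference of two coordinate derivatives with integral zero. The sign \<open>s\<close>
  compares the area measure, which has density |\<epsilon>_12|, with the area form itself.\<close>

lemma integral_cut_zero:
  assumes \<eta>: "test \<eta>" and lp: "local_param M S V (\<psi> :: real^2 \<Rightarrow> 'a)" and K: "compact K" "K \<inter> S \<subseteq> \<psi> ` V" "\<And>p. p \<notin> K \<Longrightarrow> \<eta> p = 0"
    and s: "s = 1 \<or> s = -1" "\<And>u. u \<in> V \<Longrightarrow> s * area_form M k l \<psi> u 1 2 > 0"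
  shows "(LINT p:S|\<mu>. cut \<eta> p) = 0"
proof -
  interpret horizon_param M S N k l X V \<psi> by (rule hparam[OF lp])
  have cK: "closed K" by (rule compact_imp_closed[OF K(1)])
  have "compact (K \<inter> S)" using css K(1) by (intro compact_Int) (auto simp: closed_spacelike_surface_def)
  then have C: "compact (inv_into V \<psi> ` (K \<inter> S))"
    by (intro compact_continuous_image continuous_on_subset[OF homeomorphism_cont2[OF homeo] K(2)])
  have CV: "inv_into V \<psi> ` (K \<inter> S) \<subseteq> V" using K(2) by (auto intro: inv_into_into)
  have z: "\<eta> (\<psi> u) = 0" if "u \<in> V" "u \<notin> inv_into V \<psi> ` (K \<inter> S)" for u
  proof -
    have "\<psi> u \<notin> K" using that homeomorphism_apply1[OF homeo that(1)] \<psi>S[OF that(1)] by (metis IntI imageI)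
    then show ?thesis by (rule K(3))
  qed
  \<comment> \<open>Outside the closed set \<open>K\<close> the function \<eta> vanishes on a
    neighbourhood, so its differential vanishes as well.\<close>
  have z2: "cut \<eta> p = 0" if p: "p \<in> S" "p \<notin> \<psi> ` V" for p
  proof -
    obtain V2 \<psi>2 u where L: "local_param M S V2 (\<psi>2 :: real^2 \<Rightarrow> 'a)" "u \<in> V2" "\<psi>2 u = p" using ex_param[OF p(1)] by blast
    interpret H2: horizon_param M S N k l X V2 \<psi>2 by (rule hparam[OF L(1)])
    have pK: "p \<notin> K" using p K(2) by blast
    have o: "open {u\<in>V2. \<psi>2 u \<in> - K}" by (rule H2.open_preimage) (use cK in \<open>simp add: open_Compl\<close>)
    have "fder (\<eta> \<circ> \<psi>2) u = fder (\<lambda>_. 0) u"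
      by (rule fder_cong_open[OF o]) (use L pK K(3) in auto)
    then show ?thesis using cut_eq(1)[OF \<eta> L(1,2)] L(3) K(3)[OF pK] by (simp add: wedge_def)
  qed
  have m: "(\<lambda>p. indicator (\<psi> ` V) p *\<^sub>R cut \<eta> p) \<in> borel_measurable borel"
  proof -
    have "\<psi> ` V \<subseteq> S" using \<psi>S by blast
    from continuous_on_subset[OF continuous_cut[OF \<eta>] this] show ?thesis
      by (rule borel_measurable_continuous_on_indicator[OF image_borel])
  qed
  have C1: "Ck_on (Suc 0) V (\<lambda>u. \<eta> (\<psi> u) * beta \<psi> \<alpha> u)" for \<alpha>
    using \<eta> lp unfolding test_def comp_def by (intro Ck_on_mult openV smooth_on_Ck[OF smooth_beta[OF lp]]) auto
  have i0: "(LINT u:V|lborel. fder (\<lambda>u. \<eta> (\<psi> u) * beta \<psi> \<alpha> u) u v) = 0" for \<alpha> v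
    by (rule integral_fder_open[OF openV C1 C CV]) (simp add: z)
  have ii: "set_integrable lborel V (\<lambda>u. fder (\<lambda>u. \<eta> (\<psi> u) * beta \<psi> \<alpha> u) u v)" for \<alpha> v
  proof -
    let ?D = "\<lambda>u. fder (\<lambda>u. \<eta> (\<psi> u) * beta \<psi> \<alpha> u) u v"
    let ?C = "inv_into V \<psi> ` (K \<inter> S)"
    have cD: "continuous_on V ?D" using Ck_on_fder[OF C1] by simp
    have oV: "open (V - ?C)" by (rule open_Diff[OF openV compact_imp_closed[OF C]])
    have D0: "?D u = 0" if "u \<in> V" "u \<notin> ?C" for u
      using fder_cong_open[OF oV, of u "\<lambda>u. \<eta> (\<psi> u) * beta \<psi> \<alpha> u" "\<lambda>_. 0"] that z by simp
    have eq: "indicator V u *\<^sub>R ?D u = indicator ?C u *\<^sub>R ?D u" for u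
      using D0[of u] CV by (auto simp: indicator_def)
    have "integrable lborel (\<lambda>u. indicator ?C u *\<^sub>R ?D u)"
      by (rule borel_integrable_compact[OF C continuous_on_subset[OF cD CV]])
    then show ?thesis unfolding set_integrable_def eq .
  qed
  have pt: "sqrt (det (induced M \<psi> u)) * cut \<eta> (\<psi> u) =
     s * (fder (\<lambda>u. \<eta> (\<psi> u) * beta \<psi> 2 u) u (axis 1 1) - fder (\<lambda>u. \<eta> (\<psi> u) * beta \<psi> 1 u) u (axis 2 1))" if u: "u \<in> V" for u
  proof -
    have "sqrt (det (induced M \<psi> u)) = \<bar>area_form M k l \<psi> u 1 2\<bar>"
      unfolding area_form_sq[OF u, symmetric] by simp
    also have "\<dots> = s * area_form M k l \<psi> u 1 2" using s(1) s(2)[OF u] by auto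
    finally show ?thesis unfolding cut_eq(2)[OF \<eta> lp u] using area_form_nz[OF u] by simp
  qed
  have "(LINT p:S|\<mu>. cut \<eta> p) = (LINT u:V|lborel. sqrt (det (induced M \<psi> u)) * cut \<eta> (\<psi> u))"
    by (rule area_integral_patch[OF lp m z2])
  also have "\<dots> = (LINT u:V|lborel. s * (fder (\<lambda>u. \<eta> (\<psi> u) * beta \<psi> 2 u) u (axis 1 1) - fder (\<lambda>u. \<eta> (\<psi> u) * beta \<psi> 1 u) u (axis 2 1)))"
    by (rule set_lebesgue_integral_cong) (use openV pt in auto)
  also have "\<dots> = s * ((LINT u:V|lborel. fder (\<lambda>u. \<eta> (\<psi> u) * beta \<psi> 2 u) u (axis 1 1)) - (LINT u:V|lborel. fder (\<lambda>u. \<eta> (\<psi> u) * beta \<psi> 1 u) u (axis 2 1)))"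
    unfolding set_integral_mult_right set_integral_diff(2)[OF ii ii] ..
  finally show ?thesis unfolding i0 by simp
qed

definition cutoff :: "'a set \<Rightarrow> ('a \<Rightarrow> real) \<Rightarrow> bool" where
  "cutoff Z b \<longleftrightarrow> open Z \<and> (\<forall>x. b x \<ge> 0) \<and> (\<forall>x\<in>Z. b x > 0) \<and> test b \<and>
    (\<exists>V \<psi> K s. local_param M S V (\<psi> :: real^2 \<Rightarrow> 'a) \<and> compact K \<and> K \<inter> S \<subseteq> \<psi> ` V \<and> (\<forall>x. x \<notin> K \<longrightarrow> b x = 0) \<and>
      (s = 1 \<or> s = -1) \<and> (\<forall>u\<in>V. s * area_form M k l \<psi> u 1 2 > 0))"

lemma exists_cutoff:
  assumes p: "p \<in> S"
  shows "\<exists>Z b. p \<in> Z \<and> cutoff Z b"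
proof -
  obtain V0 \<psi> u0 where L0: "local_param M S V0 (\<psi> :: real^2 \<Rightarrow> 'a)" "u0 \<in> V0" "\<psi> u0 = p" using ex_param[OF p] by blast
  interpret H0: horizon_param M S N k l X V0 \<psi> by (rule hparam[OF L0(1)])
  obtain d where d: "d > 0" "ball u0 d \<subseteq> V0" using H0.openV L0(2) open_contains_ball by blast
  \<comment> \<open>A ball is connected, so the area form, being continuous without zeros, has
    constant sign on it.\<close>
  define V where "V = ball u0 d"
  have lp: "local_param M S V (\<psi> :: real^2 \<Rightarrow> 'a)" unfolding V_def by (rule H0.restrict_param[OF d(2)]) simp
  have u0: "u0 \<in> V" using d by (simp add: V_def)
  interpret H: horizon_param M S N k l X V \<psi> by (rule hparam[OF lp])
  obtain s :: real where s: "s = 1 \<or> s = -1" "\<And>u. u \<in> V \<Longrightarrow> s * area_form M k l \<psi> u 1 2 > 0"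
  proof -
    let ?e = "\<lambda>u. area_form M k l \<psi> u 1 2"
    have con: "connected (?e ` V)" unfolding V_def
      by (rule connected_continuous_image[OF _ connected_ball]) (use H.continuous_area_form in \<open>simp add: V_def\<close>)
    have n0: "0 \<notin> ?e ` V" using H.area_form_nz by force
    show ?thesis
    proof (cases "?e u0 > 0")
      case True
      have "?e u > 0" if u: "u \<in> V" for u
      proof (rule ccontr)
        assume "\<not> ?e u > 0"
        then have "0 \<in> ?e ` V" using connectedD_interval[OF con, of "?e u" "?e u0" 0] u u0 True by auto
        then show False using n0 by blast
      qed
      then show ?thesis using that[of 1] by simp
    next
      case False
      have "?e u < 0" if u: "u \<in> V" for u
      proof (rule ccontr)
        assume "\<not> ?e u < 0"
        then have "0 \<in> ?e ` V" using connectedD_interval[OF con, of "?e u0" "?e u" 0] u u0 False by auto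
        then show False using n0 by blast
      qed
      then show ?thesis using that[of "-1"] by simp
    qed
  qed
  obtain Z0 where Z0: "open Z0" "\<psi> ` V = S \<inter> Z0" using lp unfolding local_param_def by (metis openin_open)
  define c where "c = chart_at M p"
  have c: "c \<in> charts M" "p \<in> fst c" using chart_at by (auto simp: c_def)
  have pZ0: "p \<in> Z0" using Z0(2) u0 L0(3) by blast
  have "open (snd c ` (fst c \<inter> Z0))" by (rule open_chart_image[OF c(1) Z0(1)])
  moreover have "snd c p \<in> snd c ` (fst c \<inter> Z0)" using c pZ0 by blast
  \<comment> \<open>The coordinate ball is taken inside \<open>Z0\<close>, so that the leaf meets it
    only within the patch.\<close>
  ultimately obtain r where r: "r > 0" "cball (snd c p) r \<subseteq> snd c ` (fst c \<inter> Z0)"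
    using open_contains_cball by blast
  have rc: "cball (snd c p) r \<subseteq> snd c ` fst c" using r(2) by blast
  define b where "b = bump c (snd c p) r"
  define K where "K = coord_inv c ` cball (snd c p) r"
  define Z where "Z = fst c \<inter> snd c -` ball (snd c p) r"
  have z1: "open Z" unfolding Z_def
    by (rule continuous_open_preimage[OF homeomorphism_cont1[OF chart_homeo[OF c(1)]] chart_open[OF c(1)]]) simp
  have z2: "p \<in> Z" using c r by (simp add: Z_def)
  have z3: "\<forall>x. b x \<ge> 0" by (simp add: b_def bump_nonneg)
  have z4: "\<forall>x\<in>Z. b x > 0" using bump_pos r by (auto simp: b_def Z_def)
  have z5: "test b" unfolding test_def
  proof (intro allI impI)
    fix V' \<psi>' assume lp': "local_param M S V' (\<psi>' :: real^2 \<Rightarrow> 'a)"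
    interpret P: horizon_param M S N k l X V' \<psi>' by (rule hparam[OF lp'])
    show "Ck_on (Suc 0) V' (b \<circ> \<psi>')" unfolding b_def by (rule P.Ck_bump[OF c(1) r(1) rc])
  qed
  have z6: "compact K" unfolding K_def by (rule compact_coord_ball[OF c(1) rc])
  have z7: "K \<inter> S \<subseteq> \<psi> ` V"
  proof
    fix x assume x: "x \<in> K \<inter> S"
    then obtain y where y: "y \<in> cball (snd c p) r" "x = coord_inv c y" by (auto simp: K_def)
    then obtain z where z: "z \<in> fst c" "z \<in> Z0" "y = snd c z" using r(2) by blast
    then have "x = z" using y coord_inv_snd[OF c(1) z(1)] by simp
    then show "x \<in> \<psi> ` V" using Z0(2) z x by blast
  qed
  have z8: "\<forall>x. x \<notin> K \<longrightarrow> b x = 0" using bump_zero[OF c(1) r(1)] by (simp add: b_def K_def)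
  have "\<exists>V \<psi> K s. local_param M S V (\<psi> :: real^2 \<Rightarrow> 'a) \<and> compact K \<and> K \<inter> S \<subseteq> \<psi> ` V \<and> (\<forall>x. x \<notin> K \<longrightarrow> b x = 0) \<and>
      (s = 1 \<or> s = -1) \<and> (\<forall>u\<in>V. s * area_form M k l \<psi> u 1 2 > 0)"
    by (rule exI[of _ V], rule exI[of _ \<psi>], rule exI[of _ K], rule exI[of _ s]) (use lp z6 z7 z8 s in simp)
  then have "cutoff Z b" unfolding cutoff_def using z1 z3 z4 z5 by simp
  with z2 show ?thesis by blast
qed

text \<open>A partition of unity: bumps that are positive on finitely many sets covering the compact
  leaf are divided by their sum, and \<open>integral_cut_zero\<close> applies to each of the
  resulting functions.\<close>

theorem stokes: "(LINT p:S|\<mu>. \<Phi> p) = 0"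
proof -
  have "\<forall>p\<in>S. \<exists>Zb. p \<in> fst Zb \<and> cutoff (fst Zb) (snd Zb)" using exists_cutoff by force
  from bchoice[OF this] obtain Zb where Zb: "\<forall>p\<in>S. p \<in> fst (Zb p) \<and> cutoff (fst (Zb p)) (snd (Zb p))" ..
  define Z where "Z p = fst (Zb p)" for p
  define b where "b p = snd (Zb p)" for p
  have bZ: "p \<in> Z p" "cutoff (Z p) (b p)" if "p \<in> S" for p
    using Zb that unfolding Z_def b_def by simp_all
  have Zo: "open (Z p)" "p \<in> Z p" "b p x \<ge> 0" "x \<in> Z p \<Longrightarrow> b p x > 0" "test (b p)" if "p \<in> S" for p x
    using bZ[OF that] unfolding cutoff_def by simp_all
  have cS: "compact S" using css by (simp add: closed_spacelike_surface_def)
  obtain C where C: "C \<subseteq> S" "finite C" "S \<subseteq> (\<Union>p\<in>C. Z p)"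
    by (rule compactE_image[OF cS, of S Z]) (use Zo in auto)
  define \<sigma> where "\<sigma> x = (\<Sum>p\<in>C. b p x)" for x
  define \<eta> where "\<eta> p x = b p x / \<sigma> x" for p x
  have \<sigma>: "\<sigma> x > 0" if x: "x \<in> S" for x
  proof -
    obtain p where p: "p \<in> C" "x \<in> Z p" using C(3) x by blast
    show ?thesis unfolding \<sigma>_def
      by (rule sum_pos2[OF C(2) p(1)]) (use Zo(4)[of p x] Zo(3) p C(1) in auto)
  qed
  have tst: "test (\<eta> p)" if p: "p \<in> C" for p
    unfolding test_def
  proof (intro allI impI)
    fix V \<psi> assume lp: "local_param M S V (\<psi> :: real^2 \<Rightarrow> 'a)"
    interpret H: horizon_param M S N k l X V \<psi> by (rule hparam[OF lp])
    have bC: "Ck_on (Suc 0) V (\<lambda>u. b p (\<psi> u))" if "p \<in> C" for p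
      using Zo(5)[of p] that C(1) lp unfolding test_def comp_def by blast
    have "Ck_on (Suc 0) V (\<lambda>u. b p (\<psi> u) / \<sigma> (\<psi> u))"
    proof (rule Ck_on_divide[OF H.openV _ bC[OF p]])
      show "Ck_on (Suc 0) V (\<lambda>u. \<sigma> (\<psi> u))" unfolding \<sigma>_def by (rule Ck_on_sum[OF H.openV bC])
      show "\<sigma> (\<psi> x) \<noteq> 0" if "x \<in> V" for x using \<sigma>[OF H.\<psi>S[OF that]] by simp
    qed
    then show "Ck_on (Suc 0) V (\<eta> p \<circ> \<psi>)" unfolding \<eta>_def comp_def .
  qed
  have one: "(\<Sum>p\<in>C. \<eta> p x) = 1" if "x \<in> S" for x
    using \<sigma>[OF that] unfolding \<eta>_def sum_divide_distrib[symmetric] \<sigma>_def[symmetric] by simp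
  have int0: "(LINT x:S|\<mu>. cut (\<eta> p) x) = 0" if p: "p \<in> C" for p
  proof -
    have "p \<in> S" using p C(1) by blast
    then obtain V \<psi> K s where d: "local_param M S V (\<psi> :: real^2 \<Rightarrow> 'a)" "compact K" "K \<inter> S \<subseteq> \<psi> ` V" "\<And>x. x \<notin> K \<Longrightarrow> b p x = 0"
      "s = 1 \<or> s = -1" "\<And>u. u \<in> V \<Longrightarrow> s * area_form M k l \<psi> u 1 2 > 0" using bZ(2)[of p] unfolding cutoff_def by metis
    show ?thesis
      by (rule integral_cut_zero[OF tst[OF p] d(1-3) _ d(5,6)]) (simp add: \<eta>_def d(4))
  qed
  \<comment> \<open>The functions \<open>\<eta> p\<close> add up to 1 on the leaf, so their
    differentials add up to 0 and the \<open>wedge\<close> terms cancel.\<close>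
  have dec: "\<Phi> x = (\<Sum>p\<in>C. cut (\<eta> p) x)" if x: "x \<in> S" for x
  proof -
    obtain V \<psi> u where L: "local_param M S V (\<psi> :: real^2 \<Rightarrow> 'a)" "u \<in> V" "\<psi> u = x" using ex_param[OF x] by blast
    interpret H: horizon_param M S N k l X V \<psi> by (rule hparam[OF L(1)])
    have d: "((\<eta> p \<circ> \<psi>) has_derivative fder (\<eta> p \<circ> \<psi>) u) (at u)" if "p \<in> C" for p
      using tst[OF that] L(1,2) Ck_on_has_derivative[of 0 V "\<eta> p \<circ> \<psi>" u] unfolding test_def by blast
    have "((\<lambda>u. \<Sum>p\<in>C. (\<eta> p \<circ> \<psi>) u) has_derivative (\<lambda>h. \<Sum>p\<in>C. fder (\<eta> p \<circ> \<psi>) u h)) (at u)"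
      by (rule has_derivative_sum[OF d])
    then have "((\<lambda>u. 1) has_derivative (\<lambda>h. \<Sum>p\<in>C. fder (\<eta> p \<circ> \<psi>) u h)) (at u)"
      by (rule has_derivative_transform_within_open[OF _ H.openV L(2)]) (simp add: one[OF H.\<psi>S])
    from has_derivative_unique[OF this has_derivative_const] have z: "(\<Sum>p\<in>C. fder (\<eta> p \<circ> \<psi>) u h) = 0" for h
      by (simp add: fun_eq_iff)
    have "(\<Sum>p\<in>C. wedge (\<eta> p) \<psi> u) = ((\<Sum>p\<in>C. fder (\<eta> p \<circ> \<psi>) u (axis 1 1)) * beta \<psi> 2 u - (\<Sum>p\<in>C. fder (\<eta> p \<circ> \<psi>) u (axis 2 1)) * beta \<psi> 1 u) / area_form M k l \<psi> u 1 2"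
      unfolding wedge_def by (simp only: sum_divide_distrib[symmetric] sum_subtractf sum_distrib_right)
    then have w: "(\<Sum>p\<in>C. wedge (\<eta> p) \<psi> u) = 0" unfolding z by simp
    have "(\<Sum>p\<in>C. cut (\<eta> p) x) = (\<Sum>p\<in>C. \<eta> p x * \<Phi> x + wedge (\<eta> p) \<psi> u)"
      using cut_eq(1)[OF tst L(1,2)] unfolding L(3) by (intro sum.cong) auto
    also have "\<dots> = \<Phi> x" unfolding sum.distrib w sum_distrib_right[symmetric] one[OF x] by simp
    finally show ?thesis by simp
  qed
  have i: "integrable \<mu> (\<lambda>x. indicator S x *\<^sub>R cut (\<eta> p) x)" if "p \<in> C" for p
    using integrable_on_S[OF ne continuous_cut[OF tst[OF that]]] unfolding set_integrable_def .
  have "(LINT p:S|\<mu>. \<Phi> p) = (LINT x|\<mu>. (\<Sum>p\<in>C. indicator S x *\<^sub>R cut (\<eta> p) x))"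
    unfolding set_lebesgue_integral_def
    by (intro Bochner_Integration.integral_cong refl) (simp add: dec indicator_def)
  also have "\<dots> = (\<Sum>p\<in>C. (LINT x|\<mu>. indicator S x *\<^sub>R cut (\<eta> p) x))"
    by (rule Bochner_Integration.integral_sum[OF i])
  also have "\<dots> = 0" using int0 unfolding set_lebesgue_integral_def by simp
  finally show ?thesis .
qed

lemma spin_integral:
  "(LINT p:S|\<mu>. 2 * curlS p * Y p) = (LINT p:S - zeros_on M X S|\<mu>. - 2 * \<kappa> p * Y' p / \<rho>)"
proof -
  let ?f = "\<lambda>p. 2 * curlS p * Y p" and ?g = "\<lambda>p. - 2 * \<kappa> p * Y' p / \<rho>"
  have cf: "continuous_on S ?f"
    by (rule continuous_on_S) (unfold comp_def, intro continuous_on_mult continuous_on_const continuous_curlS[unfolded comp_def] continuous_Y[unfolded comp_def])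
  have cg: "continuous_on S ?g"
    by (rule continuous_on_S) (unfold comp_def divide_inverse, intro continuous_on_mult continuous_on_const continuous_\<kappa>[unfolded comp_def] continuous_Y'[unfolded comp_def])
  have "\<Phi> p = ?f p - ?g p" for p unfolding \<Phi>_def by (simp add: algebra_simps)
  then have "(LINT p:S|\<mu>. ?f p - ?g p) = 0" using stokes by simp
  then have "(LINT p:S|\<mu>. ?f p) = (LINT p:S|\<mu>. ?g p)"
    unfolding set_integral_diff(2)[OF integrable_on_S[OF ne cf] integrable_on_S[OF ne cg]] by simp
  also have "\<dots> = (LINT p:S - zeros_on M X S|\<mu>. ?g p)"
  \<comment> \<open>The zeros of \<open>X\<close> form a finite set of measure zero, so they can be
    left out.\<close>
  proof -
    have zS: "zeros_on M X S \<subseteq> S" by (auto simp: zeros_on_def)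
    have zm: "zeros_on M X S \<in> sets \<mu>" using finite_imp_closed[OF fz] sets_\<mu>[OF ne] by simp
    have "emeasure \<mu> (zeros_on M X S) = (\<Sum>p\<in>zeros_on M X S. emeasure \<mu> {p})"
      by (rule emeasure_eq_sum_singleton[OF fz]) (simp add: sets_\<mu>[OF ne])
    also have "\<dots> = 0" using area_point zS by (intro sum.neutral) blast
    finally have "zeros_on M X S \<in> null_sets \<mu>" using zm by (rule null_setsI)
    from AE_not_in[OF this] have "AE p in \<mu>. indicator S p *\<^sub>R ?g p = indicator (S - zeros_on M X S) p *\<^sub>R ?g p"
      by eventually_elim (auto simp: indicator_def)
    moreover have mS: "(\<lambda>p. indicator S p *\<^sub>R ?g p) \<in> borel_measurable \<mu>"
      using integrable_on_S[OF ne cg] unfolding set_integrable_def by (rule borel_measurable_integrable)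
    moreover have "(\<lambda>p. indicator (S - zeros_on M X S) p *\<^sub>R ?g p) \<in> borel_measurable \<mu>"
    proof -
      have "(\<lambda>p. indicator (- zeros_on M X S) p *\<^sub>R (indicator S p *\<^sub>R ?g p)) \<in> borel_measurable \<mu>"
        by (rule borel_measurable_scaleR[OF borel_measurable_indicator mS]) (use zm sets.compl_sets[OF zm] sets_eq_imp_space_eq[OF sets_\<mu>[OF ne]] in \<open>simp add: Compl_eq_Diff_UNIV\<close>)
      moreover have eq: "(\<lambda>p. indicator (- zeros_on M X S) p *\<^sub>R (indicator S p *\<^sub>R ?g p)) = (\<lambda>p. indicator (S - zeros_on M X S) p *\<^sub>R ?g p)"
        by (auto simp: indicator_def fun_eq_iff)
      ultimately show ?thesis by (simp only: eq)
    qed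
    ultimately show ?thesis unfolding set_lebesgue_integral_def by (intro integral_cong_AE)
  qed
  finally show ?thesis .
qed

lemma twist_derivative:
  assumes lp: "local_param M S V (\<psi> :: real^2 \<Rightarrow> 'a)" and u: "u \<in> V" "\<psi> u \<notin> zeros_on M X S"
  shows "1 / norm_sq M X (\<psi> u) * fder (Y \<circ> \<psi>) u (tangent_part M (twist M X) \<psi> u) = - 2 * \<kappa> (\<psi> u) * Y' (\<psi> u) / \<rho>"
proof -
  interpret horizon_param M S N k l X V \<psi> by (rule hparam[OF lp])
  define e D q11 q12 q22 T1 T2 K where "e = area_form M k l \<psi> u 1 2" and "D = det (induced M \<psi> u)"
    and "q11 = induced M \<psi> u $ 1 $ 1" and "q12 = induced M \<psi> u $ 1 $ 2" and "q22 = induced M \<psi> u $ 2 $ 2"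
    and "T1 = T u $ 1" and "T2 = T u $ 2" and "K = \<kappa> (\<psi> u)"
  note defs = e_def[symmetric] D_def[symmetric] q11_def[symmetric] q12_def[symmetric] q22_def[symmetric] T1_def[symmetric] T2_def[symmetric] K_def[symmetric]
  have D: "D > 0" unfolding D_def by (rule qinv(5)[OF u(1)])
  have eD: "e * e = D" using area_form_sq[OF u(1)] by (simp add: e_def D_def power2_eq_square)
  define n where "n = q11 * T1 * T1 + 2 * q12 * T1 * T2 + q22 * T2 * T2"
  have nn: "norm_sq M X (\<psi> u) = n"
    unfolding norm_sq_eq[OF u(1)] t3_sum sum_2 induced_sym[of u 2 1] n_def defs by (simp add: algebra_simps)
  have "T u \<noteq> 0" using u zeros_iff[OF u(1)] by simp
  then have n0: "n > 0" using induced_pos[OF u(1)] norm_sq_eq[OF u(1)] nn by simp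
  \<comment> \<open>The raised components of the twist. In \<open>T1 * B - T2 * A\<close> the square
    norm \<open>n\<close> of \<open>X\<close> reappears, and \<open>e * e = D\<close> removes the
    determinant that comes from raising the index.\<close>
  define A B where "A = (q22 * (2 * K * e * T2) - q12 * (- 2 * K * e * T1)) / D" and "B = (q11 * (- 2 * K * e * T1) - q12 * (2 * K * e * T2)) / D"
  have AB: "tangent_part M (twist M X) \<psi> u $ 1 = A" "tangent_part M (twist M X) \<psi> u $ 2 = B"
    unfolding tangent_part_2[OF u(1), of "twist M X"] twist_tangent_low[OF u(1)] defs A_def B_def by simp_all
  have "T1 * B - T2 * A = - 2 * K * e * n / D"
    proof -
    have "T1 * B - T2 * A = (T1 * (q11 * (- 2 * K * e * T1) - q12 * (2 * K * e * T2)) - T2 * (q22 * (2 * K * e * T2) - q12 * (- 2 * K * e * T1))) / D"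
      by (simp only: A_def B_def times_divide_eq_right diff_divide_distrib[symmetric])
    also have "T1 * (q11 * (- 2 * K * e * T1) - q12 * (2 * K * e * T2)) - T2 * (q22 * (2 * K * e * T2) - q12 * (- 2 * K * e * T1)) = - 2 * K * e * n"
      unfolding n_def by (simp add: algebra_simps)
    finally show ?thesis .
  qed
  then have "e * (T1 * B - T2 * A) = e * (- 2 * K * e * n / D)" by (simp only:)
  also have "\<dots> = (e * e) * (- 2 * K * n) / D" by (simp only: times_divide_eq_right mult.assoc mult.left_commute)
  also have "\<dots> = - 2 * K * n" unfolding eD using D by simp
  finally have eT: "e * (T1 * B - T2 * A) = - 2 * K * n" .
  have "fder (Y \<circ> \<psi>) u (tangent_part M (twist M X) \<psi> u) = Y' (\<psi> u) * (- 2 * K * n / \<rho>)"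
    unfolding d_Y[OF lp u(1)] d_\<zeta>[OF lp u(1)] AB defs eT ..
  then show ?thesis unfolding nn defs using n0 by simp
qed

end

section \<open>The spin multipoles\<close>

lemma higher_deriv_poly: "(deriv ^^ n) (poly (q :: real poly)) = poly ((pderiv ^^ n) q)"
proof (induction n)
  case (Suc n)
  have "deriv (poly p) = poly (pderiv p)" for p :: "real poly"
    by (rule ext) (rule DERIV_imp_deriv[OF poly_DERIV])
  with Suc show ?case by simp
qed simp

text \<open>For order 0 the square root in the associated Legendre function and the phase are both
  1, and Rodrigues' formula differentiates a polynomial. The range of \<open>\<zeta>\<close> matters
  for \<open>cos (arccos (\<zeta> p)) = \<zeta> p\<close>.\<close>

lemma zonal_harmonic_poly:
  "\<exists>q :: real poly. \<forall>\<zeta> \<phi> (p :: 'a). \<zeta> p \<in> {-1..1} \<longrightarrow> harmonic_on \<zeta> \<phi> n 0 p = of_real (poly q (\<zeta> p))"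
proof (intro exI allI impI)
  fix \<zeta> \<phi> :: "'a \<Rightarrow> real" and p assume "\<zeta> p \<in> {-1..1}"
  then have c: "cos (arccos (\<zeta> p)) = \<zeta> p" by simp
  have "(\<lambda>y::real. (y\<^sup>2 - 1) ^ n) = poly ([:-1, 0, 1:] ^ n)"
    by (simp add: fun_eq_iff power2_eq_square)
  then have "((deriv ^^ n) (\<lambda>y. (y\<^sup>2 - 1) ^ n)) x = poly ((pderiv ^^ n) ([:-1, 0, 1:] ^ n)) x" for x :: real
    by (simp only: higher_deriv_poly)
  then show "harmonic_on \<zeta> \<phi> n 0 p = of_real (poly (smult (sqrt ((2 * real n + 1) / (4 * pi)) / (2 ^ n * fact n)) ((pderiv ^^ n) ([:-1, 0, 1:] ^ n))) (\<zeta> p))"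
    unfolding harmonic_on_def spherical_harmonic_def assoc_legendre_def c by (simp add: Let_def)
qed

section \<open>Comparison of different null normals of the same leaf\<close>

context killing_surface begin

text \<open>A horizon only provides some null normal of nonzero expansion. It is a combination of \<open>k\<close>
  and \<open>l\<close>, and \<open>k\<close> does not contribute to its expansion.\<close>

lemma expansion_nonzero:
  assumes mt: "\<And>p. p \<in> S \<Longrightarrow> on_surface M S (expansion M k) p = 0"
    and n': "null_normals M S k' l'" "\<And>p. p \<in> S \<Longrightarrow> on_surface M S (expansion M l') p \<noteq> 0"
    and lp: "local_param M S V (\<psi> :: real^2 \<Rightarrow> 'a)" and u: "u \<in> V"
  shows "expansion M l \<psi> u \<noteq> 0"
proof -
  interpret P: killing_surface_param M S N k l X V \<psi> by (rule param_locale[OF lp])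
  have p: "\<psi> u \<in> S" by (rule P.\<psi>S[OF u])
  define \<psi>0 where "\<psi>0 = fst (sel (\<psi> u))"
  define u0 where "u0 = snd (sel (\<psi> u))"
  obtain V0 where L: "local_param M S V0 \<psi>0" "u0 \<in> V0" "\<psi>0 u0 = \<psi> u"
    using sel[OF p] unfolding \<psi>0_def u0_def by blast
  interpret K: killing_surface_param M S N k l X V0 \<psi>0 by (rule param_locale[OF L(1)])
  interpret s': killing_surface M S N k' l' X
    by unfold_locales (use css n'(1) oN SN kf tang in auto)
  interpret K': killing_surface_param M S N k' l' X V0 \<psi>0 by (rule s'.param_locale[OF L(1)])
  interpret sw: killing_surface M S N l k X
    by unfold_locales (use css null_normals_swap[OF nn] oN SN kf tang in auto)
  interpret Kw: killing_surface_param M S N l k X V0 \<psi>0 by (rule sw.param_locale[OF L(1)])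
  define c where "c = chart_at M (\<psi>0 u0)"
  have c: "c \<in> charts M" "u0 \<in> K.dom c" using chart_at K.dom_chart_at[OF L(2)] by (auto simp: c_def)
  obtain a b where ab: "l' c (\<psi>0 u0) = a *\<^sub>R k c (\<psi>0 u0) + b *\<^sub>R l c (\<psi>0 u0)"
    using K.normal_span[OF L(2), of "l' c (\<psi>0 u0)"] K'.normals(5)[OF c] unfolding c_def by blast
  have "expansion M l' \<psi>0 u0 = normal_trace M c \<psi>0 u0 (l' c (\<psi>0 u0))"
    unfolding c_def by (rule K'.expansion_normal_trace[OF L(2)])
  also have "\<dots> = a * expansion M k \<psi>0 u0 + b * expansion M l \<psi>0 u0"
    unfolding ab unfolding K.expansion_normal_trace[OF L(2)] Kw.expansion_normal_trace[OF L(2)] c_def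
    by (rule K.normal_trace_linear[OF L(2)])
  also have "expansion M k \<psi>0 u0 = 0"
    using mt[OF p] unfolding on_surface_sel \<psi>0_def u0_def .
  finally have "expansion M l' \<psi>0 u0 = b * expansion M l \<psi>0 u0" by simp
  moreover have "expansion M l' \<psi>0 u0 \<noteq> 0"
    using n'(2)[OF p] unfolding on_surface_sel \<psi>0_def u0_def .
  ultimately have "expansion M l \<psi>0 u0 \<noteq> 0" by auto
  then show ?thesis using inv_expansion[OF L(1) lp L(2) u L(3)] by simp
qed

end

context horizon_zeta begin

text \<open>\<open>twist_derivative\<close> holds in every parametrization, in particular in the one
  that \<open>on_surface\<close> chooses; passing to complex values commutes with
  differentiation.\<close>

lemma surface_deriv_twist:
  fixes f :: "'a \<Rightarrow> complex"
  assumes f: "\<And>p. p \<in> S \<Longrightarrow> f p = of_real (Y p)" and p: "p \<in> S" "p \<notin> zeros_on M X S"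
  shows "of_real (1 / norm_sq M X p) * on_surface M S (surface_deriv M (twist M X) f) p = of_real (- 2 * \<kappa> p * Y' p / \<rho>)"
proof -
  define \<psi> where "\<psi> = fst (sel p)"
  define u where "u = snd (sel p)"
  obtain V where L: "local_param M S V \<psi>" "u \<in> V" "\<psi> u = p"
    using sel[OF p(1)] unfolding \<psi>_def u_def by blast
  interpret horizon_param M S N k l X V \<psi> by (rule hparam[OF L(1)])
  have "fder (f \<circ> \<psi>) u = fder (\<lambda>u. complex_of_real ((Y \<circ> \<psi>) u)) u"
    by (rule fder_cong_open[OF openV L(2)]) (simp add: f \<psi>S)
  also have "\<dots> = (\<lambda>v. complex_of_real (fder (Y \<circ> \<psi>) u v))"
    by (rule fder_eqI[OF has_derivative_of_real[OF smooth_on_has_derivative[OF smooth_Y[OF L(1)] L(2)]]])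
  finally have "surface_deriv M (twist M X) f \<psi> u = complex_of_real (fder (Y \<circ> \<psi>) u (tangent_part M (twist M X) \<psi> u))"
    unfolding surface_deriv_def by simp
  then have "of_real (1 / norm_sq M X p) * on_surface M S (surface_deriv M (twist M X) f) p =
      complex_of_real (1 / norm_sq M X (\<psi> u) * fder (Y \<circ> \<psi>) u (tangent_part M (twist M X) \<psi> u))"
    unfolding on_surface_sel \<psi>_def[symmetric] u_def[symmetric] L(3) of_real_mult by (simp only:)
  also have "\<dots> = of_real (- 2 * \<kappa> p * Y' p / \<rho>)"
    unfolding twist_derivative[OF L(1,2), unfolded L(3), OF p(2)] L(3) ..
  finally show ?thesis .
qed

lemma spin_formula:
  fixes f :: "'a \<Rightarrow> complex"
  assumes f: "\<And>p. p \<in> S \<Longrightarrow> f p = of_real (Y p)"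
  shows "(LINT p:S|\<mu>. of_real (2 * on_surface M S (rotational_curl M k l) p) * f p) =
    (LINT p:S - zeros_on M X S|\<mu>. of_real (1 / norm_sq M X p) * on_surface M S (surface_deriv M (twist M X) f) p)"
proof -
  have "(LINT p:S|\<mu>. of_real (2 * on_surface M S (rotational_curl M k l) p) * f p) =
     (LINT p:S|\<mu>. complex_of_real (2 * curlS p * Y p))"
    unfolding set_lebesgue_integral_def curlS_def
    by (intro Bochner_Integration.integral_cong refl) (use f in \<open>auto simp: indicator_def\<close>)
  also have "\<dots> = of_real (LINT p:S|\<mu>. 2 * curlS p * Y p)"
    by (rule set_integral_complex_of_real)
  also have "\<dots> = (LINT p:S - zeros_on M X S|\<mu>. complex_of_real (- 2 * \<kappa> p * Y' p / \<rho>))"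
    unfolding spin_integral by (rule set_integral_complex_of_real[symmetric])
  also have "\<dots> = (LINT p:S - zeros_on M X S|\<mu>. of_real (1 / norm_sq M X p) * on_surface M S (surface_deriv M (twist M X) f) p)"
    unfolding set_lebesgue_integral_def
    by (intro Bochner_Integration.integral_cong refl) (use surface_deriv_twist[OF f] in \<open>auto simp: indicator_def\<close>)
  finally show ?thesis .
qed

end

theorem mainTheorem3:
  fixes M :: "'a::{t2_space,second_countable_topology} spacetime"
    and H N :: "'a set" and leaves :: "'a set set" and X :: "'a vfield"
  assumes "is_spacetime M"
    and "dynamical_horizon_segment M H leaves"
    and "open N" and "H \<subseteq> N" and "killing_field M N X"
    and "\<And>S. S \<in> leaves \<Longrightarrow> rotational_on M S X"
  shows "\<forall>S\<in>leaves. \<forall>k l \<zeta> \<phi>.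
    marginally_trapped M S k l \<and> zeta_coordinate M S k l X \<zeta> \<and> azimuth_coordinate M S X \<zeta> \<phi> \<longrightarrow>
      (\<forall>n. spin_multipole M S k l \<zeta> \<phi> n 0 =
         1/4 * (LINT p:S - zeros_on M X S|area_measure M S.
           of_real (1 / norm_sq M X p) *
           on_surface M S (surface_deriv M (twist M X) (harmonic_on \<zeta> \<phi> n 0)) p)) \<and>
      ((\<forall>p\<in>S. at_pt M (twist M X) p = 0) \<longrightarrow>
         (\<forall>n m. \<bar>m\<bar> \<le> int n \<longrightarrow> spin_multipole M S k l \<zeta> \<phi> n m = 0))"
proof (intro ballI allI impI)
  fix S k l \<zeta> \<phi>
  assume S: "S \<in> leaves"
    and "marginally_trapped M S k l \<and> zeta_coordinate M S k l X \<zeta> \<and> azimuth_coordinate M S X \<zeta> \<phi>"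
  then have mt: "marginally_trapped M S k l" and zc: "zeta_coordinate M S k l X \<zeta>" by simp_all
  have SH: "S \<subseteq> H" using assms(2) S unfolding dynamical_horizon_segment_def foliates_def by blast
  have rot: "rotational_on M S X" by (rule assms(6)[OF S])
  have z2: "card (zeros_on M X S) = 2" using rot unfolding rotational_on_def by simp
  then have fz: "finite (zeros_on M X S)" by (metis card.infinite zero_neq_numeral)
  have ne: "S \<noteq> {}" using z2 unfolding zeros_on_def by auto
  obtain k' l' where n': "null_normals M S k' l'" "\<forall>p\<in>S. on_surface M S (expansion M l') p \<noteq> 0"
    using assms(2) S unfolding dynamical_horizon_segment_def marginally_trapped_def by blast
  interpret killing_surface M S N k l X
    by unfold_locales (use assms(1,3-5) SH mt rot in \<open>auto simp: marginally_trapped_def rotational_on_def\<close>)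
  interpret horizon M S N k l X
  proof unfold_locales
    show "expansion M l \<psi> u \<noteq> 0" if "local_param M S V (\<psi> :: real^2 \<Rightarrow> 'a)" "u \<in> V" for V \<psi> u
      by (rule expansion_nonzero[OF _ n'(1) _ that]) (use mt n'(2) in \<open>auto simp: marginally_trapped_def\<close>)
  qed (fact fz ne)+
  have "spin_multipole M S k l \<zeta> \<phi> n 0 =
     1/4 * (LINT p:S - zeros_on M X S|area_measure M S.
           of_real (1 / norm_sq M X p) * on_surface M S (surface_deriv M (twist M X) (harmonic_on \<zeta> \<phi> n 0)) p)" for n
  proof -
    obtain q :: "real poly" where q: "\<And>p. \<zeta> p \<in> {-1..1} \<Longrightarrow> harmonic_on \<zeta> \<phi> n 0 p = of_real (poly q (\<zeta> p))"
      using zonal_harmonic_poly by metis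
    \<comment> \<open>The polynomial depends on \<open>n\<close>, so Stokes' theorem is instantiated
      for each \<open>n\<close> separately.\<close>
    interpret horizon_zeta M S N k l X \<zeta> q by unfold_locales (rule zc)
    have "harmonic_on \<zeta> \<phi> n 0 p = of_real (Y p)" if "p \<in> S" for p
      unfolding Y_def by (rule q) (use zc that in \<open>auto simp: zeta_coordinate_def\<close>)
    from spin_formula[OF this] show ?thesis unfolding spin_multipole_def by simp
  qed
  moreover have "spin_multipole M S k l \<zeta> \<phi> n m = 0" if "\<forall>p\<in>S. at_pt M (twist M X) p = 0" for n m
  proof -
    have "on_surface M S (rotational_curl M k l) p = 0" if "p \<in> S" for p
      using curl_zero[OF _ that] \<open>\<forall>p\<in>S. at_pt M (twist M X) p = 0\<close> unfolding curlS_def by blast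
    then have "(LINT p:S|area_measure M S. complex_of_real (2 * on_surface M S (rotational_curl M k l) p) * harmonic_on \<zeta> \<phi> n m p)
      = (LINT p:S|area_measure M S. 0)"
      unfolding set_lebesgue_integral_def by (intro Bochner_Integration.integral_cong refl) (simp add: indicator_def)
    then show ?thesis unfolding spin_multipole_def by (simp add: set_lebesgue_integral_def)
  qed
  ultimately show "(\<forall>n. spin_multipole M S k l \<zeta> \<phi> n 0 =
         1/4 * (LINT p:S - zeros_on M X S|area_measure M S.
           of_real (1 / norm_sq M X p) *
           on_surface M S (surface_deriv M (twist M X) (harmonic_on \<zeta> \<phi> n 0)) p)) \<and>
      ((\<forall>p\<in>S. at_pt M (twist M X) p = 0) \<longrightarrow>
         (\<forall>n m. \<bar>m\<bar> \<le> int n \<longrightarrow> spin_multipole M S k l \<zeta> \<phi> n m = 0))" by blast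
qed

end
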